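(* Let $\mathbf I$ and $\mathbf C$ be $2$-categories, and let $F\colon\mathbf I\to\mathbf C$ and $W\colon\mathbf I\to\mathbf{Cat}$ be normal pseudo-functors. Suppose that $\mathbf C$ has tensors by the category $\mathbb 2=\{0\to1\}$. Then the following statements are equivalent. (i) There is a weighted bi-limit $(X,\lambda)$ of $F$ by $W$. (ii) There is an object $X\in \mathbf C$ together with a pseudo-natural transformation $\lambda\colon W\Rightarrow\mathbf C(X,F-)$ in $\mathbf{Ps}(\mathbf I,\mathbf{Cat})$ such that $(X,\lambda)$ is bi-initial in the pseudo-slice $2$-category $W\downarrow\mathbf C(-,F)$.
   Context: **$2$-categories.** $\mathbf{Cat}$ is the $2$-category of categories, functors and natural transformations; $\mathbf C^{\mathrm{op}}$ reverses morphisms but not $2$-morphisms. A normal pseudo-functor $F\colon\mathbf A\to\mathbf B$ between (strict) $2$-categories consists of an assignment on objects, functors $\mathbf A(A,A')\to\mathbf B(FA,FA')$, and invertible compositors $\phi_{a,a'}\colon (Fa')(Fa)\Rightarrow F(a'a)$ satisfying the usual naturality, associativity and unit axioms, with all unitors identities (so $F\mathrm{id}_A=\mathrm{id}_{FA}$). $\mathbf{Ps}(\mathbf A,\mathbf B)$ is the $2$-category of normal pseudo-functors, pseudo-natural transformations (with invertible $2$-morphism components) and modifications. $\mathbf C(-,F)\colon\mathbf C^{\mathrm{op}}\to\mathbf{Ps}(\mathbf I,\mathbf{Cat})$ sends $C$ to the normal pseudo-functor $\mathbf C(C,F-)\colon\mathbf I\to\mathbf{Cat}$. **Weighted bi-limit.**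 A weighted bi-limit of $F$ by $W$ is a pair $(X,\lambda)$ of an object $X\in\mathbf C$ and a pseudo-natural transformation $\lambda\colon W\Rightarrow\mathbf C(X,F-)$ such that for every $C\in\mathbf C$ the functor $\lambda^*\circ\mathbf C(-,F)\colon\mathbf C(C,X)\to\mathbf{Ps}(\mathbf I,\mathbf{Cat})(W,\mathbf C(C,F-))$, $f\mapsto\mathbf C(f,F-)\circ\lambda$, is an adjoint equivalence of categories. **Tensors.** A tensor of an object $C\in\mathbf C$ by a category $\mathcal A$ is a pair $(C\otimes\mathcal A,\zeta)$ of an object $C\otimes\mathcal A\in\mathbf C$ and a functor $\zeta\colon\mathcal A\to\mathbf C(C,C\otimes\mathcal A)$ such that for every $C'\in\mathbf C$ the functor $\mathbf C(C\otimes\mathcal A,C')\to\mathbf{Cat}(\mathcal A,\mathbf C(C,C'))$, $h\mapsto (h\circ-)\circ\zeta$, is an isomorphism of categories. $\mathbf C$ has tensors by $\mathcal A$ if every object has one. **Pseudo-slice $2$-categories.** For a normal pseudo-functor $G\colon\mathbf B\to\mathbf A$ and an object $I\in\mathbf A$, $I\downarrow G$ has objects $(B,f\colon I\to GB)$; morphisms $(B,f)\to(B',f')$ pairs $(b,\psi)$ of $b\colon B\to B'$ in $\mathbf B$ and an invertible $\psi\colon f'\Rightarrow (Gb)f$ (composed using the compositors of $G$); $2$-morphisms $(b,\psi)\Rightarrow(c,\varphi)$ the $\beta\colon b\Rightarrow c$ with $(G\beta\, f)\circ\psi=\varphi$. Write $I\downarrow\mathbf A$ for $G=\mathrm{id}_{\mathbf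 A}$. $W\downarrow\mathbf C(-,F)$ is the case $G=\mathbf C(-,F)\colon\mathbf C^{\mathrm{op}}\to\mathbf{Ps}(\mathbf I,\mathbf{Cat})$, $I=W$. **Bi-initial objects.** A $2$-functor is a trivial fibration if it is surjective on objects, full on morphisms (every morphism $GA\to GA'$ is the image of some morphism $A\to A'$) and fully faithful on $2$-morphisms. An object $I$ of a $2$-category $\mathbf A$ is bi-initial if the projection $I\downarrow\mathbf A\to\mathbf A$ is a trivial fibration. *)

theory Defs
  imports Main "HOL-Library.FuncSet"
begin

text \<open>
  Arrows, functors, transformations etc. carry their source and target, so that no composition
  operation needs object indices. Maps are extensional (\<open>undefined\<close> off the relevant carrier), so that
  HOL equality is the mathematical equality.
  As for the records of HOL-Algebra, nothing is demanded of the operations of a category or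
  2-category outside their carriers.
\<close>

section \<open>Categories, functors and natural transformations\<close>

record ('o, 'm) cat =
  Obj :: "'o set"
  Arr :: "'m set"
  Dom :: "'m \<Rightarrow> 'o"
  Cod :: "'m \<Rightarrow> 'o"
  Ide :: "'o \<Rightarrow> 'm"
  Cmp :: "'m \<Rightarrow> 'm \<Rightarrow> 'm"  (infixl "\<cdot>\<index>" 70)

locale category =
  fixes A :: "('o, 'm) cat" (structure)
  assumes Dom_in: "f \<in> Arr A \<Longrightarrow> Dom A f \<in> Obj A"
    and Cod_in: "f \<in> Arr A \<Longrightarrow> Cod A f \<in> Obj A"
    and Ide_in: "x \<in> Obj A \<Longrightarrow> Ide A x \<in> Arr A"
    and Dom_Ide: "x \<in> Obj A \<Longrightarrow> Dom A (Ide A x) = x"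
    and Cod_Ide: "x \<in> Obj A \<Longrightarrow> Cod A (Ide A x) = x"
    and Cmp_in: "\<lbrakk>f \<in> Arr A; g \<in> Arr A; Cod A f = Dom A g\<rbrakk> \<Longrightarrow> g \<cdot> f \<in> Arr A"
    and Dom_Cmp: "\<lbrakk>f \<in> Arr A; g \<in> Arr A; Cod A f = Dom A g\<rbrakk> \<Longrightarrow> Dom A (g \<cdot> f) = Dom A f"
    and Cod_Cmp: "\<lbrakk>f \<in> Arr A; g \<in> Arr A; Cod A f = Dom A g\<rbrakk> \<Longrightarrow> Cod A (g \<cdot> f) = Cod A g"
    and Cmp_Ide_left: "f \<in> Arr A \<Longrightarrow> Ide A (Cod A f) \<cdot> f = f"
    and Cmp_Ide_right: "f \<in> Arr A \<Longrightarrow> f \<cdot> Ide A (Dom A f) = f"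
    and Cmp_assoc: "\<lbrakk>f \<in> Arr A; g \<in> Arr A; h \<in> Arr A; Cod A f = Dom A g; Cod A g = Dom A h\<rbrakk>
          \<Longrightarrow> (h \<cdot> g) \<cdot> f = h \<cdot> (g \<cdot> f)"

definition is_iso :: "('o, 'm) cat \<Rightarrow> 'm \<Rightarrow> bool" where
  "is_iso A f \<longleftrightarrow> f \<in> Arr A \<and>
     (\<exists>g\<in>Arr A. Dom A g = Cod A f \<and> Cod A g = Dom A f \<and>
        g \<cdot>\<^bsub>A\<^esub> f = Ide A (Dom A f) \<and> f \<cdot>\<^bsub>A\<^esub> g = Ide A (Cod A f))"

record ('o, 'm, 'p, 'n) func =
  FDom :: "('o, 'm) cat"
  FCod :: "('p, 'n) cat"
  FObj :: "'o \<Rightarrow> 'p"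
  FArr :: "'m \<Rightarrow> 'n"

definition is_functor ::
  "('o, 'm) cat \<Rightarrow> ('p, 'n) cat \<Rightarrow> ('o, 'm, 'p, 'n) func \<Rightarrow> bool" where
  "is_functor A B F \<longleftrightarrow> category A \<and> category B \<and> FDom F = A \<and> FCod F = B \<and>
     FObj F \<in> Obj A \<rightarrow>\<^sub>E Obj B \<and> FArr F \<in> Arr A \<rightarrow>\<^sub>E Arr B \<and>
     (\<forall>f\<in>Arr A. Dom B (FArr F f) = FObj F (Dom A f) \<and> Cod B (FArr F f) = FObj F (Cod A f)) \<and>
     (\<forall>x\<in>Obj A. FArr F (Ide A x) = Ide B (FObj F x)) \<and>
     (\<forall>f\<in>Arr A. \<forall>g\<in>Arr A. Cod A f = Dom A g \<longrightarrow> FArr F (g \<cdot>\<^bsub>A\<^esub> f) = FArr F g \<cdot>\<^bsub>B\<^esub> FArr F f)"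

definition id_func :: "('o, 'm) cat \<Rightarrow> ('o, 'm, 'o, 'm) func" where
  "id_func A = \<lparr>FDom = A, FCod = A, FObj = restrict (\<lambda>x. x) (Obj A), FArr = restrict (\<lambda>f. f) (Arr A)\<rparr>"

definition comp_func ::
  "('p, 'n, 'q, 'l) func \<Rightarrow> ('o, 'm, 'p, 'n) func \<Rightarrow> ('o, 'm, 'q, 'l) func" where
  "comp_func G F = \<lparr>FDom = FDom F, FCod = FCod G,
     FObj = restrict (\<lambda>x. FObj G (FObj F x)) (Obj (FDom F)),
     FArr = restrict (\<lambda>f. FArr G (FArr F f)) (Arr (FDom F))\<rparr>"

record ('o, 'm, 'p, 'n) nat_trans =
  NDom :: "('o, 'm, 'p, 'n) func"
  NCod :: "('o, 'm, 'p, 'n) func"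
  NAt :: "'o \<Rightarrow> 'n"

definition is_nat ::
  "('o, 'm) cat \<Rightarrow> ('p, 'n) cat \<Rightarrow> ('o, 'm, 'p, 'n) nat_trans \<Rightarrow> bool" where
  "is_nat A B \<tau> \<longleftrightarrow> is_functor A B (NDom \<tau>) \<and> is_functor A B (NCod \<tau>) \<and>
     NAt \<tau> \<in> Obj A \<rightarrow>\<^sub>E Arr B \<and>
     (\<forall>x\<in>Obj A. Dom B (NAt \<tau> x) = FObj (NDom \<tau>) x \<and> Cod B (NAt \<tau> x) = FObj (NCod \<tau>) x) \<and>
     (\<forall>f\<in>Arr A. FArr (NCod \<tau>) f \<cdot>\<^bsub>B\<^esub> NAt \<tau> (Dom A f) = NAt \<tau> (Cod A f) \<cdot>\<^bsub>B\<^esub> FArr (NDom \<tau>) f)"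

definition id_nat :: "('o, 'm, 'p, 'n) func \<Rightarrow> ('o, 'm, 'p, 'n) nat_trans" where
  "id_nat F = \<lparr>NDom = F, NCod = F, NAt = restrict (\<lambda>x. Ide (FCod F) (FObj F x)) (Obj (FDom F))\<rparr>"

definition vcomp_nat ::
  "('o, 'm, 'p, 'n) nat_trans \<Rightarrow> ('o, 'm, 'p, 'n) nat_trans \<Rightarrow> ('o, 'm, 'p, 'n) nat_trans" where
  "vcomp_nat \<tau> \<sigma> = \<lparr>NDom = NDom \<sigma>, NCod = NCod \<tau>,
     NAt = restrict (\<lambda>x. NAt \<tau> x \<cdot>\<^bsub>FCod (NDom \<sigma>)\<^esub> NAt \<sigma> x) (Obj (FDom (NDom \<sigma>)))\<rparr>"

text \<open>The horizontal composite of \<open>\<sigma> : F \<Rightarrow> F'\<close> and \<open>\<tau> : G \<Rightarrow> G'\<close> has components \<open>G'(\<sigma>\<^sub>x) \<cdot> \<tau>\<^sub>F\<^sub>x\<close>.\<close>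

definition hcomp_nat ::
  "('p, 'n, 'q, 'l) nat_trans \<Rightarrow> ('o, 'm, 'p, 'n) nat_trans \<Rightarrow> ('o, 'm, 'q, 'l) nat_trans" where
  "hcomp_nat \<tau> \<sigma> =
     \<lparr>NDom = comp_func (NDom \<tau>) (NDom \<sigma>), NCod = comp_func (NCod \<tau>) (NCod \<sigma>),
      NAt = restrict (\<lambda>x. FArr (NCod \<tau>) (NAt \<sigma> x) \<cdot>\<^bsub>FCod (NDom \<tau>)\<^esub> NAt \<tau> (FObj (NDom \<sigma>) x))
              (Obj (FDom (NDom \<sigma>)))\<rparr>"

text \<open>The category \<open>Cat(A, B)\<close>; here \<open>A\<close> and \<open>B\<close> may live in different types.\<close>

definition func_cat ::
  "('o, 'm) cat \<Rightarrow> ('p, 'n) cat \<Rightarrow> (('o, 'm, 'p, 'n) func, ('o, 'm, 'p, 'n) nat_trans) cat" where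
  "func_cat A B = \<lparr>Obj = {F. is_functor A B F}, Arr = {\<tau>. is_nat A B \<tau>},
     Dom = NDom, Cod = NCod, Ide = id_nat, Cmp = vcomp_nat\<rparr>"

definition iso_of_cats :: "('o, 'm) cat \<Rightarrow> ('p, 'n) cat \<Rightarrow> ('o, 'm, 'p, 'n) func \<Rightarrow> bool" where
  "iso_of_cats A B L \<longleftrightarrow> is_functor A B L \<and>
     (\<exists>R. is_functor B A R \<and> comp_func R L = id_func A \<and> comp_func L R = id_func B)"

text \<open>\<open>L\<close> is the left adjoint of an adjoint equivalence \<open>(L, R, \<eta>, \<epsilon>)\<close>.\<close>

definition adjoint_equivalence ::
  "('o, 'm) cat \<Rightarrow> ('p, 'n) cat \<Rightarrow> ('o, 'm, 'p, 'n) func \<Rightarrow> bool" where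
  "adjoint_equivalence A B L \<longleftrightarrow> is_functor A B L \<and>
     (\<exists>R \<eta> \<epsilon>. is_functor B A R \<and>
        is_nat A A \<eta> \<and> NDom \<eta> = id_func A \<and> NCod \<eta> = comp_func R L \<and> (\<forall>x\<in>Obj A. is_iso A (NAt \<eta> x)) \<and>
        is_nat B B \<epsilon> \<and> NDom \<epsilon> = comp_func L R \<and> NCod \<epsilon> = id_func B \<and> (\<forall>y\<in>Obj B. is_iso B (NAt \<epsilon> y)) \<and>
        (\<forall>x\<in>Obj A. NAt \<epsilon> (FObj L x) \<cdot>\<^bsub>B\<^esub> FArr L (NAt \<eta> x) = Ide B (FObj L x)) \<and>
        (\<forall>y\<in>Obj B. FArr R (NAt \<epsilon> y) \<cdot>\<^bsub>A\<^esub> NAt \<eta> (FObj R y) = Ide A (FObj R y)))"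

text \<open>The category \<open>{0 \<rightarrow> 1}\<close>, as the poset \<open>False \<le> True\<close>; the arrow from \<open>a\<close> to \<open>b\<close> is \<open>(a, b)\<close>.\<close>

definition two :: "(bool, bool \<times> bool) cat" where
  "two = \<lparr>Obj = UNIV, Arr = {(a, b). a \<le> b}, Dom = fst, Cod = snd,
     Ide = (\<lambda>a. (a, a)), Cmp = (\<lambda>g f. (fst f, snd g))\<rparr>"


section \<open>Strict 2-categories\<close>

text \<open>
  \<open>VCmp\<close> is vertical composition of 2-cells (along 1-cells), \<open>HCmp\<close> horizontal composition
  (along 0-cells).
\<close>

record ('c, 'f, 't) two_cat =
  Cell0 :: "'c set"
  Cell1 :: "'f set"
  Cell2 :: "'t set"
  Src :: "'f \<Rightarrow> 'c"
  Trg :: "'f \<Rightarrow> 'c"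
  Dom2 :: "'t \<Rightarrow> 'f"
  Cod2 :: "'t \<Rightarrow> 'f"
  Id1 :: "'c \<Rightarrow> 'f"
  Id2 :: "'f \<Rightarrow> 't"
  Cmp1 :: "'f \<Rightarrow> 'f \<Rightarrow> 'f"  (infixl "\<odot>\<index>" 75)
  HCmp :: "'t \<Rightarrow> 't \<Rightarrow> 't"  (infixl "\<star>\<index>" 75)
  VCmp :: "'t \<Rightarrow> 't \<Rightarrow> 't"  (infixl "\<bullet>\<index>" 70)

definition under_cat :: "('c, 'f, 't) two_cat \<Rightarrow> ('c, 'f) cat" where
  "under_cat C = \<lparr>Obj = Cell0 C, Arr = Cell1 C, Dom = Src C, Cod = Trg C, Ide = Id1 C, Cmp = Cmp1 C\<rparr>"

text \<open>All hom-categories taken together: 1-cells as objects, 2-cells as arrows.\<close>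

definition vert_cat :: "('c, 'f, 't) two_cat \<Rightarrow> ('f, 't) cat" where
  "vert_cat C = \<lparr>Obj = Cell1 C, Arr = Cell2 C, Dom = Dom2 C, Cod = Cod2 C, Ide = Id2 C, Cmp = VCmp C\<rparr>"

definition hom1 :: "('c, 'f, 't) two_cat \<Rightarrow> 'c \<Rightarrow> 'c \<Rightarrow> 'f set" where
  "hom1 C X Y = {f \<in> Cell1 C. Src C f = X \<and> Trg C f = Y}"

definition hom2 :: "('c, 'f, 't) two_cat \<Rightarrow> 'f \<Rightarrow> 'f \<Rightarrow> 't set" where
  "hom2 C f g = {\<alpha> \<in> Cell2 C. Dom2 C \<alpha> = f \<and> Cod2 C \<alpha> = g}"

definition hom_cat :: "('c, 'f, 't) two_cat \<Rightarrow> 'c \<Rightarrow> 'c \<Rightarrow> ('f, 't) cat" where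
  "hom_cat C X Y =
     \<lparr>Obj = hom1 C X Y, Arr = {\<alpha> \<in> Cell2 C. Dom2 C \<alpha> \<in> hom1 C X Y \<and> Cod2 C \<alpha> \<in> hom1 C X Y},
      Dom = Dom2 C, Cod = Cod2 C, Ide = Id2 C, Cmp = VCmp C\<rparr>"

definition invertible2 :: "('c, 'f, 't) two_cat \<Rightarrow> 't \<Rightarrow> bool" where
  "invertible2 C \<alpha> \<longleftrightarrow> is_iso (vert_cat C) \<alpha>"

locale two_category =
  fixes C :: "('c, 'f, 't) two_cat" (structure)
  assumes under_category: "category (under_cat C)"
    and vert_category: "category (vert_cat C)"
    and parallel: "\<alpha> \<in> Cell2 C \<Longrightarrow>
          Src C (Dom2 C \<alpha>) = Src C (Cod2 C \<alpha>) \<and> Trg C (Dom2 C \<alpha>) = Trg C (Cod2 C \<alpha>)"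
    and HCmp_in: "\<lbrakk>\<alpha> \<in> hom2 C f f'; \<beta> \<in> hom2 C g g'; Trg C f = Src C g\<rbrakk>
          \<Longrightarrow> \<beta> \<star> \<alpha> \<in> hom2 C (g \<odot> f) (g' \<odot> f')"
    and HCmp_Id2: "\<lbrakk>f \<in> Cell1 C; g \<in> Cell1 C; Trg C f = Src C g\<rbrakk>
          \<Longrightarrow> Id2 C g \<star> Id2 C f = Id2 C (g \<odot> f)"
    and interchange: "\<lbrakk>\<alpha> \<in> hom2 C f f'; \<alpha>' \<in> hom2 C f' f''; \<beta> \<in> hom2 C g g'; \<beta>' \<in> hom2 C g' g'';
          Trg C f = Src C g\<rbrakk>
          \<Longrightarrow> (\<beta>' \<bullet> \<beta>) \<star> (\<alpha>' \<bullet> \<alpha>) = (\<beta>' \<star> \<alpha>') \<bullet> (\<beta> \<star> \<alpha>)"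
    and HCmp_assoc: "\<lbrakk>\<alpha> \<in> hom2 C f f'; \<beta> \<in> hom2 C g g'; \<gamma> \<in> hom2 C h h';
          Trg C f = Src C g; Trg C g = Src C h\<rbrakk>
          \<Longrightarrow> (\<gamma> \<star> \<beta>) \<star> \<alpha> = \<gamma> \<star> (\<beta> \<star> \<alpha>)"
    and HCmp_Id_left: "\<alpha> \<in> hom2 C f f' \<Longrightarrow> Id2 C (Id1 C (Trg C f)) \<star> \<alpha> = \<alpha>"
    and HCmp_Id_right: "\<alpha> \<in> hom2 C f f' \<Longrightarrow> \<alpha> \<star> Id2 C (Id1 C (Src C f)) = \<alpha>"

definition op2 :: "('c, 'f, 't) two_cat \<Rightarrow> ('c, 'f, 't) two_cat" where
  "op2 C = C\<lparr>Src := Trg C, Trg := Src C, Cmp1 := (\<lambda>g f. f \<odot>\<^bsub>C\<^esub> g), HCmp := (\<lambda>\<beta> \<alpha>. \<alpha> \<star>\<^bsub>C\<^esub> \<beta>)\<rparr>"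

text \<open>
  The 2-category of categories whose objects are taken from \<open>'o\<close> and whose arrows are taken from
  \<open>'m\<close>; the two types play the role of the universe. In a statement about \<open>C(-, F)\<close> they are the types of
  1-cells and 2-cells of \<open>C\<close>, since the hom-categories of \<open>C\<close> must be objects of \<open>Cat\<close>; these types
  may be larger than the sets of cells of \<open>C\<close>.
\<close>

definition Cat ::
  "(('o, 'm) cat, ('o, 'm, 'o, 'm) func, ('o, 'm, 'o, 'm) nat_trans) two_cat" where
  "Cat = \<lparr>Cell0 = {A. category A}, Cell1 = {F. is_functor (FDom F) (FCod F) F},
     Cell2 = {\<tau>. is_nat (FDom (NDom \<tau>)) (FCod (NDom \<tau>)) \<tau>},
     Src = FDom, Trg = FCod, Dom2 = NDom, Cod2 = NCod, Id1 = id_func, Id2 = id_nat,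
     Cmp1 = comp_func, HCmp = hcomp_nat, VCmp = vcomp_nat\<rparr>"


section \<open>Normal pseudo-functors, pseudo-natural transformations and modifications\<close>

text \<open>\<open>Phi F a a' : (F a')(F a) \<Rightarrow> F(a' a)\<close> is the compositor.\<close>

record ('a, 'g, 's, 'b, 'h, 't) psfun =
  P0 :: "'a \<Rightarrow> 'b"
  P1 :: "'g \<Rightarrow> 'h"
  P2 :: "'s \<Rightarrow> 't"
  Phi :: "'g \<Rightarrow> 'g \<Rightarrow> 't"

locale normal_pseudofunctor = A: two_category A + B: two_category B
  for A :: "('a, 'g, 's) two_cat" and B :: "('b, 'h, 't) two_cat" +
  fixes F :: "('a, 'g, 's, 'b, 'h, 't) psfun"
  assumes P0: "P0 F \<in> Cell0 A \<rightarrow>\<^sub>E Cell0 B"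
    and P1: "P1 F \<in> Cell1 A \<rightarrow>\<^sub>E Cell1 B"
    and P2: "P2 F \<in> Cell2 A \<rightarrow>\<^sub>E Cell2 B"
    and Src_P1: "a \<in> Cell1 A \<Longrightarrow> Src B (P1 F a) = P0 F (Src A a)"
    and Trg_P1: "a \<in> Cell1 A \<Longrightarrow> Trg B (P1 F a) = P0 F (Trg A a)"
    and Dom_P2: "\<alpha> \<in> Cell2 A \<Longrightarrow> Dom2 B (P2 F \<alpha>) = P1 F (Dom2 A \<alpha>)"
    and Cod_P2: "\<alpha> \<in> Cell2 A \<Longrightarrow> Cod2 B (P2 F \<alpha>) = P1 F (Cod2 A \<alpha>)"
    and P2_Id2: "a \<in> Cell1 A \<Longrightarrow> P2 F (Id2 A a) = Id2 B (P1 F a)"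
    and P2_VCmp: "\<lbrakk>\<alpha> \<in> Cell2 A; \<beta> \<in> Cell2 A; Cod2 A \<alpha> = Dom2 A \<beta>\<rbrakk>
          \<Longrightarrow> P2 F (\<beta> \<bullet>\<^bsub>A\<^esub> \<alpha>) = P2 F \<beta> \<bullet>\<^bsub>B\<^esub> P2 F \<alpha>"
    and P1_Id1: "X \<in> Cell0 A \<Longrightarrow> P1 F (Id1 A X) = Id1 B (P0 F X)"
    and Phi_in: "\<lbrakk>a \<in> Cell1 A; a' \<in> Cell1 A; Trg A a = Src A a'\<rbrakk>
          \<Longrightarrow> Phi F a a' \<in> hom2 B (P1 F a' \<odot>\<^bsub>B\<^esub> P1 F a) (P1 F (a' \<odot>\<^bsub>A\<^esub> a))"
    and Phi_invertible: "\<lbrakk>a \<in> Cell1 A; a' \<in> Cell1 A; Trg A a = Src A a'\<rbrakk>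
          \<Longrightarrow> invertible2 B (Phi F a a')"
    and Phi_undefined: "\<not> (a \<in> Cell1 A \<and> a' \<in> Cell1 A \<and> Trg A a = Src A a')
          \<Longrightarrow> Phi F a a' = undefined"
    and Phi_natural: "\<lbrakk>\<alpha> \<in> hom2 A a b; \<alpha>' \<in> hom2 A a' b'; Trg A a = Src A a'\<rbrakk>
          \<Longrightarrow> P2 F (\<alpha>' \<star>\<^bsub>A\<^esub> \<alpha>) \<bullet>\<^bsub>B\<^esub> Phi F a a' = Phi F b b' \<bullet>\<^bsub>B\<^esub> (P2 F \<alpha>' \<star>\<^bsub>B\<^esub> P2 F \<alpha>)"
    and Phi_assoc: "\<lbrakk>a \<in> Cell1 A; a' \<in> Cell1 A; a'' \<in> Cell1 A; Trg A a = Src A a'; Trg A a' = Src A a''\<rbrakk>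
          \<Longrightarrow> Phi F a (a'' \<odot>\<^bsub>A\<^esub> a') \<bullet>\<^bsub>B\<^esub> (Phi F a' a'' \<star>\<^bsub>B\<^esub> Id2 B (P1 F a))
            = Phi F (a' \<odot>\<^bsub>A\<^esub> a) a'' \<bullet>\<^bsub>B\<^esub> (Id2 B (P1 F a'') \<star>\<^bsub>B\<^esub> Phi F a a')"
    and Phi_Id_left: "a \<in> Cell1 A \<Longrightarrow> Phi F a (Id1 A (Trg A a)) = Id2 B (P1 F a)"
    and Phi_Id_right: "a \<in> Cell1 A \<Longrightarrow> Phi F (Id1 A (Src A a)) a = Id2 B (P1 F a)"

definition id_psfun :: "('a, 'g, 's) two_cat \<Rightarrow> ('a, 'g, 's, 'a, 'g, 's) psfun" where
  "id_psfun A = \<lparr>P0 = restrict (\<lambda>x. x) (Cell0 A), P1 = restrict (\<lambda>a. a) (Cell1 A),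
     P2 = restrict (\<lambda>\<alpha>. \<alpha>) (Cell2 A),
     Phi = (\<lambda>a a'. if a \<in> Cell1 A \<and> a' \<in> Cell1 A \<and> Trg A a = Src A a'
                   then Id2 A (a' \<odot>\<^bsub>A\<^esub> a) else undefined)\<rparr>"

text \<open>
  For \<open>\<eta> : F \<Rightarrow> G\<close>, \<open>T0 \<eta> X : F X \<rightarrow> G X\<close>, and for \<open>a : X \<rightarrow> Y\<close>,
  \<open>T1 \<eta> a : (G a)(T0 \<eta> X) \<Rightarrow> (T0 \<eta> Y)(F a)\<close>.
\<close>

record ('a, 'g, 's, 'b, 'h, 't) pstrans =
  TDom :: "('a, 'g, 's, 'b, 'h, 't) psfun"
  TCod :: "('a, 'g, 's, 'b, 'h, 't) psfun"
  T0 :: "'a \<Rightarrow> 'h"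
  T1 :: "'g \<Rightarrow> 't"

locale pseudo_natural =
  dom: normal_pseudofunctor A B "TDom \<eta>" + cod: normal_pseudofunctor A B "TCod \<eta>"
  for A :: "('a, 'g, 's) two_cat" and B :: "('b, 'h, 't) two_cat"
    and \<eta> :: "('a, 'g, 's, 'b, 'h, 't) pstrans" +
  assumes T0_in: "X \<in> Cell0 A \<Longrightarrow> T0 \<eta> X \<in> hom1 B (P0 (TDom \<eta>) X) (P0 (TCod \<eta>) X)"
    and T0_ext: "T0 \<eta> \<in> extensional (Cell0 A)"
    and T1_in: "a \<in> hom1 A X Y \<Longrightarrow>
          T1 \<eta> a \<in> hom2 B (P1 (TCod \<eta>) a \<odot>\<^bsub>B\<^esub> T0 \<eta> X) (T0 \<eta> Y \<odot>\<^bsub>B\<^esub> P1 (TDom \<eta>) a)"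
    and T1_invertible: "a \<in> Cell1 A \<Longrightarrow> invertible2 B (T1 \<eta> a)"
    and T1_ext: "T1 \<eta> \<in> extensional (Cell1 A)"
    and T1_natural: "\<lbrakk>a \<in> hom1 A X Y; \<alpha> \<in> hom2 A a b\<rbrakk> \<Longrightarrow>
          T1 \<eta> b \<bullet>\<^bsub>B\<^esub> (P2 (TCod \<eta>) \<alpha> \<star>\<^bsub>B\<^esub> Id2 B (T0 \<eta> X))
            = (Id2 B (T0 \<eta> Y) \<star>\<^bsub>B\<^esub> P2 (TDom \<eta>) \<alpha>) \<bullet>\<^bsub>B\<^esub> T1 \<eta> a"
    and T1_Cmp1: "\<lbrakk>a \<in> hom1 A X Y; a' \<in> hom1 A Y Z\<rbrakk> \<Longrightarrow>
          T1 \<eta> (a' \<odot>\<^bsub>A\<^esub> a) \<bullet>\<^bsub>B\<^esub> (Phi (TCod \<eta>) a a' \<star>\<^bsub>B\<^esub> Id2 B (T0 \<eta> X))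
            = (Id2 B (T0 \<eta> Z) \<star>\<^bsub>B\<^esub> Phi (TDom \<eta>) a a')
              \<bullet>\<^bsub>B\<^esub> (T1 \<eta> a' \<star>\<^bsub>B\<^esub> Id2 B (P1 (TDom \<eta>) a))
              \<bullet>\<^bsub>B\<^esub> (Id2 B (P1 (TCod \<eta>) a') \<star>\<^bsub>B\<^esub> T1 \<eta> a)"
    and T1_Id1: "X \<in> Cell0 A \<Longrightarrow> T1 \<eta> (Id1 A X) = Id2 B (T0 \<eta> X)"

record ('a, 'g, 's, 'b, 'h, 't) modif =
  MDom :: "('a, 'g, 's, 'b, 'h, 't) pstrans"
  MCod :: "('a, 'g, 's, 'b, 'h, 't) pstrans"
  MAt :: "'a \<Rightarrow> 't"

locale modification =
  dom: pseudo_natural A B "MDom \<Gamma>" + cod: pseudo_natural A B "MCod \<Gamma>"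
  for A :: "('a, 'g, 's) two_cat" and B :: "('b, 'h, 't) two_cat"
    and \<Gamma> :: "('a, 'g, 's, 'b, 'h, 't) modif" +
  assumes TDom_eq: "TDom (MDom \<Gamma>) = TDom (MCod \<Gamma>)"
    and TCod_eq: "TCod (MDom \<Gamma>) = TCod (MCod \<Gamma>)"
    and MAt_in: "X \<in> Cell0 A \<Longrightarrow> MAt \<Gamma> X \<in> hom2 B (T0 (MDom \<Gamma>) X) (T0 (MCod \<Gamma>) X)"
    and MAt_ext: "MAt \<Gamma> \<in> extensional (Cell0 A)"
    and MAt_natural: "a \<in> hom1 A X Y \<Longrightarrow>
          T1 (MCod \<Gamma>) a \<bullet>\<^bsub>B\<^esub> (Id2 B (P1 (TCod (MDom \<Gamma>)) a) \<star>\<^bsub>B\<^esub> MAt \<Gamma> X)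
            = (MAt \<Gamma> Y \<star>\<^bsub>B\<^esub> Id2 B (P1 (TDom (MDom \<Gamma>)) a)) \<bullet>\<^bsub>B\<^esub> T1 (MDom \<Gamma>) a"

definition ps_id ::
  "('a, 'g, 's) two_cat \<Rightarrow> ('b, 'h, 't) two_cat \<Rightarrow>
   ('a, 'g, 's, 'b, 'h, 't) psfun \<Rightarrow> ('a, 'g, 's, 'b, 'h, 't) pstrans" where
  "ps_id A B F = \<lparr>TDom = F, TCod = F, T0 = restrict (\<lambda>X. Id1 B (P0 F X)) (Cell0 A),
     T1 = restrict (\<lambda>a. Id2 B (P1 F a)) (Cell1 A)\<rparr>"

text \<open>For \<open>\<eta> : F \<Rightarrow> G\<close>, \<open>\<theta> : G \<Rightarrow> H\<close> and \<open>a : X \<rightarrow> Y\<close>, the 2-cell of the composite is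
  \<open>(H a) \<theta>\<^sub>X \<eta>\<^sub>X \<Rightarrow> \<theta>\<^sub>Y (G a) \<eta>\<^sub>X \<Rightarrow> \<theta>\<^sub>Y \<eta>\<^sub>Y (F a)\<close>.\<close>

definition ps_comp ::
  "('a, 'g, 's) two_cat \<Rightarrow> ('b, 'h, 't) two_cat \<Rightarrow> ('a, 'g, 's, 'b, 'h, 't) pstrans \<Rightarrow>
   ('a, 'g, 's, 'b, 'h, 't) pstrans \<Rightarrow> ('a, 'g, 's, 'b, 'h, 't) pstrans" where
  "ps_comp A B \<theta> \<eta> = \<lparr>TDom = TDom \<eta>, TCod = TCod \<theta>,
     T0 = restrict (\<lambda>X. T0 \<theta> X \<odot>\<^bsub>B\<^esub> T0 \<eta> X) (Cell0 A),
     T1 = restrict (\<lambda>a. (Id2 B (T0 \<theta> (Trg A a)) \<star>\<^bsub>B\<^esub> T1 \<eta> a)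
                        \<bullet>\<^bsub>B\<^esub> (T1 \<theta> a \<star>\<^bsub>B\<^esub> Id2 B (T0 \<eta> (Src A a)))) (Cell1 A)\<rparr>"

definition Ps ::
  "('a, 'g, 's) two_cat \<Rightarrow> ('b, 'h, 't) two_cat \<Rightarrow>
   (('a, 'g, 's, 'b, 'h, 't) psfun, ('a, 'g, 's, 'b, 'h, 't) pstrans, ('a, 'g, 's, 'b, 'h, 't) modif) two_cat"
  where
  "Ps A B =
     \<lparr>Cell0 = {F. normal_pseudofunctor A B F},
      Cell1 = {\<eta>. pseudo_natural A B \<eta>},
      Cell2 = {\<Gamma>. modification A B \<Gamma>},
      Src = TDom, Trg = TCod, Dom2 = MDom, Cod2 = MCod,
      Id1 = ps_id A B,
      Id2 = (\<lambda>\<eta>. \<lparr>MDom = \<eta>, MCod = \<eta>, MAt = restrict (\<lambda>X. Id2 B (T0 \<eta> X)) (Cell0 A)\<rparr>),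
      Cmp1 = ps_comp A B,
      HCmp = (\<lambda>\<Delta> \<Gamma>. \<lparr>MDom = ps_comp A B (MDom \<Delta>) (MDom \<Gamma>), MCod = ps_comp A B (MCod \<Delta>) (MCod \<Gamma>),
                MAt = restrict (\<lambda>X. MAt \<Delta> X \<star>\<^bsub>B\<^esub> MAt \<Gamma> X) (Cell0 A)\<rparr>),
      VCmp = (\<lambda>\<Delta> \<Gamma>. \<lparr>MDom = MDom \<Gamma>, MCod = MCod \<Delta>,
                MAt = restrict (\<lambda>X. MAt \<Delta> X \<bullet>\<^bsub>B\<^esub> MAt \<Gamma> X) (Cell0 A)\<rparr>)\<rparr>"

text \<open>The functor \<open>A(X, Y) \<rightarrow> B(G X, G Y)\<close> that is part of a pseudo-functor \<open>G : A \<rightarrow> B\<close>.\<close>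

definition local_func ::
  "('a, 'g, 's) two_cat \<Rightarrow> ('b, 'h, 't) two_cat \<Rightarrow> ('a, 'g, 's, 'b, 'h, 't) psfun \<Rightarrow> 'a \<Rightarrow> 'a \<Rightarrow>
   ('g, 's, 'h, 't) func" where
  "local_func A B G X Y = \<lparr>FDom = hom_cat A X Y, FCod = hom_cat B (P0 G X) (P0 G Y),
     FObj = restrict (P1 G) (Obj (hom_cat A X Y)), FArr = restrict (P2 G) (Arr (hom_cat A X Y))\<rparr>"


section \<open>The pseudo-functors \<open>C(X, F-)\<close> and \<open>C(-, F)\<close>\<close>

text \<open>\<open>g \<circ> - : C(X, Y) \<rightarrow> C(X, Z)\<close> for \<open>g : Y \<rightarrow> Z\<close>, and its 2-cell version.\<close>

definition post_func :: "('c, 'f, 't) two_cat \<Rightarrow> 'c \<Rightarrow> 'f \<Rightarrow> ('f, 't, 'f, 't) func" where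
  "post_func C X g = \<lparr>FDom = hom_cat C X (Src C g), FCod = hom_cat C X (Trg C g),
     FObj = restrict (\<lambda>f. g \<odot>\<^bsub>C\<^esub> f) (Obj (hom_cat C X (Src C g))),
     FArr = restrict (\<lambda>\<alpha>. Id2 C g \<star>\<^bsub>C\<^esub> \<alpha>) (Arr (hom_cat C X (Src C g)))\<rparr>"

definition post_nat :: "('c, 'f, 't) two_cat \<Rightarrow> 'c \<Rightarrow> 't \<Rightarrow> ('f, 't, 'f, 't) nat_trans" where
  "post_nat C X \<beta> = \<lparr>NDom = post_func C X (Dom2 C \<beta>), NCod = post_func C X (Cod2 C \<beta>),
     NAt = restrict (\<lambda>f. \<beta> \<star>\<^bsub>C\<^esub> Id2 C f) (hom1 C X (Src C (Dom2 C \<beta>)))\<rparr>"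

text \<open>\<open>- \<circ> f : C(Y, Z) \<rightarrow> C(X, Z)\<close> for \<open>f : X \<rightarrow> Y\<close>, and its 2-cell version.\<close>

definition pre_func :: "('c, 'f, 't) two_cat \<Rightarrow> 'f \<Rightarrow> 'c \<Rightarrow> ('f, 't, 'f, 't) func" where
  "pre_func C f Z = \<lparr>FDom = hom_cat C (Trg C f) Z, FCod = hom_cat C (Src C f) Z,
     FObj = restrict (\<lambda>g. g \<odot>\<^bsub>C\<^esub> f) (Obj (hom_cat C (Trg C f) Z)),
     FArr = restrict (\<lambda>\<beta>. \<beta> \<star>\<^bsub>C\<^esub> Id2 C f) (Arr (hom_cat C (Trg C f) Z))\<rparr>"

definition pre_nat :: "('c, 'f, 't) two_cat \<Rightarrow> 't \<Rightarrow> 'c \<Rightarrow> ('f, 't, 'f, 't) nat_trans" where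
  "pre_nat C \<alpha> Z = \<lparr>NDom = pre_func C (Dom2 C \<alpha>) Z, NCod = pre_func C (Cod2 C \<alpha>) Z,
     NAt = restrict (\<lambda>g. Id2 C g \<star>\<^bsub>C\<^esub> \<alpha>) (hom1 C (Trg C (Dom2 C \<alpha>)) Z)\<rparr>"

text \<open>\<open>C(X, F-) : I \<rightarrow> Cat\<close>, with the compositors induced by those of \<open>F\<close>.\<close>

definition hom_psfun ::
  "('i, 'u, 'v) two_cat \<Rightarrow> ('c, 'f, 't) two_cat \<Rightarrow> ('i, 'u, 'v, 'c, 'f, 't) psfun \<Rightarrow> 'c \<Rightarrow>
   ('i, 'u, 'v, ('f, 't) cat, ('f, 't, 'f, 't) func, ('f, 't, 'f, 't) nat_trans) psfun" where
  "hom_psfun I C F X =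
     \<lparr>P0 = restrict (\<lambda>i. hom_cat C X (P0 F i)) (Cell0 I),
      P1 = restrict (\<lambda>u. post_func C X (P1 F u)) (Cell1 I),
      P2 = restrict (\<lambda>\<mu>. post_nat C X (P2 F \<mu>)) (Cell2 I),
      Phi = (\<lambda>u v. if u \<in> Cell1 I \<and> v \<in> Cell1 I \<and> Trg I u = Src I v
               then \<lparr>NDom = comp_func (post_func C X (P1 F v)) (post_func C X (P1 F u)),
                     NCod = post_func C X (P1 F (v \<odot>\<^bsub>I\<^esub> u)),
                     NAt = restrict (\<lambda>f. Phi F u v \<star>\<^bsub>C\<^esub> Id2 C f) (hom1 C X (P0 F (Src I u)))\<rparr>
               else undefined)\<rparr>"

text \<open>\<open>C(f, F-) : C(Y, F-) \<Rightarrow> C(X, F-)\<close> for \<open>f : X \<rightarrow> Y\<close>; it is strictly natural.\<close>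

definition hom_pstrans ::
  "('i, 'u, 'v) two_cat \<Rightarrow> ('c, 'f, 't) two_cat \<Rightarrow> ('i, 'u, 'v, 'c, 'f, 't) psfun \<Rightarrow> 'f \<Rightarrow>
   ('i, 'u, 'v, ('f, 't) cat, ('f, 't, 'f, 't) func, ('f, 't, 'f, 't) nat_trans) pstrans" where
  "hom_pstrans I C F f =
     \<lparr>TDom = hom_psfun I C F (Trg C f), TCod = hom_psfun I C F (Src C f),
      T0 = restrict (\<lambda>i. pre_func C f (P0 F i)) (Cell0 I),
      T1 = restrict (\<lambda>u. id_nat (comp_func (post_func C (Src C f) (P1 F u))
                                           (pre_func C f (P0 F (Src I u))))) (Cell1 I)\<rparr>"

definition hom_modif ::
  "('i, 'u, 'v) two_cat \<Rightarrow> ('c, 'f, 't) two_cat \<Rightarrow> ('i, 'u, 'v, 'c, 'f, 't) psfun \<Rightarrow> 't \<Rightarrow>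
   ('i, 'u, 'v, ('f, 't) cat, ('f, 't, 'f, 't) func, ('f, 't, 'f, 't) nat_trans) modif" where
  "hom_modif I C F \<alpha> =
     \<lparr>MDom = hom_pstrans I C F (Dom2 C \<alpha>), MCod = hom_pstrans I C F (Cod2 C \<alpha>),
      MAt = restrict (\<lambda>i. pre_nat C \<alpha> (P0 F i)) (Cell0 I)\<rparr>"

text \<open>\<open>C(-, F) : C\<^sup>o\<^sup>p \<rightarrow> Ps(I, Cat)\<close>. It is a strict 2-functor, hence the identity compositors.\<close>

definition hom_2func ::
  "('i, 'u, 'v) two_cat \<Rightarrow> ('c, 'f, 't) two_cat \<Rightarrow> ('i, 'u, 'v, 'c, 'f, 't) psfun \<Rightarrow>
   ('c, 'f, 't,
    ('i, 'u, 'v, ('f, 't) cat, ('f, 't, 'f, 't) func, ('f, 't, 'f, 't) nat_trans) psfun,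
    ('i, 'u, 'v, ('f, 't) cat, ('f, 't, 'f, 't) func, ('f, 't, 'f, 't) nat_trans) pstrans,
    ('i, 'u, 'v, ('f, 't) cat, ('f, 't, 'f, 't) func, ('f, 't, 'f, 't) nat_trans) modif) psfun" where
  "hom_2func I C F =
     \<lparr>P0 = restrict (hom_psfun I C F) (Cell0 C),
      P1 = restrict (hom_pstrans I C F) (Cell1 C),
      P2 = restrict (hom_modif I C F) (Cell2 C),
      Phi = (\<lambda>f g. if f \<in> Cell1 C \<and> g \<in> Cell1 C \<and> Trg (op2 C) f = Src (op2 C) g
                   then Id2 (Ps I Cat) (hom_pstrans I C F (g \<odot>\<^bsub>op2 C\<^esub> f)) else undefined)\<rparr>"


section \<open>Weighted bi-limits and tensors\<close>

definition bilimit_comparison ::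
  "('i, 'u, 'v) two_cat \<Rightarrow> ('c, 'f, 't) two_cat \<Rightarrow> ('i, 'u, 'v, 'c, 'f, 't) psfun \<Rightarrow> 'c \<Rightarrow>
   ('i, 'u, 'v, ('f, 't) cat, ('f, 't, 'f, 't) func, ('f, 't, 'f, 't) nat_trans) pstrans \<Rightarrow> 'c \<Rightarrow>
   ('f, 't,
    ('i, 'u, 'v, ('f, 't) cat, ('f, 't, 'f, 't) func, ('f, 't, 'f, 't) nat_trans) pstrans,
    ('i, 'u, 'v, ('f, 't) cat, ('f, 't, 'f, 't) func, ('f, 't, 'f, 't) nat_trans) modif) func" where
  "bilimit_comparison I C F X lam Y =
     comp_func (pre_func (Ps I Cat) lam (hom_psfun I C F Y))
               (local_func (op2 C) (Ps I Cat) (hom_2func I C F) X Y)"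

definition weighted_bilimit ::
  "('i, 'u, 'v) two_cat \<Rightarrow> ('c, 'f, 't) two_cat \<Rightarrow> ('i, 'u, 'v, 'c, 'f, 't) psfun \<Rightarrow>
   ('i, 'u, 'v, ('f, 't) cat, ('f, 't, 'f, 't) func, ('f, 't, 'f, 't) nat_trans) psfun \<Rightarrow> 'c \<Rightarrow>
   ('i, 'u, 'v, ('f, 't) cat, ('f, 't, 'f, 't) func, ('f, 't, 'f, 't) nat_trans) pstrans \<Rightarrow> bool" where
  "weighted_bilimit I C F W X lam \<longleftrightarrow>
     X \<in> Cell0 C \<and> lam \<in> hom1 (Ps I Cat) W (hom_psfun I C F X) \<and>
     (\<forall>Y\<in>Cell0 C. adjoint_equivalence (hom_cat C Y X) (hom_cat (Ps I Cat) W (hom_psfun I C F Y))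
                    (bilimit_comparison I C F X lam Y))"

definition tensor_comparison ::
  "('c, 'f, 't) two_cat \<Rightarrow> ('o, 'm) cat \<Rightarrow> 'c \<Rightarrow> 'c \<Rightarrow> ('o, 'm, 'f, 't) func \<Rightarrow> 'c \<Rightarrow>
   ('f, 't, ('o, 'm, 'f, 't) func, ('o, 'm, 'f, 't) nat_trans) func" where
  "tensor_comparison C A X T \<zeta> Y =
     \<lparr>FDom = hom_cat C T Y, FCod = func_cat A (hom_cat C X Y),
      FObj = restrict (\<lambda>h. comp_func (post_func C X h) \<zeta>) (Obj (hom_cat C T Y)),
      FArr = restrict (\<lambda>\<beta>. hcomp_nat (post_nat C X \<beta>) (id_nat \<zeta>)) (Arr (hom_cat C T Y))\<rparr>"

definition is_tensor ::
  "('c, 'f, 't) two_cat \<Rightarrow> ('o, 'm) cat \<Rightarrow> 'c \<Rightarrow> 'c \<Rightarrow> ('o, 'm, 'f, 't) func \<Rightarrow> bool" where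
  "is_tensor C A X T \<zeta> \<longleftrightarrow> T \<in> Cell0 C \<and> is_functor A (hom_cat C X T) \<zeta> \<and>
     (\<forall>Y\<in>Cell0 C. iso_of_cats (hom_cat C T Y) (func_cat A (hom_cat C X Y)) (tensor_comparison C A X T \<zeta> Y))"

definition has_tensors :: "('c, 'f, 't) two_cat \<Rightarrow> ('o, 'm) cat \<Rightarrow> bool" where
  "has_tensors C A \<longleftrightarrow> (\<forall>X\<in>Cell0 C. \<exists>T \<zeta>. is_tensor C A X T \<zeta>)"


section \<open>Pseudo-slices and bi-initial objects\<close>

text \<open>A 1-cell of \<open>J \<down> G\<close> is recorded with its source \<open>(X, f)\<close> and target \<open>(Y, g)\<close>, together with
  \<open>b : X \<rightarrow> Y\<close> and an invertible \<open>\<psi> : g \<Rightarrow> (G b) f\<close>.\<close>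

record ('b, 'h, 'g, 't) slice1 =
  S1Src :: "'b \<times> 'h"
  S1Trg :: "'b \<times> 'h"
  S1Mor :: "'g"
  S1Cell :: "'t"

record ('b, 'h, 'g, 's, 't) slice2 =
  S2Dom :: "('b, 'h, 'g, 't) slice1"
  S2Cod :: "('b, 'h, 'g, 't) slice1"
  S2Cell :: "'s"

text \<open>The 2-cell of a composite is \<open>h \<Rightarrow> (G c) g \<Rightarrow> (G c)(G b) f \<Rightarrow> G(c b) f\<close>.\<close>

definition pseudo_slice ::
  "('b, 'g, 's) two_cat \<Rightarrow> ('a, 'h, 't) two_cat \<Rightarrow> ('b, 'g, 's, 'a, 'h, 't) psfun \<Rightarrow> 'a \<Rightarrow>
   ('b \<times> 'h, ('b, 'h, 'g, 't) slice1, ('b, 'h, 'g, 's, 't) slice2) two_cat" where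
  "pseudo_slice B A G J =
    (let
       ob = {(X, f). X \<in> Cell0 B \<and> f \<in> hom1 A J (P0 G X)};
       mor = {m. S1Src m \<in> ob \<and> S1Trg m \<in> ob \<and> S1Mor m \<in> hom1 B (fst (S1Src m)) (fst (S1Trg m)) \<and>
                 S1Cell m \<in> hom2 A (snd (S1Trg m)) (P1 G (S1Mor m) \<odot>\<^bsub>A\<^esub> snd (S1Src m)) \<and>
                 invertible2 A (S1Cell m)};
       id1 = (\<lambda>x. \<lparr>S1Src = x, S1Trg = x, S1Mor = Id1 B (fst x), S1Cell = Id2 A (snd x)\<rparr>);
       comp1 = (\<lambda>n m. \<lparr>S1Src = S1Src m, S1Trg = S1Trg n, S1Mor = S1Mor n \<odot>\<^bsub>B\<^esub> S1Mor m,
                  S1Cell = (Phi G (S1Mor m) (S1Mor n) \<star>\<^bsub>A\<^esub> Id2 A (snd (S1Src m)))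
                           \<bullet>\<^bsub>A\<^esub> (Id2 A (P1 G (S1Mor n)) \<star>\<^bsub>A\<^esub> S1Cell m) \<bullet>\<^bsub>A\<^esub> S1Cell n\<rparr>)
     in
     \<lparr>Cell0 = ob,
      Cell1 = mor,
      Cell2 = {c. S2Dom c \<in> mor \<and> S2Cod c \<in> mor \<and>
                  S1Src (S2Dom c) = S1Src (S2Cod c) \<and> S1Trg (S2Dom c) = S1Trg (S2Cod c) \<and>
                  S2Cell c \<in> hom2 B (S1Mor (S2Dom c)) (S1Mor (S2Cod c)) \<and>
                  (P2 G (S2Cell c) \<star>\<^bsub>A\<^esub> Id2 A (snd (S1Src (S2Dom c)))) \<bullet>\<^bsub>A\<^esub> S1Cell (S2Dom c)
                    = S1Cell (S2Cod c)},
      Src = S1Src, Trg = S1Trg, Dom2 = S2Dom, Cod2 = S2Cod,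
      Id1 = id1,
      Id2 = (\<lambda>m. \<lparr>S2Dom = m, S2Cod = m, S2Cell = Id2 B (S1Mor m)\<rparr>),
      Cmp1 = comp1,
      HCmp = (\<lambda>d c. \<lparr>S2Dom = comp1 (S2Dom d) (S2Dom c), S2Cod = comp1 (S2Cod d) (S2Cod c),
                    S2Cell = S2Cell d \<star>\<^bsub>B\<^esub> S2Cell c\<rparr>),
      VCmp = (\<lambda>d c. \<lparr>S2Dom = S2Dom c, S2Cod = S2Cod d, S2Cell = S2Cell d \<bullet>\<^bsub>B\<^esub> S2Cell c\<rparr>)\<rparr>)"

text \<open>The projection \<open>J \<down> G \<rightarrow> B\<close>, a strict 2-functor.\<close>

definition slice_proj ::
  "('b, 'g, 's) two_cat \<Rightarrow> ('a, 'h, 't) two_cat \<Rightarrow> ('b, 'g, 's, 'a, 'h, 't) psfun \<Rightarrow> 'a \<Rightarrow>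
   ('b \<times> 'h, ('b, 'h, 'g, 't) slice1, ('b, 'h, 'g, 's, 't) slice2, 'b, 'g, 's) psfun" where
  "slice_proj B A G J =
     (let S = pseudo_slice B A G J in
      \<lparr>P0 = restrict fst (Cell0 S), P1 = restrict S1Mor (Cell1 S), P2 = restrict S2Cell (Cell2 S),
       Phi = (\<lambda>m n. if m \<in> Cell1 S \<and> n \<in> Cell1 S \<and> Trg S m = Src S n
                    then Id2 B (S1Mor n \<odot>\<^bsub>B\<^esub> S1Mor m) else undefined)\<rparr>)"

text \<open>To be used for 2-functors \<open>G : A \<rightarrow> B\<close> only.\<close>

definition trivial_fibration ::
  "('a, 'g, 's) two_cat \<Rightarrow> ('b, 'h, 't) two_cat \<Rightarrow> ('a, 'g, 's, 'b, 'h, 't) psfun \<Rightarrow> bool" where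
  "trivial_fibration A B G \<longleftrightarrow>
     (\<forall>Y\<in>Cell0 B. \<exists>X\<in>Cell0 A. P0 G X = Y) \<and>
     (\<forall>X\<in>Cell0 A. \<forall>Y\<in>Cell0 A. \<forall>b\<in>hom1 B (P0 G X) (P0 G Y). \<exists>a\<in>hom1 A X Y. P1 G a = b) \<and>
     (\<forall>X\<in>Cell0 A. \<forall>Y\<in>Cell0 A. \<forall>a\<in>hom1 A X Y. \<forall>a'\<in>hom1 A X Y.
        bij_betw (P2 G) (hom2 A a a') (hom2 B (P1 G a) (P1 G a')))"

definition bi_initial :: "('a, 'g, 's) two_cat \<Rightarrow> 'a \<Rightarrow> bool" where
  "bi_initial A J \<longleftrightarrow> J \<in> Cell0 A \<and>
     trivial_fibration (pseudo_slice A A (id_psfun A) J) A (slice_proj A A (id_psfun A) J)"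

end

theory Submission
  imports Defs
begin

text \<open>
  Write \<open>G = C(-, F)\<close>. A pair \<open>(X, \<lambda>)\<close> is a weighted bi-limit when, for every \<open>Y\<close>, the functor
  \<open>K\<^sub>Y : C(Y, X) \<rightarrow> Ps(I, Cat)(W, G Y)\<close>, \<open>b \<mapsto> G b \<cdot> \<lambda>\<close>, is an adjoint equivalence, which by choice means essentially
  surjective and fully faithful (\<open>adjoint_equivalence_imp\<close>, \<open>adjoint_equivalenceI\<close>). Bi-initiality of \<open>J\<close> in a
  2-category says that each hom-category out of \<open>J\<close> is non-empty with exactly one 2-cell between any two of
  its objects (\<open>bi_initial_iff\<close>). A 1-cell of the slice \<open>W \<down> G\<close> from \<open>(X, \<lambda>)\<close> to \<open>(Y, f)\<close> is a \<open>b : Y \<rightarrow> X\<close>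
  together with an isomorphism \<open>f \<cong> K\<^sub>Y b\<close>, so \<open>(X, \<lambda>)\<close> is bi-initial there iff every \<open>K\<^sub>Y\<close> is essentially
  surjective and every \<^emph>\<open>isomorphism\<close> between values of \<open>K\<^sub>Y\<close> has a unique preimage
  (\<open>bi_initial_slice_iff\<close>). A weighted bi-limit clearly has this property. What has to be explained is why,
  conversely, unique preimages of isomorphisms give unique preimages of all 2-cells.

  This is where tensors by the arrow category enter. The tensor \<open>T\<close> of \<open>Y\<close> carries a universal 2-cell
  \<open>\<tau> : p \<Rightarrow> q : Y \<rightarrow> T\<close>, so a 2-cell between 1-cells \<open>Y \<rightarrow> X\<close> is a 1-cell \<open>T \<rightarrow> X\<close>. The 2-functor \<open>G\<close> respects this:
  a 2-cell \<open>\<mu>\<close> between 1-cells \<open>W \<rightarrow> G Y\<close>, invertible or not, is the same as a 1-cell \<open>W \<rightarrow> G T\<close>, because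
  the components of \<open>\<mu>\<close> are 2-cells between 1-cells out of \<open>Y\<close> (\<open>modification_eq_cone\<close>). Essential
  surjectivity of \<open>K\<^sub>T\<close> therefore approximates \<open>\<mu>\<close>, up to isomorphism of its source and target, by the image of
  some \<open>h \<cdot> \<tau>\<close>; lifting these two isomorphisms along \<open>K\<^sub>Y\<close> corrects \<open>h \<cdot> \<tau>\<close> to a preimage of \<open>\<mu>\<close>. Uniqueness comes
  from the unique lifting of an identity along \<open>K\<^sub>T\<close>. This argument is \<open>universal_iff_bi_initial\<close>; it concerns an
  arbitrary strict 2-functor whose source has such objects of arrows.

  The remaining work is to see that everything lives in 2-categories: \<open>Cat\<close>, the pseudo-functors
  \<open>Ps(A, B)\<close> and the pseudo-slices are 2-categories, and \<open>C(-, F)\<close> is a strict 2-functor.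
\<close>

section \<open>Calculating in categories and in strict 2-categories\<close>

definition inverse_in :: "('o, 'm) cat \<Rightarrow> 'm \<Rightarrow> 'm" where
  "inverse_in A f = (SOME g. g \<in> Arr A \<and> Dom A g = Cod A f \<and> Cod A g = Dom A f \<and>
     g \<cdot>\<^bsub>A\<^esub> f = Ide A (Dom A f) \<and> f \<cdot>\<^bsub>A\<^esub> g = Ide A (Cod A f))"

lemma inverse_in:
  assumes "is_iso A f"
  shows "f \<in> Arr A" "inverse_in A f \<in> Arr A"
    "Dom A (inverse_in A f) = Cod A f" "Cod A (inverse_in A f) = Dom A f"
    "inverse_in A f \<cdot>\<^bsub>A\<^esub> f = Ide A (Dom A f)" "f \<cdot>\<^bsub>A\<^esub> inverse_in A f = Ide A (Cod A f)"
proof -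
  from assms show "f \<in> Arr A" by (simp add: is_iso_def)
  from assms have "\<exists>g. g \<in> Arr A \<and> Dom A g = Cod A f \<and> Cod A g = Dom A f \<and>
     g \<cdot>\<^bsub>A\<^esub> f = Ide A (Dom A f) \<and> f \<cdot>\<^bsub>A\<^esub> g = Ide A (Cod A f)"
    by (auto simp: is_iso_def)
  from someI_ex[OF this, folded inverse_in_def]
  show "inverse_in A f \<in> Arr A"
    "Dom A (inverse_in A f) = Cod A f" "Cod A (inverse_in A f) = Dom A f"
    "inverse_in A f \<cdot>\<^bsub>A\<^esub> f = Ide A (Dom A f)" "f \<cdot>\<^bsub>A\<^esub> inverse_in A f = Ide A (Cod A f)" by auto
qed

lemma is_isoI:
  assumes "f \<in> Arr A" "g \<in> Arr A" "Dom A g = Cod A f" "Cod A g = Dom A f"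
    "g \<cdot>\<^bsub>A\<^esub> f = Ide A (Dom A f)" "f \<cdot>\<^bsub>A\<^esub> g = Ide A (Cod A f)"
  shows "is_iso A f"
  using assms by (auto simp: is_iso_def)

lemma is_iso_inverse_in: "is_iso A f \<Longrightarrow> is_iso A (inverse_in A f)"
  by (rule is_isoI[of _ _ f]) (simp_all add: inverse_in)

context category
begin

declare Dom_in [simp] Cod_in [simp] Ide_in [simp] Dom_Ide [simp] Cod_Ide [simp] Cmp_in [simp]
  Dom_Cmp [simp] Cod_Cmp [simp] Cmp_assoc [simp]

lemma Cmp_Ide_left' [simp]: "\<lbrakk>f \<in> Arr A; Cod A f = x\<rbrakk> \<Longrightarrow> Ide A x \<cdot> f = f"
  using Cmp_Ide_left by blast

lemma Cmp_Ide_right' [simp]: "\<lbrakk>f \<in> Arr A; Dom A f = x\<rbrakk> \<Longrightarrow> f \<cdot> Ide A x = f"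
  using Cmp_Ide_right by blast

lemma Cmp_inverse_left [simp]:
  "\<lbrakk>is_iso A f; h \<in> Arr A; Cod A h = Dom A f\<rbrakk> \<Longrightarrow> inverse_in A f \<cdot> (f \<cdot> h) = h"
  using inverse_in[of A f] Cmp_assoc[of h f "inverse_in A f"] by simp

lemma Cmp_inverse_right [simp]:
  "\<lbrakk>is_iso A f; h \<in> Arr A; Cod A h = Cod A f\<rbrakk> \<Longrightarrow> f \<cdot> (inverse_in A f \<cdot> h) = h"
  using inverse_in[of A f] Cmp_assoc[of h "inverse_in A f" f] by simp

lemma iso_cancel_left:
  assumes "is_iso A f" "g \<in> Arr A" "h \<in> Arr A" "Cod A g = Dom A f" "Cod A h = Dom A f"
    "f \<cdot> g = f \<cdot> h"
  shows "g = h"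
proof -
  have "inverse_in A f \<cdot> (f \<cdot> g) = inverse_in A f \<cdot> (f \<cdot> h)" using assms(6) by simp
  then show ?thesis using assms(1-5) by simp
qed

lemma iso_cancel_right:
  assumes "is_iso A f" "g \<in> Arr A" "h \<in> Arr A" "Dom A g = Cod A f" "Dom A h = Cod A f"
    "g \<cdot> f = h \<cdot> f"
  shows "g = h"
proof -
  have "(g \<cdot> f) \<cdot> inverse_in A f = (h \<cdot> f) \<cdot> inverse_in A f" using assms by simp
  then show ?thesis using assms(1-5) inverse_in[of A f] by simp
qed

end

lemma hom1D: "f \<in> hom1 C X Y \<Longrightarrow> f \<in> Cell1 C" "f \<in> hom1 C X Y \<Longrightarrow> Src C f = X"
  "f \<in> hom1 C X Y \<Longrightarrow> Trg C f = Y"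
  by (simp_all add: hom1_def)

lemma hom2D: "\<alpha> \<in> hom2 C f g \<Longrightarrow> \<alpha> \<in> Cell2 C" "\<alpha> \<in> hom2 C f g \<Longrightarrow> Dom2 C \<alpha> = f"
  "\<alpha> \<in> hom2 C f g \<Longrightarrow> Cod2 C \<alpha> = g"
  by (simp_all add: hom2_def)

text \<open>
  The axioms of a 2-category, restated so that rewriting discharges their typing conditions by
  computing sources and targets. The whiskering rules below turn every pasting into a vertical
  composite of cells \<open>h \<star> (\<alpha> \<star> f)\<close> with \<open>h\<close> and \<open>f\<close> identities on (composite) 1-cells; after that
  only the exchange law has to be applied by hand.
\<close>

context two_category
begin

lemma Cell1_simps [simp]:
  "f \<in> Cell1 C \<Longrightarrow> Src C f \<in> Cell0 C" "f \<in> Cell1 C \<Longrightarrow> Trg C f \<in> Cell0 C"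
  "X \<in> Cell0 C \<Longrightarrow> Id1 C X \<in> Cell1 C"
  "X \<in> Cell0 C \<Longrightarrow> Src C (Id1 C X) = X" "X \<in> Cell0 C \<Longrightarrow> Trg C (Id1 C X) = X"
  "\<lbrakk>f \<in> Cell1 C; g \<in> Cell1 C; Trg C f = Src C g\<rbrakk> \<Longrightarrow> g \<odot> f \<in> Cell1 C"
  "\<lbrakk>f \<in> Cell1 C; g \<in> Cell1 C; Trg C f = Src C g\<rbrakk> \<Longrightarrow> Src C (g \<odot> f) = Src C f"
  "\<lbrakk>f \<in> Cell1 C; g \<in> Cell1 C; Trg C f = Src C g\<rbrakk> \<Longrightarrow> Trg C (g \<odot> f) = Trg C g"
  "\<lbrakk>f \<in> Cell1 C; Trg C f = X\<rbrakk> \<Longrightarrow> Id1 C X \<odot> f = f"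
  "\<lbrakk>f \<in> Cell1 C; Src C f = X\<rbrakk> \<Longrightarrow> f \<odot> Id1 C X = f"
  "\<lbrakk>f \<in> Cell1 C; g \<in> Cell1 C; h \<in> Cell1 C; Trg C f = Src C g; Trg C g = Src C h\<rbrakk>
     \<Longrightarrow> (h \<odot> g) \<odot> f = h \<odot> (g \<odot> f)"
  using category.Dom_in[OF under_category] category.Cod_in[OF under_category]
    category.Ide_in[OF under_category] category.Dom_Ide[OF under_category]
    category.Cod_Ide[OF under_category] category.Cmp_in[OF under_category]
    category.Dom_Cmp[OF under_category] category.Cod_Cmp[OF under_category]
    category.Cmp_Ide_left'[OF under_category] category.Cmp_Ide_right'[OF under_category]
    category.Cmp_assoc[OF under_category]
  by (simp_all add: under_cat_def)

lemma Cell2_simps [simp]: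
  "\<alpha> \<in> Cell2 C \<Longrightarrow> Dom2 C \<alpha> \<in> Cell1 C" "\<alpha> \<in> Cell2 C \<Longrightarrow> Cod2 C \<alpha> \<in> Cell1 C"
  "f \<in> Cell1 C \<Longrightarrow> Id2 C f \<in> Cell2 C"
  "f \<in> Cell1 C \<Longrightarrow> Dom2 C (Id2 C f) = f" "f \<in> Cell1 C \<Longrightarrow> Cod2 C (Id2 C f) = f"
  "\<lbrakk>\<alpha> \<in> Cell2 C; \<beta> \<in> Cell2 C; Cod2 C \<alpha> = Dom2 C \<beta>\<rbrakk> \<Longrightarrow> \<beta> \<bullet> \<alpha> \<in> Cell2 C"
  "\<lbrakk>\<alpha> \<in> Cell2 C; \<beta> \<in> Cell2 C; Cod2 C \<alpha> = Dom2 C \<beta>\<rbrakk> \<Longrightarrow> Dom2 C (\<beta> \<bullet> \<alpha>) = Dom2 C \<alpha>"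
  "\<lbrakk>\<alpha> \<in> Cell2 C; \<beta> \<in> Cell2 C; Cod2 C \<alpha> = Dom2 C \<beta>\<rbrakk> \<Longrightarrow> Cod2 C (\<beta> \<bullet> \<alpha>) = Cod2 C \<beta>"
  "\<lbrakk>\<alpha> \<in> Cell2 C; Cod2 C \<alpha> = f\<rbrakk> \<Longrightarrow> Id2 C f \<bullet> \<alpha> = \<alpha>"
  "\<lbrakk>\<alpha> \<in> Cell2 C; Dom2 C \<alpha> = f\<rbrakk> \<Longrightarrow> \<alpha> \<bullet> Id2 C f = \<alpha>"
  "\<lbrakk>\<alpha> \<in> Cell2 C; \<beta> \<in> Cell2 C; \<gamma> \<in> Cell2 C; Cod2 C \<alpha> = Dom2 C \<beta>; Cod2 C \<beta> = Dom2 C \<gamma>\<rbrakk>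
     \<Longrightarrow> (\<gamma> \<bullet> \<beta>) \<bullet> \<alpha> = \<gamma> \<bullet> (\<beta> \<bullet> \<alpha>)"
  using category.Dom_in[OF vert_category] category.Cod_in[OF vert_category]
    category.Ide_in[OF vert_category] category.Dom_Ide[OF vert_category]
    category.Cod_Ide[OF vert_category] category.Cmp_in[OF vert_category]
    category.Dom_Cmp[OF vert_category] category.Cod_Cmp[OF vert_category]
    category.Cmp_Ide_left'[OF vert_category] category.Cmp_Ide_right'[OF vert_category]
    category.Cmp_assoc[OF vert_category]
  by (simp_all add: vert_cat_def)

lemma parallel_simps [simp]:
  "\<alpha> \<in> Cell2 C \<Longrightarrow> Src C (Cod2 C \<alpha>) = Src C (Dom2 C \<alpha>)"
  "\<alpha> \<in> Cell2 C \<Longrightarrow> Trg C (Cod2 C \<alpha>) = Trg C (Dom2 C \<alpha>)"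
  using parallel by simp_all

lemma HCmp_simps [simp]:
  assumes "\<alpha> \<in> Cell2 C" "\<beta> \<in> Cell2 C" "Trg C (Dom2 C \<alpha>) = Src C (Dom2 C \<beta>)"
  shows "\<beta> \<star> \<alpha> \<in> Cell2 C" "Dom2 C (\<beta> \<star> \<alpha>) = Dom2 C \<beta> \<odot> Dom2 C \<alpha>"
    "Cod2 C (\<beta> \<star> \<alpha>) = Cod2 C \<beta> \<odot> Cod2 C \<alpha>"
  using HCmp_in[of \<alpha> "Dom2 C \<alpha>" "Cod2 C \<alpha>" \<beta> "Dom2 C \<beta>" "Cod2 C \<beta>"] assms
  by (simp_all add: hom2_def)

lemma HCmp_Id2' [simp]:
  "\<lbrakk>f \<in> Cell1 C; g \<in> Cell1 C; Trg C f = Src C g\<rbrakk> \<Longrightarrow> Id2 C g \<star> Id2 C f = Id2 C (g \<odot> f)"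
  by (rule HCmp_Id2)

lemma HCmp_Id_left' [simp]:
  "\<lbrakk>\<alpha> \<in> Cell2 C; Trg C (Dom2 C \<alpha>) = X\<rbrakk> \<Longrightarrow> Id2 C (Id1 C X) \<star> \<alpha> = \<alpha>"
  using HCmp_Id_left[of \<alpha> "Dom2 C \<alpha>" "Cod2 C \<alpha>"] by (simp add: hom2_def)

lemma HCmp_Id_right' [simp]:
  "\<lbrakk>\<alpha> \<in> Cell2 C; Src C (Dom2 C \<alpha>) = X\<rbrakk> \<Longrightarrow> \<alpha> \<star> Id2 C (Id1 C X) = \<alpha>"
  using HCmp_Id_right[of \<alpha> "Dom2 C \<alpha>" "Cod2 C \<alpha>"] by (simp add: hom2_def)

lemma HCmp_assoc':
  "\<lbrakk>\<alpha> \<in> Cell2 C; \<beta> \<in> Cell2 C; \<gamma> \<in> Cell2 C; Trg C (Dom2 C \<alpha>) = Src C (Dom2 C \<beta>);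
    Trg C (Dom2 C \<beta>) = Src C (Dom2 C \<gamma>)\<rbrakk> \<Longrightarrow> (\<gamma> \<star> \<beta>) \<star> \<alpha> = \<gamma> \<star> (\<beta> \<star> \<alpha>)"
  using HCmp_assoc[of \<alpha> "Dom2 C \<alpha>" "Cod2 C \<alpha>" \<beta> "Dom2 C \<beta>" "Cod2 C \<beta>" \<gamma> "Dom2 C \<gamma>" "Cod2 C \<gamma>"]
  by (simp add: hom2_def)

lemma interchange':
  "\<lbrakk>\<alpha> \<in> Cell2 C; \<alpha>' \<in> Cell2 C; \<beta> \<in> Cell2 C; \<beta>' \<in> Cell2 C; Cod2 C \<alpha> = Dom2 C \<alpha>';
    Cod2 C \<beta> = Dom2 C \<beta>'; Trg C (Dom2 C \<alpha>) = Src C (Dom2 C \<beta>)\<rbrakk>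
   \<Longrightarrow> (\<beta>' \<bullet> \<beta>) \<star> (\<alpha>' \<bullet> \<alpha>) = (\<beta>' \<star> \<alpha>') \<bullet> (\<beta> \<star> \<alpha>)"
  using interchange[of \<alpha> "Dom2 C \<alpha>" "Cod2 C \<alpha>" \<alpha>' "Cod2 C \<alpha>'" \<beta> "Dom2 C \<beta>" "Cod2 C \<beta>" \<beta>' "Cod2 C \<beta>'"]
  by (simp add: hom2_def)

lemma whisker_simps [simp]:
  "\<lbrakk>\<alpha> \<in> Cell2 C; \<alpha>' \<in> Cell2 C; g \<in> Cell1 C; Cod2 C \<alpha> = Dom2 C \<alpha>'; Trg C (Dom2 C \<alpha>) = Src C g\<rbrakk>
     \<Longrightarrow> Id2 C g \<star> (\<alpha>' \<bullet> \<alpha>) = (Id2 C g \<star> \<alpha>') \<bullet> (Id2 C g \<star> \<alpha>)"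
  "\<lbrakk>\<beta> \<in> Cell2 C; \<beta>' \<in> Cell2 C; f \<in> Cell1 C; Cod2 C \<beta> = Dom2 C \<beta>'; Trg C f = Src C (Dom2 C \<beta>)\<rbrakk>
     \<Longrightarrow> (\<beta>' \<bullet> \<beta>) \<star> Id2 C f = (\<beta>' \<star> Id2 C f) \<bullet> (\<beta> \<star> Id2 C f)"
  "\<lbrakk>\<alpha> \<in> Cell2 C; g \<in> Cell1 C; h \<in> Cell1 C; Trg C (Dom2 C \<alpha>) = Src C g; Trg C g = Src C h\<rbrakk>
     \<Longrightarrow> Id2 C h \<star> (Id2 C g \<star> \<alpha>) = Id2 C (h \<odot> g) \<star> \<alpha>"
  "\<lbrakk>\<alpha> \<in> Cell2 C; f \<in> Cell1 C; g \<in> Cell1 C; Trg C g = Src C (Dom2 C \<alpha>); Trg C f = Src C g\<rbrakk>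
     \<Longrightarrow> (\<alpha> \<star> Id2 C g) \<star> Id2 C f = \<alpha> \<star> Id2 C (g \<odot> f)"
  "\<lbrakk>\<alpha> \<in> Cell2 C; f \<in> Cell1 C; h \<in> Cell1 C; Trg C (Dom2 C \<alpha>) = Src C h; Trg C f = Src C (Dom2 C \<alpha>)\<rbrakk>
     \<Longrightarrow> (Id2 C h \<star> \<alpha>) \<star> Id2 C f = Id2 C h \<star> (\<alpha> \<star> Id2 C f)"
  using interchange'[of \<alpha> \<alpha>' "Id2 C g" "Id2 C g"] interchange'[of "Id2 C f" "Id2 C f" \<beta> \<beta>']
    HCmp_assoc'[of \<alpha> "Id2 C g" "Id2 C h"] HCmp_assoc'[of "Id2 C f" "Id2 C g" \<alpha>]
    HCmp_assoc'[of "Id2 C f" \<alpha> "Id2 C h"]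
  by simp_all

lemma HCmp_slice_left:
  "\<lbrakk>\<alpha> \<in> hom2 C f f'; \<beta> \<in> hom2 C g g'; Trg C f = Src C g\<rbrakk>
   \<Longrightarrow> \<beta> \<star> \<alpha> = (\<beta> \<star> Id2 C f') \<bullet> (Id2 C g \<star> \<alpha>)"
  using interchange'[of \<alpha> "Id2 C f'" "Id2 C g" \<beta>] by (auto simp: hom2_def)

lemma HCmp_slice_right:
  "\<lbrakk>\<alpha> \<in> hom2 C f f'; \<beta> \<in> hom2 C g g'; Trg C f = Src C g\<rbrakk>
   \<Longrightarrow> \<beta> \<star> \<alpha> = (Id2 C g' \<star> \<alpha>) \<bullet> (\<beta> \<star> Id2 C f)"
  using interchange'[of "Id2 C f" \<alpha> \<beta> "Id2 C g'"] by (auto simp: hom2_def)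

lemma exchange:
  assumes "\<alpha> \<in> hom2 C f f'" "\<beta> \<in> hom2 C g g'" "Trg C f = Src C g"
  shows "(\<beta> \<star> Id2 C f') \<bullet> (Id2 C g \<star> \<alpha>) = (Id2 C g' \<star> \<alpha>) \<bullet> (\<beta> \<star> Id2 C f)"
  using HCmp_slice_left[OF assms] HCmp_slice_right[OF assms] by simp

abbreviation vinv :: "'t \<Rightarrow> 't" where
  "vinv \<equiv> inverse_in (vert_cat C)"

lemma vinv_simps:
  assumes "invertible2 C \<alpha>"
  shows "\<alpha> \<in> Cell2 C" "vinv \<alpha> \<in> Cell2 C" "Dom2 C (vinv \<alpha>) = Cod2 C \<alpha>"
    "Cod2 C (vinv \<alpha>) = Dom2 C \<alpha>" "vinv \<alpha> \<bullet> \<alpha> = Id2 C (Dom2 C \<alpha>)"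
    "\<alpha> \<bullet> vinv \<alpha> = Id2 C (Cod2 C \<alpha>)" "invertible2 C (vinv \<alpha>)"
    "\<lbrakk>\<gamma> \<in> Cell2 C; Cod2 C \<gamma> = Dom2 C \<alpha>\<rbrakk> \<Longrightarrow> vinv \<alpha> \<bullet> (\<alpha> \<bullet> \<gamma>) = \<gamma>"
    "\<lbrakk>\<gamma> \<in> Cell2 C; Cod2 C \<gamma> = Cod2 C \<alpha>\<rbrakk> \<Longrightarrow> \<alpha> \<bullet> (vinv \<alpha> \<bullet> \<gamma>) = \<gamma>"
  using inverse_in[of "vert_cat C" \<alpha>] is_iso_inverse_in[of "vert_cat C" \<alpha>] assms
    category.Cmp_inverse_left[OF vert_category, of \<alpha> \<gamma>]
    category.Cmp_inverse_right[OF vert_category, of \<alpha> \<gamma>]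
  by (simp_all add: invertible2_def vert_cat_def)

declare vinv_simps(2-9) [simp]

lemma invertible2I:
  assumes "\<alpha> \<in> hom2 C f g" "\<beta> \<in> hom2 C g f" "\<beta> \<bullet> \<alpha> = Id2 C f" "\<alpha> \<bullet> \<beta> = Id2 C g"
  shows "invertible2 C \<alpha>"
  unfolding invertible2_def
  by (rule is_isoI[of _ _ \<beta>]) (use assms in \<open>auto simp: vert_cat_def hom2_def\<close>)

lemma invertible2_Id2 [simp]: "f \<in> Cell1 C \<Longrightarrow> invertible2 C (Id2 C f)"
  by (rule invertible2I[of _ f f "Id2 C f"]) (simp_all add: hom2_def)

lemma invertible2_VCmp [simp]:
  "\<lbrakk>invertible2 C \<alpha>; invertible2 C \<beta>; Cod2 C \<alpha> = Dom2 C \<beta>\<rbrakk> \<Longrightarrow> invertible2 C (\<beta> \<bullet> \<alpha>)"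
  by (rule invertible2I[of _ "Dom2 C \<alpha>" "Cod2 C \<beta>" "vinv \<alpha> \<bullet> vinv \<beta>"]) (simp_all add: hom2_def vinv_simps(1))

lemma invertible2_HCmp [simp]:
  assumes "invertible2 C \<alpha>" "invertible2 C \<beta>" "Trg C (Dom2 C \<alpha>) = Src C (Dom2 C \<beta>)"
  shows "invertible2 C (\<beta> \<star> \<alpha>)"
proof (rule invertible2I[of _ "Dom2 C \<beta> \<odot> Dom2 C \<alpha>" "Cod2 C \<beta> \<odot> Cod2 C \<alpha>" "vinv \<beta> \<star> vinv \<alpha>"])
  show "(vinv \<beta> \<star> vinv \<alpha>) \<bullet> (\<beta> \<star> \<alpha>) = Id2 C (Dom2 C \<beta> \<odot> Dom2 C \<alpha>)"
    using assms by (subst interchange'[symmetric]) (simp_all add: vinv_simps(1))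
  show "(\<beta> \<star> \<alpha>) \<bullet> (vinv \<beta> \<star> vinv \<alpha>) = Id2 C (Cod2 C \<beta> \<odot> Cod2 C \<alpha>)"
    using assms by (subst interchange'[symmetric]) (simp_all add: vinv_simps(1))
qed (use assms in \<open>simp_all add: hom2_def vinv_simps(1)\<close>)

lemma category_hom_cat:
  assumes "X \<in> Cell0 C" "Y \<in> Cell0 C"
  shows "category (hom_cat C X Y)"
  by standard (use assms in \<open>auto simp: hom_cat_def hom1_def\<close>)

end

section \<open>The 2-category of categories\<close>

lemma is_functorD:
  assumes "is_functor A B F"
  shows "category A" "category B" "FDom F = A" "FCod F = B"
    "FObj F \<in> extensional (Obj A)" "FArr F \<in> extensional (Arr A)"
    "x \<in> Obj A \<Longrightarrow> FObj F x \<in> Obj B" "f \<in> Arr A \<Longrightarrow> FArr F f \<in> Arr B"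
    "f \<in> Arr A \<Longrightarrow> Dom B (FArr F f) = FObj F (Dom A f)"
    "f \<in> Arr A \<Longrightarrow> Cod B (FArr F f) = FObj F (Cod A f)"
    "x \<in> Obj A \<Longrightarrow> FArr F (Ide A x) = Ide B (FObj F x)"
    "\<lbrakk>f \<in> Arr A; g \<in> Arr A; Cod A f = Dom A g\<rbrakk> \<Longrightarrow> FArr F (g \<cdot>\<^bsub>A\<^esub> f) = FArr F g \<cdot>\<^bsub>B\<^esub> FArr F f"
  using assms by (auto simp: is_functor_def PiE_def)

lemma is_functorI:
  assumes "category A" "category B" "FDom F = A" "FCod F = B"
    "FObj F \<in> extensional (Obj A)" "FArr F \<in> extensional (Arr A)"
    "\<And>x. x \<in> Obj A \<Longrightarrow> FObj F x \<in> Obj B" "\<And>f. f \<in> Arr A \<Longrightarrow> FArr F f \<in> Arr B"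
    "\<And>f. f \<in> Arr A \<Longrightarrow> Dom B (FArr F f) = FObj F (Dom A f)"
    "\<And>f. f \<in> Arr A \<Longrightarrow> Cod B (FArr F f) = FObj F (Cod A f)"
    "\<And>x. x \<in> Obj A \<Longrightarrow> FArr F (Ide A x) = Ide B (FObj F x)"
    "\<And>f g. \<lbrakk>f \<in> Arr A; g \<in> Arr A; Cod A f = Dom A g\<rbrakk>
        \<Longrightarrow> FArr F (g \<cdot>\<^bsub>A\<^esub> f) = FArr F g \<cdot>\<^bsub>B\<^esub> FArr F f"
  shows "is_functor A B F"
  using assms by (auto simp: is_functor_def PiE_def)

lemma func_eqI:
  assumes "is_functor A B F" "is_functor A B G"
    "\<And>x. x \<in> Obj A \<Longrightarrow> FObj F x = FObj G x" "\<And>f. f \<in> Arr A \<Longrightarrow> FArr F f = FArr G f"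
  shows "F = G"
  using assms is_functorD(3-6)[OF assms(1)] is_functorD(3-6)[OF assms(2)]
  by (intro func.equality) (auto intro: extensionalityI)

lemma is_natD:
  assumes "is_nat A B \<tau>"
  shows "is_functor A B (NDom \<tau>)" "is_functor A B (NCod \<tau>)" "NAt \<tau> \<in> extensional (Obj A)"
    "x \<in> Obj A \<Longrightarrow> NAt \<tau> x \<in> Arr B"
    "x \<in> Obj A \<Longrightarrow> Dom B (NAt \<tau> x) = FObj (NDom \<tau>) x"
    "x \<in> Obj A \<Longrightarrow> Cod B (NAt \<tau> x) = FObj (NCod \<tau>) x"
    "f \<in> Arr A \<Longrightarrow>
      FArr (NCod \<tau>) f \<cdot>\<^bsub>B\<^esub> NAt \<tau> (Dom A f) = NAt \<tau> (Cod A f) \<cdot>\<^bsub>B\<^esub> FArr (NDom \<tau>) f"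
  using assms by (auto simp: is_nat_def PiE_def)

lemma is_natI:
  assumes "is_functor A B (NDom \<tau>)" "is_functor A B (NCod \<tau>)" "NAt \<tau> \<in> extensional (Obj A)"
    "\<And>x. x \<in> Obj A \<Longrightarrow> NAt \<tau> x \<in> Arr B"
    "\<And>x. x \<in> Obj A \<Longrightarrow> Dom B (NAt \<tau> x) = FObj (NDom \<tau>) x"
    "\<And>x. x \<in> Obj A \<Longrightarrow> Cod B (NAt \<tau> x) = FObj (NCod \<tau>) x"
    "\<And>f. f \<in> Arr A \<Longrightarrow>
      FArr (NCod \<tau>) f \<cdot>\<^bsub>B\<^esub> NAt \<tau> (Dom A f) = NAt \<tau> (Cod A f) \<cdot>\<^bsub>B\<^esub> FArr (NDom \<tau>) f"
  shows "is_nat A B \<tau>"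
  using assms by (auto simp: is_nat_def PiE_def)

lemma nat_eqI:
  assumes "is_nat A B \<sigma>" "is_nat A B \<tau>" "NDom \<sigma> = NDom \<tau>" "NCod \<sigma> = NCod \<tau>"
    "\<And>x. x \<in> Obj A \<Longrightarrow> NAt \<sigma> x = NAt \<tau> x"
  shows "\<sigma> = \<tau>"
  using assms is_natD(3)[OF assms(1)] is_natD(3)[OF assms(2)]
  by (intro nat_trans.equality) (auto intro: extensionalityI)

lemma is_functor_id: "category A \<Longrightarrow> is_functor A A (id_func A)"
  by (rule is_functorI)
    (auto simp: id_func_def category.Dom_in category.Cod_in category.Ide_in category.Cmp_in)

lemma id_func_simps [simp]:
  "FDom (id_func A) = A" "FCod (id_func A) = A"
  "x \<in> Obj A \<Longrightarrow> FObj (id_func A) x = x" "f \<in> Arr A \<Longrightarrow> FArr (id_func A) f = f"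
  by (simp_all add: id_func_def)

lemma comp_func_simps [simp]:
  "FDom (comp_func G F) = FDom F" "FCod (comp_func G F) = FCod G"
  "x \<in> Obj (FDom F) \<Longrightarrow> FObj (comp_func G F) x = FObj G (FObj F x)"
  "f \<in> Arr (FDom F) \<Longrightarrow> FArr (comp_func G F) f = FArr G (FArr F f)"
  by (simp_all add: comp_func_def)

lemma is_functor_comp:
  assumes F: "is_functor A B F" and G: "is_functor B E G"
  shows "is_functor A E (comp_func G F)"
proof (rule is_functorI)
  interpret A: category A using is_functorD(1)[OF F] .
  fix f g assume "f \<in> Arr A" "g \<in> Arr A" "Cod A f = Dom A g"
  then show "FArr (comp_func G F) (g \<cdot>\<^bsub>A\<^esub> f) = FArr (comp_func G F) g \<cdot>\<^bsub>E\<^esub> FArr (comp_func G F) f"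
    using is_functorD[OF F] is_functorD[OF G] by simp
qed (use is_functorD[OF F] is_functorD[OF G]
  category.Dom_in[of A] category.Cod_in[of A] category.Ide_in[of A] in
    \<open>simp_all\<close>, simp_all add: comp_func_def)

lemma comp_func_id:
  assumes F: "is_functor A B F"
  shows "comp_func (id_func B) F = F" "comp_func F (id_func A) = F"
  by (rule func_eqI[OF is_functor_comp[OF F is_functor_id[OF is_functorD(2)[OF F]]] F],
      use is_functorD[OF F] in simp_all)
    (rule func_eqI[OF is_functor_comp[OF is_functor_id[OF is_functorD(1)[OF F]] F] F],
      use is_functorD[OF F] in simp_all)

lemma is_nat_id:
  assumes F: "is_functor A B F"
  shows "is_nat A B (id_nat F)"
proof -
  interpret A: category A using is_functorD(1)[OF F] .
  interpret B: category B using is_functorD(2)[OF F] .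
  show ?thesis using is_functorD[OF F] F by (intro is_natI) (auto simp: id_nat_def)
qed

lemma id_nat_simps [simp]:
  "NDom (id_nat F) = F" "NCod (id_nat F) = F"
  "x \<in> Obj (FDom F) \<Longrightarrow> NAt (id_nat F) x = Ide (FCod F) (FObj F x)"
  by (simp_all add: id_nat_def)

lemma vcomp_nat_simps [simp]:
  "NDom (vcomp_nat \<tau> \<sigma>) = NDom \<sigma>" "NCod (vcomp_nat \<tau> \<sigma>) = NCod \<tau>"
  "x \<in> Obj (FDom (NDom \<sigma>)) \<Longrightarrow> NAt (vcomp_nat \<tau> \<sigma>) x = NAt \<tau> x \<cdot>\<^bsub>FCod (NDom \<sigma>)\<^esub> NAt \<sigma> x"
  by (simp_all add: vcomp_nat_def)

lemma hcomp_nat_simps [simp]: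
  "NDom (hcomp_nat \<tau> \<sigma>) = comp_func (NDom \<tau>) (NDom \<sigma>)"
  "NCod (hcomp_nat \<tau> \<sigma>) = comp_func (NCod \<tau>) (NCod \<sigma>)"
  "x \<in> Obj (FDom (NDom \<sigma>)) \<Longrightarrow> NAt (hcomp_nat \<tau> \<sigma>) x =
     FArr (NCod \<tau>) (NAt \<sigma> x) \<cdot>\<^bsub>FCod (NDom \<tau>)\<^esub> NAt \<tau> (FObj (NDom \<sigma>) x)"
  by (simp_all add: hcomp_nat_def)

lemma is_nat_vcomp:
  assumes \<sigma>: "is_nat A B \<sigma>" and \<tau>: "is_nat A B \<tau>" and eq: "NCod \<sigma> = NDom \<tau>"
  shows "is_nat A B (vcomp_nat \<tau> \<sigma>)"
proof -
  note s = is_natD[OF \<sigma>] and t = is_natD[OF \<tau>]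
  interpret A: category A using is_functorD(1)[OF s(1)] .
  interpret B: category B using is_functorD(2)[OF s(1)] .
  show ?thesis
  proof (rule is_natI)
    fix f assume f: "f \<in> Arr A"
    note F = is_functorD[OF s(1)] and G = is_functorD[OF s(2)] and H = is_functorD[OF t(2)]
    have "FArr (NCod \<tau>) f \<cdot>\<^bsub>B\<^esub> (NAt \<tau> (Dom A f) \<cdot>\<^bsub>B\<^esub> NAt \<sigma> (Dom A f))
        = (FArr (NCod \<tau>) f \<cdot>\<^bsub>B\<^esub> NAt \<tau> (Dom A f)) \<cdot>\<^bsub>B\<^esub> NAt \<sigma> (Dom A f)"
      using f s(4-6) t(4-6) H eq by simp
    also have "\<dots> = NAt \<tau> (Cod A f) \<cdot>\<^bsub>B\<^esub> (FArr (NCod \<sigma>) f \<cdot>\<^bsub>B\<^esub> NAt \<sigma> (Dom A f))"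
      using f s(4-6) t(4-6) t(7)[OF f] G eq by simp
    also have "\<dots> = (NAt \<tau> (Cod A f) \<cdot>\<^bsub>B\<^esub> NAt \<sigma> (Cod A f)) \<cdot>\<^bsub>B\<^esub> FArr (NDom \<sigma>) f"
      using f s(4-6) t(4-6) s(7)[OF f] F eq by simp
    finally show "FArr (NCod (vcomp_nat \<tau> \<sigma>)) f \<cdot>\<^bsub>B\<^esub> NAt (vcomp_nat \<tau> \<sigma>) (Dom A f)
        = NAt (vcomp_nat \<tau> \<sigma>) (Cod A f) \<cdot>\<^bsub>B\<^esub> FArr (NDom (vcomp_nat \<tau> \<sigma>)) f"
      using f F(3,4) by simp
  qed (use s t eq is_functorD(3,4)[OF s(1)] in \<open>simp_all\<close>, simp_all add: vcomp_nat_def)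
qed

lemma is_nat_hcomp:
  assumes \<sigma>: "is_nat A B \<sigma>" and \<tau>: "is_nat B E \<tau>"
  shows "is_nat A E (hcomp_nat \<tau> \<sigma>)"
proof -
  note s = is_natD[OF \<sigma>] and t = is_natD[OF \<tau>]
  note F = is_functorD[OF s(1)] and F' = is_functorD[OF s(2)]
    and G = is_functorD[OF t(1)] and G' = is_functorD[OF t(2)]
  interpret A: category A using F(1) .
  interpret B: category B using F(2) .
  interpret E: category E using G(2) .
  show ?thesis
  proof (rule is_natI)
    fix f assume f: "f \<in> Arr A"
    have "FArr (NCod \<tau>) (FArr (NCod \<sigma>) f) \<cdot>\<^bsub>E\<^esub>
          (FArr (NCod \<tau>) (NAt \<sigma> (Dom A f)) \<cdot>\<^bsub>E\<^esub> NAt \<tau> (FObj (NDom \<sigma>) (Dom A f)))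
        = FArr (NCod \<tau>) (FArr (NCod \<sigma>) f \<cdot>\<^bsub>B\<^esub> NAt \<sigma> (Dom A f)) \<cdot>\<^bsub>E\<^esub> NAt \<tau> (FObj (NDom \<sigma>) (Dom A f))"
      using f s(4-6) t(4-6) F F' G' by simp
    also have "\<dots> = FArr (NCod \<tau>) (NAt \<sigma> (Cod A f)) \<cdot>\<^bsub>E\<^esub>
        (FArr (NCod \<tau>) (FArr (NDom \<sigma>) f) \<cdot>\<^bsub>E\<^esub> NAt \<tau> (Dom B (FArr (NDom \<sigma>) f)))"
      using f s(4-6) t(4-6) F F' G' by (simp add: s(7))
    also have "\<dots> = FArr (NCod \<tau>) (NAt \<sigma> (Cod A f)) \<cdot>\<^bsub>E\<^esub>
        (NAt \<tau> (Cod B (FArr (NDom \<sigma>) f)) \<cdot>\<^bsub>E\<^esub> FArr (NDom \<tau>) (FArr (NDom \<sigma>) f))"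
      by (simp only: t(7)[OF F(8)[OF f]])
    finally show "FArr (NCod (hcomp_nat \<tau> \<sigma>)) f \<cdot>\<^bsub>E\<^esub> NAt (hcomp_nat \<tau> \<sigma>) (Dom A f)
        = NAt (hcomp_nat \<tau> \<sigma>) (Cod A f) \<cdot>\<^bsub>E\<^esub> FArr (NDom (hcomp_nat \<tau> \<sigma>)) f"
      using f s(4-6) t(4-6) F F' G G' by simp
  qed (use s t F F' G G' in \<open>simp_all add: is_functor_comp[OF s(1) t(1)] is_functor_comp[OF s(2) t(2)]\<close>,
      simp_all add: hcomp_nat_def)
qed

lemma Cat_simps [simp]:
  "Cell0 Cat = {A. category A}" "Cell1 Cat = {F. is_functor (FDom F) (FCod F) F}"
  "Cell2 Cat = {\<tau>. is_nat (FDom (NDom \<tau>)) (FCod (NDom \<tau>)) \<tau>}"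
  "Src Cat = FDom" "Trg Cat = FCod" "Dom2 Cat = NDom" "Cod2 Cat = NCod" "Id1 Cat = id_func"
  "Id2 Cat = id_nat" "Cmp1 Cat = comp_func" "HCmp Cat = hcomp_nat" "VCmp Cat = vcomp_nat"
  by (simp_all add: Cat_def)

lemma is_nat_parallel:
  assumes "is_nat A B \<tau>"
  shows "FDom (NDom \<tau>) = A" "FCod (NDom \<tau>) = B" "FDom (NCod \<tau>) = A" "FCod (NCod \<tau>) = B"
  using is_functorD(3,4)[OF is_natD(1)[OF assms]] is_functorD(3,4)[OF is_natD(2)[OF assms]] by auto

lemma two_category_Cat: "two_category (Cat :: (('o, 'm) cat, _, _) two_cat)"
proof (rule two_category.intro)
  show "category (under_cat (Cat :: (('o, 'm) cat, _, _) two_cat))"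
  proof (unfold_locales, simp_all add: under_cat_def)
    fix F :: "('o, 'm, 'o, 'm) func" assume F: "is_functor (FDom F) (FCod F) F"
    show "category (FDom F)" "category (FCod F)" using is_functorD[OF F] by auto
    show "comp_func (id_func (FCod F)) F = F" "comp_func F (id_func (FDom F)) = F"
      using comp_func_id[OF F] by simp_all
  next
    fix A :: "('o, 'm) cat" assume "category A"
    then show "is_functor A A (id_func A)" by (rule is_functor_id)
  next
    fix F G :: "('o, 'm, 'o, 'm) func"
    assume F': "is_functor (FDom F) (FDom G) F" and G: "is_functor (FDom G) (FCod G) G"
    show "is_functor (FDom F) (FCod G) (comp_func G F)"
      by (rule is_functor_comp[OF F' G])
  next
    fix F G H :: "('o, 'm, 'o, 'm) func"
    assume F': "is_functor (FDom F) (FDom G) F" and G': "is_functor (FDom G) (FDom H) G"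
      and H: "is_functor (FDom H) (FCod H) H"
    show "comp_func (comp_func H G) F = comp_func H (comp_func G F)"
      by (rule func_eqI[OF is_functor_comp[OF F' is_functor_comp[OF G' H]]
            is_functor_comp[OF is_functor_comp[OF F' G'] H]])
        (use is_functorD[OF F'] is_functorD[OF G'] in simp_all)
  qed
  show "category (vert_cat (Cat :: (('o, 'm) cat, _, _) two_cat))"
  proof (unfold_locales, simp_all add: vert_cat_def)
    fix \<tau> :: "('o, 'm, 'o, 'm) nat_trans" assume t: "is_nat (FDom (NDom \<tau>)) (FCod (NDom \<tau>)) \<tau>"
    let ?A = "FDom (NDom \<tau>)" and ?B = "FCod (NDom \<tau>)"
    show "is_functor (FDom (NDom \<tau>)) (FCod (NDom \<tau>)) (NDom \<tau>)"
      using is_natD(1)[OF t] .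
    show "is_functor (FDom (NCod \<tau>)) (FCod (NCod \<tau>)) (NCod \<tau>)"
      using is_natD(2)[OF t] is_nat_parallel[OF t] by simp
    interpret B: category ?B using is_functorD(2)[OF is_natD(1)[OF t]] .
    show "vcomp_nat (id_nat (NCod \<tau>)) \<tau> = \<tau>" "vcomp_nat \<tau> (id_nat (NDom \<tau>)) = \<tau>"
      using is_nat_vcomp[OF t is_nat_id[OF is_natD(2)[OF t]]]
        is_nat_vcomp[OF is_nat_id[OF is_natD(1)[OF t]] t] t is_natD[OF t] is_nat_parallel[OF t]
      by (auto intro!: nat_eqI[of ?A ?B])
  next
    fix F :: "('o, 'm, 'o, 'm) func" assume F: "is_functor (FDom F) (FCod F) F"
    show "is_nat (FDom F) (FCod F) (id_nat F)" using is_nat_id[OF F] .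
  next
    fix \<rho> \<sigma> :: "('o, 'm, 'o, 'm) nat_trans"
    assume r: "is_nat (FDom (NDom \<rho>)) (FCod (NDom \<rho>)) \<rho>"
      and s: "is_nat (FDom (NDom \<sigma>)) (FCod (NDom \<sigma>)) \<sigma>" and rs: "NCod \<rho> = NDom \<sigma>"
    let ?A = "FDom (NDom \<rho>)" and ?B = "FCod (NDom \<rho>)"
    have s': "is_nat ?A ?B \<sigma>" using s is_nat_parallel[OF r] rs by simp
    show vc: "is_nat ?A ?B (vcomp_nat \<sigma> \<rho>)" using is_nat_vcomp[OF r s' rs] .
    fix \<tau> :: "('o, 'm, 'o, 'm) nat_trans"
    assume t: "is_nat (FDom (NDom \<tau>)) (FCod (NDom \<tau>)) \<tau>" and st: "NCod \<sigma> = NDom \<tau>"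
    have t': "is_nat ?A ?B \<tau>" using t is_nat_parallel[OF s'] st by simp
    interpret B: category ?B using is_functorD(2)[OF is_natD(1)[OF r]] .
    show "vcomp_nat (vcomp_nat \<tau> \<sigma>) \<rho> = vcomp_nat \<tau> (vcomp_nat \<sigma> \<rho>)"
      using is_natD[OF r] is_natD[OF s'] is_natD[OF t'] rs st
        is_nat_parallel[OF r] is_nat_parallel[OF s']
      by (intro nat_eqI[of ?A ?B] is_nat_vcomp r s' t') simp_all
  qed
next
  fix \<alpha> :: "('o, 'm, 'o, 'm) nat_trans"
  assume "\<alpha> \<in> Cell2 Cat"
  then show "Src Cat (Dom2 Cat \<alpha>) = Src Cat (Cod2 Cat \<alpha>) \<and> Trg Cat (Dom2 Cat \<alpha>) = Trg Cat (Cod2 Cat \<alpha>)"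
    using is_nat_parallel[of "FDom (NDom \<alpha>)" "FCod (NDom \<alpha>)" \<alpha>] by simp
next
  fix F G :: "('o, 'm, 'o, 'm) func"
  assume "F \<in> Cell1 Cat" "G \<in> Cell1 Cat" "Trg Cat F = Src Cat G"
  then have F: "is_functor (FDom F) (FDom G) F" and G: "is_functor (FDom G) (FCod G) G"
    and eq: "FCod F = FDom G" by simp_all
  interpret E: category "FCod G" using is_functorD(2)[OF G] .
  show "Id2 Cat G \<star>\<^bsub>Cat\<^esub> Id2 Cat F = Id2 Cat (G \<odot>\<^bsub>Cat\<^esub> F)"
    unfolding Cat_simps
    by (rule nat_eqI[OF is_nat_hcomp[OF is_nat_id[OF F] is_nat_id[OF G]] is_nat_id[OF is_functor_comp[OF F G]]])
      (use is_functorD[OF F] is_functorD[OF G] in simp_all)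
next
  fix \<alpha> F F' \<beta> G G' assume a: "\<alpha> \<in> hom2 Cat F F'" "\<beta> \<in> hom2 Cat G G'" "Trg Cat F = Src Cat (G :: ('o, 'm, 'o, 'm) func)"
  let ?A = "FDom (NDom \<alpha>)" and ?B = "FDom G" and ?C = "FCod G"
  have \<alpha>: "is_nat ?A ?B \<alpha>" and \<beta>: "is_nat ?B ?C \<beta>" and e: "NDom \<alpha> = F" "NCod \<alpha> = F'" "NDom \<beta> = G" "NCod \<beta> = G'"
    using a by (auto simp: hom2_def)
  have h: "is_nat ?A ?C (hcomp_nat \<beta> \<alpha>)" by (rule is_nat_hcomp[OF \<alpha> \<beta>])
  then show "\<beta> \<star>\<^bsub>Cat\<^esub> \<alpha> \<in> hom2 Cat (G \<odot>\<^bsub>Cat\<^esub> F) (G' \<odot>\<^bsub>Cat\<^esub> F')"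
    using e by (auto simp: hom2_def)
  note As = is_natD[OF \<alpha>] is_nat_parallel[OF \<alpha>] and Bs = is_natD[OF \<beta>] is_nat_parallel[OF \<beta>]
  {
    fix \<gamma> H H' assume g: "\<gamma> \<in> hom2 Cat H H'" "Trg Cat G = Src Cat H"
    let ?D = "FCod H"
    have \<gamma>: "is_nat ?C ?D \<gamma>" and e': "NDom \<gamma> = H" "NCod \<gamma> = H'" using g by (auto simp: hom2_def)
    note Cs = is_natD[OF \<gamma>] is_nat_parallel[OF \<gamma>]
    note Fs = is_functorD[OF As(1)] is_functorD[OF Bs(1)] is_functorD[OF Cs(1)]
      is_functorD[OF As(2)] is_functorD[OF Bs(2)] is_functorD[OF Cs(2)]
    interpret D: category ?D using Fs by simp
    interpret C: category ?C using Fs by simp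
    show "(\<gamma> \<star>\<^bsub>Cat\<^esub> \<beta>) \<star>\<^bsub>Cat\<^esub> \<alpha> = \<gamma> \<star>\<^bsub>Cat\<^esub> (\<beta> \<star>\<^bsub>Cat\<^esub> \<alpha>)"
    proof (unfold Cat_simps, rule nat_eqI[OF is_nat_hcomp[OF \<alpha> is_nat_hcomp[OF \<beta> \<gamma>]]
          is_nat_hcomp[OF is_nat_hcomp[OF \<alpha> \<beta>] \<gamma>]])
      show "NDom (hcomp_nat (hcomp_nat \<gamma> \<beta>) \<alpha>) = NDom (hcomp_nat \<gamma> (hcomp_nat \<beta> \<alpha>))"
        unfolding hcomp_nat_simps using As(1) Bs(1) Cs(1) is_functorD[OF As(1)] is_functorD[OF Bs(1)]
        by (intro func_eqI[of ?A ?D] is_functor_comp) simp_all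
      show "NCod (hcomp_nat (hcomp_nat \<gamma> \<beta>) \<alpha>) = NCod (hcomp_nat \<gamma> (hcomp_nat \<beta> \<alpha>))"
        unfolding hcomp_nat_simps using As(2) Bs(2) Cs(2) is_functorD[OF As(2)] is_functorD[OF Bs(2)]
        by (intro func_eqI[of ?A ?D] is_functor_comp) simp_all
      fix x assume "x \<in> Obj ?A"
      then show "NAt (hcomp_nat (hcomp_nat \<gamma> \<beta>) \<alpha>) x = NAt (hcomp_nat \<gamma> (hcomp_nat \<beta> \<alpha>)) x"
        using Fs As Bs Cs by simp
    qed
  }
  {
    fix \<alpha>' F'' \<beta>' G'' assume a': "\<alpha>' \<in> hom2 Cat F' F''" "\<beta>' \<in> hom2 Cat G' G''"
    have \<alpha>': "is_nat ?A ?B \<alpha>'" and \<beta>': "is_nat ?B ?C \<beta>'"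
      and e': "NDom \<alpha>' = F'" "NCod \<alpha>' = F''" "NDom \<beta>' = G'" "NCod \<beta>' = G''"
      using a' As Bs e by (auto simp: hom2_def)
    note As' = is_natD[OF \<alpha>'] is_nat_parallel[OF \<alpha>'] and Bs' = is_natD[OF \<beta>'] is_nat_parallel[OF \<beta>']
    note Fs = is_functorD[OF As(1)] is_functorD[OF Bs(1)]
      is_functorD[OF As(2)] is_functorD[OF Bs(2)] is_functorD[OF As'(2)] is_functorD[OF Bs'(2)]
    interpret B: category ?B using Fs by simp
    interpret C: category ?C using Fs by simp
    show "(\<beta>' \<bullet>\<^bsub>Cat\<^esub> \<beta>) \<star>\<^bsub>Cat\<^esub> (\<alpha>' \<bullet>\<^bsub>Cat\<^esub> \<alpha>) = (\<beta>' \<star>\<^bsub>Cat\<^esub> \<alpha>') \<bullet>\<^bsub>Cat\<^esub> (\<beta> \<star>\<^bsub>Cat\<^esub> \<alpha>)"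
    proof (unfold Cat_simps, rule nat_eqI[of ?A ?C])
      show "is_nat ?A ?C (hcomp_nat (vcomp_nat \<beta>' \<beta>) (vcomp_nat \<alpha>' \<alpha>))"
        using e e' by (intro is_nat_hcomp[of _ ?B] is_nat_vcomp \<alpha> \<alpha>' \<beta> \<beta>') simp_all
      show "is_nat ?A ?C (vcomp_nat (hcomp_nat \<beta>' \<alpha>') (hcomp_nat \<beta> \<alpha>))"
        using e e' by (intro is_nat_vcomp is_nat_hcomp[of _ ?B] \<alpha> \<alpha>' \<beta> \<beta>') simp_all
      fix x assume x: "x \<in> Obj ?A"
      have "FArr G'' (NAt \<alpha> x) \<cdot>\<^bsub>?C\<^esub> (NAt \<beta>' (FObj F x) \<cdot>\<^bsub>?C\<^esub> NAt \<beta> (FObj F x))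
        = (FArr G'' (NAt \<alpha> x) \<cdot>\<^bsub>?C\<^esub> NAt \<beta>' (FObj F x)) \<cdot>\<^bsub>?C\<^esub> NAt \<beta> (FObj F x)"
        using x As(4-6) Bs(4-6) Bs'(4-6) Fs e e' by simp
      also have "\<dots> = (NAt \<beta>' (FObj F' x) \<cdot>\<^bsub>?C\<^esub> FArr G' (NAt \<alpha> x)) \<cdot>\<^bsub>?C\<^esub> NAt \<beta> (FObj F x)"
        using Bs'(7)[of "NAt \<alpha> x"] x As(4-6) e e' by simp
      finally show "NAt (hcomp_nat (vcomp_nat \<beta>' \<beta>) (vcomp_nat \<alpha>' \<alpha>)) x
        = NAt (vcomp_nat (hcomp_nat \<beta>' \<alpha>') (hcomp_nat \<beta> \<alpha>)) x"
        using x As(4-6) Bs(4-6) As'(4-6) Bs'(4-6) Fs e e' by simp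
    qed simp_all
  }
next
  fix \<alpha> F F' assume "\<alpha> \<in> hom2 Cat F (F' :: ('o, 'm, 'o, 'm) func)"
  then have \<alpha>: "is_nat (FDom F) (FCod F) \<alpha>" and e: "NDom \<alpha> = F" "NCod \<alpha> = F'" by (auto simp: hom2_def)
  note As = is_natD[OF \<alpha>] is_nat_parallel[OF \<alpha>]
  note F = As(1)[unfolded e] and F' = As(2)[unfolded e]
  note Fs = is_functorD[OF F] is_functorD[OF F']
  interpret A: category "FDom F" using Fs by simp
  interpret B: category "FCod F" using Fs by simp
  have i: "comp_func (id_func (FCod F)) F = F" "comp_func (id_func (FCod F)) F' = F'"
    "comp_func F (id_func (FDom F)) = F" "comp_func F' (id_func (FDom F)) = F'"
    using comp_func_id[OF F] comp_func_id[OF F'] by simp_all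
  show "Id2 Cat (Id1 Cat (Trg Cat F)) \<star>\<^bsub>Cat\<^esub> \<alpha> = \<alpha>"
    unfolding Cat_simps
    by (rule nat_eqI[OF is_nat_hcomp[OF \<alpha> is_nat_id[OF is_functor_id[OF B.category_axioms]]] \<alpha>])
      (use As Fs e i in simp_all)
  show "\<alpha> \<star>\<^bsub>Cat\<^esub> Id2 Cat (Id1 Cat (Src Cat F)) = \<alpha>"
    unfolding Cat_simps
    by (rule nat_eqI[OF is_nat_hcomp[OF is_nat_id[OF is_functor_id[OF A.category_axioms]] \<alpha>] \<alpha>])
      (use As Fs e i in simp_all)
qed

text \<open>The inverses of the components are again natural.\<close>

lemma invertible2_Cat:
  assumes \<tau>: "is_nat A B \<tau>" and iso: "\<And>x. x \<in> Obj A \<Longrightarrow> is_iso B (NAt \<tau> x)"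
  shows "invertible2 Cat \<tau>"
proof -
  note T = is_natD[OF \<tau>] is_nat_parallel[OF \<tau>]
  note Fs = is_functorD[OF T(1)] is_functorD[OF T(2)]
  interpret A: category A using Fs by simp
  interpret B: category B using Fs by simp
  let ?s = "\<lparr>NDom = NCod \<tau>, NCod = NDom \<tau>, NAt = restrict (\<lambda>x. inverse_in B (NAt \<tau> x)) (Obj A)\<rparr>"
  note I = inverse_in[OF iso]
  have s: "is_nat A B ?s"
  proof (rule is_natI)
    fix f assume f: "f \<in> Arr A"
    let ?x = "Dom A f" and ?y = "Cod A f"
    have "FArr (NDom \<tau>) f \<cdot>\<^bsub>B\<^esub> inverse_in B (NAt \<tau> ?x)
      = inverse_in B (NAt \<tau> ?y) \<cdot>\<^bsub>B\<^esub> ((NAt \<tau> ?y \<cdot>\<^bsub>B\<^esub> FArr (NDom \<tau>) f) \<cdot>\<^bsub>B\<^esub> inverse_in B (NAt \<tau> ?x))"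
      using f Fs T(4-6) I iso by simp
    also have "\<dots> = inverse_in B (NAt \<tau> ?y) \<cdot>\<^bsub>B\<^esub> ((FArr (NCod \<tau>) f \<cdot>\<^bsub>B\<^esub> NAt \<tau> ?x) \<cdot>\<^bsub>B\<^esub> inverse_in B (NAt \<tau> ?x))"
      using T(7)[OF f] by simp
    also have "\<dots> = inverse_in B (NAt \<tau> ?y) \<cdot>\<^bsub>B\<^esub> FArr (NCod \<tau>) f"
      using f Fs T(4-6) I by simp
    finally show "FArr (NCod ?s) f \<cdot>\<^bsub>B\<^esub> NAt ?s (Dom A f) = NAt ?s (Cod A f) \<cdot>\<^bsub>B\<^esub> FArr (NDom ?s) f"
      using f by simp
  qed (use T I in simp_all)
  show ?thesis
    unfolding invertible2_def
  proof (rule is_isoI[of _ _ ?s])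
    show "?s \<cdot>\<^bsub>vert_cat Cat\<^esub> \<tau> = Ide (vert_cat Cat) (Dom (vert_cat Cat) \<tau>)"
      unfolding vert_cat_def cat.simps Cat_simps
      by (rule nat_eqI[OF is_nat_vcomp[OF \<tau> s] is_nat_id[OF T(1)]]) (use T I in simp_all)
    show "\<tau> \<cdot>\<^bsub>vert_cat Cat\<^esub> ?s = Ide (vert_cat Cat) (Cod (vert_cat Cat) \<tau>)"
      unfolding vert_cat_def cat.simps Cat_simps
      by (rule nat_eqI[OF is_nat_vcomp[OF s \<tau>] is_nat_id[OF T(2)]]) (use T I in simp_all)
  qed (use s \<tau> T in \<open>simp_all add: vert_cat_def\<close>)
qed

declare Cat_simps [simp del]

section \<open>The 2-category of normal pseudo-functors\<close>

context normal_pseudofunctor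
begin

lemma P_simps [simp]:
  "X \<in> Cell0 A \<Longrightarrow> P0 F X \<in> Cell0 B" "a \<in> Cell1 A \<Longrightarrow> P1 F a \<in> Cell1 B"
  "\<alpha> \<in> Cell2 A \<Longrightarrow> P2 F \<alpha> \<in> Cell2 B"
  using P0 P1 P2 by auto

declare Src_P1 [simp] Trg_P1 [simp] Dom_P2 [simp] Cod_P2 [simp] P2_Id2 [simp] P1_Id1 [simp]

lemma Phi_simps [simp]:
  assumes "a \<in> Cell1 A" "a' \<in> Cell1 A" "Trg A a = Src A a'"
  shows "Phi F a a' \<in> Cell2 B" "Dom2 B (Phi F a a') = P1 F a' \<odot>\<^bsub>B\<^esub> P1 F a"
    "Cod2 B (Phi F a a') = P1 F (a' \<odot>\<^bsub>A\<^esub> a)"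
  using Phi_in[OF assms] by (simp_all add: hom2_def)

end

context pseudo_natural
begin

lemma T_simps [simp]:
  "X \<in> Cell0 A \<Longrightarrow> T0 \<eta> X \<in> Cell1 B"
  "X \<in> Cell0 A \<Longrightarrow> Src B (T0 \<eta> X) = P0 (TDom \<eta>) X"
  "X \<in> Cell0 A \<Longrightarrow> Trg B (T0 \<eta> X) = P0 (TCod \<eta>) X"
  "a \<in> Cell1 A \<Longrightarrow> T1 \<eta> a \<in> Cell2 B"
  "a \<in> Cell1 A \<Longrightarrow> Dom2 B (T1 \<eta> a) = P1 (TCod \<eta>) a \<odot>\<^bsub>B\<^esub> T0 \<eta> (Src A a)"
  "a \<in> Cell1 A \<Longrightarrow> Cod2 B (T1 \<eta> a) = T0 \<eta> (Trg A a) \<odot>\<^bsub>B\<^esub> P1 (TDom \<eta>) a"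
  using T0_in[of X] T1_in[of a "Src A a" "Trg A a"] by (simp_all add: hom1_def hom2_def)

end

lemma pstrans_eqI:
  assumes "pseudo_natural A B \<eta>" "pseudo_natural A B \<theta>" "TDom \<eta> = TDom \<theta>" "TCod \<eta> = TCod \<theta>"
    "\<And>X. X \<in> Cell0 A \<Longrightarrow> T0 \<eta> X = T0 \<theta> X" "\<And>a. a \<in> Cell1 A \<Longrightarrow> T1 \<eta> a = T1 \<theta> a"
  shows "\<eta> = \<theta>"
proof -
  interpret e: pseudo_natural A B \<eta> by fact
  interpret t: pseudo_natural A B \<theta> by fact
  show ?thesis
    using assms(3-6) extensionalityI[OF e.T0_ext t.T0_ext] extensionalityI[OF e.T1_ext t.T1_ext]
    by (intro pstrans.equality) auto
qed

lemma modif_eqI: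
  assumes "modification A B \<Gamma>" "modification A B \<Delta>" "MDom \<Gamma> = MDom \<Delta>" "MCod \<Gamma> = MCod \<Delta>"
    "\<And>X. X \<in> Cell0 A \<Longrightarrow> MAt \<Gamma> X = MAt \<Delta> X"
  shows "\<Gamma> = \<Delta>"
proof -
  interpret g: modification A B \<Gamma> by fact
  interpret d: modification A B \<Delta> by fact
  show ?thesis
    using assms(3-5) extensionalityI[OF g.MAt_ext d.MAt_ext]
    by (intro modif.equality) auto
qed

lemma (in modification) MAt_simps [simp]:
  "X \<in> Cell0 A \<Longrightarrow> MAt \<Gamma> X \<in> Cell2 B"
  "X \<in> Cell0 A \<Longrightarrow> Dom2 B (MAt \<Gamma> X) = T0 (MDom \<Gamma>) X"
  "X \<in> Cell0 A \<Longrightarrow> Cod2 B (MAt \<Gamma> X) = T0 (MCod \<Gamma>) X"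
  using MAt_in[of X] by (simp_all add: hom2_def)

lemma ps_id_simps [simp]:
  "TDom (ps_id A B F) = F" "TCod (ps_id A B F) = F"
  "X \<in> Cell0 A \<Longrightarrow> T0 (ps_id A B F) X = Id1 B (P0 F X)"
  "a \<in> Cell1 A \<Longrightarrow> T1 (ps_id A B F) a = Id2 B (P1 F a)"
  by (simp_all add: ps_id_def)

lemma ps_comp_simps [simp]:
  "TDom (ps_comp A B \<theta> \<eta>) = TDom \<eta>" "TCod (ps_comp A B \<theta> \<eta>) = TCod \<theta>"
  "X \<in> Cell0 A \<Longrightarrow> T0 (ps_comp A B \<theta> \<eta>) X = T0 \<theta> X \<odot>\<^bsub>B\<^esub> T0 \<eta> X"
  "a \<in> Cell1 A \<Longrightarrow> T1 (ps_comp A B \<theta> \<eta>) a =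
     (Id2 B (T0 \<theta> (Trg A a)) \<star>\<^bsub>B\<^esub> T1 \<eta> a) \<bullet>\<^bsub>B\<^esub> (T1 \<theta> a \<star>\<^bsub>B\<^esub> Id2 B (T0 \<eta> (Src A a)))"
  by (simp_all add: ps_comp_def)

lemma pseudo_natural_id:
  assumes "normal_pseudofunctor A B F"
  shows "pseudo_natural A B (ps_id A B F)"
proof -
  interpret normal_pseudofunctor A B F by fact
  show ?thesis
  proof (rule pseudo_natural.intro, simp_all add: normal_pseudofunctor_axioms, rule pseudo_natural_axioms.intro)
  qed (auto simp: hom1_def hom2_def, simp_all add: ps_id_def)
qed

text \<open>Each axiom follows by pasting the corresponding ones of \<open>\<theta>\<close> and \<open>\<eta>\<close>. For composites of 1-cells, the
  2-cell of \<open>\<eta>\<close> at \<open>a\<close> and that of \<open>\<theta>\<close> at \<open>a'\<close> appear in the wrong order and are exchanged.\<close>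

lemma pseudo_natural_comp:
  assumes "pseudo_natural A B \<eta>" "pseudo_natural A B \<theta>" and eq: "TCod \<eta> = TDom \<theta>"
  shows "pseudo_natural A B (ps_comp A B \<theta> \<eta>)"
proof -
  interpret e: pseudo_natural A B \<eta> by fact
  interpret t: pseudo_natural A B \<theta> by fact
  let ?I = "Id2 B" and ?H = "TCod \<theta>" and ?G = "TDom \<theta>" and ?F = "TDom \<eta>" and ?k = "ps_comp A B \<theta> \<eta>"
  note e.dom.B.whisker_simps(1,2) [simp del]
  note w = e.dom.B.whisker_simps(1,2)
  show ?thesis
  proof (rule pseudo_natural.intro)
    show "pseudo_natural_axioms A B ?k"
    proof (rule pseudo_natural_axioms.intro)
      fix a b X Y \<alpha> assume "a \<in> hom1 A X Y" "\<alpha> \<in> hom2 A a b"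
      note h = hom1D[OF this(1)] hom2D[OF this(2)]
      have [simp]: "a \<in> Cell1 A" "\<alpha> \<in> Cell2 A" "Dom2 A \<alpha> = a" "Cod2 A \<alpha> = b"
        "Src A a = X" "Trg A a = Y" using h by simp_all
      have [simp]: "b \<in> Cell1 A" "Src A b = X" "Trg A b = Y" "X \<in> Cell0 A" "Y \<in> Cell0 A"
        using e.dom.A.Cell2_simps(2)[of \<alpha>] e.dom.A.parallel_simps[of \<alpha>]
          e.dom.A.Cell1_simps(1,2)[of a] by simp_all
      note n = e.T1_natural[OF \<open>a \<in> hom1 A X Y\<close> \<open>\<alpha> \<in> hom2 A a b\<close>]
        t.T1_natural[OF \<open>a \<in> hom1 A X Y\<close> \<open>\<alpha> \<in> hom2 A a b\<close>]
      have "T1 ?k b \<bullet>\<^bsub>B\<^esub> (P2 ?H \<alpha> \<star>\<^bsub>B\<^esub> ?I (T0 ?k X))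
          = (?I (T0 \<theta> Y) \<star>\<^bsub>B\<^esub> T1 \<eta> b) \<bullet>\<^bsub>B\<^esub> ((T1 \<theta> b \<bullet>\<^bsub>B\<^esub> (P2 ?H \<alpha> \<star>\<^bsub>B\<^esub> ?I (T0 \<theta> X))) \<star>\<^bsub>B\<^esub> ?I (T0 \<eta> X))"
        by (simp add: eq w)
      also have "\<dots> = (?I (T0 \<theta> Y) \<star>\<^bsub>B\<^esub> (T1 \<eta> b \<bullet>\<^bsub>B\<^esub> (P2 ?G \<alpha> \<star>\<^bsub>B\<^esub> ?I (T0 \<eta> X)))) \<bullet>\<^bsub>B\<^esub> (T1 \<theta> a \<star>\<^bsub>B\<^esub> ?I (T0 \<eta> X))"
        unfolding n(2) by (simp add: eq w)
      also have "\<dots> = (?I (T0 ?k Y) \<star>\<^bsub>B\<^esub> P2 ?F \<alpha>) \<bullet>\<^bsub>B\<^esub> T1 ?k a"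
        unfolding n(1)[unfolded eq] by (simp add: eq w)
      finally show "T1 ?k b \<bullet>\<^bsub>B\<^esub> (P2 (TCod ?k) \<alpha> \<star>\<^bsub>B\<^esub> ?I (T0 ?k X))
          = (?I (T0 ?k Y) \<star>\<^bsub>B\<^esub> P2 (TDom ?k) \<alpha>) \<bullet>\<^bsub>B\<^esub> T1 ?k a" by (simp only: ps_comp_simps)
    next
      fix a a' X Y Z assume aa: "a \<in> hom1 A X Y" "a' \<in> hom1 A Y Z"
      then have [simp]: "a \<in> Cell1 A" "a' \<in> Cell1 A" "Src A a = X" "Trg A a = Y" "Src A a' = Y"
        "Trg A a' = Z" "X \<in> Cell0 A" "Y \<in> Cell0 A" "Z \<in> Cell0 A"
        by (auto simp: hom1_def)
      let ?c = "a' \<odot>\<^bsub>A\<^esub> a"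
      have ex: "(?I (T0 \<theta> Z \<odot>\<^bsub>B\<^esub> P1 ?G a') \<star>\<^bsub>B\<^esub> T1 \<eta> a) \<bullet>\<^bsub>B\<^esub> (T1 \<theta> a' \<star>\<^bsub>B\<^esub> ?I (P1 ?G a \<odot>\<^bsub>B\<^esub> T0 \<eta> X))
        = (T1 \<theta> a' \<star>\<^bsub>B\<^esub> ?I (T0 \<eta> Y \<odot>\<^bsub>B\<^esub> P1 ?F a)) \<bullet>\<^bsub>B\<^esub> (?I (P1 ?H a' \<odot>\<^bsub>B\<^esub> T0 \<theta> Y) \<star>\<^bsub>B\<^esub> T1 \<eta> a)"
        by (rule e.dom.B.exchange[symmetric]) (simp_all add: hom2_def eq)
      have "T1 ?k ?c \<bullet>\<^bsub>B\<^esub> (Phi ?H a a' \<star>\<^bsub>B\<^esub> ?I (T0 ?k X))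
        = (?I (T0 \<theta> Z) \<star>\<^bsub>B\<^esub> T1 \<eta> ?c) \<bullet>\<^bsub>B\<^esub> ((T1 \<theta> ?c \<bullet>\<^bsub>B\<^esub> (Phi ?H a a' \<star>\<^bsub>B\<^esub> ?I (T0 \<theta> X))) \<star>\<^bsub>B\<^esub> ?I (T0 \<eta> X))"
        by (simp add: eq w)
      also have "\<dots> = (?I (T0 \<theta> Z) \<star>\<^bsub>B\<^esub> (T1 \<eta> ?c \<bullet>\<^bsub>B\<^esub> (Phi ?G a a' \<star>\<^bsub>B\<^esub> ?I (T0 \<eta> X))))
          \<bullet>\<^bsub>B\<^esub> ((T1 \<theta> a' \<star>\<^bsub>B\<^esub> ?I (P1 ?G a \<odot>\<^bsub>B\<^esub> T0 \<eta> X)) \<bullet>\<^bsub>B\<^esub> (?I (P1 ?H a') \<star>\<^bsub>B\<^esub> (T1 \<theta> a \<star>\<^bsub>B\<^esub> ?I (T0 \<eta> X))))"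
        unfolding t.T1_Cmp1[OF aa] by (simp add: eq w)
      also have "\<dots> = (?I (T0 \<theta> Z \<odot>\<^bsub>B\<^esub> T0 \<eta> Z) \<star>\<^bsub>B\<^esub> Phi ?F a a') \<bullet>\<^bsub>B\<^esub>
          ((?I (T0 \<theta> Z) \<star>\<^bsub>B\<^esub> (T1 \<eta> a' \<star>\<^bsub>B\<^esub> ?I (P1 ?F a))) \<bullet>\<^bsub>B\<^esub>
          (((?I (T0 \<theta> Z \<odot>\<^bsub>B\<^esub> P1 ?G a') \<star>\<^bsub>B\<^esub> T1 \<eta> a) \<bullet>\<^bsub>B\<^esub> (T1 \<theta> a' \<star>\<^bsub>B\<^esub> ?I (P1 ?G a \<odot>\<^bsub>B\<^esub> T0 \<eta> X)))
          \<bullet>\<^bsub>B\<^esub> (?I (P1 ?H a') \<star>\<^bsub>B\<^esub> (T1 \<theta> a \<star>\<^bsub>B\<^esub> ?I (T0 \<eta> X)))))"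
        unfolding e.T1_Cmp1[OF aa, unfolded eq] by (simp add: eq w)
      also have "\<dots> = (?I (T0 ?k Z) \<star>\<^bsub>B\<^esub> Phi ?F a a') \<bullet>\<^bsub>B\<^esub> (T1 ?k a' \<star>\<^bsub>B\<^esub> ?I (P1 ?F a))
          \<bullet>\<^bsub>B\<^esub> (?I (P1 ?H a') \<star>\<^bsub>B\<^esub> T1 ?k a)"
        unfolding ex by (simp add: eq w)
      finally show "T1 ?k ?c \<bullet>\<^bsub>B\<^esub> (Phi (TCod ?k) a a' \<star>\<^bsub>B\<^esub> ?I (T0 ?k X))
        = (?I (T0 ?k Z) \<star>\<^bsub>B\<^esub> Phi (TDom ?k) a a') \<bullet>\<^bsub>B\<^esub> (T1 ?k a' \<star>\<^bsub>B\<^esub> ?I (P1 (TDom ?k) a))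
          \<bullet>\<^bsub>B\<^esub> (?I (P1 (TCod ?k) a') \<star>\<^bsub>B\<^esub> T1 ?k a)" by (simp only: ps_comp_simps)
    next
      show "T0 ?k \<in> extensional (Cell0 A)" "T1 ?k \<in> extensional (Cell1 A)" by (simp_all add: ps_comp_def)
    qed (use eq e.T1_Id1 t.T1_Id1 e.T1_invertible t.T1_invertible in \<open>auto simp: hom1_def hom2_def\<close>)
  qed (simp_all add: e.dom.normal_pseudofunctor_axioms t.cod.normal_pseudofunctor_axioms)
qed

lemma ps_comp_assoc:
  assumes "pseudo_natural A B \<eta>" "pseudo_natural A B \<theta>" "pseudo_natural A B \<kappa>"
    and eq: "TCod \<eta> = TDom \<theta>" "TCod \<theta> = TDom \<kappa>"
  shows "ps_comp A B (ps_comp A B \<kappa> \<theta>) \<eta> = ps_comp A B \<kappa> (ps_comp A B \<theta> \<eta>)"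
proof -
  interpret e: pseudo_natural A B \<eta> by fact
  interpret t: pseudo_natural A B \<theta> by fact
  interpret k: pseudo_natural A B \<kappa> by fact
  show ?thesis
    by (intro pstrans_eqI[of A B] pseudo_natural_comp assms)
      (use eq in \<open>simp_all\<close>)
qed

lemma ps_comp_id:
  assumes "pseudo_natural A B \<eta>"
  shows "ps_comp A B (ps_id A B (TCod \<eta>)) \<eta> = \<eta>" "ps_comp A B \<eta> (ps_id A B (TDom \<eta>)) = \<eta>"
proof -
  interpret e: pseudo_natural A B \<eta> by fact
  note i = pseudo_natural_id[OF e.dom.normal_pseudofunctor_axioms] pseudo_natural_id[OF e.cod.normal_pseudofunctor_axioms]
  show "ps_comp A B (ps_id A B (TCod \<eta>)) \<eta> = \<eta>"
    by (rule pstrans_eqI[OF pseudo_natural_comp[OF assms i(2)] assms]) simp_all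
  show "ps_comp A B \<eta> (ps_id A B (TDom \<eta>)) = \<eta>"
    by (rule pstrans_eqI[OF pseudo_natural_comp[OF i(1) assms] assms]) simp_all
qed

lemma Ps_simps:
  "Cell0 (Ps A B) = {F. normal_pseudofunctor A B F}" "Cell1 (Ps A B) = {\<eta>. pseudo_natural A B \<eta>}"
  "Cell2 (Ps A B) = {\<Gamma>. modification A B \<Gamma>}" "Src (Ps A B) = TDom" "Trg (Ps A B) = TCod"
  "Dom2 (Ps A B) = MDom" "Cod2 (Ps A B) = MCod" "Id1 (Ps A B) = ps_id A B"
  "Id2 (Ps A B) \<eta> = \<lparr>MDom = \<eta>, MCod = \<eta>, MAt = restrict (\<lambda>X. Id2 B (T0 \<eta> X)) (Cell0 A)\<rparr>"
  "Cmp1 (Ps A B) = ps_comp A B"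
  "HCmp (Ps A B) \<Delta> \<Gamma> = \<lparr>MDom = ps_comp A B (MDom \<Delta>) (MDom \<Gamma>), MCod = ps_comp A B (MCod \<Delta>) (MCod \<Gamma>),
     MAt = restrict (\<lambda>X. MAt \<Delta> X \<star>\<^bsub>B\<^esub> MAt \<Gamma> X) (Cell0 A)\<rparr>"
  "VCmp (Ps A B) \<Delta> \<Gamma> = \<lparr>MDom = MDom \<Gamma>, MCod = MCod \<Delta>,
     MAt = restrict (\<lambda>X. MAt \<Delta> X \<bullet>\<^bsub>B\<^esub> MAt \<Gamma> X) (Cell0 A)\<rparr>"
  by (simp_all add: Ps_def)

lemma modification_Id2:
  assumes "pseudo_natural A B \<eta>"
  shows "modification A B (Id2 (Ps A B) \<eta>)"
proof -
  interpret e: pseudo_natural A B \<eta> by fact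
  show ?thesis
    by (rule modification.intro, simp_all add: Ps_simps e.pseudo_natural_axioms, rule modification_axioms.intro)
      (auto simp: hom1_def hom2_def)
qed

lemma modification_VCmp:
  assumes "modification A B \<Gamma>" "modification A B \<Delta>" and eq: "MCod \<Gamma> = MDom \<Delta>"
  shows "modification A B (VCmp (Ps A B) \<Delta> \<Gamma>)"
proof -
  interpret g: modification A B \<Gamma> by fact
  interpret d: modification A B \<Delta> by fact
  note [simp] = g.TDom_eq g.TCod_eq
  let ?E = "VCmp (Ps A B) \<Delta> \<Gamma>"
  show ?thesis
  proof (rule modification.intro)
    show "modification_axioms A B ?E"
    proof (rule modification_axioms.intro)
      fix a X Y assume a: "a \<in> hom1 A X Y"
      then have [simp]: "a \<in> Cell1 A" "Src A a = X" "Trg A a = Y" "X \<in> Cell0 A" "Y \<in> Cell0 A"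
        by (auto simp: hom1_def)
      let ?u = "Id2 B (P1 (TCod (MDom \<Gamma>)) a)" and ?v = "Id2 B (P1 (TDom (MDom \<Gamma>)) a)"
      have "T1 (MCod \<Delta>) a \<bullet>\<^bsub>B\<^esub> (?u \<star>\<^bsub>B\<^esub> (MAt \<Delta> X \<bullet>\<^bsub>B\<^esub> MAt \<Gamma> X))
        = (T1 (MCod \<Delta>) a \<bullet>\<^bsub>B\<^esub> (?u \<star>\<^bsub>B\<^esub> MAt \<Delta> X)) \<bullet>\<^bsub>B\<^esub> (?u \<star>\<^bsub>B\<^esub> MAt \<Gamma> X)"
        using d.TCod_eq by (simp add: eq)
      also have "\<dots> = (MAt \<Delta> Y \<star>\<^bsub>B\<^esub> ?v) \<bullet>\<^bsub>B\<^esub> (T1 (MCod \<Gamma>) a \<bullet>\<^bsub>B\<^esub> (?u \<star>\<^bsub>B\<^esub> MAt \<Gamma> X))"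
        using d.MAt_natural[OF a] d.TCod_eq d.TDom_eq by (simp add: eq)
      also have "\<dots> = ((MAt \<Delta> Y \<bullet>\<^bsub>B\<^esub> MAt \<Gamma> Y) \<star>\<^bsub>B\<^esub> ?v) \<bullet>\<^bsub>B\<^esub> T1 (MDom \<Gamma>) a"
        unfolding g.MAt_natural[OF a] using d.TCod_eq d.TDom_eq by (simp add: eq)
      finally show "T1 (MCod ?E) a \<bullet>\<^bsub>B\<^esub> (Id2 B (P1 (TCod (MDom ?E)) a) \<star>\<^bsub>B\<^esub> MAt ?E X)
          = (MAt ?E Y \<star>\<^bsub>B\<^esub> Id2 B (P1 (TDom (MDom ?E)) a)) \<bullet>\<^bsub>B\<^esub> T1 (MDom ?E) a"
        by (simp add: Ps_simps)
    qed (use eq d.TDom_eq d.TCod_eq in \<open>simp_all add: Ps_simps hom2_def\<close>)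
  qed (simp_all add: Ps_simps g.dom.pseudo_natural_axioms d.cod.pseudo_natural_axioms)
qed

text \<open>After slicing \<open>\<Delta> \<star> \<Gamma>\<close>, the two modification axioms apply one after the other, with one exchange for
  each of the two layers.\<close>

lemma modification_HCmp:
  assumes "modification A B \<Gamma>" "modification A B \<Delta>" and eq0: "TCod (MDom \<Gamma>) = TDom (MDom \<Delta>)"
  shows "modification A B (HCmp (Ps A B) \<Delta> \<Gamma>)"
proof -
  interpret g: modification A B \<Gamma> by fact
  interpret d: modification A B \<Delta> by fact
  note [simp] = g.TDom_eq[symmetric] g.TCod_eq[symmetric] d.TDom_eq[symmetric] d.TCod_eq[symmetric] eq0
  let ?E = "HCmp (Ps A B) \<Delta> \<Gamma>"
  let ?\<eta> = "MDom \<Gamma>" and ?\<eta>' = "MCod \<Gamma>" and ?\<theta> = "MDom \<Delta>" and ?\<theta>' = "MCod \<Delta>"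
  let ?F = "TDom ?\<eta>" and ?G = "TDom ?\<theta>" and ?H = "TCod ?\<theta>"
  let ?I = "Id2 B"
  show ?thesis
  proof (rule modification.intro)
    show "modification_axioms A B ?E"
    proof (rule modification_axioms.intro)
      fix a X Y assume a: "a \<in> hom1 A X Y"
      then have [simp]: "a \<in> Cell1 A" "Src A a = X" "Trg A a = Y" "X \<in> Cell0 A" "Y \<in> Cell0 A"
        by (auto simp: hom1_def)
      have s: "MAt \<Delta> Z \<star>\<^bsub>B\<^esub> MAt \<Gamma> Z = (MAt \<Delta> Z \<star>\<^bsub>B\<^esub> ?I (T0 ?\<eta>' Z)) \<bullet>\<^bsub>B\<^esub> (?I (T0 ?\<theta> Z) \<star>\<^bsub>B\<^esub> MAt \<Gamma> Z)"
        if "Z \<in> Cell0 A" for Z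
        using that
        by (intro g.dom.dom.B.HCmp_slice_left[of _ "T0 ?\<eta> Z" _ _ _ "T0 ?\<theta>' Z"]) (simp_all add: hom2_def)
      have ex1: "(T1 ?\<theta> a \<star>\<^bsub>B\<^esub> ?I (T0 ?\<eta>' X)) \<bullet>\<^bsub>B\<^esub> (?I (P1 ?H a \<odot>\<^bsub>B\<^esub> T0 ?\<theta> X) \<star>\<^bsub>B\<^esub> MAt \<Gamma> X)
        = (?I (T0 ?\<theta> Y \<odot>\<^bsub>B\<^esub> P1 ?G a) \<star>\<^bsub>B\<^esub> MAt \<Gamma> X) \<bullet>\<^bsub>B\<^esub> (T1 ?\<theta> a \<star>\<^bsub>B\<^esub> ?I (T0 ?\<eta> X))"
        by (rule g.dom.dom.B.exchange) (simp_all add: hom2_def)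
      have ex2: "(?I (T0 ?\<theta>' Y) \<star>\<^bsub>B\<^esub> T1 ?\<eta>' a) \<bullet>\<^bsub>B\<^esub> (MAt \<Delta> Y \<star>\<^bsub>B\<^esub> ?I (P1 ?G a \<odot>\<^bsub>B\<^esub> T0 ?\<eta>' X))
        = (MAt \<Delta> Y \<star>\<^bsub>B\<^esub> ?I (T0 ?\<eta>' Y \<odot>\<^bsub>B\<^esub> P1 ?F a)) \<bullet>\<^bsub>B\<^esub> (?I (T0 ?\<theta> Y) \<star>\<^bsub>B\<^esub> T1 ?\<eta>' a)"
        by (rule g.dom.dom.B.exchange[symmetric]) (simp_all add: hom2_def)
      have "T1 (MCod ?E) a \<bullet>\<^bsub>B\<^esub> (?I (P1 ?H a) \<star>\<^bsub>B\<^esub> MAt ?E X)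
        = (?I (T0 ?\<theta>' Y) \<star>\<^bsub>B\<^esub> T1 ?\<eta>' a) \<bullet>\<^bsub>B\<^esub>
          (((T1 ?\<theta>' a \<bullet>\<^bsub>B\<^esub> (?I (P1 ?H a) \<star>\<^bsub>B\<^esub> MAt \<Delta> X)) \<star>\<^bsub>B\<^esub> ?I (T0 ?\<eta>' X)) \<bullet>\<^bsub>B\<^esub>
          (?I (P1 ?H a \<odot>\<^bsub>B\<^esub> T0 ?\<theta> X) \<star>\<^bsub>B\<^esub> MAt \<Gamma> X))"
        by (simp add: Ps_simps s)
      also have "\<dots> = ((?I (T0 ?\<theta>' Y) \<star>\<^bsub>B\<^esub> T1 ?\<eta>' a) \<bullet>\<^bsub>B\<^esub> (MAt \<Delta> Y \<star>\<^bsub>B\<^esub> ?I (P1 ?G a \<odot>\<^bsub>B\<^esub> T0 ?\<eta>' X))) \<bullet>\<^bsub>B\<^esub>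
          ((T1 ?\<theta> a \<star>\<^bsub>B\<^esub> ?I (T0 ?\<eta>' X)) \<bullet>\<^bsub>B\<^esub> (?I (P1 ?H a \<odot>\<^bsub>B\<^esub> T0 ?\<theta> X) \<star>\<^bsub>B\<^esub> MAt \<Gamma> X))"
        unfolding d.MAt_natural[OF a] by simp
      also have "\<dots> = (MAt \<Delta> Y \<star>\<^bsub>B\<^esub> ?I (T0 ?\<eta>' Y \<odot>\<^bsub>B\<^esub> P1 ?F a)) \<bullet>\<^bsub>B\<^esub>
          ((?I (T0 ?\<theta> Y) \<star>\<^bsub>B\<^esub> (T1 ?\<eta>' a \<bullet>\<^bsub>B\<^esub> (?I (P1 (TCod ?\<eta>) a) \<star>\<^bsub>B\<^esub> MAt \<Gamma> X))) \<bullet>\<^bsub>B\<^esub> (T1 ?\<theta> a \<star>\<^bsub>B\<^esub> ?I (T0 ?\<eta> X)))"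
        unfolding ex1 ex2 by simp
      also have "\<dots> = (MAt ?E Y \<star>\<^bsub>B\<^esub> ?I (P1 ?F a)) \<bullet>\<^bsub>B\<^esub> T1 (MDom ?E) a"
        unfolding g.MAt_natural[OF a] by (simp add: Ps_simps s)
      finally show "T1 (MCod ?E) a \<bullet>\<^bsub>B\<^esub> (Id2 B (P1 (TCod (MDom ?E)) a) \<star>\<^bsub>B\<^esub> MAt ?E X)
          = (MAt ?E Y \<star>\<^bsub>B\<^esub> Id2 B (P1 (TDom (MDom ?E)) a)) \<bullet>\<^bsub>B\<^esub> T1 (MDom ?E) a"
        by (simp add: Ps_simps)
    qed (simp_all add: Ps_simps hom2_def)
  qed (simp_all add: Ps_simps g.dom.pseudo_natural_axioms d.dom.pseudo_natural_axioms
      g.cod.pseudo_natural_axioms d.cod.pseudo_natural_axioms pseudo_natural_comp)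
qed

lemma two_category_Ps:
  assumes "two_category A" "two_category B"
  shows "two_category (Ps A B)"
proof (rule two_category.intro)
  interpret A: two_category A by fact
  interpret B: two_category B by fact
  let ?P = "Ps A B"
  show "category (under_cat ?P)"
    by unfold_locales
      (auto simp: under_cat_def Ps_simps pseudo_natural_id pseudo_natural_comp ps_comp_assoc ps_comp_id
        intro: pseudo_natural.axioms)
  have VI: "VCmp ?P (Id2 ?P (MCod \<Gamma>)) \<Gamma> = \<Gamma>" "VCmp ?P \<Gamma> (Id2 ?P (MDom \<Gamma>)) = \<Gamma>"
    if "modification A B \<Gamma>" for \<Gamma>
  proof -
    interpret g: modification A B \<Gamma> by fact
    note i = modification_Id2[OF g.dom.pseudo_natural_axioms] modification_Id2[OF g.cod.pseudo_natural_axioms]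
    show "VCmp ?P (Id2 ?P (MCod \<Gamma>)) \<Gamma> = \<Gamma>"
      by (rule modif_eqI[OF modification_VCmp[OF that i(2)] that]) (simp_all add: Ps_simps)
    show "VCmp ?P \<Gamma> (Id2 ?P (MDom \<Gamma>)) = \<Gamma>"
      by (rule modif_eqI[OF modification_VCmp[OF i(1) that] that]) (simp_all add: Ps_simps)
  qed
  have VA: "VCmp ?P (VCmp ?P \<Delta> \<Gamma>) \<Theta> = VCmp ?P \<Delta> (VCmp ?P \<Gamma> \<Theta>)"
    if t: "modification A B \<Theta>" and g: "modification A B \<Gamma>" and d: "modification A B \<Delta>"
      and eq: "MCod \<Theta> = MDom \<Gamma>" "MCod \<Gamma> = MDom \<Delta>" for \<Gamma> \<Delta> \<Theta>
  proof -
    interpret t: modification A B \<Theta> by fact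
    interpret g: modification A B \<Gamma> by fact
    interpret d: modification A B \<Delta> by fact
    show ?thesis
      by (rule modif_eqI[OF modification_VCmp[OF t modification_VCmp[OF g d]]
            modification_VCmp[OF modification_VCmp[OF t g] d]])
        (use eq in \<open>simp_all add: Ps_simps\<close>)
  qed
  show "category (vert_cat ?P)"
  proof (rule category.intro, unfold vert_cat_def cat.simps)
    show "Id2 ?P \<eta> \<in> Cell2 ?P" if "\<eta> \<in> Cell1 ?P" for \<eta>
      using that modification_Id2 by (auto simp: Ps_simps)
    show "\<Delta> \<bullet>\<^bsub>?P\<^esub> \<Gamma> \<in> Cell2 ?P" if "\<Gamma> \<in> Cell2 ?P" "\<Delta> \<in> Cell2 ?P" "Cod2 ?P \<Gamma> = Dom2 ?P \<Delta>" for \<Gamma> \<Delta>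
      using that modification_VCmp by (auto simp: Ps_simps)
  qed (use VI VA in \<open>auto simp: Ps_simps intro: modification.axioms\<close>)
  show "Src ?P (Dom2 ?P \<Gamma>) = Src ?P (Cod2 ?P \<Gamma>) \<and> Trg ?P (Dom2 ?P \<Gamma>) = Trg ?P (Cod2 ?P \<Gamma>)"
    if "\<Gamma> \<in> Cell2 ?P" for \<Gamma>
    using that modification.TDom_eq modification.TCod_eq by (auto simp: Ps_simps)
  show "\<Delta> \<star>\<^bsub>?P\<^esub> \<Gamma> \<in> hom2 ?P (\<theta> \<odot>\<^bsub>?P\<^esub> \<eta>) (\<theta>' \<odot>\<^bsub>?P\<^esub> \<eta>')"
    if "\<Gamma> \<in> hom2 ?P \<eta> \<eta>'" "\<Delta> \<in> hom2 ?P \<theta> \<theta>'" "Trg ?P \<eta> = Src ?P \<theta>" for \<Gamma> \<Delta> \<eta> \<eta>' \<theta> \<theta>'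
    using that modification_HCmp[of A B \<Gamma> \<Delta>] by (auto simp: Ps_simps hom2_def)
  show "Id2 ?P \<theta> \<star>\<^bsub>?P\<^esub> Id2 ?P \<eta> = Id2 ?P (\<theta> \<odot>\<^bsub>?P\<^esub> \<eta>)"
    if \<eta>: "\<eta> \<in> Cell1 ?P" and \<theta>: "\<theta> \<in> Cell1 ?P" and eq: "Trg ?P \<eta> = Src ?P \<theta>" for \<eta> \<theta>
  proof -
    interpret e: pseudo_natural A B \<eta> using \<eta> by (simp add: Ps_simps)
    interpret t: pseudo_natural A B \<theta> using \<theta> by (simp add: Ps_simps)
    show ?thesis using eq by (auto simp: Ps_simps intro!: restrict_ext)
  qed
  show "(\<Delta>' \<bullet>\<^bsub>?P\<^esub> \<Delta>) \<star>\<^bsub>?P\<^esub> (\<Gamma>' \<bullet>\<^bsub>?P\<^esub> \<Gamma>) = (\<Delta>' \<star>\<^bsub>?P\<^esub> \<Gamma>') \<bullet>\<^bsub>?P\<^esub> (\<Delta> \<star>\<^bsub>?P\<^esub> \<Gamma>)"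
    if "\<Gamma> \<in> hom2 ?P \<eta> \<eta>'" "\<Gamma>' \<in> hom2 ?P \<eta>' \<eta>''" "\<Delta> \<in> hom2 ?P \<theta> \<theta>'" "\<Delta>' \<in> hom2 ?P \<theta>' \<theta>''"
      "Trg ?P \<eta> = Src ?P \<theta>" for \<Gamma> \<Gamma>' \<Delta> \<Delta>' \<eta> \<eta>' \<eta>'' \<theta> \<theta>' \<theta>''
  proof -
    interpret g: modification A B \<Gamma> using that by (simp add: hom2_def Ps_simps)
    interpret g': modification A B \<Gamma>' using that by (simp add: hom2_def Ps_simps)
    interpret d: modification A B \<Delta> using that by (simp add: hom2_def Ps_simps)
    interpret d': modification A B \<Delta>' using that by (simp add: hom2_def Ps_simps)
    show ?thesis using that by (auto simp: Ps_simps hom2_def B.interchange' intro!: restrict_ext)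
  qed
  show "(\<Theta> \<star>\<^bsub>?P\<^esub> \<Delta>) \<star>\<^bsub>?P\<^esub> \<Gamma> = \<Theta> \<star>\<^bsub>?P\<^esub> (\<Delta> \<star>\<^bsub>?P\<^esub> \<Gamma>)"
    if "\<Gamma> \<in> hom2 ?P \<eta> \<eta>'" "\<Delta> \<in> hom2 ?P \<theta> \<theta>'" "\<Theta> \<in> hom2 ?P \<kappa> \<kappa>'"
      "Trg ?P \<eta> = Src ?P \<theta>" "Trg ?P \<theta> = Src ?P \<kappa>" for \<Gamma> \<Delta> \<Theta> \<eta> \<eta>' \<theta> \<theta>' \<kappa> \<kappa>'
  proof -
    interpret g: modification A B \<Gamma> using that by (simp add: hom2_def Ps_simps)
    interpret d: modification A B \<Delta> using that by (simp add: hom2_def Ps_simps)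
    interpret t: modification A B \<Theta> using that by (simp add: hom2_def Ps_simps)
    have "TCod \<eta>' = TDom \<theta>'" "TCod \<theta>' = TDom \<kappa>'"
      using that g.TCod_eq d.TDom_eq d.TCod_eq t.TDom_eq by (auto simp: Ps_simps hom2_def)
    then show ?thesis using that g.dom.pseudo_natural_axioms d.dom.pseudo_natural_axioms t.dom.pseudo_natural_axioms
        g.cod.pseudo_natural_axioms d.cod.pseudo_natural_axioms t.cod.pseudo_natural_axioms
      by (auto simp: Ps_simps hom2_def B.HCmp_assoc' ps_comp_assoc intro!: restrict_ext)
  qed
  fix \<Gamma> \<eta> \<eta>' assume a: "\<Gamma> \<in> hom2 ?P \<eta> \<eta>'"
  then interpret g: modification A B \<Gamma> by (simp add: hom2_def Ps_simps)
  from a have e: "MDom \<Gamma> = \<eta>" "MCod \<Gamma> = \<eta>'" "TDom \<eta> = TDom \<eta>'" "TCod \<eta> = TCod \<eta>'"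
    using g.TDom_eq g.TCod_eq by (auto simp: hom2_def Ps_simps)
  note i = modification_Id2[OF pseudo_natural_id[OF g.dom.cod.normal_pseudofunctor_axioms]]
    modification_Id2[OF pseudo_natural_id[OF g.dom.dom.normal_pseudofunctor_axioms]]
  note c = ps_comp_id[OF g.dom.pseudo_natural_axioms] ps_comp_id[OF g.cod.pseudo_natural_axioms]
  show "Id2 ?P (Id1 ?P (Trg ?P \<eta>)) \<star>\<^bsub>?P\<^esub> \<Gamma> = \<Gamma>"
    by (rule modif_eqI[OF modification_HCmp[OF g.modification_axioms] g.modification_axioms])
      (use i c e(3,4) in \<open>simp_all add: Ps_simps e(1,2)[symmetric]\<close>)
  show "\<Gamma> \<star>\<^bsub>?P\<^esub> Id2 ?P (Id1 ?P (Src ?P \<eta>)) = \<Gamma>"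
    by (rule modif_eqI[OF modification_HCmp[OF _ g.modification_axioms] g.modification_axioms])
      (use i c e(3,4) in \<open>simp_all add: Ps_simps e(1,2)[symmetric]\<close>)
qed

section \<open>Adjoint equivalences\<close>

definition hom_in :: "('o, 'm) cat \<Rightarrow> 'o \<Rightarrow> 'o \<Rightarrow> 'm set" where
  "hom_in A x y = {f \<in> Arr A. Dom A f = x \<and> Cod A f = y}"

definition fully_faithful :: "('o, 'm) cat \<Rightarrow> ('p, 'n) cat \<Rightarrow> ('o, 'm, 'p, 'n) func \<Rightarrow> bool" where
  "fully_faithful A B L \<longleftrightarrow>
     (\<forall>x\<in>Obj A. \<forall>y\<in>Obj A. \<forall>g\<in>hom_in B (FObj L x) (FObj L y). \<exists>!f. f \<in> hom_in A x y \<and> FArr L f = g)"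

definition essentially_surjective ::
  "('o, 'm) cat \<Rightarrow> ('p, 'n) cat \<Rightarrow> ('o, 'm, 'p, 'n) func \<Rightarrow> bool" where
  "essentially_surjective A B L \<longleftrightarrow>
     (\<forall>y\<in>Obj B. \<exists>x\<in>Obj A. \<exists>g. g \<in> hom_in B (FObj L x) y \<and> is_iso B g)"

text \<open>\<open>R\<close> is faithful because the counit is invertible. The preimage of \<open>g : L x \<rightarrow> L y\<close> is \<open>R g\<close> conjugated by
  the unit; its image under \<open>L\<close> is \<open>g\<close> because both have the same image under \<open>R\<close>.\<close>

lemma adjoint_equivalence_imp:
  assumes "adjoint_equivalence A B L"
  shows "fully_faithful A B L" "essentially_surjective A B L"
proof -
  from assms obtain R \<eta> \<epsilon> where L: "is_functor A B L" and R: "is_functor B A R"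
    and \<eta>: "is_nat A A \<eta>" and \<eta>1: "NDom \<eta> = id_func A" "NCod \<eta> = comp_func R L"
    and \<eta>i: "\<And>x. x \<in> Obj A \<Longrightarrow> is_iso A (NAt \<eta> x)"
    and \<epsilon>: "is_nat B B \<epsilon>" and \<epsilon>1: "NDom \<epsilon> = comp_func L R" "NCod \<epsilon> = id_func B"
    and \<epsilon>i: "\<And>y. y \<in> Obj B \<Longrightarrow> is_iso B (NAt \<epsilon> y)"
    unfolding adjoint_equivalence_def by metis
  note Ls = is_functorD[OF L] and Rs = is_functorD[OF R]
  interpret A: category A using Ls(1) .
  interpret B: category B using Ls(2) .
  have \<eta>_at: "NAt \<eta> x \<in> Arr A" "Dom A (NAt \<eta> x) = x" "Cod A (NAt \<eta> x) = FObj R (FObj L x)"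
    if "x \<in> Obj A" for x
    using that is_natD(4-6)[OF \<eta> that] Ls \<eta>1 by simp_all
  have \<epsilon>_at: "NAt \<epsilon> y \<in> Arr B" "Dom B (NAt \<epsilon> y) = FObj L (FObj R y)" "Cod B (NAt \<epsilon> y) = y"
    if "y \<in> Obj B" for y
    using that is_natD(4-6)[OF \<epsilon> that] Rs \<epsilon>1 by simp_all
  have \<eta>_nat: "FArr R (FArr L f) \<cdot>\<^bsub>A\<^esub> NAt \<eta> (Dom A f) = NAt \<eta> (Cod A f) \<cdot>\<^bsub>A\<^esub> f" if "f \<in> Arr A" for f
    using that is_natD(7)[OF \<eta> that] Ls \<eta>1 by simp
  have \<epsilon>_nat: "g \<cdot>\<^bsub>B\<^esub> NAt \<epsilon> (Dom B g) = NAt \<epsilon> (Cod B g) \<cdot>\<^bsub>B\<^esub> FArr L (FArr R g)" if "g \<in> Arr B" for g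
    using that is_natD(7)[OF \<epsilon> that] Rs \<epsilon>1 by simp
  show "essentially_surjective A B L"
    unfolding essentially_surjective_def hom_in_def using \<epsilon>_at \<epsilon>i Rs(7) by blast
  have R_faithful: "g = g'" if g: "g \<in> Arr B" "g' \<in> Arr B" "Dom B g = Dom B g'" "Cod B g = Cod B g'"
      "FArr R g = FArr R g'" for g g'
  proof (rule B.iso_cancel_right[OF \<epsilon>i[of "Dom B g"]])
    show "g \<cdot>\<^bsub>B\<^esub> NAt \<epsilon> (Dom B g) = g' \<cdot>\<^bsub>B\<^esub> NAt \<epsilon> (Dom B g)"
      using \<epsilon>_nat[of g] \<epsilon>_nat[of g'] g by simp
  qed (use g \<epsilon>_at in auto)
  show "fully_faithful A B L"
    unfolding fully_faithful_def
  proof (intro ballI ex_ex1I)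
    fix x y g assume x: "x \<in> Obj A" and y: "y \<in> Obj A" and "g \<in> hom_in B (FObj L x) (FObj L y)"
    then have g: "g \<in> Arr B" "Dom B g = FObj L x" "Cod B g = FObj L y" by (auto simp: hom_in_def)
    let ?f = "inverse_in A (NAt \<eta> y) \<cdot>\<^bsub>A\<^esub> (FArr R g \<cdot>\<^bsub>A\<^esub> NAt \<eta> x)"
    note i = inverse_in[OF \<eta>i[OF y]]
    have f: "?f \<in> Arr A" "Dom A ?f = x" "Cod A ?f = y"
      using x y g i Rs Ls \<eta>_at by simp_all
    have "FArr R (FArr L ?f) \<cdot>\<^bsub>A\<^esub> NAt \<eta> x = FArr R g \<cdot>\<^bsub>A\<^esub> NAt \<eta> x"
      using \<eta>_nat[OF f(1)] f \<eta>i[OF y] x y g i Rs Ls \<eta>_at by simp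
    then have "FArr R (FArr L ?f) = FArr R g"
      by (rule A.iso_cancel_right[OF \<eta>i[OF x], rotated -1]) (use x y g f Rs Ls \<eta>_at in simp_all)
    then have "FArr L ?f = g"
      by (rule R_faithful[rotated -1]) (use x y g f Rs Ls in simp_all)
    with f show "\<exists>f. f \<in> hom_in A x y \<and> FArr L f = g" by (auto simp: hom_in_def)
  next
    fix x y g f f' assume x: "x \<in> Obj A" and y: "y \<in> Obj A"
      and "f \<in> hom_in A x y \<and> FArr L f = g" "f' \<in> hom_in A x y \<and> FArr L f' = g"
    then show "f = f'"
      using \<eta>_nat[of f] \<eta>_nat[of f'] \<eta>_at A.iso_cancel_left[OF \<eta>i[OF y], of f f'] by (auto simp: hom_in_def)
  qed
qed

text \<open>
  The converse chooses, for every \<open>y\<close>, an object \<open>R y\<close> with an isomorphism \<open>\<epsilon>\<^sub>y : L (R y) \<rightarrow> y\<close>. Full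
  faithfulness then leaves no freedom: \<open>R\<close> on arrows and \<open>\<eta>\<close> are determined by naturality of \<open>\<epsilon>\<close> and by
  the first triangle identity, and the remaining equations can be checked after applying \<open>L\<close>.
\<close>

lemma adjoint_equivalenceI:
  assumes L: "is_functor A B L" and ff: "fully_faithful A B L" and es: "essentially_surjective A B L"
  shows "adjoint_equivalence A B L"
proof -
  note Ls = is_functorD[OF L]
  interpret A: category A using Ls(1) .
  interpret B: category B using Ls(2) .
  define l where "l x y g = (THE f. f \<in> hom_in A x y \<and> FArr L f = g)" for x y g
  have l: "l x y g \<in> Arr A \<and> Dom A (l x y g) = x \<and> Cod A (l x y g) = y \<and> FArr L (l x y g) = g"
    if "x \<in> Obj A" "y \<in> Obj A" "g \<in> Arr B" "Dom B g = FObj L x" "Cod B g = FObj L y" for x y g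
    using ff[unfolded fully_faithful_def, rule_format, of x y g, THEN theI'] that
    unfolding l_def[symmetric] by (simp add: hom_in_def)
  have faithful: "f = f'" if "f \<in> Arr A" "f' \<in> Arr A" "Dom A f = Dom A f'" "Cod A f = Cod A f'"
      "FArr L f = FArr L f'" for f f'
  proof -
    have "\<exists>!h. h \<in> hom_in A (Dom A f) (Cod A f) \<and> FArr L h = FArr L f"
      using ff that Ls unfolding fully_faithful_def by (auto simp: hom_in_def)
    then show ?thesis using that by (auto simp: hom_in_def)
  qed
  obtain r e where re: "\<And>y. y \<in> Obj B \<Longrightarrow> r y \<in> Obj A \<and> e y \<in> hom_in B (FObj L (r y)) y \<and> is_iso B (e y)"
    using es unfolding essentially_surjective_def by metis
  have r: "r y \<in> Obj A" and ei: "is_iso B (e y)"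
    and e: "e y \<in> Arr B" "Dom B (e y) = FObj L (r y)" "Cod B (e y) = y"
    if "y \<in> Obj B" for y using re[OF that] by (auto simp: hom_in_def)
  let ?i = "\<lambda>y. inverse_in B (e y)"
  have i: "?i y \<in> Arr B" "Dom B (?i y) = y" "Cod B (?i y) = FObj L (r y)"
    "?i y \<cdot>\<^bsub>B\<^esub> e y = Ide B (FObj L (r y))" "e y \<cdot>\<^bsub>B\<^esub> ?i y = Ide B y"
    if "y \<in> Obj B" for y using inverse_in[OF ei[OF that]] e[OF that] by auto
  let ?Ra = "\<lambda>g. l (r (Dom B g)) (r (Cod B g)) (?i (Cod B g) \<cdot>\<^bsub>B\<^esub> (g \<cdot>\<^bsub>B\<^esub> e (Dom B g)))"
  have Ra: "?Ra g \<in> Arr A \<and> Dom A (?Ra g) = r (Dom B g) \<and> Cod A (?Ra g) = r (Cod B g) \<and>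
      FArr L (?Ra g) = ?i (Cod B g) \<cdot>\<^bsub>B\<^esub> (g \<cdot>\<^bsub>B\<^esub> e (Dom B g))" if "g \<in> Arr B" for g
    by (rule l) (use that r e i in simp_all)
  define R where "R = \<lparr>FDom = B, FCod = A, FObj = restrict r (Obj B), FArr = restrict ?Ra (Arr B)\<rparr>"
  have R_simps: "FDom R = B" "FCod R = A" "\<And>y. y \<in> Obj B \<Longrightarrow> FObj R y = r y"
    "\<And>g. g \<in> Arr B \<Longrightarrow> FArr R g = ?Ra g"
    by (simp_all add: R_def)
  have R: "is_functor B A R"
  proof (rule is_functorI)
    fix y assume y: "y \<in> Obj B"
    show "FArr R (Ide B y) = Ide A (FObj R y)"
      by (rule faithful) (use Ra[of "Ide B y"] R_simps y r Ls e i in simp_all)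
  next
    fix g h assume g: "g \<in> Arr B" "h \<in> Arr B" "Cod B g = Dom B h"
    show "FArr R (h \<cdot>\<^bsub>B\<^esub> g) = FArr R h \<cdot>\<^bsub>A\<^esub> FArr R g"
    proof (rule faithful)
      show "FArr L (FArr R (h \<cdot>\<^bsub>B\<^esub> g)) = FArr L (FArr R h \<cdot>\<^bsub>A\<^esub> FArr R g)"
        using Ra[of "h \<cdot>\<^bsub>B\<^esub> g"] Ra[of g] Ra[of h] g R_simps Ls e i ei by simp
    qed (use Ra[of "h \<cdot>\<^bsub>B\<^esub> g"] Ra[of g] Ra[of h] g R_simps in simp_all)
  qed (use Ra R_simps r Ls in \<open>simp_all\<close>, simp_all add: R_def)
  note Rs = is_functorD[OF R]
  let ?Ea = "\<lambda>x. l x (r (FObj L x)) (?i (FObj L x))"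
  have Ea: "?Ea x \<in> Arr A \<and> Dom A (?Ea x) = x \<and> Cod A (?Ea x) = r (FObj L x) \<and>
      FArr L (?Ea x) = ?i (FObj L x)" if "x \<in> Obj A" for x
    by (rule l) (use that r i Ls in simp_all)
  define \<eta> where "\<eta> = \<lparr>NDom = id_func A, NCod = comp_func R L, NAt = restrict ?Ea (Obj A)\<rparr>"
  define \<epsilon> where "\<epsilon> = \<lparr>NDom = comp_func L R, NCod = id_func B, NAt = restrict e (Obj B)\<rparr>"
  have \<eta>: "is_nat A A \<eta>"
  proof (rule is_natI)
    fix f assume f: "f \<in> Arr A"
    have "FArr R (FArr L f) \<cdot>\<^bsub>A\<^esub> ?Ea (Dom A f) = ?Ea (Cod A f) \<cdot>\<^bsub>A\<^esub> f"
      by (rule faithful)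
        (use f Ra[of "FArr L f"] Ea[of "Dom A f"] Ea[of "Cod A f"] R_simps Ls e i ei in simp_all)
    then show "FArr (NCod \<eta>) f \<cdot>\<^bsub>A\<^esub> NAt \<eta> (Dom A f) = NAt \<eta> (Cod A f) \<cdot>\<^bsub>A\<^esub> FArr (NDom \<eta>) f"
      using f Ls by (simp add: \<eta>_def)
  qed (use Ea R_simps Ls is_functor_id[OF A.category_axioms] is_functor_comp[OF L R] in
      \<open>simp_all add: \<eta>_def\<close>)
  have \<epsilon>: "is_nat B B \<epsilon>"
  proof (rule is_natI)
    fix g assume g: "g \<in> Arr B"
    then show "FArr (NCod \<epsilon>) g \<cdot>\<^bsub>B\<^esub> NAt \<epsilon> (Dom B g) = NAt \<epsilon> (Cod B g) \<cdot>\<^bsub>B\<^esub> FArr (NDom \<epsilon>) g"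
      using Ra[OF g] R_simps e i ei by (simp add: \<epsilon>_def)
  qed (use e R_simps Ls is_functor_id[OF B.category_axioms] is_functor_comp[OF R L] in
      \<open>simp_all add: \<epsilon>_def\<close>)
  have \<eta>i: "is_iso A (NAt \<eta> x)" if x: "x \<in> Obj A" for x
  proof -
    let ?g = "l (r (FObj L x)) x (e (FObj L x))"
    have g: "?g \<in> Arr A \<and> Dom A ?g = r (FObj L x) \<and> Cod A ?g = x \<and> FArr L ?g = e (FObj L x)"
      by (rule l) (use x r e Ls in simp_all)
    have "?g \<cdot>\<^bsub>A\<^esub> ?Ea x = Ide A x" "?Ea x \<cdot>\<^bsub>A\<^esub> ?g = Ide A (r (FObj L x))"
      by (rule faithful; use x g Ea[OF x] r e i Ls in simp)+
    then show ?thesis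
      by (intro is_isoI[of _ _ ?g]) (use x g Ea[OF x] in \<open>simp_all add: \<eta>_def\<close>)
  qed
  have t1: "NAt \<epsilon> (FObj L x) \<cdot>\<^bsub>B\<^esub> FArr L (NAt \<eta> x) = Ide B (FObj L x)" if "x \<in> Obj A" for x
    using that Ea[OF that] Ls i by (simp add: \<eta>_def \<epsilon>_def)
  have t2: "FArr R (NAt \<epsilon> y) \<cdot>\<^bsub>A\<^esub> NAt \<eta> (FObj R y) = Ide A (FObj R y)" if y: "y \<in> Obj B" for y
    by (rule faithful)
      (use y Ea[OF r[OF y]] Ra[OF e(1)[OF y]] Ls r e i ei R_simps in \<open>simp_all add: \<eta>_def \<epsilon>_def\<close>)
  have "NDom \<eta> = id_func A" "NCod \<eta> = comp_func R L" "NDom \<epsilon> = comp_func L R" "NCod \<epsilon> = id_func B"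
    "\<forall>y\<in>Obj B. is_iso B (NAt \<epsilon> y)"
    using ei by (simp_all add: \<eta>_def \<epsilon>_def)
  with L R \<eta> \<epsilon> \<eta>i t1 t2 show ?thesis unfolding adjoint_equivalence_def by blast
qed

section \<open>Pseudo-slices and bi-initial objects\<close>

lemma slice_simps:
  "Cell0 (pseudo_slice A B F J) = {(X, f). X \<in> Cell0 A \<and> f \<in> hom1 B J (P0 F X)}"
  "Cell1 (pseudo_slice A B F J) = {m. S1Src m \<in> Cell0 (pseudo_slice A B F J) \<and>
     S1Trg m \<in> Cell0 (pseudo_slice A B F J) \<and> S1Mor m \<in> hom1 A (fst (S1Src m)) (fst (S1Trg m)) \<and>
     S1Cell m \<in> hom2 B (snd (S1Trg m)) (P1 F (S1Mor m) \<odot>\<^bsub>B\<^esub> snd (S1Src m)) \<and>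
     invertible2 B (S1Cell m)}"
  "Cell2 (pseudo_slice A B F J) = {c. S2Dom c \<in> Cell1 (pseudo_slice A B F J) \<and>
     S2Cod c \<in> Cell1 (pseudo_slice A B F J) \<and>
     S1Src (S2Dom c) = S1Src (S2Cod c) \<and> S1Trg (S2Dom c) = S1Trg (S2Cod c) \<and>
     S2Cell c \<in> hom2 A (S1Mor (S2Dom c)) (S1Mor (S2Cod c)) \<and>
     (P2 F (S2Cell c) \<star>\<^bsub>B\<^esub> Id2 B (snd (S1Src (S2Dom c)))) \<bullet>\<^bsub>B\<^esub> S1Cell (S2Dom c) = S1Cell (S2Cod c)}"
  "Src (pseudo_slice A B F J) = S1Src" "Trg (pseudo_slice A B F J) = S1Trg"
  "Dom2 (pseudo_slice A B F J) = S2Dom" "Cod2 (pseudo_slice A B F J) = S2Cod"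
  "Id1 (pseudo_slice A B F J) x =
     \<lparr>S1Src = x, S1Trg = x, S1Mor = Id1 A (fst x), S1Cell = Id2 B (snd x)\<rparr>"
  "Id2 (pseudo_slice A B F J) m = \<lparr>S2Dom = m, S2Cod = m, S2Cell = Id2 A (S1Mor m)\<rparr>"
  "Cmp1 (pseudo_slice A B F J) n m =
     \<lparr>S1Src = S1Src m, S1Trg = S1Trg n, S1Mor = S1Mor n \<odot>\<^bsub>A\<^esub> S1Mor m,
      S1Cell = (Phi F (S1Mor m) (S1Mor n) \<star>\<^bsub>B\<^esub> Id2 B (snd (S1Src m)))
               \<bullet>\<^bsub>B\<^esub> (Id2 B (P1 F (S1Mor n)) \<star>\<^bsub>B\<^esub> S1Cell m) \<bullet>\<^bsub>B\<^esub> S1Cell n\<rparr>"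
  "HCmp (pseudo_slice A B F J) d c = \<lparr>S2Dom = Cmp1 (pseudo_slice A B F J) (S2Dom d) (S2Dom c),
     S2Cod = Cmp1 (pseudo_slice A B F J) (S2Cod d) (S2Cod c), S2Cell = S2Cell d \<star>\<^bsub>A\<^esub> S2Cell c\<rparr>"
  "VCmp (pseudo_slice A B F J) d c =
     \<lparr>S2Dom = S2Dom c, S2Cod = S2Cod d, S2Cell = S2Cell d \<bullet>\<^bsub>A\<^esub> S2Cell c\<rparr>"
  by (simp_all add: pseudo_slice_def Let_def)

lemma slice_hom1_iff:
  "m \<in> hom1 (pseudo_slice A B F J) (X, f) (Y, g) \<longleftrightarrow>
     (X, f) \<in> Cell0 (pseudo_slice A B F J) \<and> (Y, g) \<in> Cell0 (pseudo_slice A B F J) \<and>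
     S1Src m = (X, f) \<and> S1Trg m = (Y, g) \<and> S1Mor m \<in> hom1 A X Y \<and>
     S1Cell m \<in> hom2 B g (P1 F (S1Mor m) \<odot>\<^bsub>B\<^esub> f) \<and> invertible2 B (S1Cell m)"
  by (auto simp: slice_simps(2,4,5) hom1_def)

lemma slice_hom2_iff:
  assumes "m \<in> hom1 (pseudo_slice A B F J) (X, f) (Y, g)" "n \<in> hom1 (pseudo_slice A B F J) (X, f) (Y, g)"
  shows "x \<in> hom2 (pseudo_slice A B F J) m n \<longleftrightarrow> S2Dom x = m \<and> S2Cod x = n \<and>
     S2Cell x \<in> hom2 A (S1Mor m) (S1Mor n) \<and>
     (P2 F (S2Cell x) \<star>\<^bsub>B\<^esub> Id2 B f) \<bullet>\<^bsub>B\<^esub> S1Cell m = S1Cell n"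
  using assms by (auto simp: hom1_def hom2_def slice_simps(3-7))

context normal_pseudofunctor
begin

lemma slice_Cmp1_in:
  assumes "m \<in> Cell1 (pseudo_slice A B F J)" "n \<in> Cell1 (pseudo_slice A B F J)" "S1Trg m = S1Src n"
  shows "n \<odot>\<^bsub>pseudo_slice A B F J\<^esub> m \<in> Cell1 (pseudo_slice A B F J)"
  using assms Phi_invertible[of "S1Mor m" "S1Mor n"]
  by (auto simp: slice_simps hom1_def hom2_def split_beta)

text \<open>An exchange moves the 2-cell of \<open>m\<close> past the compositor of \<open>n\<close> and \<open>p\<close>; then the two composites differ
  by the associativity of the compositors.\<close>

lemma slice_Cmp1_assoc:
  assumes "m \<in> Cell1 (pseudo_slice A B F J)" "n \<in> Cell1 (pseudo_slice A B F J)"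
    "p \<in> Cell1 (pseudo_slice A B F J)" and eq: "S1Trg m = S1Src n" "S1Trg n = S1Src p"
  shows "(p \<odot>\<^bsub>pseudo_slice A B F J\<^esub> n) \<odot>\<^bsub>pseudo_slice A B F J\<^esub> m
    = p \<odot>\<^bsub>pseudo_slice A B F J\<^esub> (n \<odot>\<^bsub>pseudo_slice A B F J\<^esub> m)"
proof -
  obtain X f where m0: "S1Src m = (X, f)" by fastforce
  obtain Y g where n0: "S1Src n = (Y, g)" by fastforce
  obtain Z h where p0: "S1Src p = (Z, h)" by fastforce
  obtain U k where q0: "S1Trg p = (U, k)" by fastforce
  let ?m = "S1Mor m" and ?n = "S1Mor n" and ?p = "S1Mor p" and ?I = "Id2 B"
  have [simp]: "X \<in> Cell0 A" "Y \<in> Cell0 A" "Z \<in> Cell0 A" "f \<in> Cell1 B" "g \<in> Cell1 B" "h \<in> Cell1 B"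
    "k \<in> Cell1 B"
    "Src B f = J" "Trg B f = P0 F X" "Src B g = J" "Trg B g = P0 F Y" "Src B h = J" "Trg B h = P0 F Z"
    "?m \<in> Cell1 A" "Src A ?m = X" "Trg A ?m = Y" "?n \<in> Cell1 A" "Src A ?n = Y" "Trg A ?n = Z"
    "?p \<in> Cell1 A" "Src A ?p = Z" "Trg A ?p = U"
    "S1Cell m \<in> Cell2 B" "Dom2 B (S1Cell m) = g" "Cod2 B (S1Cell m) = P1 F ?m \<odot>\<^bsub>B\<^esub> f"
    "S1Cell n \<in> Cell2 B" "Dom2 B (S1Cell n) = h" "Cod2 B (S1Cell n) = P1 F ?n \<odot>\<^bsub>B\<^esub> g"
    "S1Cell p \<in> Cell2 B" "Dom2 B (S1Cell p) = k" "Cod2 B (S1Cell p) = P1 F ?p \<odot>\<^bsub>B\<^esub> h"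
    using assms m0 n0 p0 q0 by (auto simp: slice_simps hom1_def hom2_def)
  have ex: "(?I (P1 F (?p \<odot>\<^bsub>A\<^esub> ?n)) \<star>\<^bsub>B\<^esub> S1Cell m) \<bullet>\<^bsub>B\<^esub> (Phi F ?n ?p \<star>\<^bsub>B\<^esub> ?I g)
      = (Phi F ?n ?p \<star>\<^bsub>B\<^esub> ?I (P1 F ?m \<odot>\<^bsub>B\<^esub> f)) \<bullet>\<^bsub>B\<^esub> (?I (P1 F ?p \<odot>\<^bsub>B\<^esub> P1 F ?n) \<star>\<^bsub>B\<^esub> S1Cell m)"
    by (rule B.exchange[symmetric]) (simp_all add: hom2_def)
  let ?r = "(?I (P1 F ?p) \<star>\<^bsub>B\<^esub> S1Cell n) \<bullet>\<^bsub>B\<^esub> S1Cell p"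
  have "(Phi F ?m (?p \<odot>\<^bsub>A\<^esub> ?n) \<star>\<^bsub>B\<^esub> ?I f) \<bullet>\<^bsub>B\<^esub> (?I (P1 F (?p \<odot>\<^bsub>A\<^esub> ?n)) \<star>\<^bsub>B\<^esub> S1Cell m) \<bullet>\<^bsub>B\<^esub>
      ((Phi F ?n ?p \<star>\<^bsub>B\<^esub> ?I g) \<bullet>\<^bsub>B\<^esub> (?I (P1 F ?p) \<star>\<^bsub>B\<^esub> S1Cell n) \<bullet>\<^bsub>B\<^esub> S1Cell p)
    = (Phi F ?m (?p \<odot>\<^bsub>A\<^esub> ?n) \<star>\<^bsub>B\<^esub> ?I f) \<bullet>\<^bsub>B\<^esub>
      (((?I (P1 F (?p \<odot>\<^bsub>A\<^esub> ?n)) \<star>\<^bsub>B\<^esub> S1Cell m) \<bullet>\<^bsub>B\<^esub> (Phi F ?n ?p \<star>\<^bsub>B\<^esub> ?I g)) \<bullet>\<^bsub>B\<^esub> ?r)"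
    by simp
  also have "\<dots> = ((Phi F ?m (?p \<odot>\<^bsub>A\<^esub> ?n) \<bullet>\<^bsub>B\<^esub> (Phi F ?n ?p \<star>\<^bsub>B\<^esub> ?I (P1 F ?m))) \<star>\<^bsub>B\<^esub> ?I f) \<bullet>\<^bsub>B\<^esub>
      ((?I (P1 F ?p \<odot>\<^bsub>B\<^esub> P1 F ?n) \<star>\<^bsub>B\<^esub> S1Cell m) \<bullet>\<^bsub>B\<^esub> ?r)"
    unfolding ex by simp
  also have "\<dots> = (Phi F (?n \<odot>\<^bsub>A\<^esub> ?m) ?p \<star>\<^bsub>B\<^esub> ?I f) \<bullet>\<^bsub>B\<^esub> (?I (P1 F ?p) \<star>\<^bsub>B\<^esub>
      ((Phi F ?m ?n \<star>\<^bsub>B\<^esub> ?I f) \<bullet>\<^bsub>B\<^esub> (?I (P1 F ?n) \<star>\<^bsub>B\<^esub> S1Cell m) \<bullet>\<^bsub>B\<^esub> S1Cell n)) \<bullet>\<^bsub>B\<^esub> S1Cell p"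
    by (subst Phi_assoc) simp_all
  finally show ?thesis
    by (simp add: slice_simps m0 n0 p0 q0 eq)
qed

text \<open>By naturality, the compositors can be moved in front of the images of \<open>c\<close> and \<open>d\<close>; after an exchange
  these meet the 2-cells of their own domains.\<close>

lemma slice_HCmp_in:
  assumes c: "c \<in> Cell2 (pseudo_slice A B F J)" and d: "d \<in> Cell2 (pseudo_slice A B F J)"
    and eq: "S1Trg (S2Dom c) = S1Src (S2Dom d)"
  shows "d \<star>\<^bsub>pseudo_slice A B F J\<^esub> c \<in> Cell2 (pseudo_slice A B F J)"
proof -
  let ?S = "pseudo_slice A B F J"
  define m m' n n' where mn: "m = S2Dom c" "m' = S2Cod c" "n = S2Dom d" "n' = S2Cod d"
  obtain X f where m0: "S1Src m = (X, f)" by fastforce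
  obtain Y g where n0: "S1Src n = (Y, g)" by fastforce
  obtain Z h where p0: "S1Trg n = (Z, h)" by fastforce
  have e: "S1Trg m = (Y, g)" "S1Src m' = (X, f)" "S1Trg m' = (Y, g)" "S1Src n' = (Y, g)" "S1Trg n' = (Z, h)"
    using c d eq m0 n0 p0 unfolding mn by (auto simp: slice_simps)
  let ?m = "S1Mor m" and ?n = "S1Mor n" and ?m' = "S1Mor m'" and ?n' = "S1Mor n'" and ?I = "Id2 B"
  let ?c = "S2Cell c" and ?d = "S2Cell d"
  have [simp]: "X \<in> Cell0 A" "Y \<in> Cell0 A" "Z \<in> Cell0 A" "f \<in> Cell1 B" "g \<in> Cell1 B" "h \<in> Cell1 B"
    "Src B f = J" "Trg B f = P0 F X" "Src B g = J" "Trg B g = P0 F Y" "Src B h = J" "Trg B h = P0 F Z"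
    "?m \<in> Cell1 A" "Src A ?m = X" "Trg A ?m = Y" "?n \<in> Cell1 A" "Src A ?n = Y" "Trg A ?n = Z"
    "?m' \<in> Cell1 A" "Src A ?m' = X" "Trg A ?m' = Y" "?n' \<in> Cell1 A" "Src A ?n' = Y" "Trg A ?n' = Z"
    "S1Cell m \<in> Cell2 B" "Dom2 B (S1Cell m) = g" "Cod2 B (S1Cell m) = P1 F ?m \<odot>\<^bsub>B\<^esub> f"
    "S1Cell n \<in> Cell2 B" "Dom2 B (S1Cell n) = h" "Cod2 B (S1Cell n) = P1 F ?n \<odot>\<^bsub>B\<^esub> g"
    "?c \<in> Cell2 A" "Dom2 A ?c = ?m" "Cod2 A ?c = ?m'" "?d \<in> Cell2 A" "Dom2 A ?d = ?n" "Cod2 A ?d = ?n'"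
    using c d m0 n0 p0 e by (auto simp: slice_simps hom1_def hom2_def mn)
  have cc: "(P2 F ?c \<star>\<^bsub>B\<^esub> ?I f) \<bullet>\<^bsub>B\<^esub> S1Cell m = S1Cell m'"
    and dd: "(P2 F ?d \<star>\<^bsub>B\<^esub> ?I g) \<bullet>\<^bsub>B\<^esub> S1Cell n = S1Cell n'"
    using c d m0 n0 by (auto simp: slice_simps mn)
  have hs: "P2 F ?d \<star>\<^bsub>B\<^esub> P2 F ?c = (?I (P1 F ?n') \<star>\<^bsub>B\<^esub> P2 F ?c) \<bullet>\<^bsub>B\<^esub> (P2 F ?d \<star>\<^bsub>B\<^esub> ?I (P1 F ?m))"
    by (rule B.HCmp_slice_right[of _ _ "P1 F ?m'" _ "P1 F ?n"]) (simp_all add: hom2_def)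
  have ex: "(P2 F ?d \<star>\<^bsub>B\<^esub> ?I (P1 F ?m \<odot>\<^bsub>B\<^esub> f)) \<bullet>\<^bsub>B\<^esub> (?I (P1 F ?n) \<star>\<^bsub>B\<^esub> S1Cell m)
      = (?I (P1 F ?n') \<star>\<^bsub>B\<^esub> S1Cell m) \<bullet>\<^bsub>B\<^esub> (P2 F ?d \<star>\<^bsub>B\<^esub> ?I g)"
    by (rule B.exchange) (simp_all add: hom2_def)
  have nat: "P2 F (?d \<star>\<^bsub>A\<^esub> ?c) \<bullet>\<^bsub>B\<^esub> Phi F ?m ?n = Phi F ?m' ?n' \<bullet>\<^bsub>B\<^esub> (P2 F ?d \<star>\<^bsub>B\<^esub> P2 F ?c)"
    by (rule Phi_natural) (simp_all add: hom2_def)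
  have "(P2 F (?d \<star>\<^bsub>A\<^esub> ?c) \<star>\<^bsub>B\<^esub> ?I f) \<bullet>\<^bsub>B\<^esub>
      ((Phi F ?m ?n \<star>\<^bsub>B\<^esub> ?I f) \<bullet>\<^bsub>B\<^esub> (?I (P1 F ?n) \<star>\<^bsub>B\<^esub> S1Cell m) \<bullet>\<^bsub>B\<^esub> S1Cell n)
    = ((P2 F (?d \<star>\<^bsub>A\<^esub> ?c) \<bullet>\<^bsub>B\<^esub> Phi F ?m ?n) \<star>\<^bsub>B\<^esub> ?I f) \<bullet>\<^bsub>B\<^esub> ((?I (P1 F ?n) \<star>\<^bsub>B\<^esub> S1Cell m) \<bullet>\<^bsub>B\<^esub> S1Cell n)"
    by simp
  also have "\<dots> = (Phi F ?m' ?n' \<star>\<^bsub>B\<^esub> ?I f) \<bullet>\<^bsub>B\<^esub> ((?I (P1 F ?n') \<star>\<^bsub>B\<^esub> (P2 F ?c \<star>\<^bsub>B\<^esub> ?I f)) \<bullet>\<^bsub>B\<^esub>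
      (((P2 F ?d \<star>\<^bsub>B\<^esub> ?I (P1 F ?m \<odot>\<^bsub>B\<^esub> f)) \<bullet>\<^bsub>B\<^esub> (?I (P1 F ?n) \<star>\<^bsub>B\<^esub> S1Cell m)) \<bullet>\<^bsub>B\<^esub> S1Cell n))"
    unfolding nat hs by simp
  also have "\<dots> = (Phi F ?m' ?n' \<star>\<^bsub>B\<^esub> ?I f) \<bullet>\<^bsub>B\<^esub>
      ((?I (P1 F ?n') \<star>\<^bsub>B\<^esub> ((P2 F ?c \<star>\<^bsub>B\<^esub> ?I f) \<bullet>\<^bsub>B\<^esub> S1Cell m)) \<bullet>\<^bsub>B\<^esub> ((P2 F ?d \<star>\<^bsub>B\<^esub> ?I g) \<bullet>\<^bsub>B\<^esub> S1Cell n))"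
    unfolding ex by simp
  finally have key: "(P2 F (?d \<star>\<^bsub>A\<^esub> ?c) \<star>\<^bsub>B\<^esub> ?I f) \<bullet>\<^bsub>B\<^esub> S1Cell (n \<odot>\<^bsub>?S\<^esub> m) = S1Cell (n' \<odot>\<^bsub>?S\<^esub> m')"
    unfolding cc dd using e m0 n0 c d by (simp add: slice_simps hom1_def hom2_def mn)
  have 1: "m \<in> Cell1 ?S" "n \<in> Cell1 ?S" "m' \<in> Cell1 ?S" "n' \<in> Cell1 ?S" "S1Trg m = S1Src n" "S1Trg m' = S1Src n'"
    using c d e n0 unfolding mn by (auto simp: slice_simps(3))
  have 2: "n \<odot>\<^bsub>?S\<^esub> m \<in> Cell1 ?S" "n' \<odot>\<^bsub>?S\<^esub> m' \<in> Cell1 ?S" using slice_Cmp1_in 1 by blast+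
  have "?d \<star>\<^bsub>A\<^esub> ?c \<in> hom2 A (?n \<odot>\<^bsub>A\<^esub> ?m) (?n' \<odot>\<^bsub>A\<^esub> ?m')" by (simp add: hom2_def)
  then show ?thesis
    using 2 key e m0 p0 by (simp add: slice_simps(3,11) mn[symmetric]) (simp add: slice_simps(10))
qed

lemma two_category_slice: "two_category (pseudo_slice A B F J)"
proof (rule two_category.intro)
  let ?S = "pseudo_slice A B F J"
  show "category (under_cat ?S)"
  proof (rule category.intro; unfold under_cat_def cat.simps)
    fix x assume "x \<in> Cell0 ?S"
    then show "Id1 ?S x \<in> Cell1 ?S" "Src ?S (Id1 ?S x) = x" "Trg ?S (Id1 ?S x) = x"
      by (auto simp: slice_simps hom1_def hom2_def)
  next
    fix m assume m: "m \<in> Cell1 ?S"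
    then show "Src ?S m \<in> Cell0 ?S" "Trg ?S m \<in> Cell0 ?S" by (auto simp: slice_simps)
    show "Id1 ?S (Trg ?S m) \<odot>\<^bsub>?S\<^esub> m = m" "m \<odot>\<^bsub>?S\<^esub> Id1 ?S (Src ?S m) = m"
      using m Phi_Id_left[of "S1Mor m"] Phi_Id_right[of "S1Mor m"]
      by (auto simp: slice_simps hom1_def hom2_def split_beta)
  next
    fix m n assume "m \<in> Cell1 ?S" "n \<in> Cell1 ?S" "Trg ?S m = Src ?S n"
    then show "n \<odot>\<^bsub>?S\<^esub> m \<in> Cell1 ?S" by (intro slice_Cmp1_in) (simp_all add: slice_simps(4,5))
    show "Src ?S (n \<odot>\<^bsub>?S\<^esub> m) = Src ?S m" "Trg ?S (n \<odot>\<^bsub>?S\<^esub> m) = Trg ?S n"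
      by (simp_all add: slice_simps(4,5,10))
  next
    fix m n p assume "m \<in> Cell1 ?S" "n \<in> Cell1 ?S" "p \<in> Cell1 ?S" "Trg ?S m = Src ?S n" "Trg ?S n = Src ?S p"
    then show "(p \<odot>\<^bsub>?S\<^esub> n) \<odot>\<^bsub>?S\<^esub> m = p \<odot>\<^bsub>?S\<^esub> (n \<odot>\<^bsub>?S\<^esub> m)"
      by (intro slice_Cmp1_assoc) (simp_all add: slice_simps(4,5))
  qed
  have C1: "snd (S1Src m) \<in> Cell1 B" "Trg B (snd (S1Src m)) = P0 F (fst (S1Src m))"
    "S1Mor m \<in> Cell1 A" "Src A (S1Mor m) = fst (S1Src m)" "S1Cell m \<in> Cell2 B"
    "Dom2 B (S1Cell m) = snd (S1Trg m)" "Cod2 B (S1Cell m) = P1 F (S1Mor m) \<odot>\<^bsub>B\<^esub> snd (S1Src m)"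
    if "m \<in> Cell1 ?S" for m
    using that by (auto simp: slice_simps(1,2) hom1_def hom2_def)
  have C2: "S2Dom c \<in> Cell1 ?S" "S2Cod c \<in> Cell1 ?S" "S2Cell c \<in> Cell2 A"
     "S1Src (S2Cod c) = S1Src (S2Dom c)" "S1Trg (S2Cod c) = S1Trg (S2Dom c)"
     "Dom2 A (S2Cell c) = S1Mor (S2Dom c)" "Cod2 A (S2Cell c) = S1Mor (S2Cod c)"
     "(P2 F (S2Cell c) \<star>\<^bsub>B\<^esub> Id2 B (snd (S1Src (S2Dom c)))) \<bullet>\<^bsub>B\<^esub> S1Cell (S2Dom c) = S1Cell (S2Cod c)"
    if "c \<in> Cell2 ?S" for c
    using that by (auto simp: slice_simps(3) hom2_def)
  have C2I: "c \<in> Cell2 ?S"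
    if "S2Dom c \<in> Cell1 ?S" "S2Cod c \<in> Cell1 ?S" "S2Cell c \<in> Cell2 A"
     "S1Src (S2Cod c) = S1Src (S2Dom c)" "S1Trg (S2Cod c) = S1Trg (S2Dom c)"
     "Dom2 A (S2Cell c) = S1Mor (S2Dom c)" "Cod2 A (S2Cell c) = S1Mor (S2Cod c)"
     "(P2 F (S2Cell c) \<star>\<^bsub>B\<^esub> Id2 B (snd (S1Src (S2Dom c)))) \<bullet>\<^bsub>B\<^esub> S1Cell (S2Dom c) = S1Cell (S2Cod c)" for c
    using that by (simp add: slice_simps(3) hom2_def)
  show "category (vert_cat ?S)"
  proof (rule category.intro; unfold vert_cat_def cat.simps slice_simps(6,7))
    fix m assume m: "m \<in> Cell1 ?S"
    show "Id2 ?S m \<in> Cell2 ?S" using m C1[OF m] by (intro C2I) (simp_all add: slice_simps(9))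
    show "S2Dom (Id2 ?S m) = m" "S2Cod (Id2 ?S m) = m" by (simp_all add: slice_simps(9))
  next
    fix c d assume c: "c \<in> Cell2 ?S" and d: "d \<in> Cell2 ?S" and eq: "S2Cod c = S2Dom d"
    note c' = C2[OF c] C1[OF C2(1)[OF c]] C1[OF C2(2)[OF c]]
    note d' = C2[OF d] C1[OF C2(1)[OF d]] C1[OF C2(2)[OF d]]
    note [simp] = c'(3-7,9-22)[unfolded eq] d'(3-7,16-22) eq
    have "(P2 F (S2Cell d \<bullet>\<^bsub>A\<^esub> S2Cell c) \<star>\<^bsub>B\<^esub> Id2 B (snd (S1Src (S2Dom c)))) \<bullet>\<^bsub>B\<^esub> S1Cell (S2Dom c)
      = (P2 F (S2Cell d) \<star>\<^bsub>B\<^esub> Id2 B (snd (S1Src (S2Dom d)))) \<bullet>\<^bsub>B\<^esub>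
        ((P2 F (S2Cell c) \<star>\<^bsub>B\<^esub> Id2 B (snd (S1Src (S2Dom c)))) \<bullet>\<^bsub>B\<^esub> S1Cell (S2Dom c))"
      by (simp add: P2_VCmp)
    also have "\<dots> = S1Cell (S2Cod d)" unfolding c'(8) eq d'(8) ..
    finally show "d \<bullet>\<^bsub>?S\<^esub> c \<in> Cell2 ?S"
      using c'(1,2) d'(1,2) by (intro C2I) (simp_all add: slice_simps(12))
    show "S2Dom (d \<bullet>\<^bsub>?S\<^esub> c) = S2Dom c" "S2Cod (d \<bullet>\<^bsub>?S\<^esub> c) = S2Cod d" by (simp_all add: slice_simps(12))
  next
    fix c assume c: "c \<in> Cell2 ?S"
    show "Id2 ?S (S2Cod c) \<bullet>\<^bsub>?S\<^esub> c = c" "c \<bullet>\<^bsub>?S\<^esub> Id2 ?S (S2Dom c) = c"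
      using C2[OF c] by (simp_all add: slice_simps(9,12))
  next
    fix c d e assume "c \<in> Cell2 ?S" "d \<in> Cell2 ?S" "e \<in> Cell2 ?S" "S2Cod c = S2Dom d" "S2Cod d = S2Dom e"
    then show "(e \<bullet>\<^bsub>?S\<^esub> d) \<bullet>\<^bsub>?S\<^esub> c = e \<bullet>\<^bsub>?S\<^esub> (d \<bullet>\<^bsub>?S\<^esub> c)"
      using C2(3,6,7)[of c] C2(3,6,7)[of d] C2(3,6,7)[of e] by (simp add: slice_simps(12))
  qed (use C2(1,2) in auto)
  show "Src ?S (Dom2 ?S c) = Src ?S (Cod2 ?S c) \<and> Trg ?S (Dom2 ?S c) = Trg ?S (Cod2 ?S c)"
    if "c \<in> Cell2 ?S" for c using that by (auto simp: slice_simps)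
  show "d \<star>\<^bsub>?S\<^esub> c \<in> hom2 ?S (n \<odot>\<^bsub>?S\<^esub> m) (n' \<odot>\<^bsub>?S\<^esub> m')"
    if "c \<in> hom2 ?S m m'" "d \<in> hom2 ?S n n'" "Trg ?S m = Src ?S n" for c d m m' n n'
    using that slice_HCmp_in[of c J d] by (auto simp: hom2_def slice_simps(4-7,11))
  show "Id2 ?S n \<star>\<^bsub>?S\<^esub> Id2 ?S m = Id2 ?S (n \<odot>\<^bsub>?S\<^esub> m)"
    if "m \<in> Cell1 ?S" "n \<in> Cell1 ?S" "Trg ?S m = Src ?S n" for m n
    using that by (auto simp: slice_simps hom1_def)
  show "(d' \<bullet>\<^bsub>?S\<^esub> d) \<star>\<^bsub>?S\<^esub> (c' \<bullet>\<^bsub>?S\<^esub> c) = (d' \<star>\<^bsub>?S\<^esub> c') \<bullet>\<^bsub>?S\<^esub> (d \<star>\<^bsub>?S\<^esub> c)"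
    if "c \<in> hom2 ?S m m'" "c' \<in> hom2 ?S m' m''" "d \<in> hom2 ?S n n'" "d' \<in> hom2 ?S n' n''"
      "Trg ?S m = Src ?S n" for c c' d d' m m' m'' n n' n''
  proof -
    note h = hom2D[OF that(1)] hom2D[OF that(2)] hom2D[OF that(3)] hom2D[OF that(4)]
    have mn: "m \<in> Cell1 ?S" "n \<in> Cell1 ?S"
      using C2(1)[OF h(1)] C2(1)[OF h(7)] h(2,8) by (simp_all add: slice_simps(6))
    have "(S2Cell d' \<bullet>\<^bsub>A\<^esub> S2Cell d) \<star>\<^bsub>A\<^esub> (S2Cell c' \<bullet>\<^bsub>A\<^esub> S2Cell c)
        = (S2Cell d' \<star>\<^bsub>A\<^esub> S2Cell c') \<bullet>\<^bsub>A\<^esub> (S2Cell d \<star>\<^bsub>A\<^esub> S2Cell c)"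
    proof (rule A.interchange')
      show "Trg A (Dom2 A (S2Cell c)) = Src A (Dom2 A (S2Cell d))"
        using C2(6)[OF h(1)] C2(6)[OF h(7)] h(2,8) mn that(5)
        by (simp add: slice_simps(1,2,4-7) hom1_def)
    qed (use C2(3,6,7)[OF h(1)] C2(3,6,7)[OF h(4)] C2(3,6,7)[OF h(7)] C2(3,6,7)[OF h(10)] h in
        \<open>simp_all add: slice_simps(6,7)\<close>)
    then show ?thesis using h by (simp add: slice_simps(6,7,11,12))
  qed
  show "(p \<star>\<^bsub>?S\<^esub> d) \<star>\<^bsub>?S\<^esub> c = p \<star>\<^bsub>?S\<^esub> (d \<star>\<^bsub>?S\<^esub> c)"
    if "c \<in> hom2 ?S m m'" "d \<in> hom2 ?S n n'" "p \<in> hom2 ?S k k'" "Trg ?S m = Src ?S n" "Trg ?S n = Src ?S k"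
    for c d p m m' n n' k k'
  proof -
    have "(k \<odot>\<^bsub>?S\<^esub> n) \<odot>\<^bsub>?S\<^esub> m = k \<odot>\<^bsub>?S\<^esub> (n \<odot>\<^bsub>?S\<^esub> m)" "(k' \<odot>\<^bsub>?S\<^esub> n') \<odot>\<^bsub>?S\<^esub> m' = k' \<odot>\<^bsub>?S\<^esub> (n' \<odot>\<^bsub>?S\<^esub> m')"
      using that by (auto simp: slice_simps(3-7) hom2_def intro!: slice_Cmp1_assoc)
    moreover have "(S2Cell p \<star>\<^bsub>A\<^esub> S2Cell d) \<star>\<^bsub>A\<^esub> S2Cell c = S2Cell p \<star>\<^bsub>A\<^esub> (S2Cell d \<star>\<^bsub>A\<^esub> S2Cell c)"
      using that by (auto simp: slice_simps hom1_def hom2_def intro!: A.HCmp_assoc')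
    ultimately show ?thesis using that by (auto simp: slice_simps(6,7,11) hom2_def)
  qed
  fix c m m' assume "c \<in> hom2 ?S m m'"
  note c = hom2D[OF this]
  have e: "m = S2Dom c" "m' = S2Cod c" using c(2,3) by (simp_all add: slice_simps(6,7))
  note C = C2[OF c(1)] C1[OF C2(1)[OF c(1)]] C1[OF C2(2)[OF c(1)]]
  have "Id1 ?S (Trg ?S k) \<odot>\<^bsub>?S\<^esub> k = k" "k \<odot>\<^bsub>?S\<^esub> Id1 ?S (Src ?S k) = k" if "k \<in> Cell1 ?S" for k
    using category.Cmp_Ide_left[OF \<open>category (under_cat ?S)\<close>] category.Cmp_Ide_right[OF \<open>category (under_cat ?S)\<close>] that
    by (simp_all add: under_cat_def)
  note u = this[OF C(1)] this[OF C(2)]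
  have "Trg A (S1Mor (S2Dom c)) = fst (S1Trg (S2Dom c))" "fst (S1Trg (S2Dom c)) \<in> Cell0 A"
    "fst (S1Src (S2Dom c)) \<in> Cell0 A"
    using C(1) by (auto simp: slice_simps(1,2) hom1_def)
  then show "Id2 ?S (Id1 ?S (Trg ?S m)) \<star>\<^bsub>?S\<^esub> c = c" "c \<star>\<^bsub>?S\<^esub> Id2 ?S (Id1 ?S (Src ?S m)) = c"
    using u C(3-7,12) by (simp_all add: slice_simps(4,5,9,11) e) (simp_all add: slice_simps(8))
qed

end

text \<open>
  Fullness on 1-cells of the projection \<open>J \<down> C \<rightarrow> C\<close>, applied to the objects \<open>(J, Id)\<close> and \<open>(Y, c)\<close>, makes
  any two 1-cells \<open>b, c : J \<rightarrow> Y\<close> isomorphic; fullness on 2-cells says that a 2-cell \<open>b \<Rightarrow> c\<close> is equal to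
  whichever isomorphism \<open>b \<Rightarrow> c\<close> one prescribes.
\<close>

lemma (in two_category) bi_initial_iff:
  assumes J: "J \<in> Cell0 C"
  shows "bi_initial C J \<longleftrightarrow> (\<forall>Y\<in>Cell0 C. (\<exists>f. f \<in> hom1 C J Y) \<and>
    (\<forall>b\<in>hom1 C J Y. \<forall>c\<in>hom1 C J Y. \<exists>!\<beta>. \<beta> \<in> hom2 C b c))"
proof -
  let ?L = "pseudo_slice C C (id_psfun C) J" and ?p = "slice_proj C C (id_psfun C) J"
  have ob: "(Y, f) \<in> Cell0 ?L \<longleftrightarrow> Y \<in> Cell0 C \<and> f \<in> hom1 C J Y" for Y f
    by (auto simp: slice_simps id_psfun_def)
  have mor: "m \<in> hom1 ?L (Y, f) (Z, g) \<longleftrightarrow> (Y, f) \<in> Cell0 ?L \<and> (Z, g) \<in> Cell0 ?L \<and>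
      S1Src m = (Y, f) \<and> S1Trg m = (Z, g) \<and> S1Mor m \<in> hom1 C Y Z \<and>
      S1Cell m \<in> hom2 C g (S1Mor m \<odot> f) \<and> invertible2 C (S1Cell m)" for m Y f Z g
    unfolding slice_hom1_iff by (auto simp: id_psfun_def hom1_def)
  have cell: "x \<in> hom2 ?L m n \<longleftrightarrow> S2Dom x = m \<and> S2Cod x = n \<and> S2Cell x \<in> hom2 C (S1Mor m) (S1Mor n) \<and>
      (S2Cell x \<star> Id2 C f) \<bullet> S1Cell m = S1Cell n"
    if "m \<in> hom1 ?L (Y, f) (Z, g)" "n \<in> hom1 ?L (Y, f) (Z, g)" for x m n Y f Z g
    unfolding slice_hom2_iff[OF that] by (auto simp: id_psfun_def hom2_def)
  have p0: "P0 ?p (Y, f) = Y" if "(Y, f) \<in> Cell0 ?L" for Y f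
    using that by (simp add: slice_proj_def Let_def)
  have p1: "P1 ?p m = S1Mor m" if "m \<in> hom1 ?L x y" for m x y
    using that by (simp add: slice_proj_def Let_def hom1_def)
  have p2: "P2 ?p x = S2Cell x" if "x \<in> hom2 ?L m n" for m n x
    using that by (simp add: slice_proj_def Let_def hom2_def)
  show ?thesis
  proof (intro iffI ballI conjI)
    assume "bi_initial C J"
    then have T: "trivial_fibration ?L C ?p" by (simp add: bi_initial_def)
    fix Y assume Y: "Y \<in> Cell0 C"
    from T Y obtain x where "x \<in> Cell0 ?L" "P0 ?p x = Y" unfolding trivial_fibration_def by blast
    then show "\<exists>f. f \<in> hom1 C J Y" using ob[of "fst x" "snd x"] p0[of "fst x" "snd x"] by auto
    fix b c assume b: "b \<in> hom1 C J Y" and c: "c \<in> hom1 C J Y"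
    let ?j = "(J, Id1 C J)"
    have j: "?j \<in> Cell0 ?L" using J by (simp add: ob hom1_def)
    have ex: "\<exists>m\<in>hom1 ?L ?j (Y, c). S1Mor m = b \<and> S1Cell m \<in> hom2 C c b \<and> invertible2 C (S1Cell m)"
      if b: "b \<in> hom1 C J Y" and c: "c \<in> hom1 C J Y" for b c
    proof -
      have c': "(Y, c) \<in> Cell0 ?L" using c Y by (simp add: ob)
      with T b j have "\<exists>m\<in>hom1 ?L ?j (Y, c). P1 ?p m = b"
        unfolding trivial_fibration_def using p0[OF j] p0[OF c'] by metis
      then obtain m where m: "m \<in> hom1 ?L ?j (Y, c)" "S1Mor m = b" using p1 by metis
      moreover have "b \<odot> Id1 C J = b" using b by (simp add: hom1_def)
      ultimately show ?thesis by (metis mor)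
    qed
    from ex[OF b c] obtain m where m: "m \<in> hom1 ?L ?j (Y, c)" "S1Cell m \<in> hom2 C c b" "invertible2 C (S1Cell m)"
      by blast
    from ex[OF c b] obtain n where n: "n \<in> hom1 ?L ?j (Y, b)" "S1Mor n = c" by blast
    let ?m = "\<lparr>S1Src = ?j, S1Trg = (Y, b), S1Mor = b, S1Cell = Id2 C b\<rparr>"
    have m': "?m \<in> hom1 ?L ?j (Y, b)"
      using b Y j hom1D[OF b] unfolding mor by (simp add: ob hom2_def)
    show "\<exists>!\<beta>. \<beta> \<in> hom2 C b c"
    proof (rule ex1I)
      show "vinv (S1Cell m) \<in> hom2 C b c" using m by (simp add: hom2_def)
      have eq: "\<beta> = S1Cell n" if \<beta>: "\<beta> \<in> hom2 C b c" for \<beta>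
      proof -
        have jb: "(Y, b) \<in> Cell0 ?L" using b Y by (simp add: ob)
        from T j jb m' n(1) have "bij_betw (P2 ?p) (hom2 ?L ?m n) (hom2 C (P1 ?p ?m) (P1 ?p n))"
          unfolding trivial_fibration_def by blast
        moreover have "\<beta> \<in> hom2 C (P1 ?p ?m) (P1 ?p n)" using \<beta> p1[OF m'] p1[OF n(1)] n(2) by simp
        ultimately have "\<beta> \<in> P2 ?p ` hom2 ?L ?m n" unfolding bij_betw_def by blast
        then obtain x where x: "x \<in> hom2 ?L ?m n" "P2 ?p x = \<beta>" by blast
        with cell[OF m' n(1)] p2[OF x(1)] have "(\<beta> \<star> Id2 C (Id1 C J)) \<bullet> Id2 C b = S1Cell n" by auto
        then show ?thesis using \<beta> b by (simp add: hom1_def hom2_def)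
      qed
      fix \<beta> assume "\<beta> \<in> hom2 C b c"
      with eq \<open>vinv (S1Cell m) \<in> hom2 C b c\<close> show "\<beta> = vinv (S1Cell m)" by metis
    qed
  next
    assume H: "\<forall>Y\<in>Cell0 C. (\<exists>f. f \<in> hom1 C J Y) \<and> (\<forall>b\<in>hom1 C J Y. \<forall>c\<in>hom1 C J Y. \<exists>!\<beta>. \<beta> \<in> hom2 C b c)"
    then have ex: "\<exists>\<beta>. \<beta> \<in> hom2 C b c" and uniq: "\<beta> \<in> hom2 C b c \<Longrightarrow> \<beta>' \<in> hom2 C b c \<Longrightarrow> \<beta> = \<beta>'"
      if "Y \<in> Cell0 C" "b \<in> hom1 C J Y" "c \<in> hom1 C J Y" for Y b c \<beta> \<beta>'
      using that by blast+
    have "trivial_fibration ?L C ?p"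
      unfolding trivial_fibration_def
    proof (intro conjI ballI)
      fix Y assume Y: "Y \<in> Cell0 C"
      with H obtain f where "f \<in> hom1 C J Y" by blast
      then show "\<exists>x\<in>Cell0 ?L. P0 ?p x = Y" using Y ob p0 by blast
    next
      fix x y b assume x: "x \<in> Cell0 ?L" and y: "y \<in> Cell0 ?L" and "b \<in> hom1 C (P0 ?p x) (P0 ?p y)"
      moreover obtain Y f Z g where xy: "x = (Y, f)" "y = (Z, g)" by fastforce
      ultimately have b: "b \<in> hom1 C Y Z" and f: "f \<in> hom1 C J Y" and g: "g \<in> hom1 C J Z" and Z: "Z \<in> Cell0 C"
        using p0 ob by auto
      have bf: "b \<odot> f \<in> hom1 C J Z" using b f by (auto simp: hom1_def)
      from ex[OF Z g bf] ex[OF Z bf g] obtain \<psi> \<psi>' where p: "\<psi> \<in> hom2 C g (b \<odot> f)" "\<psi>' \<in> hom2 C (b \<odot> f) g" by blast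
      have "\<psi>' \<bullet> \<psi> = Id2 C g" by (rule uniq[OF Z g g]) (use p hom1D[OF g] in \<open>auto simp: hom2_def\<close>)
      moreover have "\<psi> \<bullet> \<psi>' = Id2 C (b \<odot> f)" by (rule uniq[OF Z bf bf]) (use p hom1D[OF bf] in \<open>auto simp: hom2_def\<close>)
      ultimately have "invertible2 C \<psi>" using p by (intro invertible2I)
      then have m: "\<lparr>S1Src = x, S1Trg = y, S1Mor = b, S1Cell = \<psi>\<rparr> \<in> hom1 ?L x y"
        using x y b p unfolding xy by (simp add: mor)
      from p1[OF m] m show "\<exists>m\<in>hom1 ?L x y. P1 ?p m = b" by auto
    next
      fix x y m n assume x: "x \<in> Cell0 ?L" and y: "y \<in> Cell0 ?L" and m: "m \<in> hom1 ?L x y" and n: "n \<in> hom1 ?L x y"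
      obtain Y f Z g where xy: "x = (Y, f)" "y = (Z, g)" by fastforce
      note m = m[unfolded xy] and n = n[unfolded xy]
      from m n have M: "S1Mor m \<in> hom1 C Y Z" "S1Cell m \<in> hom2 C g (S1Mor m \<odot> f)" "S1Mor n \<in> hom1 C Y Z"
        "S1Cell n \<in> hom2 C g (S1Mor n \<odot> f)" and f: "f \<in> hom1 C J Y" and g: "g \<in> hom1 C J Z" and Z: "Z \<in> Cell0 C"
        by (auto simp: mor ob)
      have nf: "S1Mor n \<odot> f \<in> hom1 C J Z" using M f by (auto simp: hom1_def)
      have "(\<beta> \<star> Id2 C f) \<bullet> S1Cell m = S1Cell n" if b: "\<beta> \<in> hom2 C (S1Mor m) (S1Mor n)" for \<beta>
        by (rule uniq[OF Z g nf _ M(4)]) (use b M f in \<open>auto simp: hom1_def hom2_def\<close>)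
      then have *: "\<lparr>S2Dom = m, S2Cod = n, S2Cell = \<beta>\<rparr> \<in> hom2 ?L m n" if b: "\<beta> \<in> hom2 C (S1Mor m) (S1Mor n)" for \<beta>
        using that cell[OF m n] by simp
      have cx: "P2 ?p x = S2Cell x" "S2Dom x = m" "S2Cod x = n" "S2Cell x \<in> hom2 C (S1Mor m) (S1Mor n)"
        if "x \<in> hom2 ?L m n" for x
        using p2[OF that] cell[OF m n, of x] that by simp_all
      show "bij_betw (P2 ?p) (hom2 ?L m n) (hom2 C (P1 ?p m) (P1 ?p n))"
        unfolding p1[OF m] p1[OF n]
        by (rule bij_betwI[where g = "\<lambda>\<beta>. \<lparr>S2Dom = m, S2Cod = n, S2Cell = \<beta>\<rparr>"]) (use * cx in auto)
    qed
    with J show "bi_initial C J" by (simp add: bi_initial_def)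
  qed
qed

section \<open>Bi-initial objects of a pseudo-slice and universal objects\<close>

lemma hom_cat_simps [simp]:
  "Obj (hom_cat C X Y) = hom1 C X Y" "Dom (hom_cat C X Y) = Dom2 C" "Cod (hom_cat C X Y) = Cod2 C"
  "Ide (hom_cat C X Y) = Id2 C" "Cmp (hom_cat C X Y) = VCmp C"
  "\<alpha> \<in> Arr (hom_cat C X Y) \<longleftrightarrow> \<alpha> \<in> Cell2 C \<and> Dom2 C \<alpha> \<in> hom1 C X Y \<and> Cod2 C \<alpha> \<in> hom1 C X Y"
  by (auto simp: hom_cat_def)

lemma hom_in_hom_cat:
  "\<lbrakk>f \<in> hom1 C X Y; g \<in> hom1 C X Y\<rbrakk> \<Longrightarrow> hom_in (hom_cat C X Y) f g = hom2 C f g"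
  by (auto simp: hom_in_def hom2_def)

lemma is_iso_hom_cat:
  assumes "f \<in> hom1 C X Y" "g \<in> hom1 C X Y" "\<alpha> \<in> hom2 C f g"
  shows "is_iso (hom_cat C X Y) \<alpha> \<longleftrightarrow> invertible2 C \<alpha>"
  using assms by (auto simp: is_iso_def invertible2_def vert_cat_def hom2_def)

text \<open>For \<open>C(-, F)\<close> in the place of \<open>F\<close>, this is the functor that a weighted bi-limit makes an adjoint
  equivalence.\<close>

abbreviation comparison where
  "comparison A B F X l Y \<equiv> comp_func (pre_func B l (P0 F Y)) (local_func A B F X Y)"

context normal_pseudofunctor
begin

context
  fixes X l J
  assumes X: "X \<in> Cell0 A" and l: "l \<in> hom1 B J (P0 F X)"
begin

lemma l_simps [simp]: "l \<in> Cell1 B" "Src B l = J" "Trg B l = P0 F X" "J \<in> Cell0 B" "X \<in> Cell0 A"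
  using l X B.Cell1_simps(1)[of l] by (auto simp: hom1_def)

lemma comparison_simps:
  "b \<in> hom1 A X Y \<Longrightarrow> FObj (comparison A B F X l Y) b = P1 F b \<odot>\<^bsub>B\<^esub> l"
  "\<lbrakk>\<beta> \<in> hom2 A b c; b \<in> hom1 A X Y; c \<in> hom1 A X Y\<rbrakk>
     \<Longrightarrow> FArr (comparison A B F X l Y) \<beta> = P2 F \<beta> \<star>\<^bsub>B\<^esub> Id2 B l"
  by (auto simp: local_func_def pre_func_def hom1_def hom2_def)

lemma is_functor_comparison:
  assumes Y: "Y \<in> Cell0 A"
  shows "is_functor (hom_cat A X Y) (hom_cat B J (P0 F Y)) (comparison A B F X l Y)"
proof (rule is_functor_comp)
  show "is_functor (hom_cat A X Y) (hom_cat B (P0 F X) (P0 F Y)) (local_func A B F X Y)"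
    by (rule is_functorI)
      (use Y in \<open>auto simp: local_func_def hom1_def P2_VCmp intro: A.category_hom_cat B.category_hom_cat\<close>)
  show "is_functor (hom_cat B (P0 F X) (P0 F Y)) (hom_cat B J (P0 F Y)) (pre_func B l (P0 F Y))"
    by (rule is_functorI)
      (use Y in \<open>auto simp: pre_func_def hom1_def intro: B.category_hom_cat\<close>)
qed

text \<open>
  A 1-cell \<open>(X, l) \<rightarrow> (Y, f)\<close> of the slice is a 1-cell \<open>b : X \<rightarrow> Y\<close> with an isomorphism from \<open>f\<close> to the value
  of the comparison functor at \<open>b\<close>. So the slice only sees the \<^emph>\<open>isomorphisms\<close> between such values:
  bi-initiality is essential surjectivity of the comparison functors, together with unique lifting of
  invertible 2-cells.
\<close>

lemma bi_initial_slice_iff: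
  "bi_initial (pseudo_slice A B F J) (X, l) \<longleftrightarrow> (\<forall>Y\<in>Cell0 A.
     essentially_surjective (hom_cat A X Y) (hom_cat B J (P0 F Y)) (comparison A B F X l Y) \<and>
     (\<forall>b\<in>hom1 A X Y. \<forall>c\<in>hom1 A X Y. \<forall>\<chi>\<in>hom2 B (P1 F b \<odot>\<^bsub>B\<^esub> l) (P1 F c \<odot>\<^bsub>B\<^esub> l).
        invertible2 B \<chi> \<longrightarrow> (\<exists>!\<beta>. \<beta> \<in> hom2 A b c \<and> P2 F \<beta> \<star>\<^bsub>B\<^esub> Id2 B l = \<chi>)))"
  (is "_ \<longleftrightarrow> (\<forall>Y\<in>_. ?es Y \<and> ?lift Y)")
proof -
  let ?S = "pseudo_slice A B F J"
  interpret S: two_category ?S by (rule two_category_slice)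
  have ob: "(Y, f) \<in> Cell0 ?S \<longleftrightarrow> Y \<in> Cell0 A \<and> f \<in> hom1 B J (P0 F Y)" for Y f
    by (simp add: slice_simps)
  have Xl: "(X, l) \<in> Cell0 ?S" using X l ob by simp
  have Kb: "P1 F b \<odot>\<^bsub>B\<^esub> l \<in> hom1 B J (P0 F Y)" if "b \<in> hom1 A X Y" for b Y
    using that by (auto simp: hom1_def)
  let ?C = "\<lambda>Y f. (\<exists>m. m \<in> hom1 ?S (X, l) (Y, f)) \<and>
    (\<forall>m\<in>hom1 ?S (X, l) (Y, f). \<forall>n\<in>hom1 ?S (X, l) (Y, f). \<exists>!x. x \<in> hom2 ?S m n)"
  have bi: "bi_initial ?S (X, l) \<longleftrightarrow> (\<forall>Y\<in>Cell0 A. \<forall>f\<in>hom1 B J (P0 F Y). ?C Y f)"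
    unfolding S.bi_initial_iff[OF Xl] Ball_def split_paired_All ob by blast
  have es: "?es Y \<longleftrightarrow> (\<forall>f\<in>hom1 B J (P0 F Y). \<exists>m. m \<in> hom1 ?S (X, l) (Y, f))" if Y: "Y \<in> Cell0 A" for Y
  proof -
    have "(\<exists>m. m \<in> hom1 ?S (X, l) (Y, f)) \<longleftrightarrow>
        (\<exists>b\<in>hom1 A X Y. \<exists>g. g \<in> hom_in (hom_cat B J (P0 F Y)) (FObj (comparison A B F X l Y) b) f \<and>
           is_iso (hom_cat B J (P0 F Y)) g)" if f: "f \<in> hom1 B J (P0 F Y)" for f
    proof -
      have "(\<exists>m. m \<in> hom1 ?S (X, l) (Y, f)) \<longleftrightarrow>
          (\<exists>b\<in>hom1 A X Y. \<exists>\<psi>\<in>hom2 B f (P1 F b \<odot>\<^bsub>B\<^esub> l). invertible2 B \<psi>)"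
      proof
        assume "\<exists>b\<in>hom1 A X Y. \<exists>\<psi>\<in>hom2 B f (P1 F b \<odot>\<^bsub>B\<^esub> l). invertible2 B \<psi>"
        then obtain b \<psi> where "b \<in> hom1 A X Y" "\<psi> \<in> hom2 B f (P1 F b \<odot>\<^bsub>B\<^esub> l)" "invertible2 B \<psi>" by blast
        then have "\<lparr>S1Src = (X, l), S1Trg = (Y, f), S1Mor = b, S1Cell = \<psi>\<rparr> \<in> hom1 ?S (X, l) (Y, f)"
          using Y f Xl by (simp add: slice_hom1_iff ob)
        then show "\<exists>m. m \<in> hom1 ?S (X, l) (Y, f)" ..
      qed (auto simp: slice_hom1_iff)
      also have "\<dots> \<longleftrightarrow> (\<exists>b\<in>hom1 A X Y. \<exists>g\<in>hom2 B (P1 F b \<odot>\<^bsub>B\<^esub> l) f. invertible2 B g)"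
      proof -
        have "B.vinv \<psi> \<in> hom2 B k j" if "\<psi> \<in> hom2 B j k" "invertible2 B \<psi>" for \<psi> j k
          using that by (auto simp: hom2_def)
        then show ?thesis using B.vinv_simps(7) by metis
      qed
      also have "\<dots> \<longleftrightarrow> (\<exists>b\<in>hom1 A X Y. \<exists>g. g \<in> hom_in (hom_cat B J (P0 F Y)) (FObj (comparison A B F X l Y) b) f \<and>
           is_iso (hom_cat B J (P0 F Y)) g)"
        using is_iso_hom_cat[OF Kb f] f Kb
        by (intro bex_cong refl) (auto simp: comparison_simps hom_in_hom_cat)
      finally show ?thesis .
    qed
    then show ?thesis unfolding essentially_surjective_def by simp
  qed
  have lift: "?lift Y \<longleftrightarrow> (\<forall>f\<in>hom1 B J (P0 F Y). \<forall>m\<in>hom1 ?S (X, l) (Y, f). \<forall>n\<in>hom1 ?S (X, l) (Y, f).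
      \<exists>!x. x \<in> hom2 ?S m n)" if Y: "Y \<in> Cell0 A" for Y
  proof (intro iffI ballI impI)
    fix f m n assume L: "?lift Y" and f: "f \<in> hom1 B J (P0 F Y)"
      and m: "m \<in> hom1 ?S (X, l) (Y, f)" and n: "n \<in> hom1 ?S (X, l) (Y, f)"
    let ?b = "S1Mor m" and ?c = "S1Mor n" and ?\<psi> = "S1Cell m" and ?\<phi> = "S1Cell n"
    note mn = m[unfolded slice_hom1_iff] n[unfolded slice_hom1_iff]
    have [simp]: "?\<psi> \<in> Cell2 B" "?\<phi> \<in> Cell2 B" "?b \<in> Cell1 A" "Src A ?b = X" "Trg A ?b = Y" "?c \<in> Cell1 A" "Src A ?c = X" "Trg A ?c = Y"
      and \<psi>\<phi>: "Dom2 B ?\<psi> = f" "Cod2 B ?\<psi> = P1 F ?b \<odot>\<^bsub>B\<^esub> l" "invertible2 B ?\<psi>"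
      "Dom2 B ?\<phi> = f" "Cod2 B ?\<phi> = P1 F ?c \<odot>\<^bsub>B\<^esub> l" "invertible2 B ?\<phi>"
      using mn by (auto simp: hom1_def hom2_def)
    let ?\<chi> = "?\<phi> \<bullet>\<^bsub>B\<^esub> B.vinv ?\<psi>"
    have "?\<chi> \<in> hom2 B (P1 F ?b \<odot>\<^bsub>B\<^esub> l) (P1 F ?c \<odot>\<^bsub>B\<^esub> l)" "invertible2 B ?\<chi>"
      using \<psi>\<phi> by (simp_all add: hom2_def)
    then have ex: "\<exists>!\<beta>. \<beta> \<in> hom2 A ?b ?c \<and> P2 F \<beta> \<star>\<^bsub>B\<^esub> Id2 B l = ?\<chi>" using L mn by blast
    have eq: "P2 F \<beta> \<star>\<^bsub>B\<^esub> Id2 B l = ?\<chi> \<longleftrightarrow> (P2 F \<beta> \<star>\<^bsub>B\<^esub> Id2 B l) \<bullet>\<^bsub>B\<^esub> ?\<psi> = ?\<phi>"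
      if "\<beta> \<in> hom2 A ?b ?c" for \<beta>
    proof
      assume e: "(P2 F \<beta> \<star>\<^bsub>B\<^esub> Id2 B l) \<bullet>\<^bsub>B\<^esub> ?\<psi> = ?\<phi>"
      show "P2 F \<beta> \<star>\<^bsub>B\<^esub> Id2 B l = ?\<chi>"
        unfolding e[symmetric] using that \<psi>\<phi> by (simp add: hom2_def)
    qed (use that \<psi>\<phi> in \<open>simp add: hom2_def\<close>)
    from ex obtain \<beta> where \<beta>: "\<beta> \<in> hom2 A ?b ?c" "P2 F \<beta> \<star>\<^bsub>B\<^esub> Id2 B l = ?\<chi>"
      and u: "\<And>\<beta>'. \<beta>' \<in> hom2 A ?b ?c \<Longrightarrow> P2 F \<beta>' \<star>\<^bsub>B\<^esub> Id2 B l = ?\<chi> \<Longrightarrow> \<beta>' = \<beta>" by blast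
    show "\<exists>!x. x \<in> hom2 ?S m n"
    proof (rule ex1I)
      show "\<lparr>S2Dom = m, S2Cod = n, S2Cell = \<beta>\<rparr> \<in> hom2 ?S m n"
        unfolding slice_hom2_iff[OF m n] using \<beta> eq by simp
      fix x assume "x \<in> hom2 ?S m n"
      then show "x = \<lparr>S2Dom = m, S2Cod = n, S2Cell = \<beta>\<rparr>"
        unfolding slice_hom2_iff[OF m n] using u eq by (intro slice2.equality) auto
    qed
  next
    fix b c \<chi> assume H: "\<forall>f\<in>hom1 B J (P0 F Y). \<forall>m\<in>hom1 ?S (X, l) (Y, f). \<forall>n\<in>hom1 ?S (X, l) (Y, f).
        \<exists>!x. x \<in> hom2 ?S m n"
      and b: "b \<in> hom1 A X Y" and c: "c \<in> hom1 A X Y"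
      and \<chi>: "\<chi> \<in> hom2 B (P1 F b \<odot>\<^bsub>B\<^esub> l) (P1 F c \<odot>\<^bsub>B\<^esub> l)" "invertible2 B \<chi>"
    let ?f = "P1 F b \<odot>\<^bsub>B\<^esub> l"
    let ?m = "\<lparr>S1Src = (X, l), S1Trg = (Y, ?f), S1Mor = b, S1Cell = Id2 B ?f\<rparr>"
    let ?n = "\<lparr>S1Src = (X, l), S1Trg = (Y, ?f), S1Mor = c, S1Cell = \<chi>\<rparr>"
    have m: "?m \<in> hom1 ?S (X, l) (Y, ?f)" and n: "?n \<in> hom1 ?S (X, l) (Y, ?f)"
      using Xl Y b c \<chi> Kb[OF b] hom1D[OF Kb[OF b]] by (simp_all add: slice_hom1_iff ob hom2_def)
    have "\<exists>!x. x \<in> hom2 ?S ?m ?n" using H Kb[OF b] m n by blast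
    then obtain x where x: "x \<in> hom2 ?S ?m ?n" and u: "\<And>x'. x' \<in> hom2 ?S ?m ?n \<Longrightarrow> x' = x" by blast
    have eq: "(P2 F \<beta> \<star>\<^bsub>B\<^esub> Id2 B l) \<bullet>\<^bsub>B\<^esub> Id2 B ?f = P2 F \<beta> \<star>\<^bsub>B\<^esub> Id2 B l" if "\<beta> \<in> hom2 A b c" for \<beta>
      using that hom1D[OF b] by (simp add: hom2_def)
    show "\<exists>!\<beta>. \<beta> \<in> hom2 A b c \<and> P2 F \<beta> \<star>\<^bsub>B\<^esub> Id2 B l = \<chi>"
    proof (rule ex1I)
      show "S2Cell x \<in> hom2 A b c \<and> P2 F (S2Cell x) \<star>\<^bsub>B\<^esub> Id2 B l = \<chi>"
        using x unfolding slice_hom2_iff[OF m n] using eq by auto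
      fix \<beta> assume \<beta>: "\<beta> \<in> hom2 A b c \<and> P2 F \<beta> \<star>\<^bsub>B\<^esub> Id2 B l = \<chi>"
      have "\<lparr>S2Dom = ?m, S2Cod = ?n, S2Cell = \<beta>\<rparr> = x"
        using \<beta> eq[OF conjunct1[OF \<beta>]] by (intro u) (simp add: slice_hom2_iff[OF m n])
      then show "\<beta> = S2Cell x" by auto
    qed
  qed
  show ?thesis
    unfolding bi by (intro ball_cong refl) (simp only: es lift ball_conj_distrib)
qed

text \<open>
  For strict \<open>F\<close>, suppose every \<open>Y\<close> has an object \<open>T\<close> of arrows: a 2-cell \<open>\<tau> : p \<Rightarrow> q : T \<rightarrow> Y\<close> through which
  all 2-cells \<open>b \<Rightarrow> c : X \<rightarrow> Y\<close> factor, and such that 1-cells \<open>J \<rightarrow> F T\<close> are the same as 2-cells between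
  1-cells \<open>J \<rightarrow> F Y\<close>. Then bi-initiality also controls 2-cells that are not invertible, because such a 2-cell
  is a 1-cell into \<open>F T\<close>.

  To lift \<open>\<mu> : F b \<cdot> l \<Rightarrow> F c \<cdot> l\<close>, approximate the corresponding 1-cell \<open>f : J \<rightarrow> F T\<close> by some \<open>\<psi> : f \<cong> F h \<cdot> l\<close>,
  lift the isomorphisms \<open>F p \<star> \<psi>\<close> and \<open>F q \<star> \<psi>\<close> along the comparison functor, and conjugate \<open>\<tau> \<star> h\<close> by
  them. If \<open>\<tau> \<star> h\<close> and \<open>\<tau> \<star> h'\<close> have the same image, then \<open>F h \<cdot> l = F h' \<cdot> l\<close>; lifting this identity gives
  \<open>\<gamma> : h \<Rightarrow> h'\<close> with \<open>p \<star> \<gamma>\<close> and \<open>q \<star> \<gamma>\<close> identities, and the exchange law identifies \<open>\<tau> \<star> h\<close> with \<open>\<tau> \<star> h'\<close>.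
\<close>

lemma universal_iff_bi_initial:
  assumes strict: "\<And>a a'. \<lbrakk>a \<in> Cell1 A; a' \<in> Cell1 A; Trg A a = Src A a'\<rbrakk>
        \<Longrightarrow> Phi F a a' = Id2 B (P1 F (a' \<odot>\<^bsub>A\<^esub> a))"
    and arrows: "\<And>Y. Y \<in> Cell0 A \<Longrightarrow> \<exists>T p q \<tau>. T \<in> Cell0 A \<and> p \<in> hom1 A T Y \<and> q \<in> hom1 A T Y \<and>
        \<tau> \<in> hom2 A p q \<and>
        (\<forall>b\<in>hom1 A X Y. \<forall>c\<in>hom1 A X Y. \<forall>\<beta>\<in>hom2 A b c. \<exists>h\<in>hom1 A X T. \<tau> \<star>\<^bsub>A\<^esub> Id2 A h = \<beta>) \<and>
        (\<forall>f\<in>hom1 B J (P0 F Y). \<forall>g\<in>hom1 B J (P0 F Y). \<forall>\<mu>\<in>hom2 B f g.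
           \<exists>!k. k \<in> hom1 B J (P0 F T) \<and> P2 F \<tau> \<star>\<^bsub>B\<^esub> Id2 B k = \<mu>)"
  shows "(\<forall>Y\<in>Cell0 A. adjoint_equivalence (hom_cat A X Y) (hom_cat B J (P0 F Y)) (comparison A B F X l Y))
    \<longleftrightarrow> bi_initial (pseudo_slice A B F J) (X, l)"
proof -
  have P1s: "P1 F (a' \<odot>\<^bsub>A\<^esub> a) = P1 F a' \<odot>\<^bsub>B\<^esub> P1 F a"
    if "a \<in> Cell1 A" "a' \<in> Cell1 A" "Trg A a = Src A a'" for a a'
    using Phi_simps(2)[OF that] strict[OF that] that by simp
  have P2s: "P2 F (\<beta> \<star>\<^bsub>A\<^esub> \<alpha>) = P2 F \<beta> \<star>\<^bsub>B\<^esub> P2 F \<alpha>"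
    if "\<alpha> \<in> Cell2 A" "\<beta> \<in> Cell2 A" "Trg A (Dom2 A \<alpha>) = Src A (Dom2 A \<beta>)" for \<alpha> \<beta>
    using Phi_natural[of \<alpha> "Dom2 A \<alpha>" "Cod2 A \<alpha>" \<beta> "Dom2 A \<beta>" "Cod2 A \<beta>"] that
    by (simp add: strict hom2_def P1s)
  have Kb: "P1 F b \<odot>\<^bsub>B\<^esub> l \<in> hom1 B J (P0 F Y)" if "b \<in> hom1 A X Y" for b Y
    using that by (auto simp: hom1_def)
  have ff_iff: "fully_faithful (hom_cat A X Y) (hom_cat B J (P0 F Y)) (comparison A B F X l Y) \<longleftrightarrow>
      (\<forall>b\<in>hom1 A X Y. \<forall>c\<in>hom1 A X Y. \<forall>\<chi>\<in>hom2 B (P1 F b \<odot>\<^bsub>B\<^esub> l) (P1 F c \<odot>\<^bsub>B\<^esub> l).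
        \<exists>!\<beta>. \<beta> \<in> hom2 A b c \<and> P2 F \<beta> \<star>\<^bsub>B\<^esub> Id2 B l = \<chi>)" if Y: "Y \<in> Cell0 A" for Y
    unfolding fully_faithful_def hom_cat_simps
    by (intro ball_cong refl)
      (auto simp: comparison_simps hom_in_hom_cat Kb cong: conj_cong)
  show ?thesis
  proof
    assume "\<forall>Y\<in>Cell0 A. adjoint_equivalence (hom_cat A X Y) (hom_cat B J (P0 F Y)) (comparison A B F X l Y)"
    then show "bi_initial (pseudo_slice A B F J) (X, l)"
      unfolding bi_initial_slice_iff using adjoint_equivalence_imp ff_iff by blast
  next
    assume "bi_initial (pseudo_slice A B F J) (X, l)"
    then have es: "\<And>Y. Y \<in> Cell0 A \<Longrightarrow>
        essentially_surjective (hom_cat A X Y) (hom_cat B J (P0 F Y)) (comparison A B F X l Y)"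
      and lift: "\<And>Y b c \<chi>. \<lbrakk>Y \<in> Cell0 A; b \<in> hom1 A X Y; c \<in> hom1 A X Y;
          \<chi> \<in> hom2 B (P1 F b \<odot>\<^bsub>B\<^esub> l) (P1 F c \<odot>\<^bsub>B\<^esub> l); invertible2 B \<chi>\<rbrakk>
          \<Longrightarrow> \<exists>!\<beta>. \<beta> \<in> hom2 A b c \<and> P2 F \<beta> \<star>\<^bsub>B\<^esub> Id2 B l = \<chi>"
      unfolding bi_initial_slice_iff by blast+
    have ff: "\<exists>!\<beta>. \<beta> \<in> hom2 A b c \<and> P2 F \<beta> \<star>\<^bsub>B\<^esub> Id2 B l = \<mu>"
      if Y: "Y \<in> Cell0 A" and b: "b \<in> hom1 A X Y" and c: "c \<in> hom1 A X Y"
        and \<mu>: "\<mu> \<in> hom2 B (P1 F b \<odot>\<^bsub>B\<^esub> l) (P1 F c \<odot>\<^bsub>B\<^esub> l)" for Y b c \<mu>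
    proof -
      from arrows[OF Y] obtain T p q \<tau> where T: "T \<in> Cell0 A" and p: "p \<in> hom1 A T Y" and q: "q \<in> hom1 A T Y"
        and \<tau>: "\<tau> \<in> hom2 A p q"
        and fac: "\<forall>b\<in>hom1 A X Y. \<forall>c\<in>hom1 A X Y. \<forall>\<beta>\<in>hom2 A b c. \<exists>h\<in>hom1 A X T. \<tau> \<star>\<^bsub>A\<^esub> Id2 A h = \<beta>"
        and "\<forall>f\<in>hom1 B J (P0 F Y). \<forall>g\<in>hom1 B J (P0 F Y). \<forall>\<mu>\<in>hom2 B f g.
            \<exists>!k. k \<in> hom1 B J (P0 F T) \<and> P2 F \<tau> \<star>\<^bsub>B\<^esub> Id2 B k = \<mu>"
        by (elim exE conjE) (rule that)
      then have cot: "\<exists>!k. k \<in> hom1 B J (P0 F T) \<and> P2 F \<tau> \<star>\<^bsub>B\<^esub> Id2 B k = \<mu>"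
        using \<mu> Kb[OF b] Kb[OF c] by blast
      note [simp] = hom1D[OF p] hom1D[OF q] hom2D[OF \<tau>] hom1D[OF b] hom1D[OF c] Y T hom2D[OF \<mu>]
      show ?thesis
      proof (rule ex_ex1I)
        from cot obtain f where f: "f \<in> hom1 B J (P0 F T)"
          and f\<mu>: "P2 F \<tau> \<star>\<^bsub>B\<^esub> Id2 B f = \<mu>" by blast
        note [simp] = hom1D[OF f]
        have pf: "P1 F p \<odot>\<^bsub>B\<^esub> f = P1 F b \<odot>\<^bsub>B\<^esub> l" and qf: "P1 F q \<odot>\<^bsub>B\<^esub> f = P1 F c \<odot>\<^bsub>B\<^esub> l"
          using hom2D(2,3)[OF \<mu>] unfolding f\<mu>[symmetric] by simp_all
        from es[OF T] f obtain h \<phi> where h: "h \<in> hom1 A X T"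
          and "\<phi> \<in> hom_in (hom_cat B J (P0 F T)) (FObj (comparison A B F X l T) h) f"
          and "is_iso (hom_cat B J (P0 F T)) \<phi>"
          unfolding essentially_surjective_def hom_cat_simps by blast
        then have \<phi>: "\<phi> \<in> hom2 B (P1 F h \<odot>\<^bsub>B\<^esub> l) f" "invertible2 B \<phi>"
          using f Kb[OF h] by (auto simp: comparison_simps hom_in_hom_cat is_iso_hom_cat)
        note [simp] = hom1D[OF h] hom2D[OF \<phi>(1)] \<phi>(2)
        let ?\<psi> = "B.vinv \<phi>"
        have ph: "p \<odot>\<^bsub>A\<^esub> h \<in> hom1 A X Y" "q \<odot>\<^bsub>A\<^esub> h \<in> hom1 A X Y" by (simp_all add: hom1_def)
        have "Id2 B (P1 F p) \<star>\<^bsub>B\<^esub> ?\<psi> \<in> hom2 B (P1 F b \<odot>\<^bsub>B\<^esub> l) (P1 F (p \<odot>\<^bsub>A\<^esub> h) \<odot>\<^bsub>B\<^esub> l)"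
          by (simp add: hom2_def pf P1s)
        then obtain \<alpha> where \<alpha>: "\<alpha> \<in> hom2 A b (p \<odot>\<^bsub>A\<^esub> h)" "P2 F \<alpha> \<star>\<^bsub>B\<^esub> Id2 B l = Id2 B (P1 F p) \<star>\<^bsub>B\<^esub> ?\<psi>"
          using lift[OF Y b ph(1), of "Id2 B (P1 F p) \<star>\<^bsub>B\<^esub> ?\<psi>"] by auto
        have "Id2 B (P1 F q) \<star>\<^bsub>B\<^esub> \<phi> \<in> hom2 B (P1 F (q \<odot>\<^bsub>A\<^esub> h) \<odot>\<^bsub>B\<^esub> l) (P1 F c \<odot>\<^bsub>B\<^esub> l)"
          by (simp add: hom2_def qf P1s)
        then obtain \<alpha>' where \<alpha>': "\<alpha>' \<in> hom2 A (q \<odot>\<^bsub>A\<^esub> h) c" "P2 F \<alpha>' \<star>\<^bsub>B\<^esub> Id2 B l = Id2 B (P1 F q) \<star>\<^bsub>B\<^esub> \<phi>"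
          using lift[OF Y ph(2) c, of "Id2 B (P1 F q) \<star>\<^bsub>B\<^esub> \<phi>"] by auto
        note [simp] = hom2D[OF \<alpha>(1)] hom2D[OF \<alpha>'(1)]
        let ?\<beta> = "\<alpha>' \<bullet>\<^bsub>A\<^esub> ((\<tau> \<star>\<^bsub>A\<^esub> Id2 A h) \<bullet>\<^bsub>A\<^esub> \<alpha>)"
        have "P2 F ?\<beta> \<star>\<^bsub>B\<^esub> Id2 B l = (P2 F \<alpha>' \<star>\<^bsub>B\<^esub> Id2 B l) \<bullet>\<^bsub>B\<^esub>
            ((P2 F \<tau> \<star>\<^bsub>B\<^esub> Id2 B (P1 F h \<odot>\<^bsub>B\<^esub> l)) \<bullet>\<^bsub>B\<^esub> (P2 F \<alpha> \<star>\<^bsub>B\<^esub> Id2 B l))"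
          by (simp add: P2_VCmp P2s P1s)
        also have "\<dots> = (Id2 B (P1 F q) \<star>\<^bsub>B\<^esub> \<phi>) \<bullet>\<^bsub>B\<^esub>
            ((P2 F \<tau> \<star>\<^bsub>B\<^esub> Id2 B (P1 F h \<odot>\<^bsub>B\<^esub> l)) \<bullet>\<^bsub>B\<^esub> (Id2 B (P1 F p) \<star>\<^bsub>B\<^esub> ?\<psi>))"
          by (simp only: \<alpha>(2) \<alpha>'(2))
        also have "(P2 F \<tau> \<star>\<^bsub>B\<^esub> Id2 B (P1 F h \<odot>\<^bsub>B\<^esub> l)) \<bullet>\<^bsub>B\<^esub> (Id2 B (P1 F p) \<star>\<^bsub>B\<^esub> ?\<psi>)
            = (Id2 B (P1 F q) \<star>\<^bsub>B\<^esub> ?\<psi>) \<bullet>\<^bsub>B\<^esub> (P2 F \<tau> \<star>\<^bsub>B\<^esub> Id2 B f)"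
          by (rule B.exchange) (simp_all add: hom2_def)
        also have "(Id2 B (P1 F q) \<star>\<^bsub>B\<^esub> \<phi>) \<bullet>\<^bsub>B\<^esub> ((Id2 B (P1 F q) \<star>\<^bsub>B\<^esub> ?\<psi>) \<bullet>\<^bsub>B\<^esub> (P2 F \<tau> \<star>\<^bsub>B\<^esub> Id2 B f))
            = (Id2 B (P1 F q) \<star>\<^bsub>B\<^esub> (\<phi> \<bullet>\<^bsub>B\<^esub> ?\<psi>)) \<bullet>\<^bsub>B\<^esub> (P2 F \<tau> \<star>\<^bsub>B\<^esub> Id2 B f)"
          by (subst B.whisker_simps(1)) simp_all
        also have "\<dots> = \<mu>" using f\<mu> qf by simp
        finally show "\<exists>\<beta>. \<beta> \<in> hom2 A b c \<and> P2 F \<beta> \<star>\<^bsub>B\<^esub> Id2 B l = \<mu>"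
          by (intro exI[of _ ?\<beta>]) (simp add: hom2_def)
      next
        fix \<beta> \<beta>' assume "\<beta> \<in> hom2 A b c \<and> P2 F \<beta> \<star>\<^bsub>B\<^esub> Id2 B l = \<mu>" "\<beta>' \<in> hom2 A b c \<and> P2 F \<beta>' \<star>\<^bsub>B\<^esub> Id2 B l = \<mu>"
        then have \<beta>: "\<beta> \<in> hom2 A b c" "P2 F \<beta> \<star>\<^bsub>B\<^esub> Id2 B l = \<mu>"
          and \<beta>': "\<beta>' \<in> hom2 A b c" "P2 F \<beta>' \<star>\<^bsub>B\<^esub> Id2 B l = \<mu>" by auto
        obtain h where h: "h \<in> hom1 A X T" "\<tau> \<star>\<^bsub>A\<^esub> Id2 A h = \<beta>" using fac b c \<beta>(1) by blast
        obtain h' where h': "h' \<in> hom1 A X T" "\<tau> \<star>\<^bsub>A\<^esub> Id2 A h' = \<beta>'" using fac b c \<beta>'(1) by blast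
        note [simp] = hom1D[OF h(1)] hom1D[OF h'(1)]
        have "P2 F \<tau> \<star>\<^bsub>B\<^esub> Id2 B (P1 F k \<odot>\<^bsub>B\<^esub> l) = P2 F (\<tau> \<star>\<^bsub>A\<^esub> Id2 A k) \<star>\<^bsub>B\<^esub> Id2 B l" if "k \<in> hom1 A X T" for k
          using hom1D[OF that] by (simp add: P2s)
        then have "P2 F \<tau> \<star>\<^bsub>B\<^esub> Id2 B (P1 F h \<odot>\<^bsub>B\<^esub> l) = \<mu>" "P2 F \<tau> \<star>\<^bsub>B\<^esub> Id2 B (P1 F h' \<odot>\<^bsub>B\<^esub> l) = \<mu>"
          using h h' \<beta> \<beta>' by simp_all
        then have hh': "P1 F h \<odot>\<^bsub>B\<^esub> l = P1 F h' \<odot>\<^bsub>B\<^esub> l"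
          using cot Kb[OF h(1)] Kb[OF h'(1)] by blast
        have "Id2 B (P1 F h \<odot>\<^bsub>B\<^esub> l) \<in> hom2 B (P1 F h \<odot>\<^bsub>B\<^esub> l) (P1 F h' \<odot>\<^bsub>B\<^esub> l)"
          using hh' hom1D[OF Kb[OF h(1)]] by (simp add: hom2_def)
        then obtain \<gamma> where \<gamma>: "\<gamma> \<in> hom2 A h h'" "P2 F \<gamma> \<star>\<^bsub>B\<^esub> Id2 B l = Id2 B (P1 F h \<odot>\<^bsub>B\<^esub> l)"
          using lift[OF T h(1) h'(1), of "Id2 B (P1 F h \<odot>\<^bsub>B\<^esub> l)"] by auto
        note [simp] = hom2D[OF \<gamma>(1)]
        have id: "Id2 A r \<star>\<^bsub>A\<^esub> \<gamma> = Id2 A d"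
          if r: "r \<in> hom1 A T Y" and d: "d \<in> hom1 A X Y" "r \<odot>\<^bsub>A\<^esub> h = d" "r \<odot>\<^bsub>A\<^esub> h' = d" for r d
        proof -
          note [simp] = hom1D[OF r] hom1D[OF d(1)]
          have "P2 F (Id2 A r \<star>\<^bsub>A\<^esub> \<gamma>) \<star>\<^bsub>B\<^esub> Id2 B l = Id2 B (P1 F r) \<star>\<^bsub>B\<^esub> (P2 F \<gamma> \<star>\<^bsub>B\<^esub> Id2 B l)"
            by (simp add: P2s)
          also have "\<dots> = Id2 B (P1 F d \<odot>\<^bsub>B\<^esub> l)"
            unfolding \<gamma>(2) d(2)[symmetric] by (simp add: P1s)
          finally have "P2 F (Id2 A r \<star>\<^bsub>A\<^esub> \<gamma>) \<star>\<^bsub>B\<^esub> Id2 B l = Id2 B (P1 F d \<odot>\<^bsub>B\<^esub> l)" .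
          moreover have "P2 F (Id2 A d) \<star>\<^bsub>B\<^esub> Id2 B l = Id2 B (P1 F d \<odot>\<^bsub>B\<^esub> l)" by simp
          moreover have "Id2 A r \<star>\<^bsub>A\<^esub> \<gamma> \<in> hom2 A d d" "Id2 A d \<in> hom2 A d d"
            using d by (simp_all add: hom2_def)
          moreover have "Id2 B (P1 F d \<odot>\<^bsub>B\<^esub> l) \<in> hom2 B (P1 F d \<odot>\<^bsub>B\<^esub> l) (P1 F d \<odot>\<^bsub>B\<^esub> l)"
            by (simp add: hom2_def)
          ultimately show ?thesis
            using lift[OF Y d(1) d(1), of "Id2 B (P1 F d \<odot>\<^bsub>B\<^esub> l)"] by auto
        qed
        have dc: "p \<odot>\<^bsub>A\<^esub> h = b" "q \<odot>\<^bsub>A\<^esub> h = c" "p \<odot>\<^bsub>A\<^esub> h' = b" "q \<odot>\<^bsub>A\<^esub> h' = c"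
          using hom2D(2,3)[OF \<beta>(1)] hom2D(2,3)[OF \<beta>'(1)] unfolding h(2)[symmetric] h'(2)[symmetric]
          by simp_all
        have "(\<tau> \<star>\<^bsub>A\<^esub> Id2 A h') \<bullet>\<^bsub>A\<^esub> (Id2 A p \<star>\<^bsub>A\<^esub> \<gamma>) = (Id2 A q \<star>\<^bsub>A\<^esub> \<gamma>) \<bullet>\<^bsub>A\<^esub> (\<tau> \<star>\<^bsub>A\<^esub> Id2 A h)"
          by (rule A.exchange[OF \<gamma>(1) \<tau>]) simp
        then have "\<beta>' \<bullet>\<^bsub>A\<^esub> Id2 A b = Id2 A c \<bullet>\<^bsub>A\<^esub> \<beta>"
          unfolding h(2) h'(2) id[OF p b dc(1,3)] id[OF q c dc(2,4)] .
        then show "\<beta> = \<beta>'" using hom2D[OF \<beta>(1)] hom2D[OF \<beta>'(1)] by simp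
      qed
    qed
    show "\<forall>Y\<in>Cell0 A. adjoint_equivalence (hom_cat A X Y) (hom_cat B J (P0 F Y)) (comparison A B F X l Y)"
      using ff ff_iff es adjoint_equivalenceI is_functor_comparison by blast
  qed
qed

end

(* Outside the context these rules have premises with variables that their conclusions do not
   determine, and rewriting with them does not terminate. *)
declare l_simps [simp del]

end

section \<open>The 2-functor \<open>C(-, F)\<close>\<close>

lemma op2_simps [simp]:
  "Cell0 (op2 C) = Cell0 C" "Cell1 (op2 C) = Cell1 C" "Cell2 (op2 C) = Cell2 C"
  "Src (op2 C) = Trg C" "Trg (op2 C) = Src C" "Dom2 (op2 C) = Dom2 C" "Cod2 (op2 C) = Cod2 C"
  "Id1 (op2 C) = Id1 C" "Id2 (op2 C) = Id2 C" "VCmp (op2 C) = VCmp C"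
  "g \<odot>\<^bsub>op2 C\<^esub> f = f \<odot>\<^bsub>C\<^esub> g" "\<beta> \<star>\<^bsub>op2 C\<^esub> \<alpha> = \<alpha> \<star>\<^bsub>C\<^esub> \<beta>"
  "hom1 (op2 C) X Y = hom1 C Y X" "hom2 (op2 C) f g = hom2 C f g"
  "hom_cat (op2 C) X Y = hom_cat C Y X"
  by (auto simp: op2_def hom1_def hom2_def hom_cat_def)

lemma two_category_op2:
  assumes "two_category C"
  shows "two_category (op2 C)"
proof (rule two_category.intro)
  interpret two_category C by fact
  show "category (under_cat (op2 C))" by (rule category.intro) (auto simp: under_cat_def)
  show "category (vert_cat (op2 C))" by (rule category.intro) (auto simp: vert_cat_def)
  show "\<beta> \<star>\<^bsub>op2 C\<^esub> \<alpha> \<in> hom2 (op2 C) (g \<odot>\<^bsub>op2 C\<^esub> f) (g' \<odot>\<^bsub>op2 C\<^esub> f')"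
    if "\<alpha> \<in> hom2 (op2 C) f f'" "\<beta> \<in> hom2 (op2 C) g g'" "Trg (op2 C) f = Src (op2 C) g" for \<alpha> \<beta> f f' g g'
    using HCmp_in[of \<beta> g g' \<alpha> f f'] that by simp
  show "(\<beta>' \<bullet>\<^bsub>op2 C\<^esub> \<beta>) \<star>\<^bsub>op2 C\<^esub> (\<alpha>' \<bullet>\<^bsub>op2 C\<^esub> \<alpha>) = (\<beta>' \<star>\<^bsub>op2 C\<^esub> \<alpha>') \<bullet>\<^bsub>op2 C\<^esub> (\<beta> \<star>\<^bsub>op2 C\<^esub> \<alpha>)"
    if "\<alpha> \<in> hom2 (op2 C) f f'" "\<alpha>' \<in> hom2 (op2 C) f' f''" "\<beta> \<in> hom2 (op2 C) g g'"
      "\<beta>' \<in> hom2 (op2 C) g' g''" "Trg (op2 C) f = Src (op2 C) g" for \<alpha> \<alpha>' \<beta> \<beta>' f f' f'' g g' g''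
    using interchange[of \<beta> g g' \<beta>' g'' \<alpha> f f' \<alpha>' f''] that by simp
  show "(\<gamma> \<star>\<^bsub>op2 C\<^esub> \<beta>) \<star>\<^bsub>op2 C\<^esub> \<alpha> = \<gamma> \<star>\<^bsub>op2 C\<^esub> (\<beta> \<star>\<^bsub>op2 C\<^esub> \<alpha>)"
    if "\<alpha> \<in> hom2 (op2 C) f f'" "\<beta> \<in> hom2 (op2 C) g g'" "\<gamma> \<in> hom2 (op2 C) h h'"
      "Trg (op2 C) f = Src (op2 C) g" "Trg (op2 C) g = Src (op2 C) h" for \<alpha> \<beta> \<gamma> f f' g g' h h'
    using HCmp_assoc[of \<gamma> h h' \<beta> g g' \<alpha> f f'] that by simp
qed (auto simp: two_category.HCmp_Id_left'[OF assms] two_category.HCmp_Id_right'[OF assms]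
    two_category.HCmp_Id2'[OF assms] two_category.parallel_simps[OF assms] hom2_def)

text \<open>
  From here on, \<open>Cat\<close> is handled as an abstract 2-category, whose laws compute sources and targets, and
  functors and natural transformations are compared componentwise; the following rules evaluate the
  components.
\<close>

lemma Cat_eval:
  "x \<in> Obj (Src Cat F) \<Longrightarrow> FObj (G \<odot>\<^bsub>Cat\<^esub> F) x = FObj G (FObj F x)"
  "f \<in> Arr (Src Cat F) \<Longrightarrow> FArr (G \<odot>\<^bsub>Cat\<^esub> F) f = FArr G (FArr F f)"
  "x \<in> Obj A \<Longrightarrow> FObj (Id1 Cat A) x = x" "f \<in> Arr A \<Longrightarrow> FArr (Id1 Cat A) f = f"
  "x \<in> Obj (Src Cat F) \<Longrightarrow> NAt (Id2 Cat F) x = Ide (Trg Cat F) (FObj F x)"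
  "x \<in> Obj (Src Cat (Dom2 Cat \<sigma>)) \<Longrightarrow>
     NAt (\<tau> \<bullet>\<^bsub>Cat\<^esub> \<sigma>) x = NAt \<tau> x \<cdot>\<^bsub>Trg Cat (Dom2 Cat \<sigma>)\<^esub> NAt \<sigma> x"
  "x \<in> Obj (Src Cat (Dom2 Cat \<sigma>)) \<Longrightarrow> NAt (\<tau> \<star>\<^bsub>Cat\<^esub> \<sigma>) x =
     FArr (Cod2 Cat \<tau>) (NAt \<sigma> x) \<cdot>\<^bsub>Trg Cat (Dom2 Cat \<tau>)\<^esub> NAt \<tau> (FObj (Dom2 Cat \<sigma>) x)"
  by (simp_all add: Cat_simps)

lemma Cat_Cell1_eqI:
  assumes "F \<in> Cell1 Cat" "G \<in> Cell1 Cat" "Src Cat F = Src Cat G" "Trg Cat F = Trg Cat G"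
    "\<And>x. x \<in> Obj (Src Cat F) \<Longrightarrow> FObj F x = FObj G x" "\<And>f. f \<in> Arr (Src Cat F) \<Longrightarrow> FArr F f = FArr G f"
  shows "F = G"
  using assms by (intro func_eqI[of "FDom F" "FCod F"]) (simp_all add: Cat_simps)

lemma Cat_Cell2_eqI:
  assumes "\<sigma> \<in> Cell2 Cat" "\<tau> \<in> Cell2 Cat" "Dom2 Cat \<sigma> = Dom2 Cat \<tau>" "Cod2 Cat \<sigma> = Cod2 Cat \<tau>"
    "\<And>x. x \<in> Obj (Src Cat (Dom2 Cat \<sigma>)) \<Longrightarrow> NAt \<sigma> x = NAt \<tau> x"
  shows "\<sigma> = \<tau>"
  using assms by (intro nat_eqI[of "FDom (NDom \<sigma>)" "FCod (NDom \<sigma>)"]) (simp_all add: Cat_simps)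

lemma Cat_Cell1I: "is_functor A B F \<Longrightarrow> F \<in> Cell1 Cat \<and> Src Cat F = A \<and> Trg Cat F = B"
  using is_functorD(3,4)[of A B F] by (auto simp: Cat_simps)

lemma Cat_Cell1D: "\<lbrakk>F \<in> Cell1 Cat; Src Cat F = A; Trg Cat F = B\<rbrakk> \<Longrightarrow> is_functor A B F"
  by (auto simp: Cat_simps)

lemma Cat_Cell2I:
  "is_nat A B \<tau> \<Longrightarrow> \<tau> \<in> Cell2 Cat \<and> Dom2 Cat \<tau> = NDom \<tau> \<and> Cod2 Cat \<tau> = NCod \<tau>"
  using is_nat_parallel[of A B \<tau>] by (auto simp: Cat_simps)

lemma Cat_Cell0 [simp]: "A \<in> Cell0 Cat \<longleftrightarrow> category A"
  by (simp add: Cat_simps)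

interpretation Cat: two_category Cat
  by (rule two_category_Cat)

context two_category
begin

declare category_hom_cat [simp]

lemma post_func_simps [simp]:
  assumes g: "g \<in> Cell1 C" and X: "X \<in> Cell0 C"
  shows "post_func C X g \<in> Cell1 Cat" "Src Cat (post_func C X g) = hom_cat C X (Src C g)"
    "Trg Cat (post_func C X g) = hom_cat C X (Trg C g)"
    "f \<in> hom1 C X (Src C g) \<Longrightarrow> FObj (post_func C X g) f = g \<odot> f"
    "\<lbrakk>\<alpha> \<in> Cell2 C; Dom2 C \<alpha> \<in> hom1 C X (Src C g)\<rbrakk> \<Longrightarrow> FArr (post_func C X g) \<alpha> = Id2 C g \<star> \<alpha>"
proof -
  have "is_functor (hom_cat C X (Src C g)) (hom_cat C X (Trg C g)) (post_func C X g)"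
    by (rule is_functorI) (use g X in \<open>auto simp: post_func_def hom1_def\<close>)
  then show "post_func C X g \<in> Cell1 Cat" "Src Cat (post_func C X g) = hom_cat C X (Src C g)"
    "Trg Cat (post_func C X g) = hom_cat C X (Trg C g)"
    using Cat_Cell1I by blast+
qed (auto simp: post_func_def hom1_def)

lemma pre_func_simps [simp]:
  assumes f: "f \<in> Cell1 C" and Z: "Z \<in> Cell0 C"
  shows "pre_func C f Z \<in> Cell1 Cat" "Src Cat (pre_func C f Z) = hom_cat C (Trg C f) Z"
    "Trg Cat (pre_func C f Z) = hom_cat C (Src C f) Z"
    "g \<in> hom1 C (Trg C f) Z \<Longrightarrow> FObj (pre_func C f Z) g = g \<odot> f"
    "\<lbrakk>\<beta> \<in> Cell2 C; Dom2 C \<beta> \<in> hom1 C (Trg C f) Z\<rbrakk> \<Longrightarrow> FArr (pre_func C f Z) \<beta> = \<beta> \<star> Id2 C f"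
proof -
  have "is_functor (hom_cat C (Trg C f) Z) (hom_cat C (Src C f) Z) (pre_func C f Z)"
    by (rule is_functorI) (use f Z in \<open>auto simp: pre_func_def hom1_def\<close>)
  then show "pre_func C f Z \<in> Cell1 Cat" "Src Cat (pre_func C f Z) = hom_cat C (Trg C f) Z"
    "Trg Cat (pre_func C f Z) = hom_cat C (Src C f) Z"
    using Cat_Cell1I by blast+
qed (auto simp: pre_func_def hom1_def)

lemma post_nat_simps [simp]:
  assumes \<beta>: "\<beta> \<in> Cell2 C" and X: "X \<in> Cell0 C"
  shows "post_nat C X \<beta> \<in> Cell2 Cat" "Dom2 Cat (post_nat C X \<beta>) = post_func C X (Dom2 C \<beta>)"
    "Cod2 Cat (post_nat C X \<beta>) = post_func C X (Cod2 C \<beta>)"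
    "f \<in> hom1 C X (Src C (Dom2 C \<beta>)) \<Longrightarrow> NAt (post_nat C X \<beta>) f = \<beta> \<star> Id2 C f"
proof -
  have fs: "is_functor (hom_cat C X (Src C g)) (hom_cat C X (Trg C g)) (post_func C X g)"
    if "g \<in> Cell1 C" for g
    using post_func_simps(1-3)[OF that X] by (simp add: Cat_simps)
  have "is_nat (hom_cat C X (Src C (Dom2 C \<beta>))) (hom_cat C X (Trg C (Dom2 C \<beta>))) (post_nat C X \<beta>)"
  proof (rule is_natI)
    fix \<alpha> assume "\<alpha> \<in> Arr (hom_cat C X (Src C (Dom2 C \<beta>)))"
    then have \<alpha>: "\<alpha> \<in> Cell2 C" "Src C (Dom2 C \<alpha>) = X" "Trg C (Dom2 C \<alpha>) = Src C (Dom2 C \<beta>)"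
      by (auto simp: hom1_def)
    show "FArr (NCod (post_nat C X \<beta>)) \<alpha> \<cdot>\<^bsub>hom_cat C X (Trg C (Dom2 C \<beta>))\<^esub>
        NAt (post_nat C X \<beta>) (Dom (hom_cat C X (Src C (Dom2 C \<beta>))) \<alpha>)
      = NAt (post_nat C X \<beta>) (Cod (hom_cat C X (Src C (Dom2 C \<beta>))) \<alpha>) \<cdot>\<^bsub>hom_cat C X (Trg C (Dom2 C \<beta>))\<^esub>
        FArr (NDom (post_nat C X \<beta>)) \<alpha>"
      using exchange[of \<alpha> "Dom2 C \<alpha>" "Cod2 C \<alpha>" \<beta> "Dom2 C \<beta>" "Cod2 C \<beta>"] \<alpha> \<beta> X
      by (simp add: post_nat_def hom1_def hom2_def)
  qed (use \<beta> X fs[of "Dom2 C \<beta>"] fs[of "Cod2 C \<beta>"] in \<open>auto simp: post_nat_def\<close>, auto simp: hom1_def)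
  from Cat_Cell2I[OF this]
  show "post_nat C X \<beta> \<in> Cell2 Cat" "Dom2 Cat (post_nat C X \<beta>) = post_func C X (Dom2 C \<beta>)"
    "Cod2 Cat (post_nat C X \<beta>) = post_func C X (Cod2 C \<beta>)" by (auto simp: post_nat_def)
qed (simp add: post_nat_def)

lemma pre_nat_simps [simp]:
  assumes \<alpha>: "\<alpha> \<in> Cell2 C" and Z: "Z \<in> Cell0 C"
  shows "pre_nat C \<alpha> Z \<in> Cell2 Cat" "Dom2 Cat (pre_nat C \<alpha> Z) = pre_func C (Dom2 C \<alpha>) Z"
    "Cod2 Cat (pre_nat C \<alpha> Z) = pre_func C (Cod2 C \<alpha>) Z"
    "g \<in> hom1 C (Trg C (Dom2 C \<alpha>)) Z \<Longrightarrow> NAt (pre_nat C \<alpha> Z) g = Id2 C g \<star> \<alpha>"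
proof -
  have fs: "is_functor (hom_cat C (Trg C f) Z) (hom_cat C (Src C f) Z) (pre_func C f Z)"
    if "f \<in> Cell1 C" for f
    using pre_func_simps(1-3)[OF that Z] by (simp add: Cat_simps)
  have "is_nat (hom_cat C (Trg C (Dom2 C \<alpha>)) Z) (hom_cat C (Src C (Dom2 C \<alpha>)) Z) (pre_nat C \<alpha> Z)"
  proof (rule is_natI)
    fix \<beta> assume "\<beta> \<in> Arr (hom_cat C (Trg C (Dom2 C \<alpha>)) Z)"
    then have \<beta>: "\<beta> \<in> Cell2 C" "Src C (Dom2 C \<beta>) = Trg C (Dom2 C \<alpha>)" "Trg C (Dom2 C \<beta>) = Z"
      by (auto simp: hom1_def)
    show "FArr (NCod (pre_nat C \<alpha> Z)) \<beta> \<cdot>\<^bsub>hom_cat C (Src C (Dom2 C \<alpha>)) Z\<^esub>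
        NAt (pre_nat C \<alpha> Z) (Dom (hom_cat C (Trg C (Dom2 C \<alpha>)) Z) \<beta>)
      = NAt (pre_nat C \<alpha> Z) (Cod (hom_cat C (Trg C (Dom2 C \<alpha>)) Z) \<beta>) \<cdot>\<^bsub>hom_cat C (Src C (Dom2 C \<alpha>)) Z\<^esub>
        FArr (NDom (pre_nat C \<alpha> Z)) \<beta>"
      using exchange[of \<alpha> "Dom2 C \<alpha>" "Cod2 C \<alpha>" \<beta> "Dom2 C \<beta>" "Cod2 C \<beta>"] \<alpha> \<beta> Z
      by (simp add: pre_nat_def hom1_def hom2_def)
  qed (use \<alpha> Z fs[of "Dom2 C \<alpha>"] fs[of "Cod2 C \<alpha>"] in \<open>auto simp: pre_nat_def\<close>, auto simp: hom1_def)
  from Cat_Cell2I[OF this]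
  show "pre_nat C \<alpha> Z \<in> Cell2 Cat" "Dom2 Cat (pre_nat C \<alpha> Z) = pre_func C (Dom2 C \<alpha>) Z"
    "Cod2 Cat (pre_nat C \<alpha> Z) = pre_func C (Cod2 C \<alpha>) Z" by (auto simp: pre_nat_def)
qed (simp add: pre_nat_def)

lemma post_func_Id1:
  "\<lbrakk>X \<in> Cell0 C; Y \<in> Cell0 C\<rbrakk> \<Longrightarrow> post_func C X (Id1 C Y) = Id1 Cat (hom_cat C X Y)"
  by (rule Cat_Cell1_eqI) (auto simp: Cat_eval hom1_def)

lemma pre_func_Id1:
  "\<lbrakk>X \<in> Cell0 C; Z \<in> Cell0 C\<rbrakk> \<Longrightarrow> pre_func C (Id1 C X) Z = Id1 Cat (hom_cat C X Z)"
  by (rule Cat_Cell1_eqI) (auto simp: Cat_eval hom1_def)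

lemma pre_func_Cmp1:
  "\<lbrakk>f \<in> Cell1 C; g \<in> Cell1 C; Trg C f = Src C g; Z \<in> Cell0 C\<rbrakk>
   \<Longrightarrow> pre_func C (g \<odot> f) Z = pre_func C f Z \<odot>\<^bsub>Cat\<^esub> pre_func C g Z"
  by (rule Cat_Cell1_eqI) (auto simp: Cat_eval hom1_def)

lemma pre_post_func:
  "\<lbrakk>f \<in> Cell1 C; g \<in> Cell1 C; Trg C f = Y; Src C f = X; Src C g = Z; Trg C g = Z'\<rbrakk>
   \<Longrightarrow> pre_func C f Z' \<odot>\<^bsub>Cat\<^esub> post_func C Y g = post_func C X g \<odot>\<^bsub>Cat\<^esub> pre_func C f Z"
  by (rule Cat_Cell1_eqI) (auto simp: Cat_eval hom1_def)

lemma post_nat_Id2: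
  "\<lbrakk>X \<in> Cell0 C; g \<in> Cell1 C\<rbrakk> \<Longrightarrow> post_nat C X (Id2 C g) = Id2 Cat (post_func C X g)"
  by (rule Cat_Cell2_eqI) (auto simp: Cat_eval hom1_def)

lemma pre_nat_Id2:
  "\<lbrakk>Z \<in> Cell0 C; f \<in> Cell1 C\<rbrakk> \<Longrightarrow> pre_nat C (Id2 C f) Z = Id2 Cat (pre_func C f Z)"
  by (rule Cat_Cell2_eqI) (auto simp: Cat_eval hom1_def)

lemma post_nat_VCmp:
  "\<lbrakk>\<alpha> \<in> Cell2 C; \<beta> \<in> Cell2 C; Cod2 C \<alpha> = Dom2 C \<beta>; X \<in> Cell0 C\<rbrakk>
   \<Longrightarrow> post_nat C X (\<beta> \<bullet> \<alpha>) = post_nat C X \<beta> \<bullet>\<^bsub>Cat\<^esub> post_nat C X \<alpha>"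
  using parallel_simps[of \<alpha>] by (intro Cat_Cell2_eqI) (auto simp: Cat_eval hom1_def)

lemma pre_nat_VCmp:
  "\<lbrakk>\<alpha> \<in> Cell2 C; \<beta> \<in> Cell2 C; Cod2 C \<alpha> = Dom2 C \<beta>; Z \<in> Cell0 C\<rbrakk>
   \<Longrightarrow> pre_nat C (\<beta> \<bullet> \<alpha>) Z = pre_nat C \<beta> Z \<bullet>\<^bsub>Cat\<^esub> pre_nat C \<alpha> Z"
  using parallel_simps[of \<alpha>] by (intro Cat_Cell2_eqI) (auto simp: Cat_eval hom1_def)

lemma pre_nat_HCmp:
  assumes "\<alpha> \<in> Cell2 C" "\<beta> \<in> Cell2 C" "Trg C (Dom2 C \<alpha>) = Src C (Dom2 C \<beta>)" "Z \<in> Cell0 C"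
  shows "pre_nat C (\<beta> \<star> \<alpha>) Z = pre_nat C \<alpha> Z \<star>\<^bsub>Cat\<^esub> pre_nat C \<beta> Z"
proof (rule Cat_Cell2_eqI)
  fix g assume "g \<in> Obj (Src Cat (Dom2 Cat (pre_nat C (\<beta> \<star> \<alpha>) Z)))"
  then show "NAt (pre_nat C (\<beta> \<star> \<alpha>) Z) g = NAt (pre_nat C \<alpha> Z \<star>\<^bsub>Cat\<^esub> pre_nat C \<beta> Z) g"
    using assms HCmp_slice_left[of \<alpha> "Dom2 C \<alpha>" "Cod2 C \<alpha>" "Id2 C g \<star> \<beta>" "g \<odot> Dom2 C \<beta>" "g \<odot> Cod2 C \<beta>"]
      HCmp_assoc'[of \<alpha> \<beta> "Id2 C g"]
    by (auto simp: Cat_eval hom1_def hom2_def)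
qed (use assms in \<open>auto simp: pre_func_Cmp1\<close>)

end

lemma hom_psfun_simps [simp]:
  "i \<in> Cell0 A \<Longrightarrow> P0 (hom_psfun A B F X) i = hom_cat B X (P0 F i)"
  "u \<in> Cell1 A \<Longrightarrow> P1 (hom_psfun A B F X) u = post_func B X (P1 F u)"
  "\<mu> \<in> Cell2 A \<Longrightarrow> P2 (hom_psfun A B F X) \<mu> = post_nat B X (P2 F \<mu>)"
  by (simp_all add: hom_psfun_def)

lemma hom_pstrans_simps [simp]:
  "TDom (hom_pstrans A B F f) = hom_psfun A B F (Trg B f)"
  "TCod (hom_pstrans A B F f) = hom_psfun A B F (Src B f)"
  "i \<in> Cell0 A \<Longrightarrow> T0 (hom_pstrans A B F f) i = pre_func B f (P0 F i)"
  "u \<in> Cell1 A \<Longrightarrow> T1 (hom_pstrans A B F f) u =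
     Id2 Cat (post_func B (Src B f) (P1 F u) \<odot>\<^bsub>Cat\<^esub> pre_func B f (P0 F (Src A u)))"
  by (simp_all add: hom_pstrans_def Cat_simps)

lemma hom_modif_simps [simp]:
  "MDom (hom_modif A B F \<alpha>) = hom_pstrans A B F (Dom2 B \<alpha>)"
  "MCod (hom_modif A B F \<alpha>) = hom_pstrans A B F (Cod2 B \<alpha>)"
  "i \<in> Cell0 A \<Longrightarrow> MAt (hom_modif A B F \<alpha>) i = pre_nat B \<alpha> (P0 F i)"
  by (simp_all add: hom_modif_def)

context normal_pseudofunctor
begin

lemma Phi_hom_psfun_simps [simp]:
  assumes u: "u \<in> Cell1 A" "v \<in> Cell1 A" "Trg A u = Src A v" and X: "X \<in> Cell0 B"
  shows "Phi (hom_psfun A B F X) u v \<in> Cell2 Cat"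
    "Dom2 Cat (Phi (hom_psfun A B F X) u v) = post_func B X (P1 F v) \<odot>\<^bsub>Cat\<^esub> post_func B X (P1 F u)"
    "Cod2 Cat (Phi (hom_psfun A B F X) u v) = post_func B X (P1 F (v \<odot>\<^bsub>A\<^esub> u))"
    "f \<in> hom1 B X (P0 F (Src A u)) \<Longrightarrow>
       NAt (Phi (hom_psfun A B F X) u v) f = Phi F u v \<star>\<^bsub>B\<^esub> Id2 B f"
    "invertible2 Cat (Phi (hom_psfun A B F X) u v)"
proof -
  let ?Ph = "Phi (hom_psfun A B F X) u v"
  have D: "NDom ?Ph = post_func B X (P1 F v) \<odot>\<^bsub>Cat\<^esub> post_func B X (P1 F u)"
    "NCod ?Ph = post_func B X (P1 F (v \<odot>\<^bsub>A\<^esub> u))"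
    using u by (simp_all add: hom_psfun_def Cat_simps)
  show at: "NAt ?Ph f = Phi F u v \<star>\<^bsub>B\<^esub> Id2 B f" if "f \<in> hom1 B X (P0 F (Src A u))" for f
    using u that by (simp add: hom_psfun_def)
  let ?A = "hom_cat B X (P0 F (Src A u))" and ?B = "hom_cat B X (P0 F (Trg A v))"
  have C1: "post_func B X (P1 F v) \<odot>\<^bsub>Cat\<^esub> post_func B X (P1 F u) \<in> Cell1 Cat"
    "post_func B X (P1 F (v \<odot>\<^bsub>A\<^esub> u)) \<in> Cell1 Cat" using u X by simp_all
  have n: "is_nat ?A ?B ?Ph"
  proof (rule is_natI)
    show "is_functor ?A ?B (NDom ?Ph)" "is_functor ?A ?B (NCod ?Ph)"
      unfolding D using u X by (auto intro!: Cat_Cell1D)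
    show "NAt ?Ph \<in> extensional (Obj ?A)" using u by (simp add: hom_psfun_def)
  next
    fix f assume "f \<in> Obj ?A"
    then have f: "f \<in> hom1 B X (P0 F (Src A u))" by simp
    then show "NAt ?Ph f \<in> Arr ?B" "Dom ?B (NAt ?Ph f) = FObj (NDom ?Ph) f" "Cod ?B (NAt ?Ph f) = FObj (NCod ?Ph) f"
      using u X hom1D[OF f] by (simp_all add: at D Cat_eval hom1_def)
  next
    fix \<alpha> assume "\<alpha> \<in> Arr ?A"
    then have \<alpha>: "\<alpha> \<in> Cell2 B" "Src B (Dom2 B \<alpha>) = X" "Trg B (Dom2 B \<alpha>) = P0 F (Src A u)"
      by (auto simp: hom1_def)
    show "FArr (NCod ?Ph) \<alpha> \<cdot>\<^bsub>?B\<^esub> NAt ?Ph (Dom ?A \<alpha>) = NAt ?Ph (Cod ?A \<alpha>) \<cdot>\<^bsub>?B\<^esub> FArr (NDom ?Ph) \<alpha>"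
      using B.exchange[of \<alpha> "Dom2 B \<alpha>" "Cod2 B \<alpha>" "Phi F u v" "P1 F v \<odot>\<^bsub>B\<^esub> P1 F u" "P1 F (v \<odot>\<^bsub>A\<^esub> u)"] \<alpha> u X
      by (simp add: at D Cat_eval hom1_def hom2_def)
  qed
  from Cat_Cell2I[OF n] show "?Ph \<in> Cell2 Cat"
    "Dom2 Cat ?Ph = post_func B X (P1 F v) \<odot>\<^bsub>Cat\<^esub> post_func B X (P1 F u)"
    "Cod2 Cat ?Ph = post_func B X (P1 F (v \<odot>\<^bsub>A\<^esub> u))" by (simp_all add: D)
  show "invertible2 Cat ?Ph"
  proof (rule invertible2_Cat[OF n])
    fix f assume "f \<in> Obj ?A"
    then have f: "f \<in> hom1 B X (P0 F (Src A u))" by simp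
    note h = hom1D[OF f]
    show "is_iso ?B (NAt ?Ph f)"
      unfolding at[OF f]
      by (subst is_iso_hom_cat[of "P1 F v \<odot>\<^bsub>B\<^esub> (P1 F u \<odot>\<^bsub>B\<^esub> f)" _ _ _ "P1 F (v \<odot>\<^bsub>A\<^esub> u) \<odot>\<^bsub>B\<^esub> f"])
        (use h u X Phi_invertible[OF u] in \<open>simp_all add: hom1_def hom2_def\<close>)
  qed
qed

lemma normal_pseudofunctor_hom_psfun:
  assumes X [simp]: "X \<in> Cell0 B"
  shows "normal_pseudofunctor A Cat (hom_psfun A B F X)"
proof (rule normal_pseudofunctor.intro[OF A.two_category_axioms two_category_Cat], rule normal_pseudofunctor_axioms.intro)
  let ?H = "hom_psfun A B F X"
  show "P0 ?H \<in> Cell0 A \<rightarrow>\<^sub>E Cell0 Cat" by (auto simp: hom_psfun_def)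
  show "P1 ?H \<in> Cell1 A \<rightarrow>\<^sub>E Cell1 Cat" by (auto simp: hom_psfun_def)
  show "P2 ?H \<in> Cell2 A \<rightarrow>\<^sub>E Cell2 Cat" by (auto simp: hom_psfun_def)
  show "Phi ?H u v = undefined" if "\<not> (u \<in> Cell1 A \<and> v \<in> Cell1 A \<and> Trg A u = Src A v)" for u v
    using that by (auto simp: hom_psfun_def)
  show "Phi ?H u v \<in> hom2 Cat (P1 ?H v \<odot>\<^bsub>Cat\<^esub> P1 ?H u) (P1 ?H (v \<odot>\<^bsub>A\<^esub> u))"
    if "u \<in> Cell1 A" "v \<in> Cell1 A" "Trg A u = Src A v" for u v
    using that by (simp add: hom2_def)
  show "P2 ?H (\<beta> \<bullet>\<^bsub>A\<^esub> \<alpha>) = P2 ?H \<beta> \<bullet>\<^bsub>Cat\<^esub> P2 ?H \<alpha>"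
    if "\<alpha> \<in> Cell2 A" "\<beta> \<in> Cell2 A" "Cod2 A \<alpha> = Dom2 A \<beta>" for \<alpha> \<beta>
    using that by (simp add: P2_VCmp B.post_nat_VCmp)
  show "P2 ?H (\<beta> \<star>\<^bsub>A\<^esub> \<alpha>) \<bullet>\<^bsub>Cat\<^esub> Phi ?H a a' = Phi ?H b b' \<bullet>\<^bsub>Cat\<^esub> (P2 ?H \<beta> \<star>\<^bsub>Cat\<^esub> P2 ?H \<alpha>)"
    if h: "\<alpha> \<in> hom2 A a b" "\<beta> \<in> hom2 A a' b'" "Trg A a = Src A a'" for \<alpha> \<beta> a a' b b'
  proof -
    note [simp] = hom2D(1)[OF h(1)] hom2D(1)[OF h(2)] hom2D(2,3)[OF h(1), symmetric] hom2D(2,3)[OF h(2), symmetric]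
    have e [simp]: "Trg A (Dom2 A \<alpha>) = Src A (Dom2 A \<beta>)" using h(3) by simp
    show ?thesis
    proof (rule Cat_Cell2_eqI)
      fix f assume "f \<in> Obj (Src Cat (Dom2 Cat (P2 ?H (\<beta> \<star>\<^bsub>A\<^esub> \<alpha>) \<bullet>\<^bsub>Cat\<^esub> Phi ?H a a')))"
      then have f: "f \<in> Cell1 B" "Src B f = X" "Trg B f = P0 F (Src A (Dom2 A \<alpha>))"
        by (simp_all add: hom1_def)
      have e': "P2 F \<beta> \<star>\<^bsub>B\<^esub> P2 F \<alpha>
          = (Id2 B (P1 F b') \<star>\<^bsub>B\<^esub> P2 F \<alpha>) \<bullet>\<^bsub>B\<^esub> (P2 F \<beta> \<star>\<^bsub>B\<^esub> Id2 B (P1 F a))"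
        by (rule B.HCmp_slice_right[of _ _ "P1 F b" _ "P1 F a'"]) (simp_all add: hom2_def)
      have "(P2 F (\<beta> \<star>\<^bsub>A\<^esub> \<alpha>) \<bullet>\<^bsub>B\<^esub> Phi F a a') \<star>\<^bsub>B\<^esub> Id2 B f
          = (Phi F b b' \<bullet>\<^bsub>B\<^esub> ((Id2 B (P1 F b') \<star>\<^bsub>B\<^esub> P2 F \<alpha>) \<bullet>\<^bsub>B\<^esub> (P2 F \<beta> \<star>\<^bsub>B\<^esub> Id2 B (P1 F a)))) \<star>\<^bsub>B\<^esub> Id2 B f"
        unfolding Phi_natural[OF h] e' ..
      then show "NAt (P2 ?H (\<beta> \<star>\<^bsub>A\<^esub> \<alpha>) \<bullet>\<^bsub>Cat\<^esub> Phi ?H a a') f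
          = NAt (Phi ?H b b' \<bullet>\<^bsub>Cat\<^esub> (P2 ?H \<beta> \<star>\<^bsub>Cat\<^esub> P2 ?H \<alpha>)) f"
        using f by (simp add: Cat_eval hom1_def)
    qed simp_all
  qed
  show "Phi ?H a (a'' \<odot>\<^bsub>A\<^esub> a') \<bullet>\<^bsub>Cat\<^esub> (Phi ?H a' a'' \<star>\<^bsub>Cat\<^esub> Id2 Cat (P1 ?H a))
      = Phi ?H (a' \<odot>\<^bsub>A\<^esub> a) a'' \<bullet>\<^bsub>Cat\<^esub> (Id2 Cat (P1 ?H a'') \<star>\<^bsub>Cat\<^esub> Phi ?H a a')"
    if h [simp]: "a \<in> Cell1 A" "a' \<in> Cell1 A" "a'' \<in> Cell1 A" "Trg A a = Src A a'" "Trg A a' = Src A a''" for a a' a''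
  proof (rule Cat_Cell2_eqI)
    fix f assume "f \<in> Obj (Src Cat (Dom2 Cat (Phi ?H a (a'' \<odot>\<^bsub>A\<^esub> a') \<bullet>\<^bsub>Cat\<^esub> (Phi ?H a' a'' \<star>\<^bsub>Cat\<^esub> Id2 Cat (P1 ?H a)))))"
    then have f: "f \<in> Cell1 B" "Src B f = X" "Trg B f = P0 F (Src A a)" by (simp_all add: hom1_def)
    from arg_cong[OF Phi_assoc[OF h], of "\<lambda>x. x \<star>\<^bsub>B\<^esub> Id2 B f"]
    show "NAt (Phi ?H a (a'' \<odot>\<^bsub>A\<^esub> a') \<bullet>\<^bsub>Cat\<^esub> (Phi ?H a' a'' \<star>\<^bsub>Cat\<^esub> Id2 Cat (P1 ?H a))) f
      = NAt (Phi ?H (a' \<odot>\<^bsub>A\<^esub> a) a'' \<bullet>\<^bsub>Cat\<^esub> (Id2 Cat (P1 ?H a'') \<star>\<^bsub>Cat\<^esub> Phi ?H a a')) f"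
      using f by (simp add: Cat_eval hom1_def)
  qed simp_all
  show "Phi ?H a (Id1 A (Trg A a)) = Id2 Cat (P1 ?H a)" "Phi ?H (Id1 A (Src A a)) a = Id2 Cat (P1 ?H a)"
    if "a \<in> Cell1 A" for a
    using that by (auto intro!: Cat_Cell2_eqI simp: B.post_func_Id1 Cat_eval Phi_Id_left Phi_Id_right hom1_def)
qed (simp_all add: B.post_func_Id1 B.post_nat_Id2)

lemma pseudo_natural_hom_pstrans:
  assumes f [simp]: "f \<in> Cell1 B"
  shows "pseudo_natural A Cat (hom_pstrans A B F f)"
proof (rule pseudo_natural.intro)
  let ?H = "hom_pstrans A B F f"
  show "normal_pseudofunctor A Cat (TDom ?H)" "normal_pseudofunctor A Cat (TCod ?H)"
    by (simp_all add: normal_pseudofunctor_hom_psfun)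
  show "pseudo_natural_axioms A Cat ?H"
  proof (rule pseudo_natural_axioms.intro)
    show "T0 ?H i \<in> hom1 Cat (P0 (TDom ?H) i) (P0 (TCod ?H) i)" if "i \<in> Cell0 A" for i
      using that by (simp add: hom1_def)
    show "T0 ?H \<in> extensional (Cell0 A)" "T1 ?H \<in> extensional (Cell1 A)"
      by (simp_all add: hom_pstrans_def)
    fix a i j assume a: "a \<in> hom1 A i j"
    note [simp] = hom1D[OF a]
    have ij [simp]: "i \<in> Cell0 A" "j \<in> Cell0 A" using A.Cell1_simps(1,2)[of a] by simp_all
    have pp [simp]: "pre_func B f (P0 F j) \<odot>\<^bsub>Cat\<^esub> post_func B (Trg B f) (P1 F a)
        = post_func B (Src B f) (P1 F a) \<odot>\<^bsub>Cat\<^esub> pre_func B f (P0 F i)"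
      by (rule B.pre_post_func) simp_all
    show "T1 ?H a \<in> hom2 Cat (P1 (TCod ?H) a \<odot>\<^bsub>Cat\<^esub> T0 ?H i) (T0 ?H j \<odot>\<^bsub>Cat\<^esub> P1 (TDom ?H) a)"
      by (simp add: hom2_def)
    show "T1 ?H b \<bullet>\<^bsub>Cat\<^esub> (P2 (TCod ?H) \<alpha> \<star>\<^bsub>Cat\<^esub> Id2 Cat (T0 ?H i))
        = (Id2 Cat (T0 ?H j) \<star>\<^bsub>Cat\<^esub> P2 (TDom ?H) \<alpha>) \<bullet>\<^bsub>Cat\<^esub> T1 ?H a" if \<alpha>: "\<alpha> \<in> hom2 A a b" for \<alpha> b
    proof -
      note [simp] = hom2D[OF \<alpha>]
      have [simp]: "b \<in> Cell1 A" "Src A b = i" "Trg A b = j"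
        using A.Cell2_simps(2)[of \<alpha>] A.parallel_simps[of \<alpha>] by simp_all
      have pp' [simp]: "pre_func B f (P0 F j) \<odot>\<^bsub>Cat\<^esub> post_func B (Trg B f) (P1 F b)
          = post_func B (Src B f) (P1 F b) \<odot>\<^bsub>Cat\<^esub> pre_func B f (P0 F i)"
        by (rule B.pre_post_func) simp_all
      show ?thesis by (rule Cat_Cell2_eqI) (auto simp: Cat_eval hom1_def)
    qed
    fix a' k assume a': "a' \<in> hom1 A j k"
    note [simp] = hom1D[OF a']
    have k [simp]: "k \<in> Cell0 A" using A.Cell1_simps(1,2)[of a'] by simp_all
    have pp' [simp]: "pre_func B f (P0 F k) \<odot>\<^bsub>Cat\<^esub> post_func B (Trg B f) (P1 F a')
        = post_func B (Src B f) (P1 F a') \<odot>\<^bsub>Cat\<^esub> pre_func B f (P0 F j)"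
      by (rule B.pre_post_func) simp_all
    have pp'' [simp]: "pre_func B f (P0 F k) \<odot>\<^bsub>Cat\<^esub> post_func B (Trg B f) (P1 F (a' \<odot>\<^bsub>A\<^esub> a))
        = post_func B (Src B f) (P1 F (a' \<odot>\<^bsub>A\<^esub> a)) \<odot>\<^bsub>Cat\<^esub> pre_func B f (P0 F i)"
      by (rule B.pre_post_func) simp_all
    have pp3 [simp]: "pre_func B f (P0 F k) \<odot>\<^bsub>Cat\<^esub> (post_func B (Trg B f) (P1 F a') \<odot>\<^bsub>Cat\<^esub> post_func B (Trg B f) (P1 F a))
        = post_func B (Src B f) (P1 F a') \<odot>\<^bsub>Cat\<^esub> (post_func B (Src B f) (P1 F a) \<odot>\<^bsub>Cat\<^esub> pre_func B f (P0 F i))"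
      by (subst Cat.Cell1_simps(11)[symmetric]) (simp_all add: pp')
    show "T1 ?H (a' \<odot>\<^bsub>A\<^esub> a) \<bullet>\<^bsub>Cat\<^esub> (Phi (TCod ?H) a a' \<star>\<^bsub>Cat\<^esub> Id2 Cat (T0 ?H i))
        = (Id2 Cat (T0 ?H k) \<star>\<^bsub>Cat\<^esub> Phi (TDom ?H) a a') \<bullet>\<^bsub>Cat\<^esub> (T1 ?H a' \<star>\<^bsub>Cat\<^esub> Id2 Cat (P1 (TDom ?H) a))
          \<bullet>\<^bsub>Cat\<^esub> (Id2 Cat (P1 (TCod ?H) a') \<star>\<^bsub>Cat\<^esub> T1 ?H a)"
      by (rule Cat_Cell2_eqI) (auto simp: Cat_eval hom1_def)
  next
    show "T1 ?H (Id1 A i) = Id2 Cat (T0 ?H i)" if "i \<in> Cell0 A" for i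
      using that by (simp add: B.post_func_Id1)
  qed simp
qed

lemma modification_hom_modif:
  assumes \<alpha> [simp]: "\<alpha> \<in> Cell2 B"
  shows "modification A Cat (hom_modif A B F \<alpha>)"
proof (rule modification.intro)
  let ?H = "hom_modif A B F \<alpha>"
  show "pseudo_natural A Cat (MDom ?H)" "pseudo_natural A Cat (MCod ?H)"
    by (simp_all add: pseudo_natural_hom_pstrans)
  show "modification_axioms A Cat ?H"
  proof (rule modification_axioms.intro)
    show "MAt ?H \<in> extensional (Cell0 A)" by (simp add: hom_modif_def)
    fix a i j assume a: "a \<in> hom1 A i j"
    note [simp] = hom1D[OF a]
    have ij [simp]: "i \<in> Cell0 A" "j \<in> Cell0 A" using A.Cell1_simps(1,2)[of a] by simp_all
    have pp [simp]: "pre_func B f (P0 F j) \<odot>\<^bsub>Cat\<^esub> post_func B (Trg B (Dom2 B \<alpha>)) (P1 F a)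
        = post_func B (Src B (Dom2 B \<alpha>)) (P1 F a) \<odot>\<^bsub>Cat\<^esub> pre_func B f (P0 F i)"
      if "f \<in> Cell1 B" "Src B f = Src B (Dom2 B \<alpha>)" "Trg B f = Trg B (Dom2 B \<alpha>)" for f
      using that by (intro B.pre_post_func) simp_all
    show "T1 (MCod ?H) a \<bullet>\<^bsub>Cat\<^esub> (Id2 Cat (P1 (TCod (MDom ?H)) a) \<star>\<^bsub>Cat\<^esub> MAt ?H i)
        = (MAt ?H j \<star>\<^bsub>Cat\<^esub> Id2 Cat (P1 (TDom (MDom ?H)) a)) \<bullet>\<^bsub>Cat\<^esub> T1 (MDom ?H) a"
      by (rule Cat_Cell2_eqI) (auto simp: Cat_eval hom1_def)
  qed (simp_all add: hom2_def)
qed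

text \<open>\<open>C(-, F)\<close> is strict because precomposition is strictly functorial and its naturality 2-cells are
  identities.\<close>

lemma hom_pstrans_Cmp1:
  assumes "f \<in> Cell1 B" "g \<in> Cell1 B" "Trg B f = Src B g"
  shows "ps_comp A Cat (hom_pstrans A B F f) (hom_pstrans A B F g) = hom_pstrans A B F (g \<odot>\<^bsub>B\<^esub> f)"
proof (rule pstrans_eqI)
  show "pseudo_natural A Cat (ps_comp A Cat (hom_pstrans A B F f) (hom_pstrans A B F g))"
    using assms by (intro pseudo_natural_comp pseudo_natural_hom_pstrans) simp_all
  show "pseudo_natural A Cat (hom_pstrans A B F (g \<odot>\<^bsub>B\<^esub> f))"
    using assms by (intro pseudo_natural_hom_pstrans) simp
  fix u assume u: "u \<in> Cell1 A"
  have "pre_func B f (P0 F (Trg A u)) \<odot>\<^bsub>Cat\<^esub> post_func B (Trg B f) (P1 F u)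
      = post_func B (Src B f) (P1 F u) \<odot>\<^bsub>Cat\<^esub> pre_func B f (P0 F (Src A u))"
    using u assms by (intro B.pre_post_func) simp_all
  then have "pre_func B f (P0 F (Trg A u)) \<odot>\<^bsub>Cat\<^esub> (post_func B (Src B g) (P1 F u) \<odot>\<^bsub>Cat\<^esub> h)
      = post_func B (Src B f) (P1 F u) \<odot>\<^bsub>Cat\<^esub> (pre_func B f (P0 F (Src A u)) \<odot>\<^bsub>Cat\<^esub> h)"
    if "h \<in> Cell1 Cat" "Trg Cat h = hom_cat B (Src B g) (P0 F (Src A u))" for h
    using that u assms Cat.Cell1_simps(11)[of h "post_func B (Src B g) (P1 F u)" "pre_func B f (P0 F (Trg A u))"]
    by simp
  then show "T1 (ps_comp A Cat (hom_pstrans A B F f) (hom_pstrans A B F g)) u = T1 (hom_pstrans A B F (g \<odot>\<^bsub>B\<^esub> f)) u"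
    using assms u by (simp add: B.pre_func_Cmp1)
qed (use assms in \<open>simp_all add: B.pre_func_Cmp1\<close>)

lemma hom_2func_simps:
  "X \<in> Cell0 B \<Longrightarrow> P0 (hom_2func A B F) X = hom_psfun A B F X"
  "f \<in> Cell1 B \<Longrightarrow> P1 (hom_2func A B F) f = hom_pstrans A B F f"
  "\<alpha> \<in> Cell2 B \<Longrightarrow> P2 (hom_2func A B F) \<alpha> = hom_modif A B F \<alpha>"
  "\<lbrakk>f \<in> Cell1 B; g \<in> Cell1 B; Src B f = Trg B g\<rbrakk> \<Longrightarrow> Phi (hom_2func A B F) f g
     = Id2 (Ps A Cat) (hom_pstrans A B F (f \<odot>\<^bsub>B\<^esub> g))"
  by (simp_all add: hom_2func_def)

lemma normal_pseudofunctor_hom_2func: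
  "normal_pseudofunctor (op2 B) (Ps A Cat) (hom_2func A B F)"
proof -
  let ?P = "Ps A Cat" and ?H = "hom_2func A B F"
  interpret P: two_category ?P by (rule two_category_Ps[OF A.two_category_axioms two_category_Cat])
  have P0s: "hom_psfun A B F X \<in> Cell0 ?P" if "X \<in> Cell0 B" for X
    using normal_pseudofunctor_hom_psfun[OF that] by (simp add: Ps_simps)
  have P1s: "hom_pstrans A B F f \<in> Cell1 ?P" "Src ?P (hom_pstrans A B F f) = hom_psfun A B F (Trg B f)"
    "Trg ?P (hom_pstrans A B F f) = hom_psfun A B F (Src B f)" if "f \<in> Cell1 B" for f
    using pseudo_natural_hom_pstrans[OF that] by (simp_all add: Ps_simps)
  have P2s: "hom_modif A B F \<alpha> \<in> Cell2 ?P" "Dom2 ?P (hom_modif A B F \<alpha>) = hom_pstrans A B F (Dom2 B \<alpha>)"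
    "Cod2 ?P (hom_modif A B F \<alpha>) = hom_pstrans A B F (Cod2 B \<alpha>)" if "\<alpha> \<in> Cell2 B" for \<alpha>
    using modification_hom_modif[OF that] by (simp_all add: Ps_simps)
  have Cmp: "hom_pstrans A B F f \<odot>\<^bsub>?P\<^esub> hom_pstrans A B F g = hom_pstrans A B F (g \<odot>\<^bsub>B\<^esub> f)"
    if "f \<in> Cell1 B" "g \<in> Cell1 B" "Trg B f = Src B g" for f g
    using hom_pstrans_Cmp1[OF that] by (simp add: Ps_simps)
  have modI: "\<Gamma> = \<Delta>" if "\<Gamma> \<in> Cell2 ?P" "\<Delta> \<in> Cell2 ?P" "Dom2 ?P \<Gamma> = Dom2 ?P \<Delta>" "Cod2 ?P \<Gamma> = Cod2 ?P \<Delta>"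
    "\<And>i. i \<in> Cell0 A \<Longrightarrow> MAt \<Gamma> i = MAt \<Delta> i" for \<Gamma> \<Delta>
    using that by (intro modif_eqI[of A Cat]) (simp_all add: Ps_simps)
  have MAt: "i \<in> Cell0 A \<Longrightarrow> MAt (\<Delta> \<bullet>\<^bsub>?P\<^esub> \<Gamma>) i = MAt \<Delta> i \<bullet>\<^bsub>Cat\<^esub> MAt \<Gamma> i"
    "i \<in> Cell0 A \<Longrightarrow> MAt (\<Delta> \<star>\<^bsub>?P\<^esub> \<Gamma>) i = MAt \<Delta> i \<star>\<^bsub>Cat\<^esub> MAt \<Gamma> i"
    "i \<in> Cell0 A \<Longrightarrow> MAt (Id2 ?P \<eta>) i = Id2 Cat (T0 \<eta> i)" for \<Gamma> \<Delta> \<eta> i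
    by (simp_all add: Ps_simps)
  have hc: "hom_modif A B F (\<beta> \<star>\<^bsub>B\<^esub> \<alpha>) = hom_modif A B F \<alpha> \<star>\<^bsub>?P\<^esub> hom_modif A B F \<beta>"
    if "\<alpha> \<in> Cell2 B" "\<beta> \<in> Cell2 B" "Trg B (Dom2 B \<alpha>) = Src B (Dom2 B \<beta>)" for \<alpha> \<beta>
    by (rule modI) (use that in \<open>simp_all add: P2s P1s Cmp MAt B.pre_nat_HCmp\<close>)
  show ?thesis
  proof (rule normal_pseudofunctor.intro[OF two_category_op2[OF B.two_category_axioms] P.two_category_axioms],
      rule normal_pseudofunctor_axioms.intro, unfold op2_simps)
    show "P0 ?H \<in> Cell0 B \<rightarrow>\<^sub>E Cell0 ?P" using P0s by (auto simp: hom_2func_def)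
    show "P1 ?H \<in> Cell1 B \<rightarrow>\<^sub>E Cell1 ?P" using P1s by (auto simp: hom_2func_def)
    show "P2 ?H \<in> Cell2 B \<rightarrow>\<^sub>E Cell2 ?P" using P2s by (auto simp: hom_2func_def)
    show "Phi ?H a a' = undefined" if "\<not> (a \<in> Cell1 B \<and> a' \<in> Cell1 B \<and> Src B a = Trg B a')" for a a'
      using that by (auto simp: hom_2func_def)
    show "P2 ?H (Id2 B a) = Id2 ?P (P1 ?H a)" if "a \<in> Cell1 B" for a
      by (rule modI) (use that in \<open>simp_all add: hom_2func_simps P2s P1s MAt B.pre_nat_Id2\<close>)
    show "P2 ?H (\<beta> \<bullet>\<^bsub>B\<^esub> \<alpha>) = P2 ?H \<beta> \<bullet>\<^bsub>?P\<^esub> P2 ?H \<alpha>"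
      if "\<alpha> \<in> Cell2 B" "\<beta> \<in> Cell2 B" "Cod2 B \<alpha> = Dom2 B \<beta>" for \<alpha> \<beta>
      by (rule modI) (use that in \<open>simp_all add: hom_2func_simps P2s P1s MAt B.pre_nat_VCmp\<close>)
    show "P1 ?H (Id1 B X) = Id1 ?P (P0 ?H X)" if X: "X \<in> Cell0 B" for X
    proof -
      have "hom_pstrans A B F (Id1 B X) = ps_id A Cat (hom_psfun A B F X)"
        using X by (intro pstrans_eqI[of A Cat] pseudo_natural_hom_pstrans pseudo_natural_id
            normal_pseudofunctor_hom_psfun) (simp_all add: B.pre_func_Id1)
      then show ?thesis using X by (simp add: hom_2func_simps Ps_simps)
    qed
  qed (auto simp: hom_2func_simps P1s P2s Cmp hc hom2_def)
qed

end

section \<open>Tensors by the arrow category\<close>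

text \<open>
  A tensor of \<open>Y\<close> by \<open>0 \<rightarrow> 1\<close>, in elementary terms: the universal 2-cell \<open>\<tau> : p \<Rightarrow> q : Y \<rightarrow> T\<close>. The two universal
  properties are the bijectivity of the comparison functors on objects and on arrows.
\<close>

locale arrow_tensor = two_category C
  for C :: "('c, 'f, 't) two_cat" (structure) +
  fixes Y T p q \<tau>
  assumes Y_in: "Y \<in> Cell0 C" and T_in: "T \<in> Cell0 C"
    and p_in: "p \<in> hom1 C Y T" and q_in: "q \<in> hom1 C Y T" and \<tau>_in: "\<tau> \<in> hom2 C p q"
    and universal1: "\<lbrakk>\<beta> \<in> Cell2 C; Src C (Dom2 C \<beta>) = Y\<rbrakk>
          \<Longrightarrow> \<exists>!h. h \<in> Cell1 C \<and> Src C h = T \<and> Trg C h = Trg C (Dom2 C \<beta>) \<and> Id2 C h \<star> \<tau> = \<beta>"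
    and universal2: "\<lbrakk>h \<in> Cell1 C; h' \<in> Cell1 C; Src C h = T; Src C h' = T; Trg C h = Trg C h';
          \<gamma>\<^sub>0 \<in> hom2 C (h \<odot> p) (h' \<odot> p); \<gamma>\<^sub>1 \<in> hom2 C (h \<odot> q) (h' \<odot> q);
          \<gamma>\<^sub>1 \<bullet> (Id2 C h \<star> \<tau>) = (Id2 C h' \<star> \<tau>) \<bullet> \<gamma>\<^sub>0\<rbrakk>
          \<Longrightarrow> \<exists>!\<gamma>. \<gamma> \<in> hom2 C h h' \<and> \<gamma> \<star> Id2 C p = \<gamma>\<^sub>0 \<and> \<gamma> \<star> Id2 C q = \<gamma>\<^sub>1"
begin

lemma pq_simps [simp]:
  "Y \<in> Cell0 C" "T \<in> Cell0 C" "p \<in> Cell1 C" "q \<in> Cell1 C" "Src C p = Y" "Src C q = Y" "Trg C p = T" "Trg C q = T"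
  "\<tau> \<in> Cell2 C" "Dom2 C \<tau> = p" "Cod2 C \<tau> = q"
  using Y_in T_in p_in q_in \<tau>_in by (auto simp: hom1_def hom2_def)

definition lift1 :: "'t \<Rightarrow> 'f" where
  "lift1 \<beta> = (THE h. h \<in> Cell1 C \<and> Src C h = T \<and> Trg C h = Trg C (Dom2 C \<beta>) \<and> Id2 C h \<star> \<tau> = \<beta>)"

definition lift2 :: "'f \<Rightarrow> 'f \<Rightarrow> 't \<Rightarrow> 't \<Rightarrow> 't" where
  "lift2 h h' \<gamma>\<^sub>0 \<gamma>\<^sub>1 = (THE \<gamma>. \<gamma> \<in> hom2 C h h' \<and> \<gamma> \<star> Id2 C p = \<gamma>\<^sub>0 \<and> \<gamma> \<star> Id2 C q = \<gamma>\<^sub>1)"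

lemma lift1 [simp]:
  assumes "\<beta> \<in> Cell2 C" "Src C (Dom2 C \<beta>) = Y"
  shows "lift1 \<beta> \<in> Cell1 C" "Src C (lift1 \<beta>) = T" "Trg C (lift1 \<beta>) = Trg C (Dom2 C \<beta>)"
    "Id2 C (lift1 \<beta>) \<star> \<tau> = \<beta>" "lift1 \<beta> \<odot> p = Dom2 C \<beta>" "lift1 \<beta> \<odot> q = Cod2 C \<beta>"
proof -
  have l: "lift1 \<beta> \<in> Cell1 C \<and> Src C (lift1 \<beta>) = T \<and> Trg C (lift1 \<beta>) = Trg C (Dom2 C \<beta>) \<and> Id2 C (lift1 \<beta>) \<star> \<tau> = \<beta>"
    unfolding lift1_def by (rule theI'[OF universal1[OF assms]])
  then show "lift1 \<beta> \<in> Cell1 C" "Src C (lift1 \<beta>) = T" "Trg C (lift1 \<beta>) = Trg C (Dom2 C \<beta>)"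
    "Id2 C (lift1 \<beta>) \<star> \<tau> = \<beta>" by auto
  from l show "lift1 \<beta> \<odot> p = Dom2 C \<beta>" "lift1 \<beta> \<odot> q = Cod2 C \<beta>"
    using HCmp_simps(2,3)[of \<tau> "Id2 C (lift1 \<beta>)"] by simp_all
qed

lemma lift1_unique:
  assumes "h \<in> Cell1 C" "Src C h = T" "Id2 C h \<star> \<tau> = \<beta>"
  shows "h = lift1 \<beta>"
proof -
  have "\<beta> \<in> Cell2 C" "Src C (Dom2 C \<beta>) = Y" "Trg C h = Trg C (Dom2 C \<beta>)"
    using assms unfolding assms(3)[symmetric] by simp_all
  then show ?thesis using universal1[of \<beta>] lift1[of \<beta>] assms by blast
qed

lemma lift2:
  assumes "h \<in> Cell1 C" "h' \<in> Cell1 C" "Src C h = T" "Src C h' = T" "Trg C h = Trg C h'"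
    "\<gamma>\<^sub>0 \<in> hom2 C (h \<odot> p) (h' \<odot> p)" "\<gamma>\<^sub>1 \<in> hom2 C (h \<odot> q) (h' \<odot> q)"
    "\<gamma>\<^sub>1 \<bullet> (Id2 C h \<star> \<tau>) = (Id2 C h' \<star> \<tau>) \<bullet> \<gamma>\<^sub>0"
  shows "lift2 h h' \<gamma>\<^sub>0 \<gamma>\<^sub>1 \<in> hom2 C h h'" "lift2 h h' \<gamma>\<^sub>0 \<gamma>\<^sub>1 \<star> Id2 C p = \<gamma>\<^sub>0" "lift2 h h' \<gamma>\<^sub>0 \<gamma>\<^sub>1 \<star> Id2 C q = \<gamma>\<^sub>1"
  using theI'[OF universal2[OF assms]] unfolding lift2_def[symmetric] by auto

text \<open>Restrictions of a 2-cell along \<open>p\<close> and \<open>q\<close> are always compatible with \<open>\<tau>\<close>, by exchange, so uniqueness in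
  the universal property makes \<open>p\<close> and \<open>q\<close> jointly faithful.\<close>

lemma cell_eqI:
  assumes "\<gamma> \<in> Cell2 C" "\<gamma>' \<in> Cell2 C" "Dom2 C \<gamma> = Dom2 C \<gamma>'" "Cod2 C \<gamma> = Cod2 C \<gamma>'"
    "Src C (Dom2 C \<gamma>') = T" "\<gamma> \<star> Id2 C p = \<gamma>' \<star> Id2 C p" "\<gamma> \<star> Id2 C q = \<gamma>' \<star> Id2 C q"
  shows "\<gamma> = \<gamma>'"
proof -
  have "\<exists>!\<delta>. \<delta> \<in> hom2 C (Dom2 C \<gamma>') (Cod2 C \<gamma>') \<and> \<delta> \<star> Id2 C p = \<gamma>' \<star> Id2 C p \<and> \<delta> \<star> Id2 C q = \<gamma>' \<star> Id2 C q"
    by (rule universal2)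
      (use assms(2,5) exchange[OF \<tau>_in, of \<gamma>' "Dom2 C \<gamma>'" "Cod2 C \<gamma>'"] in \<open>simp_all add: hom2_def\<close>)
  then show ?thesis using assms by (auto simp: hom2_def)
qed

text \<open>The inverses of the two restrictions are again compatible with \<open>\<tau>\<close>, so they are the restrictions of a
  2-cell, which is inverse to \<open>\<gamma>\<close> by joint faithfulness.\<close>

lemma invertible2_cellI:
  assumes \<gamma>: "\<gamma> \<in> Cell2 C" and "Src C (Dom2 C \<gamma>) = T"
    and i: "invertible2 C (\<gamma> \<star> Id2 C p)" "invertible2 C (\<gamma> \<star> Id2 C q)"
  shows "invertible2 C \<gamma>"
proof -
  let ?h = "Dom2 C \<gamma>" and ?h' = "Cod2 C \<gamma>"
  let ?a = "vinv (\<gamma> \<star> Id2 C p)" and ?b = "vinv (\<gamma> \<star> Id2 C q)"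
  have T: "Src C ?h = T" "Src C ?h' = T" using assms by simp_all
  note s = vinv_simps(2-4)[OF i(1)] vinv_simps(2-4)[OF i(2)]
  have ex: "(\<gamma> \<star> Id2 C q) \<bullet> (Id2 C ?h \<star> \<tau>) = (Id2 C ?h' \<star> \<tau>) \<bullet> (\<gamma> \<star> Id2 C p)"
    by (rule exchange) (use \<gamma> T in \<open>simp_all add: hom2_def\<close>)
  have "?b \<bullet> (Id2 C ?h' \<star> \<tau>) = ?b \<bullet> (((Id2 C ?h' \<star> \<tau>) \<bullet> (\<gamma> \<star> Id2 C p)) \<bullet> ?a)"
    using \<gamma> T i s by simp
  also have "\<dots> = (Id2 C ?h \<star> \<tau>) \<bullet> ?a"
    unfolding ex[symmetric] using \<gamma> T i s by simp
  finally have "\<exists>!\<delta>. \<delta> \<in> hom2 C ?h' ?h \<and> \<delta> \<star> Id2 C p = ?a \<and> \<delta> \<star> Id2 C q = ?b"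
    by (intro universal2) (use \<gamma> T s in \<open>simp_all add: hom2_def\<close>)
  then obtain \<delta> where \<delta>: "\<delta> \<in> hom2 C ?h' ?h" "\<delta> \<star> Id2 C p = ?a" "\<delta> \<star> Id2 C q = ?b" by blast
  note d = hom2D[OF \<delta>(1)]
  show ?thesis
  proof (rule invertible2I[OF _ \<delta>(1)])
    show "\<gamma> \<in> hom2 C ?h ?h'" using \<gamma> by (simp add: hom2_def)
    show "\<delta> \<bullet> \<gamma> = Id2 C ?h" by (rule cell_eqI) (use \<gamma> T d \<delta>(2,3) i in simp_all)
    show "\<gamma> \<bullet> \<delta> = Id2 C ?h'" by (rule cell_eqI) (use \<gamma> T d \<delta>(2,3) i in simp_all)
  qed
qed

end

lemma iso_of_cats_imp:
  assumes "iso_of_cats A B L"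
  shows "fully_faithful A B L" "bij_betw (FObj L) (Obj A) (Obj B)"
proof -
  from assms obtain R where L: "is_functor A B L" and R: "is_functor B A R"
    and RL: "comp_func R L = id_func A" and LR: "comp_func L R = id_func B"
    unfolding iso_of_cats_def by blast
  note Ls = is_functorD[OF L] and Rs = is_functorD[OF R]
  have o: "FObj R (FObj L x) = x" if "x \<in> Obj A" for x
    using that arg_cong[OF RL, of "\<lambda>K. FObj K x"] Ls by simp
  have o': "FObj L (FObj R y) = y" if "y \<in> Obj B" for y
    using that arg_cong[OF LR, of "\<lambda>K. FObj K y"] Rs by simp
  have a: "FArr R (FArr L f) = f" if "f \<in> Arr A" for f
    using that arg_cong[OF RL, of "\<lambda>K. FArr K f"] Ls by simp
  have a': "FArr L (FArr R g) = g" if "g \<in> Arr B" for g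
    using that arg_cong[OF LR, of "\<lambda>K. FArr K g"] Rs by simp
  show "bij_betw (FObj L) (Obj A) (Obj B)"
    by (rule bij_betwI[where g = "FObj R"]) (use o o' Ls Rs in auto)
  show "fully_faithful A B L"
    unfolding fully_faithful_def
  proof (intro ballI)
    fix x y g assume x: "x \<in> Obj A" and y: "y \<in> Obj A" and g: "g \<in> hom_in B (FObj L x) (FObj L y)"
    show "\<exists>!f. f \<in> hom_in A x y \<and> FArr L f = g"
      by (rule ex1I[of _ "FArr R g"]) (use x y g o a a' Rs in \<open>auto simp: hom_in_def\<close>)
  qed
qed

lemma two_simps [simp]:
  "Obj two = UNIV" "Arr two = {(False, False), (False, True), (True, True)}" "Dom two = fst" "Cod two = snd"
  "Ide two a = (a, a)" "Cmp two g f = (fst f, snd g)"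
  by (auto simp: two_def le_bool_def)

lemma category_two: "category two"
  by (rule category.intro) auto

lemma two_func_eqI:
  assumes "is_functor two D F" "is_functor two D G" "FArr F (False, True) = FArr G (False, True)"
  shows "F = G"
proof -
  note Fs = is_functorD[OF assms(1)] and Gs = is_functorD[OF assms(2)]
  have "FObj F b = FObj G b" for b
    using Fs(9,10)[of "(False, True)"] Gs(9,10)[of "(False, True)"] assms(3) by (cases b) auto
  then show ?thesis
    using Fs(11) Gs(11) assms(3) by (intro func_eqI[OF assms(1,2)]) auto
qed

definition arrow_func :: "('p, 'n) cat \<Rightarrow> 'n \<Rightarrow> (bool, bool \<times> bool, 'p, 'n) func" where
  "arrow_func D f = \<lparr>FDom = two, FCod = D, FObj = (\<lambda>b. if b then Cod D f else Dom D f),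
     FArr = restrict (\<lambda>(a, b). if a then Ide D (Cod D f) else if b then f else Ide D (Dom D f)) (Arr two)\<rparr>"

lemma is_functor_arrow_func:
  assumes "category D" "f \<in> Arr D"
  shows "is_functor two D (arrow_func D f)" "FArr (arrow_func D f) (False, True) = f"
proof -
  interpret D: category D by fact
  show "is_functor two D (arrow_func D f)"
    by (rule is_functorI) (use assms category_two in \<open>auto simp: arrow_func_def\<close>)
  show "FArr (arrow_func D f) (False, True) = f" by (simp add: arrow_func_def)
qed

lemma arrow_tensor_of_tensor:
  assumes C: "two_category C" and Y: "Y \<in> Cell0 C" and tensor: "is_tensor C two Y T \<zeta>"
  shows "arrow_tensor C Y T (FObj \<zeta> False) (FObj \<zeta> True) (FArr \<zeta> (False, True))"
proof -
  interpret C: two_category C by fact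
  let ?p = "FObj \<zeta> False" and ?q = "FObj \<zeta> True" and ?\<tau> = "FArr \<zeta> (False, True)"
  from tensor have T [simp]: "T \<in> Cell0 C" and \<zeta>: "is_functor two (hom_cat C Y T) \<zeta>"
    and iso: "\<And>Z. Z \<in> Cell0 C \<Longrightarrow>
      iso_of_cats (hom_cat C T Z) (func_cat two (hom_cat C Y Z)) (tensor_comparison C two Y T \<zeta> Z)"
    unfolding is_tensor_def by auto
  note [simp] = Y
  note Zs = is_functorD[OF \<zeta>]
  have p: "FObj \<zeta> b \<in> hom1 C Y T" for b using Zs(7)[of b] by simp
  note [simp] = hom1D[OF p]
  have \<tau>: "?\<tau> \<in> hom2 C ?p ?q" using Zs(8-10)[of "(False, True)"] by (simp add: hom2_def)
  note [simp] = hom2D[OF \<tau>]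
  have \<zeta>id: "FArr \<zeta> (b, b) = Id2 C (FObj \<zeta> b)" for b using Zs(11)[of b] by simp
  let ?L = "tensor_comparison C two Y T \<zeta>"
  have post: "is_functor (hom_cat C Y T) (hom_cat C Y Z) (post_func C Y h)" if "h \<in> hom1 C T Z" for h Z
    using hom1D[OF that] by (intro Cat_Cell1D) simp_all
  have L0: "is_functor two (hom_cat C Y Z) (FObj (?L Z) h)"
    "FObj (FObj (?L Z) h) b = h \<odot>\<^bsub>C\<^esub> FObj \<zeta> b"
    "FArr (FObj (?L Z) h) (False, True) = Id2 C h \<star>\<^bsub>C\<^esub> ?\<tau>" if "h \<in> hom1 C T Z" for h Z b
    using that is_functor_comp[OF \<zeta> post[OF that]] hom1D[OF that] Zs(3) p
    by (simp_all add: tensor_comparison_def)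
  have L1: "FArr (?L Z) \<gamma> = hcomp_nat (post_nat C Y \<gamma>) (id_nat \<zeta>)"
    "NAt (FArr (?L Z) \<gamma>) b = \<gamma> \<star>\<^bsub>C\<^esub> Id2 C (FObj \<zeta> b)"
    if h: "h \<in> hom1 C T Z" "h' \<in> hom1 C T Z" "\<gamma> \<in> hom2 C h h'" for h h' \<gamma> Z b
  proof -
    note [simp] = hom1D[OF h(1)] hom1D[OF h(2)] hom2D[OF h(3)]
    show e: "FArr (?L Z) \<gamma> = hcomp_nat (post_nat C Y \<gamma>) (id_nat \<zeta>)"
      using h by (simp add: tensor_comparison_def)
    have n: "NDom (post_nat C Y \<gamma>) = post_func C Y h" "NCod (post_nat C Y \<gamma>) = post_func C Y h'"
      by (simp_all add: post_nat_def)
    show "NAt (FArr (?L Z) \<gamma>) b = \<gamma> \<star>\<^bsub>C\<^esub> Id2 C (FObj \<zeta> b)"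
      unfolding e using Zs(3,4) p[of b] is_functorD(3,4)[OF post[OF h(1)]] by (simp add: n)
  qed
  show ?thesis
  proof (rule arrow_tensor.intro[OF C], rule arrow_tensor_axioms.intro)
    fix \<beta> assume \<beta>: "\<beta> \<in> Cell2 C" "Src C (Dom2 C \<beta>) = Y"
    let ?Z = "Trg C (Dom2 C \<beta>)"
    let ?A = "arrow_func (hom_cat C Y ?Z) \<beta>"
    have Z: "?Z \<in> Cell0 C" using \<beta> by simp
    have \<beta>': "\<beta> \<in> Arr (hom_cat C Y ?Z)" using \<beta> by (simp add: hom1_def)
    note A = is_functor_arrow_func[OF C.category_hom_cat[OF Y Z] \<beta>']
    note bij = iso_of_cats_imp(2)[OF iso[OF Z]]
    have eq: "FObj (?L ?Z) h = ?A \<longleftrightarrow> Id2 C h \<star>\<^bsub>C\<^esub> ?\<tau> = \<beta>" if "h \<in> hom1 C T ?Z" for h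
      using two_func_eqI[OF L0(1)[OF that] A(1)] L0(3)[OF that] A(2) by auto
    have "?A \<in> FObj (?L ?Z) ` hom1 C T ?Z"
      using bij A(1) unfolding bij_betw_def by (simp add: func_cat_def)
    then obtain h where h: "h \<in> hom1 C T ?Z" "?A = FObj (?L ?Z) h" by (rule imageE)
    show "\<exists>!h. h \<in> Cell1 C \<and> Src C h = T \<and> Trg C h = ?Z \<and> Id2 C h \<star>\<^bsub>C\<^esub> ?\<tau> = \<beta>"
    proof (rule ex1I[of _ h])
      show "h \<in> Cell1 C \<and> Src C h = T \<and> Trg C h = ?Z \<and> Id2 C h \<star>\<^bsub>C\<^esub> ?\<tau> = \<beta>"
        using h(1) eq[OF h(1)] h(2)[symmetric] by (simp add: hom1_def)
      fix k assume "k \<in> Cell1 C \<and> Src C k = T \<and> Trg C k = ?Z \<and> Id2 C k \<star>\<^bsub>C\<^esub> ?\<tau> = \<beta>"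
      then have k: "k \<in> hom1 C T ?Z" and "Id2 C k \<star>\<^bsub>C\<^esub> ?\<tau> = \<beta>" by (simp_all add: hom1_def)
      then have "FObj (?L ?Z) k = FObj (?L ?Z) h" using eq[OF k] h(2) by simp
      then show "k = h"
        using inj_onD[OF bij_betw_imp_inj_on[OF bij], of k h] k h(1) by simp
    qed
  next
    fix h h' \<gamma>\<^sub>0 \<gamma>\<^sub>1
    assume hh: "h \<in> Cell1 C" "h' \<in> Cell1 C" "Src C h = T" "Src C h' = T" "Trg C h = Trg C h'"
      and \<gamma>: "\<gamma>\<^sub>0 \<in> hom2 C (h \<odot>\<^bsub>C\<^esub> ?p) (h' \<odot>\<^bsub>C\<^esub> ?p)" "\<gamma>\<^sub>1 \<in> hom2 C (h \<odot>\<^bsub>C\<^esub> ?q) (h' \<odot>\<^bsub>C\<^esub> ?q)"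
      and sq: "\<gamma>\<^sub>1 \<bullet>\<^bsub>C\<^esub> (Id2 C h \<star>\<^bsub>C\<^esub> ?\<tau>) = (Id2 C h' \<star>\<^bsub>C\<^esub> ?\<tau>) \<bullet>\<^bsub>C\<^esub> \<gamma>\<^sub>0"
    let ?Z = "Trg C h'"
    have h: "h \<in> hom1 C T ?Z" "h' \<in> hom1 C T ?Z" and Z: "?Z \<in> Cell0 C" using hh by (auto simp: hom1_def)
    note [simp] = hh hom2D[OF \<gamma>(1)] hom2D[OF \<gamma>(2)]
    let ?F = "FObj (?L ?Z) h" and ?G = "FObj (?L ?Z) h'"
    note F = L0(1)[OF h(1)] and G = L0(1)[OF h(2)]
    note Fs = is_functorD[OF F] and Gs = is_functorD[OF G]
    let ?\<sigma> = "\<lparr>NDom = ?F, NCod = ?G, NAt = (\<lambda>b. if b then \<gamma>\<^sub>1 else \<gamma>\<^sub>0)\<rparr>"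
    have id: "FArr ?F (b, b) = Id2 C (h \<odot>\<^bsub>C\<^esub> FObj \<zeta> b)" "FArr ?G (b, b) = Id2 C (h' \<odot>\<^bsub>C\<^esub> FObj \<zeta> b)" for b
      using Fs(11)[of b] Gs(11)[of b] L0(2)[OF h(1)] L0(2)[OF h(2)] by simp_all
    have \<sigma>: "is_nat two (hom_cat C Y ?Z) ?\<sigma>"
    proof (rule is_natI)
      fix a assume "a \<in> Arr two"
      then consider "a = (False, False)" | "a = (False, True)" | "a = (True, True)" by auto
      then show "FArr (NCod ?\<sigma>) a \<cdot>\<^bsub>hom_cat C Y ?Z\<^esub> NAt ?\<sigma> (Dom two a)
          = NAt ?\<sigma> (Cod two a) \<cdot>\<^bsub>hom_cat C Y ?Z\<^esub> FArr (NDom ?\<sigma>) a"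
        by cases (use sq id L0(3)[OF h(1)] L0(3)[OF h(2)] in simp_all)
    qed (use F G L0(2)[OF h(1)] L0(2)[OF h(2)] in \<open>simp_all add: hom1_def\<close>)
    have inF: "?\<sigma> \<in> hom_in (func_cat two (hom_cat C Y ?Z)) ?F ?G"
      using \<sigma> by (simp add: hom_in_def func_cat_def)
    have eq: "FArr (?L ?Z) \<gamma> = ?\<sigma> \<longleftrightarrow> \<gamma> \<star>\<^bsub>C\<^esub> Id2 C ?p = \<gamma>\<^sub>0 \<and> \<gamma> \<star>\<^bsub>C\<^esub> Id2 C ?q = \<gamma>\<^sub>1" if g: "\<gamma> \<in> hom2 C h h'" for \<gamma>
    proof
      note at = L1(2)[OF h g]
      show "\<gamma> \<star>\<^bsub>C\<^esub> Id2 C ?p = \<gamma>\<^sub>0 \<and> \<gamma> \<star>\<^bsub>C\<^esub> Id2 C ?q = \<gamma>\<^sub>1" if "FArr (?L ?Z) \<gamma> = ?\<sigma>"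
        using at[of False] at[of True] unfolding that by simp
      assume e: "\<gamma> \<star>\<^bsub>C\<^esub> Id2 C ?p = \<gamma>\<^sub>0 \<and> \<gamma> \<star>\<^bsub>C\<^esub> Id2 C ?q = \<gamma>\<^sub>1"
      have "FArr (?L ?Z) \<gamma> \<in> Arr (func_cat two (hom_cat C Y ?Z))"
        "Dom (func_cat two (hom_cat C Y ?Z)) (FArr (?L ?Z) \<gamma>) = ?F"
        "Cod (func_cat two (hom_cat C Y ?Z)) (FArr (?L ?Z) \<gamma>) = ?G"
        using iso[OF Z] is_functorD(8-10)[of _ _ "?L ?Z" \<gamma>] h hom2D[OF g] by (auto simp: iso_of_cats_def)
      then show "FArr (?L ?Z) \<gamma> = ?\<sigma>"
        by (intro nat_eqI[OF _ \<sigma>]) (use at e in \<open>auto simp: func_cat_def\<close>)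
    qed
    have "\<exists>!\<gamma>. \<gamma> \<in> hom2 C h h' \<and> FArr (?L ?Z) \<gamma> = ?\<sigma>"
      using iso_of_cats_imp(1)[OF iso[OF Z]] h inF unfolding fully_faithful_def by (auto simp: hom_in_hom_cat)
    then show "\<exists>!\<gamma>. \<gamma> \<in> hom2 C h h' \<and> \<gamma> \<star>\<^bsub>C\<^esub> Id2 C ?p = \<gamma>\<^sub>0 \<and> \<gamma> \<star>\<^bsub>C\<^esub> Id2 C ?q = \<gamma>\<^sub>1"
      using eq by (metis (lifting))
  qed (use p \<tau> in simp_all)
qed

section \<open>Modifications as pseudo-natural transformations\<close>

lemma Cat_apply1:
  assumes "F \<in> Cell1 Cat" "Trg Cat F = D"
  shows "x \<in> Obj (Src Cat F) \<Longrightarrow> FObj F x \<in> Obj D" "f \<in> Arr (Src Cat F) \<Longrightarrow> FArr F f \<in> Arr D"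
    "f \<in> Arr (Src Cat F) \<Longrightarrow> Dom D (FArr F f) = FObj F (Dom (Src Cat F) f)"
    "f \<in> Arr (Src Cat F) \<Longrightarrow> Cod D (FArr F f) = FObj F (Cod (Src Cat F) f)"
    "x \<in> Obj (Src Cat F) \<Longrightarrow> FArr F (Ide (Src Cat F) x) = Ide D (FObj F x)"
    "\<lbrakk>f \<in> Arr (Src Cat F); g \<in> Arr (Src Cat F); Cod (Src Cat F) f = Dom (Src Cat F) g\<rbrakk>
       \<Longrightarrow> FArr F (g \<cdot>\<^bsub>Src Cat F\<^esub> f) = FArr F g \<cdot>\<^bsub>D\<^esub> FArr F f"
  using is_functorD[OF Cat_Cell1D[OF assms(1) refl assms(2)]] by auto

lemma Cat_Cell2D:
  assumes "\<sigma> \<in> Cell2 Cat" "Src Cat (Dom2 Cat \<sigma>) = A" "Trg Cat (Dom2 Cat \<sigma>) = D"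
  shows "is_nat A D \<sigma>"
  using assms by (auto simp: Cat_simps)

lemma Cat_apply2:
  assumes "\<sigma> \<in> Cell2 Cat" "Src Cat (Dom2 Cat \<sigma>) = A" "Trg Cat (Dom2 Cat \<sigma>) = D"
  shows "x \<in> Obj A \<Longrightarrow> NAt \<sigma> x \<in> Arr D"
    "x \<in> Obj A \<Longrightarrow> Dom D (NAt \<sigma> x) = FObj (Dom2 Cat \<sigma>) x"
    "x \<in> Obj A \<Longrightarrow> Cod D (NAt \<sigma> x) = FObj (Cod2 Cat \<sigma>) x"
    "f \<in> Arr A \<Longrightarrow> FArr (Cod2 Cat \<sigma>) f \<cdot>\<^bsub>D\<^esub> NAt \<sigma> (Dom A f) = NAt \<sigma> (Cod A f) \<cdot>\<^bsub>D\<^esub> FArr (Dom2 Cat \<sigma>) f"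
    "\<lbrakk>invertible2 Cat \<sigma>; x \<in> Obj A\<rbrakk> \<Longrightarrow> is_iso D (NAt \<sigma> x)"
proof -
  note n = is_natD[OF Cat_Cell2D[OF assms]]
  from n(4-7) show at: "x \<in> Obj A \<Longrightarrow> NAt \<sigma> x \<in> Arr D"
    "x \<in> Obj A \<Longrightarrow> Dom D (NAt \<sigma> x) = FObj (Dom2 Cat \<sigma>) x"
    "x \<in> Obj A \<Longrightarrow> Cod D (NAt \<sigma> x) = FObj (Cod2 Cat \<sigma>) x"
    "f \<in> Arr A \<Longrightarrow> FArr (Cod2 Cat \<sigma>) f \<cdot>\<^bsub>D\<^esub> NAt \<sigma> (Dom A f) = NAt \<sigma> (Cod A f) \<cdot>\<^bsub>D\<^esub> FArr (Dom2 Cat \<sigma>) f"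
    for x f by (simp_all add: Cat_simps)
  assume i: "invertible2 Cat \<sigma>" and x: "x \<in> Obj A"
  let ?r = "Cat.vinv \<sigma>"
  have r: "is_nat A D ?r" using i assms by (intro Cat_Cell2D) simp_all
  have sd: "Src Cat (Cod2 Cat \<sigma>) = A" "Trg Cat (Cod2 Cat \<sigma>) = D" using assms by simp_all
  have "NAt (?r \<bullet>\<^bsub>Cat\<^esub> \<sigma>) x = Ide D (FObj (Dom2 Cat \<sigma>) x)" "NAt (\<sigma> \<bullet>\<^bsub>Cat\<^esub> ?r) x = Ide D (FObj (Cod2 Cat \<sigma>) x)"
    using i x assms sd Cat.vinv_simps(5,6)[OF i] by (simp_all add: Cat_eval)
  moreover have "NAt (?r \<bullet>\<^bsub>Cat\<^esub> \<sigma>) x = NAt ?r x \<cdot>\<^bsub>D\<^esub> NAt \<sigma> x" "NAt (\<sigma> \<bullet>\<^bsub>Cat\<^esub> ?r) x = NAt \<sigma> x \<cdot>\<^bsub>D\<^esub> NAt ?r x"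
    using Cat_eval(6)[of x \<sigma> ?r] Cat_eval(6)[of x ?r \<sigma>] i x assms sd
    by (simp_all del: Cat.vinv_simps(5,6))
  ultimately show "is_iso D (NAt \<sigma> x)"
    using at(1-3)[OF x] is_natD(4-6)[OF r x] Cat.vinv_simps(3,4)[OF i] by (intro is_isoI[of _ _ "NAt ?r x"]) (simp_all add: Cat_simps)
qed

text \<open>
  A pseudo-natural transformation \<open>W \<Rightarrow> C(Y, F-)\<close>, seen as a family of 1-cells \<open>Y \<rightarrow> F i\<close> indexed by the
  objects of the categories \<open>W i\<close>, with 2-cells between them.
\<close>

locale cone = F: normal_pseudofunctor A B F + pseudo_natural A Cat \<eta>
  for A :: "('a, 'g, 's) two_cat" and B :: "('b, 'h, 't) two_cat" and F and Y and \<eta> +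
  assumes Y_in: "Y \<in> Cell0 B" and TCod_eq: "TCod \<eta> = hom_psfun A B F Y"
begin

abbreviation W where "W \<equiv> TDom \<eta>"

declare Y_in [simp] TCod_eq [simp]

lemma T0_at:
  assumes i: "i \<in> Cell0 A"
  shows "x \<in> Obj (P0 W i) \<Longrightarrow> FObj (T0 \<eta> i) x \<in> Cell1 B"
    "x \<in> Obj (P0 W i) \<Longrightarrow> Src B (FObj (T0 \<eta> i) x) = Y"
    "x \<in> Obj (P0 W i) \<Longrightarrow> Trg B (FObj (T0 \<eta> i) x) = P0 F i"
    "f \<in> Arr (P0 W i) \<Longrightarrow> FArr (T0 \<eta> i) f \<in> Cell2 B"
    "f \<in> Arr (P0 W i) \<Longrightarrow> Dom2 B (FArr (T0 \<eta> i) f) = FObj (T0 \<eta> i) (Dom (P0 W i) f)"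
    "f \<in> Arr (P0 W i) \<Longrightarrow> Cod2 B (FArr (T0 \<eta> i) f) = FObj (T0 \<eta> i) (Cod (P0 W i) f)"
    "x \<in> Obj (P0 W i) \<Longrightarrow> FArr (T0 \<eta> i) (Ide (P0 W i) x) = Id2 B (FObj (T0 \<eta> i) x)"
    "\<lbrakk>f \<in> Arr (P0 W i); g \<in> Arr (P0 W i); Cod (P0 W i) f = Dom (P0 W i) g\<rbrakk>
       \<Longrightarrow> FArr (T0 \<eta> i) (g \<cdot>\<^bsub>P0 W i\<^esub> f) = FArr (T0 \<eta> i) g \<bullet>\<^bsub>B\<^esub> FArr (T0 \<eta> i) f"
proof -
  have 1: "T0 \<eta> i \<in> Cell1 Cat" "Trg Cat (T0 \<eta> i) = hom_cat B Y (P0 F i)" "Src Cat (T0 \<eta> i) = P0 W i"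
    using i by simp_all
  note a = Cat_apply1[OF 1(1,2), unfolded 1(3) hom_cat_simps]
  show "x \<in> Obj (P0 W i) \<Longrightarrow> FObj (T0 \<eta> i) x \<in> Cell1 B"
    "x \<in> Obj (P0 W i) \<Longrightarrow> Src B (FObj (T0 \<eta> i) x) = Y"
    "x \<in> Obj (P0 W i) \<Longrightarrow> Trg B (FObj (T0 \<eta> i) x) = P0 F i"
    using hom1D[OF a(1)] by auto
  show "f \<in> Arr (P0 W i) \<Longrightarrow> FArr (T0 \<eta> i) f \<in> Cell2 B"
    "f \<in> Arr (P0 W i) \<Longrightarrow> Dom2 B (FArr (T0 \<eta> i) f) = FObj (T0 \<eta> i) (Dom (P0 W i) f)"
    "f \<in> Arr (P0 W i) \<Longrightarrow> Cod2 B (FArr (T0 \<eta> i) f) = FObj (T0 \<eta> i) (Cod (P0 W i) f)"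
    "x \<in> Obj (P0 W i) \<Longrightarrow> FArr (T0 \<eta> i) (Ide (P0 W i) x) = Id2 B (FObj (T0 \<eta> i) x)"
    "\<lbrakk>f \<in> Arr (P0 W i); g \<in> Arr (P0 W i); Cod (P0 W i) f = Dom (P0 W i) g\<rbrakk>
       \<Longrightarrow> FArr (T0 \<eta> i) (g \<cdot>\<^bsub>P0 W i\<^esub> f) = FArr (T0 \<eta> i) g \<bullet>\<^bsub>B\<^esub> FArr (T0 \<eta> i) f"
    using a(2-6) by auto
qed

lemma W_at:
  shows "\<lbrakk>u \<in> Cell1 A; x \<in> Obj (P0 W (Src A u)); Trg A u = j\<rbrakk> \<Longrightarrow> FObj (P1 W u) x \<in> Obj (P0 W j)"
    "\<lbrakk>u \<in> Cell1 A; f \<in> Arr (P0 W (Src A u)); Trg A u = j\<rbrakk> \<Longrightarrow> FArr (P1 W u) f \<in> Arr (P0 W j)"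
    "\<lbrakk>u \<in> Cell1 A; f \<in> Arr (P0 W (Src A u)); Trg A u = j\<rbrakk>
      \<Longrightarrow> Dom (P0 W j) (FArr (P1 W u) f) = FObj (P1 W u) (Dom (P0 W (Src A u)) f)"
    "\<lbrakk>u \<in> Cell1 A; f \<in> Arr (P0 W (Src A u)); Trg A u = j\<rbrakk>
      \<Longrightarrow> Cod (P0 W j) (FArr (P1 W u) f) = FObj (P1 W u) (Cod (P0 W (Src A u)) f)"
    "i \<in> Cell0 A \<Longrightarrow> category (P0 W i)"
  using Cat_apply1[of "P1 W u" "P0 W j"] dom.P_simps(1)[of i] by auto

lemma W2_at:
  assumes m: "m \<in> Cell2 A" and x: "x \<in> Obj (P0 W (Src A (Dom2 A m)))" and j: "Trg A (Dom2 A m) = j"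
  shows "NAt (P2 W m) x \<in> Arr (P0 W j)" "Dom (P0 W j) (NAt (P2 W m) x) = FObj (P1 W (Dom2 A m)) x"
    "Cod (P0 W j) (NAt (P2 W m) x) = FObj (P1 W (Cod2 A m)) x"
  using Cat_apply2(1-3)[of "P2 W m" "P0 W (Src A (Dom2 A m))" "P0 W j" x] assms by simp_all

lemma WPhi_at:
  assumes u: "u \<in> Cell1 A" "v \<in> Cell1 A" "Trg A u = Src A v" and x: "x \<in> Obj (P0 W (Src A u))"
    and k: "Trg A v = k"
  shows "NAt (Phi W u v) x \<in> Arr (P0 W k)"
    "Dom (P0 W k) (NAt (Phi W u v) x) = FObj (P1 W v) (FObj (P1 W u) x)"
    "Cod (P0 W k) (NAt (Phi W u v) x) = FObj (P1 W (v \<odot>\<^bsub>A\<^esub> u)) x"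
  using Cat_apply2(1-3)[of "Phi W u v" "P0 W (Src A u)" "P0 W k" x] assms by (simp_all add: Cat_eval)

lemma T1_at:
  assumes u: "u \<in> Cell1 A"
  shows "x \<in> Obj (P0 W (Src A u)) \<Longrightarrow> NAt (T1 \<eta> u) x \<in> Cell2 B"
    "x \<in> Obj (P0 W (Src A u)) \<Longrightarrow> Dom2 B (NAt (T1 \<eta> u) x) = P1 F u \<odot>\<^bsub>B\<^esub> FObj (T0 \<eta> (Src A u)) x"
    "x \<in> Obj (P0 W (Src A u)) \<Longrightarrow> Cod2 B (NAt (T1 \<eta> u) x) = FObj (T0 \<eta> (Trg A u)) (FObj (P1 W u) x)"
    "x \<in> Obj (P0 W (Src A u)) \<Longrightarrow> invertible2 B (NAt (T1 \<eta> u) x)"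
    "f \<in> Arr (P0 W (Src A u)) \<Longrightarrow>
      FArr (T0 \<eta> (Trg A u)) (FArr (P1 W u) f) \<bullet>\<^bsub>B\<^esub> NAt (T1 \<eta> u) (Dom (P0 W (Src A u)) f)
      = NAt (T1 \<eta> u) (Cod (P0 W (Src A u)) f) \<bullet>\<^bsub>B\<^esub> (Id2 B (P1 F u) \<star>\<^bsub>B\<^esub> FArr (T0 \<eta> (Src A u)) f)"
proof -
  have 1: "T1 \<eta> u \<in> Cell2 Cat" "Src Cat (Dom2 Cat (T1 \<eta> u)) = P0 W (Src A u)"
    "Trg Cat (Dom2 Cat (T1 \<eta> u)) = hom_cat B Y (P0 F (Trg A u))"
    using u by simp_all
  note a = Cat_apply2[OF 1, unfolded hom_cat_simps]
  have h: "FObj (T0 \<eta> (Src A u)) x \<in> hom1 B Y (P0 F (Src A u))" if "x \<in> Obj (P0 W (Src A u))" for x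
    using T0_at(1-3)[OF _ that] u by (simp add: hom1_def)
  have d: "FObj (Dom2 Cat (T1 \<eta> u)) x = P1 F u \<odot>\<^bsub>B\<^esub> FObj (T0 \<eta> (Src A u)) x"
    "FObj (Cod2 Cat (T1 \<eta> u)) x = FObj (T0 \<eta> (Trg A u)) (FObj (P1 W u) x)"
    if "x \<in> Obj (P0 W (Src A u))" for x
    using that u h[OF that] by (simp_all add: Cat_eval)
  show at: "NAt (T1 \<eta> u) x \<in> Cell2 B"
    "Dom2 B (NAt (T1 \<eta> u) x) = P1 F u \<odot>\<^bsub>B\<^esub> FObj (T0 \<eta> (Src A u)) x"
    "Cod2 B (NAt (T1 \<eta> u) x) = FObj (T0 \<eta> (Trg A u)) (FObj (P1 W u) x)"
    if "x \<in> Obj (P0 W (Src A u))" for x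
    using a(1-3)[OF that] d[OF that] by auto
  show "invertible2 B (NAt (T1 \<eta> u) x)" if "x \<in> Obj (P0 W (Src A u))"
  proof -
    have "Dom2 B (NAt (T1 \<eta> u) x) \<in> hom1 B Y (P0 F (Trg A u))" "Cod2 B (NAt (T1 \<eta> u) x) \<in> hom1 B Y (P0 F (Trg A u))"
      "NAt (T1 \<eta> u) x \<in> hom2 B (Dom2 B (NAt (T1 \<eta> u) x)) (Cod2 B (NAt (T1 \<eta> u) x))"
      using a(1)[OF that] by (simp_all add: hom2_def)
    from is_iso_hom_cat[OF this] show ?thesis
      using a(5)[OF T1_invertible[OF u] that] by simp
  qed
  show "FArr (T0 \<eta> (Trg A u)) (FArr (P1 W u) f) \<bullet>\<^bsub>B\<^esub> NAt (T1 \<eta> u) (Dom (P0 W (Src A u)) f)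
      = NAt (T1 \<eta> u) (Cod (P0 W (Src A u)) f) \<bullet>\<^bsub>B\<^esub> (Id2 B (P1 F u) \<star>\<^bsub>B\<^esub> FArr (T0 \<eta> (Src A u)) f)"
    if f: "f \<in> Arr (P0 W (Src A u))"
  proof -
    interpret category "P0 W (Src A u)" using W_at(5) u by simp
    have "FArr (T0 \<eta> (Src A u)) f \<in> Cell2 B" "Dom2 B (FArr (T0 \<eta> (Src A u)) f) \<in> hom1 B Y (P0 F (Src A u))"
      using T0_at(4,5)[OF _ f] h u f by simp_all
    then show ?thesis using a(4)[OF f] f u by (simp add: Cat_eval)
  qed
qed

lemma T1_natural_at:
  assumes m: "m \<in> Cell2 A" and x: "x \<in> Obj (P0 W (Src A (Dom2 A m)))"
  shows "NAt (T1 \<eta> (Cod2 A m)) x \<bullet>\<^bsub>B\<^esub> (P2 F m \<star>\<^bsub>B\<^esub> Id2 B (FObj (T0 \<eta> (Src A (Dom2 A m))) x))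
    = FArr (T0 \<eta> (Trg A (Dom2 A m))) (NAt (P2 W m) x) \<bullet>\<^bsub>B\<^esub> NAt (T1 \<eta> (Dom2 A m)) x"
proof -
  let ?i = "Src A (Dom2 A m)" and ?j = "Trg A (Dom2 A m)"
  have "T1 \<eta> (Cod2 A m) \<bullet>\<^bsub>Cat\<^esub> (P2 (TCod \<eta>) m \<star>\<^bsub>Cat\<^esub> Id2 Cat (T0 \<eta> ?i))
      = (Id2 Cat (T0 \<eta> ?j) \<star>\<^bsub>Cat\<^esub> P2 W m) \<bullet>\<^bsub>Cat\<^esub> T1 \<eta> (Dom2 A m)"
    by (rule T1_natural) (use m in \<open>simp_all add: hom1_def hom2_def\<close>)
  from arg_cong[OF this, of "\<lambda>\<sigma>. NAt \<sigma> x"] show ?thesis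
    using m x T0_at[of ?i] T0_at[of ?j] W_at(1) W2_at[OF m x refl] T1_at(1,2)[of "Dom2 A m" x]
    by (simp add: Cat_eval hom1_def)
qed

lemma T1_Cmp1_at:
  assumes u: "u \<in> Cell1 A" "v \<in> Cell1 A" "Trg A u = Src A v" and x: "x \<in> Obj (P0 W (Src A u))"
  shows "NAt (T1 \<eta> (v \<odot>\<^bsub>A\<^esub> u)) x \<bullet>\<^bsub>B\<^esub> (Phi F u v \<star>\<^bsub>B\<^esub> Id2 B (FObj (T0 \<eta> (Src A u)) x))
    = FArr (T0 \<eta> (Trg A v)) (NAt (Phi W u v) x) \<bullet>\<^bsub>B\<^esub>
      (NAt (T1 \<eta> v) (FObj (P1 W u) x) \<bullet>\<^bsub>B\<^esub> (Id2 B (P1 F v) \<star>\<^bsub>B\<^esub> NAt (T1 \<eta> u) x))"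
proof -
  have "T1 \<eta> (v \<odot>\<^bsub>A\<^esub> u) \<bullet>\<^bsub>Cat\<^esub> (Phi (TCod \<eta>) u v \<star>\<^bsub>Cat\<^esub> Id2 Cat (T0 \<eta> (Src A u)))
      = (Id2 Cat (T0 \<eta> (Trg A v)) \<star>\<^bsub>Cat\<^esub> Phi W u v) \<bullet>\<^bsub>Cat\<^esub> (T1 \<eta> v \<star>\<^bsub>Cat\<^esub> Id2 Cat (P1 W u))
        \<bullet>\<^bsub>Cat\<^esub> (Id2 Cat (P1 (TCod \<eta>) v) \<star>\<^bsub>Cat\<^esub> T1 \<eta> u)"
    by (rule T1_Cmp1) (use u in \<open>simp_all add: hom1_def\<close>)
  from arg_cong[OF this, of "\<lambda>\<sigma>. NAt \<sigma> x"] show ?thesis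
    using u x T0_at[of "Src A u"] T0_at[of "Src A v"] T0_at[of "Trg A v"] W_at(1) WPhi_at[OF u x refl]
      T1_at(1-3)[OF u(1) x] T1_at(1-3)[OF u(2), of "FObj (P1 W u) x"] W_at(5)
      category.Ide_in[of "P0 W (Src A v)" "FObj (P1 W u) x"]
      Cat_apply1(5)[of "P1 W v" "P0 W (Trg A v)" "FObj (P1 W u) x"]
    by (simp add: Cat_eval hom1_def)
qed

end

text \<open>Natural transformations are equal when their components are, so the axioms of a cone amount to
  equations between 2-cells of \<open>B\<close>.\<close>

lemma coneI:
  assumes F: "normal_pseudofunctor A B F" and W: "normal_pseudofunctor A Cat W" and Y: "Y \<in> Cell0 B"
    and D: "TDom \<eta> = W" "TCod \<eta> = hom_psfun A B F Y"
    and ext: "T0 \<eta> \<in> extensional (Cell0 A)" "T1 \<eta> \<in> extensional (Cell1 A)"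
    and T0: "\<And>i. i \<in> Cell0 A \<Longrightarrow> is_functor (P0 W i) (hom_cat B Y (P0 F i)) (T0 \<eta> i)"
    and T1: "\<And>u. u \<in> Cell1 A \<Longrightarrow> is_nat (P0 W (Src A u)) (hom_cat B Y (P0 F (Trg A u))) (T1 \<eta> u)"
      "\<And>u. u \<in> Cell1 A \<Longrightarrow> NDom (T1 \<eta> u) = post_func B Y (P1 F u) \<odot>\<^bsub>Cat\<^esub> T0 \<eta> (Src A u)"
      "\<And>u. u \<in> Cell1 A \<Longrightarrow> NCod (T1 \<eta> u) = T0 \<eta> (Trg A u) \<odot>\<^bsub>Cat\<^esub> P1 W u"
    and inv: "\<And>u x. \<lbrakk>u \<in> Cell1 A; x \<in> Obj (P0 W (Src A u))\<rbrakk> \<Longrightarrow> invertible2 B (NAt (T1 \<eta> u) x)"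
    and nat: "\<And>m x. \<lbrakk>m \<in> Cell2 A; x \<in> Obj (P0 W (Src A (Dom2 A m)))\<rbrakk> \<Longrightarrow>
      NAt (T1 \<eta> (Cod2 A m)) x \<bullet>\<^bsub>B\<^esub> (P2 F m \<star>\<^bsub>B\<^esub> Id2 B (FObj (T0 \<eta> (Src A (Dom2 A m))) x))
      = FArr (T0 \<eta> (Trg A (Dom2 A m))) (NAt (P2 W m) x) \<bullet>\<^bsub>B\<^esub> NAt (T1 \<eta> (Dom2 A m)) x"
    and Cmp: "\<And>u v x. \<lbrakk>u \<in> Cell1 A; v \<in> Cell1 A; Trg A u = Src A v; x \<in> Obj (P0 W (Src A u))\<rbrakk> \<Longrightarrow>
      NAt (T1 \<eta> (v \<odot>\<^bsub>A\<^esub> u)) x \<bullet>\<^bsub>B\<^esub> (Phi F u v \<star>\<^bsub>B\<^esub> Id2 B (FObj (T0 \<eta> (Src A u)) x))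
      = FArr (T0 \<eta> (Trg A v)) (NAt (Phi W u v) x) \<bullet>\<^bsub>B\<^esub>
        (NAt (T1 \<eta> v) (FObj (P1 W u) x) \<bullet>\<^bsub>B\<^esub> (Id2 B (P1 F v) \<star>\<^bsub>B\<^esub> NAt (T1 \<eta> u) x))"
    and Id: "\<And>i x. \<lbrakk>i \<in> Cell0 A; x \<in> Obj (P0 W i)\<rbrakk> \<Longrightarrow> NAt (T1 \<eta> (Id1 A i)) x = Id2 B (FObj (T0 \<eta> i) x)"
  shows "pseudo_natural A Cat \<eta>"
proof -
  interpret F: normal_pseudofunctor A B F by fact
  interpret W: normal_pseudofunctor A Cat W by fact
  note [simp] = Y
  have t0 [simp]: "T0 \<eta> i \<in> Cell1 Cat" "Src Cat (T0 \<eta> i) = P0 W i" "Trg Cat (T0 \<eta> i) = hom_cat B Y (P0 F i)"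
    if "i \<in> Cell0 A" for i using Cat_Cell1I[OF T0[OF that]] by auto
  have t1 [simp]: "T1 \<eta> u \<in> Cell2 Cat" "Dom2 Cat (T1 \<eta> u) = post_func B Y (P1 F u) \<odot>\<^bsub>Cat\<^esub> T0 \<eta> (Src A u)"
    "Cod2 Cat (T1 \<eta> u) = T0 \<eta> (Trg A u) \<odot>\<^bsub>Cat\<^esub> P1 W u"
    if "u \<in> Cell1 A" for u using Cat_Cell2I[OF T1(1)[OF that]] T1(2,3)[OF that] by auto
  have o [simp]: "FObj (T0 \<eta> i) x \<in> Cell1 B" "Src B (FObj (T0 \<eta> i) x) = Y" "Trg B (FObj (T0 \<eta> i) x) = P0 F i"
    if "i \<in> Cell0 A" "x \<in> Obj (P0 W i)" for i x
    using is_functorD(7)[OF T0[OF that(1)] that(2)] by (auto simp: hom1_def)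
  have a: "FArr (T0 \<eta> i) f \<in> Cell2 B" "Dom2 B (FArr (T0 \<eta> i) f) = FObj (T0 \<eta> i) (Dom (P0 W i) f)"
    "Cod2 B (FArr (T0 \<eta> i) f) = FObj (T0 \<eta> i) (Cod (P0 W i) f)" if "i \<in> Cell0 A" "f \<in> Arr (P0 W i)" for i f
    using is_functorD(8-10)[OF T0[OF that(1)] that(2)] by auto
  have ide: "FArr (T0 \<eta> i) (Ide (P0 W i) x) = Id2 B (FObj (T0 \<eta> i) x)" if "i \<in> Cell0 A" "x \<in> Obj (P0 W i)" for i x
    using is_functorD(11)[OF T0[OF that(1)] that(2)] by simp
  have n: "NAt (T1 \<eta> u) x \<in> Cell2 B" "Dom2 B (NAt (T1 \<eta> u) x) = P1 F u \<odot>\<^bsub>B\<^esub> FObj (T0 \<eta> (Src A u)) x"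
    "Cod2 B (NAt (T1 \<eta> u) x) = FObj (T0 \<eta> (Trg A u)) (FObj (P1 W u) x)"
    if "u \<in> Cell1 A" "x \<in> Obj (P0 W (Src A u))" for u x
    using is_natD(4-6)[OF T1(1)[OF that(1)] that(2)] T1(2,3)[OF that(1)] that by (auto simp: Cat_eval hom1_def)
  have Wo: "FObj (P1 W u) x \<in> Obj (P0 W (Trg A u))" if "u \<in> Cell1 A" "x \<in> Obj (P0 W (Src A u))" for u x
    using Cat_apply1(1)[of "P1 W u" "P0 W (Trg A u)" x] that by simp
  show ?thesis
  proof (rule pseudo_natural.intro, unfold D)
    show "normal_pseudofunctor A Cat W" by fact
    show "normal_pseudofunctor A Cat (hom_psfun A B F Y)" by (rule F.normal_pseudofunctor_hom_psfun[OF Y])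
    show "pseudo_natural_axioms A Cat \<eta>"
    proof (rule pseudo_natural_axioms.intro, unfold D)
      show "T0 \<eta> \<in> extensional (Cell0 A)" "T1 \<eta> \<in> extensional (Cell1 A)" by fact+
      show "T0 \<eta> i \<in> hom1 Cat (P0 W i) (P0 (hom_psfun A B F Y) i)" if "i \<in> Cell0 A" for i
        using that by (simp add: hom1_def)
      show "T1 \<eta> u \<in> hom2 Cat (P1 (hom_psfun A B F Y) u \<odot>\<^bsub>Cat\<^esub> T0 \<eta> i) (T0 \<eta> j \<odot>\<^bsub>Cat\<^esub> P1 W u)"
        if "u \<in> hom1 A i j" for u i j
        using hom1D[OF that] by (auto simp: hom2_def)
      show "invertible2 Cat (T1 \<eta> u)" if u: "u \<in> Cell1 A" for u
      proof (rule invertible2_Cat[OF T1(1)[OF u]])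
        fix x assume x: "x \<in> Obj (P0 W (Src A u))"
        have "NAt (T1 \<eta> u) x \<in> Arr (hom_cat B Y (P0 F (Trg A u)))" using is_natD(4)[OF T1(1)[OF u] x] .
        then show "is_iso (hom_cat B Y (P0 F (Trg A u))) (NAt (T1 \<eta> u) x)"
          using inv[OF u x] by (subst is_iso_hom_cat) (auto simp: hom2_def)
      qed
      show "T1 \<eta> v \<bullet>\<^bsub>Cat\<^esub> (P2 (hom_psfun A B F Y) m \<star>\<^bsub>Cat\<^esub> Id2 Cat (T0 \<eta> i))
          = (Id2 Cat (T0 \<eta> j) \<star>\<^bsub>Cat\<^esub> P2 W m) \<bullet>\<^bsub>Cat\<^esub> T1 \<eta> u" if h: "u \<in> hom1 A i j" "m \<in> hom2 A u v" for u i j m v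
      proof -
        note hu = hom1D[OF h(1)] and hm = hom2D[OF h(2)]
        have [simp]: "u \<in> Cell1 A" "v \<in> Cell1 A" "m \<in> Cell2 A" "Dom2 A m = u" "Cod2 A m = v"
          "Src A u = i" "Trg A u = j" "Src A v = i" "Trg A v = j" "i \<in> Cell0 A" "j \<in> Cell0 A"
          using hu hm F.A.Cell2_simps(1,2)[OF hm(1)] F.A.parallel_simps[OF hm(1)]
            F.A.Cell1_simps(1,2)[OF hu(1)] by simp_all
        show ?thesis
        proof (rule Cat_Cell2_eqI)
          fix x assume "x \<in> Obj (Src Cat (Dom2 Cat (T1 \<eta> v \<bullet>\<^bsub>Cat\<^esub> (P2 (hom_psfun A B F Y) m \<star>\<^bsub>Cat\<^esub> Id2 Cat (T0 \<eta> i)))))"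
          then have x: "x \<in> Obj (P0 W i)" by simp
          have w: "NAt (P2 W m) x \<in> Arr (P0 W j)" "Dom (P0 W j) (NAt (P2 W m) x) = FObj (P1 W u) x"
            "Cod (P0 W j) (NAt (P2 W m) x) = FObj (P1 W v) x"
            using Cat_apply2(1-3)[of "P2 W m" "P0 W i" "P0 W j" x] x by simp_all
          show "NAt (T1 \<eta> v \<bullet>\<^bsub>Cat\<^esub> (P2 (hom_psfun A B F Y) m \<star>\<^bsub>Cat\<^esub> Id2 Cat (T0 \<eta> i))) x
              = NAt ((Id2 Cat (T0 \<eta> j) \<star>\<^bsub>Cat\<^esub> P2 W m) \<bullet>\<^bsub>Cat\<^esub> T1 \<eta> u) x"
            using nat[of m x] x w a[OF _ w(1)] n[of u x] n[of v x] Wo[of u x] by (simp add: Cat_eval hom1_def)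
        qed simp_all
      qed
      show "T1 \<eta> (v \<odot>\<^bsub>A\<^esub> u) \<bullet>\<^bsub>Cat\<^esub> (Phi (hom_psfun A B F Y) u v \<star>\<^bsub>Cat\<^esub> Id2 Cat (T0 \<eta> i))
          = (Id2 Cat (T0 \<eta> k) \<star>\<^bsub>Cat\<^esub> Phi W u v) \<bullet>\<^bsub>Cat\<^esub> (T1 \<eta> v \<star>\<^bsub>Cat\<^esub> Id2 Cat (P1 W u))
            \<bullet>\<^bsub>Cat\<^esub> (Id2 Cat (P1 (hom_psfun A B F Y) v) \<star>\<^bsub>Cat\<^esub> T1 \<eta> u)"
        if h: "u \<in> hom1 A i j" "v \<in> hom1 A j k" for u v i j k
      proof -
        note hu = hom1D[OF h(1)] and hv = hom1D[OF h(2)]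
        have [simp]: "u \<in> Cell1 A" "v \<in> Cell1 A" "Src A u = i" "Trg A u = j" "Src A v = j" "Trg A v = k"
          "i \<in> Cell0 A" "j \<in> Cell0 A" "k \<in> Cell0 A"
          using hu hv F.A.Cell1_simps(1,2)[OF hu(1)] F.A.Cell1_simps(1,2)[OF hv(1)] by simp_all
        show ?thesis
        proof (rule Cat_Cell2_eqI)
          fix x assume "x \<in> Obj (Src Cat (Dom2 Cat (T1 \<eta> (v \<odot>\<^bsub>A\<^esub> u) \<bullet>\<^bsub>Cat\<^esub> (Phi (hom_psfun A B F Y) u v \<star>\<^bsub>Cat\<^esub> Id2 Cat (T0 \<eta> i)))))"
          then have x: "x \<in> Obj (P0 W i)" by simp
          have w: "NAt (Phi W u v) x \<in> Arr (P0 W k)" "Dom (P0 W k) (NAt (Phi W u v) x) = FObj (P1 W v) (FObj (P1 W u) x)"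
            "Cod (P0 W k) (NAt (Phi W u v) x) = FObj (P1 W (v \<odot>\<^bsub>A\<^esub> u)) x"
            using Cat_apply2(1-3)[of "Phi W u v" "P0 W i" "P0 W k" x] x by (simp_all add: Cat_eval)
          have Wx: "FObj (P1 W u) x \<in> Obj (P0 W j)" "FObj (P1 W v) (FObj (P1 W u) x) \<in> Obj (P0 W k)"
            using Wo[of u x] Wo[of v "FObj (P1 W u) x"] x by simp_all
          interpret Wj: category "P0 W j" using W.P_simps(1)[of j] by simp
          show "NAt (T1 \<eta> (v \<odot>\<^bsub>A\<^esub> u) \<bullet>\<^bsub>Cat\<^esub> (Phi (hom_psfun A B F Y) u v \<star>\<^bsub>Cat\<^esub> Id2 Cat (T0 \<eta> i))) x
              = NAt ((Id2 Cat (T0 \<eta> k) \<star>\<^bsub>Cat\<^esub> Phi W u v) \<bullet>\<^bsub>Cat\<^esub> (T1 \<eta> v \<star>\<^bsub>Cat\<^esub> Id2 Cat (P1 W u))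
            \<bullet>\<^bsub>Cat\<^esub> (Id2 Cat (P1 (hom_psfun A B F Y) v) \<star>\<^bsub>Cat\<^esub> T1 \<eta> u)) x"
            using Cmp[of u v x] x w a[OF _ w(1)] n[of u x] n[of v "FObj (P1 W u) x"] Wx ide[of k] Cat_apply1(5)[of "P1 W v" "P0 W k"]
            by (simp add: Cat_eval hom1_def)
        qed simp_all
      qed
      show "T1 \<eta> (Id1 A i) = Id2 Cat (T0 \<eta> i)" if i: "i \<in> Cell0 A" for i
        by (rule Cat_Cell2_eqI) (use i Id[OF i] in \<open>simp_all add: Cat_eval F.B.post_func_Id1\<close>)
    qed
  qed
qed

lemma (in cone) precomp_at:
  assumes r: "r \<in> Cell1 B" "Trg B r = Y"
  shows "\<lbrakk>i \<in> Cell0 A; x \<in> Obj (P0 W i)\<rbrakk>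
      \<Longrightarrow> FObj (T0 (ps_comp A Cat (hom_pstrans A B F r) \<eta>) i) x = FObj (T0 \<eta> i) x \<odot>\<^bsub>B\<^esub> r"
    "\<lbrakk>i \<in> Cell0 A; f \<in> Arr (P0 W i)\<rbrakk>
      \<Longrightarrow> FArr (T0 (ps_comp A Cat (hom_pstrans A B F r) \<eta>) i) f = FArr (T0 \<eta> i) f \<star>\<^bsub>B\<^esub> Id2 B r"
    "\<lbrakk>u \<in> Cell1 A; x \<in> Obj (P0 W (Src A u))\<rbrakk>
      \<Longrightarrow> NAt (T1 (ps_comp A Cat (hom_pstrans A B F r) \<eta>) u) x = NAt (T1 \<eta> u) x \<star>\<^bsub>B\<^esub> Id2 B r"
    "cone A B F (Src B r) (ps_comp A Cat (hom_pstrans A B F r) \<eta>)"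
proof -
  note [simp] = r
  show 1: "FObj (T0 (ps_comp A Cat (hom_pstrans A B F r) \<eta>) i) x = FObj (T0 \<eta> i) x \<odot>\<^bsub>B\<^esub> r"
    if "i \<in> Cell0 A" "x \<in> Obj (P0 W i)" for i x
    using that T0_at[of i] by (simp add: Cat_eval hom1_def)
  show "FArr (T0 (ps_comp A Cat (hom_pstrans A B F r) \<eta>) i) f = FArr (T0 \<eta> i) f \<star>\<^bsub>B\<^esub> Id2 B r"
    if i: "i \<in> Cell0 A" and f: "f \<in> Arr (P0 W i)" for i f
  proof -
    interpret category "P0 W i" using W_at(5)[OF i] .
    show ?thesis using i f T0_at[OF i] by (simp add: Cat_eval hom1_def)
  qed
  show "NAt (T1 (ps_comp A Cat (hom_pstrans A B F r) \<eta>) u) x = NAt (T1 \<eta> u) x \<star>\<^bsub>B\<^esub> Id2 B r"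
    if u: "u \<in> Cell1 A" and x: "x \<in> Obj (P0 W (Src A u))" for u x
  proof -
    have o: "FObj (T0 \<eta> (Src A u)) x \<in> hom1 B Y (P0 F (Src A u))"
      using T0_at(1-3)[of "Src A u" x] u x by (simp add: hom1_def)
    show ?thesis
      using u x hom1D[OF o] T1_at(1-3)[OF u x] by (simp add: Cat_eval hom1_def)
  qed
  show "cone A B F (Src B r) (ps_comp A Cat (hom_pstrans A B F r) \<eta>)"
    by (intro cone.intro cone_axioms.intro F.normal_pseudofunctor_axioms pseudo_natural_comp
        pseudo_natural_axioms F.pseudo_natural_hom_pstrans) simp_all
qed

lemma (in cone) whisker_hom_modif_at:
  assumes "\<alpha> \<in> Cell2 B" "Trg B (Dom2 B \<alpha>) = Y" "i \<in> Cell0 A" "x \<in> Obj (P0 W i)"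
  shows "NAt (MAt (hom_modif A B F \<alpha> \<star>\<^bsub>Ps A Cat\<^esub> Id2 (Ps A Cat) \<eta>) i) x = Id2 B (FObj (T0 \<eta> i) x) \<star>\<^bsub>B\<^esub> \<alpha>"
  using assms T0_at[OF assms(3)] by (simp add: Ps_simps Cat_eval hom1_def)

lemma cone_eqI:
  assumes "cone A B F Y \<eta>" "cone A B F Y \<theta>" and D: "TDom \<eta> = TDom \<theta>"
    and 0: "\<And>i x. \<lbrakk>i \<in> Cell0 A; x \<in> Obj (P0 (TDom \<theta>) i)\<rbrakk> \<Longrightarrow> FObj (T0 \<eta> i) x = FObj (T0 \<theta> i) x"
    "\<And>i f. \<lbrakk>i \<in> Cell0 A; f \<in> Arr (P0 (TDom \<theta>) i)\<rbrakk> \<Longrightarrow> FArr (T0 \<eta> i) f = FArr (T0 \<theta> i) f"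
    and 1: "\<And>u x. \<lbrakk>u \<in> Cell1 A; x \<in> Obj (P0 (TDom \<theta>) (Src A u))\<rbrakk> \<Longrightarrow> NAt (T1 \<eta> u) x = NAt (T1 \<theta> u) x"
  shows "\<eta> = \<theta>"
proof -
  interpret e: cone A B F Y \<eta> by fact
  interpret t: cone A B F Y \<theta> by fact
  have T0: "T0 \<eta> i = T0 \<theta> i" if "i \<in> Cell0 A" for i
    by (rule Cat_Cell1_eqI) (use that D 0 in simp_all)
  show ?thesis
  proof (rule pstrans_eqI[OF e.pseudo_natural_axioms t.pseudo_natural_axioms D])
    show "T1 \<eta> u = T1 \<theta> u" if "u \<in> Cell1 A" for u
      by (rule Cat_Cell2_eqI) (use that D 1 T0 in simp_all)
  qed (use T0 in simp_all)
qed

text \<open>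
  For the universal 2-cell \<open>\<tau> : p \<Rightarrow> q : Y \<rightarrow> T\<close>, a modification between cones with vertex \<open>Y\<close> is the same as
  a single cone with vertex \<open>T\<close>: its 1-cell at \<open>x\<close> is the one that classifies the component of the
  modification at \<open>x\<close>, and its 2-cells are induced by those of the two given cones, compatibility with \<open>\<tau>\<close>
  being the naturality of the modification. The axioms of a cone hold because they hold after
  restriction along \<open>p\<close> and along \<open>q\<close>.
\<close>

lemma modification_eq_cone:
  assumes F: "normal_pseudofunctor A B F" and tensor: "arrow_tensor B Y T p q \<tau>"
    and \<mu>: "modification A Cat \<mu>" and cod: "TCod (MDom \<mu>) = hom_psfun A B F Y" and dom: "TDom (MDom \<mu>) = W"
  shows "\<exists>!\<kappa>. \<kappa> \<in> hom1 (Ps A Cat) W (hom_psfun A B F T) \<and>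
    hom_modif A B F \<tau> \<star>\<^bsub>Ps A Cat\<^esub> Id2 (Ps A Cat) \<kappa> = \<mu>"
proof -
  interpret F: normal_pseudofunctor A B F by fact
  interpret B: arrow_tensor B Y T p q \<tau> by fact
  interpret M: modification A Cat \<mu> by fact
  define \<eta> \<theta> where \<eta>_def: "\<eta> = MDom \<mu>" and \<theta>_def: "\<theta> = MCod \<mu>"
  have D [simp]: "TDom \<eta> = W" "TDom \<theta> = W" "TCod \<eta> = hom_psfun A B F Y" "TCod \<theta> = hom_psfun A B F Y"
    using cod dom M.TDom_eq M.TCod_eq by (simp_all add: \<eta>_def \<theta>_def)
  interpret e: cone A B F Y \<eta>
    by (intro cone.intro cone_axioms.intro F) (use M.dom.pseudo_natural_axioms in \<open>simp_all add: \<eta>_def[symmetric]\<close>)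
  interpret t: cone A B F Y \<theta>
    by (intro cone.intro cone_axioms.intro F) (use M.cod.pseudo_natural_axioms in \<open>simp_all add: \<theta>_def[symmetric]\<close>)
  note W = e.dom.normal_pseudofunctor_axioms[unfolded D]
  interpret W: normal_pseudofunctor A Cat W by (rule W)
  note fold_\<mu> [simp] = \<eta>_def[symmetric] \<theta>_def[symmetric]
  note Wat = e.W_at[unfolded D] and W2at = e.W2_at[unfolded D] and WPhi = e.WPhi_at[unfolded D]
  note e0 = e.T0_at[unfolded D] and e1 = e.T1_at[unfolded D] and t0 = t.T0_at[unfolded D] and t1 = t.T1_at[unfolded D]
  let ?m = "\<lambda>i x. NAt (MAt \<mu> i) x"
  have M2: "MAt \<mu> i \<in> Cell2 Cat" "Dom2 Cat (MAt \<mu> i) = T0 \<eta> i" "Cod2 Cat (MAt \<mu> i) = T0 \<theta> i"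
    if "i \<in> Cell0 A" for i using M.MAt_simps[OF that] by simp_all
  have m: "?m i x \<in> Cell2 B" "Dom2 B (?m i x) = FObj (T0 \<eta> i) x" "Cod2 B (?m i x) = FObj (T0 \<theta> i) x"
    if "i \<in> Cell0 A" "x \<in> Obj (P0 W i)" for i x
    using Cat_apply2(1-3)[OF M2(1)[OF that(1)], of "P0 W i" "hom_cat B Y (P0 F i)" x] that M2(2,3)[OF that(1)]
    by auto
  have m_nat: "FArr (T0 \<theta> i) f \<bullet>\<^bsub>B\<^esub> ?m i (Dom (P0 W i) f) = ?m i (Cod (P0 W i) f) \<bullet>\<^bsub>B\<^esub> FArr (T0 \<eta> i) f"
    if "i \<in> Cell0 A" "f \<in> Arr (P0 W i)" for i f
    using Cat_apply2(4)[OF M2(1)[OF that(1)], of "P0 W i" "hom_cat B Y (P0 F i)" f] that M2(2,3)[OF that(1)]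
    by simp
  have m_T1: "NAt (T1 \<theta> u) x \<bullet>\<^bsub>B\<^esub> (Id2 B (P1 F u) \<star>\<^bsub>B\<^esub> ?m (Src A u) x)
      = ?m (Trg A u) (FObj (P1 W u) x) \<bullet>\<^bsub>B\<^esub> NAt (T1 \<eta> u) x"
    if u: "u \<in> Cell1 A" and x: "x \<in> Obj (P0 W (Src A u))" for u x
  proof -
    have "T1 \<theta> u \<bullet>\<^bsub>Cat\<^esub> (Id2 Cat (P1 (TCod \<eta>) u) \<star>\<^bsub>Cat\<^esub> MAt \<mu> (Src A u))
        = (MAt \<mu> (Trg A u) \<star>\<^bsub>Cat\<^esub> Id2 Cat (P1 (TDom \<eta>) u)) \<bullet>\<^bsub>Cat\<^esub> T1 \<eta> u"
      unfolding \<eta>_def \<theta>_def by (rule M.MAt_natural) (use u in \<open>simp add: hom1_def\<close>)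
    from arg_cong[OF this, of "\<lambda>\<sigma>. NAt \<sigma> x"] show ?thesis
      using u x M2[of "Src A u"] M2[of "Trg A u"] m[of "Src A u" x] m[of "Trg A u" "FObj (P1 W u) x"]
        Wat(1)[OF u x refl] e0[of "Src A u"] e0[of "Trg A u"] t0[of "Trg A u"] e1(1-3)[OF u x]
      by (simp add: Cat_eval hom1_def)
  qed
  \<comment> \<open>the 1-cells of the new cone, and its 2-cells at arrows of \<open>W i\<close> and at 1-cells of the index 2-category\<close>
  let ?H = "\<lambda>i x. B.lift1 (?m i x)"
  have H [simp]: "?H i x \<in> Cell1 B" "Src B (?H i x) = T" "Trg B (?H i x) = P0 F i"
    "?H i x \<odot>\<^bsub>B\<^esub> p = FObj (T0 \<eta> i) x" "?H i x \<odot>\<^bsub>B\<^esub> q = FObj (T0 \<theta> i) x" "Id2 B (?H i x) \<star>\<^bsub>B\<^esub> \<tau> = ?m i x"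
    if "i \<in> Cell0 A" "x \<in> Obj (P0 W i)" for i x
    using B.lift1[of "?m i x"] m[OF that] e0[OF that(1)] that by simp_all
  let ?Ka = "\<lambda>i f. B.lift2 (?H i (Dom (P0 W i) f)) (?H i (Cod (P0 W i) f)) (FArr (T0 \<eta> i) f) (FArr (T0 \<theta> i) f)"
  have Ka: "?Ka i f \<in> hom2 B (?H i (Dom (P0 W i) f)) (?H i (Cod (P0 W i) f))"
    "?Ka i f \<star>\<^bsub>B\<^esub> Id2 B p = FArr (T0 \<eta> i) f" "?Ka i f \<star>\<^bsub>B\<^esub> Id2 B q = FArr (T0 \<theta> i) f"
    if i: "i \<in> Cell0 A" and f: "f \<in> Arr (P0 W i)" for i f
  proof -
    interpret category "P0 W i" using Wat(5)[OF i] .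
    show "?Ka i f \<in> hom2 B (?H i (Dom (P0 W i) f)) (?H i (Cod (P0 W i) f))"
      "?Ka i f \<star>\<^bsub>B\<^esub> Id2 B p = FArr (T0 \<eta> i) f" "?Ka i f \<star>\<^bsub>B\<^esub> Id2 B q = FArr (T0 \<theta> i) f"
      by (rule B.lift2; use i f m_nat[OF i f] e0[OF i] t0[OF i] in \<open>simp add: hom2_def\<close>)+
  qed
  let ?Kt = "\<lambda>u x. B.lift2 (P1 F u \<odot>\<^bsub>B\<^esub> ?H (Src A u) x) (?H (Trg A u) (FObj (P1 W u) x))
    (NAt (T1 \<eta> u) x) (NAt (T1 \<theta> u) x)"
  have Kt: "?Kt u x \<in> hom2 B (P1 F u \<odot>\<^bsub>B\<^esub> ?H (Src A u) x) (?H (Trg A u) (FObj (P1 W u) x))"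
    "?Kt u x \<star>\<^bsub>B\<^esub> Id2 B p = NAt (T1 \<eta> u) x" "?Kt u x \<star>\<^bsub>B\<^esub> Id2 B q = NAt (T1 \<theta> u) x"
    if u: "u \<in> Cell1 A" and x: "x \<in> Obj (P0 W (Src A u))" for u x
  proof -
    have H': "Id2 B (P1 F u \<odot>\<^bsub>B\<^esub> ?H (Src A u) x) \<star>\<^bsub>B\<^esub> \<tau> = Id2 B (P1 F u) \<star>\<^bsub>B\<^esub> ?m (Src A u) x"
      using u x F.B.whisker_simps(3)[of \<tau> "?H (Src A u) x" "P1 F u"] by simp
    show "?Kt u x \<in> hom2 B (P1 F u \<odot>\<^bsub>B\<^esub> ?H (Src A u) x) (?H (Trg A u) (FObj (P1 W u) x))"
      "?Kt u x \<star>\<^bsub>B\<^esub> Id2 B p = NAt (T1 \<eta> u) x" "?Kt u x \<star>\<^bsub>B\<^esub> Id2 B q = NAt (T1 \<theta> u) x"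
      by (rule B.lift2; use u x m_T1[OF u x] H' Wat(1)[OF u x refl] e1(1-3)[OF u x] t1(1-3)[OF u x] in
          \<open>simp add: hom2_def\<close>)+
  qed
  define K0 where "K0 = (\<lambda>i\<in>Cell0 A. \<lparr>FDom = P0 W i, FCod = hom_cat B T (P0 F i),
     FObj = restrict (?H i) (Obj (P0 W i)), FArr = restrict (?Ka i) (Arr (P0 W i))\<rparr>)"
  define K1 where "K1 = (\<lambda>u\<in>Cell1 A. \<lparr>NDom = post_func B T (P1 F u) \<odot>\<^bsub>Cat\<^esub> K0 (Src A u),
     NCod = K0 (Trg A u) \<odot>\<^bsub>Cat\<^esub> P1 W u, NAt = restrict (?Kt u) (Obj (P0 W (Src A u)))\<rparr>)"
  define \<kappa> where "\<kappa> = \<lparr>TDom = W, TCod = hom_psfun A B F T, T0 = K0, T1 = K1\<rparr>"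
  have \<kappa>0: "FDom (K0 i) = P0 W i" "FCod (K0 i) = hom_cat B T (P0 F i)"
    "x \<in> Obj (P0 W i) \<Longrightarrow> FObj (K0 i) x = ?H i x" "f \<in> Arr (P0 W i) \<Longrightarrow> FArr (K0 i) f = ?Ka i f"
    if "i \<in> Cell0 A" for i x f using that by (simp_all add: K0_def)
  have K0_func: "is_functor (P0 W i) (hom_cat B T (P0 F i)) (K0 i)" if i: "i \<in> Cell0 A" for i
  proof (rule is_functorI)
    interpret category "P0 W i" using Wat(5)[OF i] .
    show "category (P0 W i)" by (rule category_axioms)
    fix x assume x: "x \<in> Obj (P0 W i)"
    show "FArr (K0 i) (Ide (P0 W i) x) = Ide (hom_cat B T (P0 F i)) (FObj (K0 i) x)"
    proof -
      have f: "Ide (P0 W i) x \<in> Arr (P0 W i)" using x by simp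
      have "?Ka i (Ide (P0 W i) x) = Id2 B (?H i x)"
        by (rule B.cell_eqI)
          (use x i Ka(2,3)[OF i f] hom2D[OF Ka(1)[OF i f]] e0(7)[OF i x] t0(7)[OF i x] in simp_all)
      then show ?thesis using x i f \<kappa>0 by simp
    qed
  next
    interpret category "P0 W i" using Wat(5)[OF i] .
    fix f g assume f: "f \<in> Arr (P0 W i)" and g: "g \<in> Arr (P0 W i)" and fg: "Cod (P0 W i) f = Dom (P0 W i) g"
    have gf: "g \<cdot>\<^bsub>P0 W i\<^esub> f \<in> Arr (P0 W i)" using f g fg by simp
    have "?Ka i (g \<cdot>\<^bsub>P0 W i\<^esub> f) = ?Ka i g \<bullet>\<^bsub>B\<^esub> ?Ka i f"
    proof (rule B.cell_eqI)
      show "?Ka i (g \<cdot>\<^bsub>P0 W i\<^esub> f) \<star>\<^bsub>B\<^esub> Id2 B p = (?Ka i g \<bullet>\<^bsub>B\<^esub> ?Ka i f) \<star>\<^bsub>B\<^esub> Id2 B p"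
        "?Ka i (g \<cdot>\<^bsub>P0 W i\<^esub> f) \<star>\<^bsub>B\<^esub> Id2 B q = (?Ka i g \<bullet>\<^bsub>B\<^esub> ?Ka i f) \<star>\<^bsub>B\<^esub> Id2 B q"
        unfolding Ka(2,3)[OF i gf]
        using i f g fg Ka(2,3)[OF i f] Ka(2,3)[OF i g] hom2D[OF Ka(1)[OF i f]] hom2D[OF Ka(1)[OF i g]]
          e0(8)[OF i f g fg] t0(8)[OF i f g fg] by simp_all
    qed (use i f g fg gf hom2D[OF Ka(1)[OF i f]] hom2D[OF Ka(1)[OF i g]] hom2D[OF Ka(1)[OF i gf]] in simp_all)
    then show "FArr (K0 i) (g \<cdot>\<^bsub>P0 W i\<^esub> f) = FArr (K0 i) g \<cdot>\<^bsub>hom_cat B T (P0 F i)\<^esub> FArr (K0 i) f"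
      using i f g gf \<kappa>0 by simp
  qed (use i \<kappa>0[OF i] hom2D[OF Ka(1)[OF i]] category.Dom_in[OF Wat(5)[OF i]] category.Cod_in[OF Wat(5)[OF i]] in
      \<open>simp_all add: hom1_def\<close>, simp_all add: K0_def)
  note K0c = Cat_Cell1I[OF K0_func]
  have [simp]: "K0 i \<in> Cell1 Cat" "Src Cat (K0 i) = P0 W i" "Trg Cat (K0 i) = hom_cat B T (P0 F i)"
    if "i \<in> Cell0 A" for i using K0c[OF that] by auto
  have Hh: "?H i x \<in> hom1 B T (P0 F i)" if "i \<in> Cell0 A" "x \<in> Obj (P0 W i)" for i x
    using H[OF that] by (simp add: hom1_def)
  have \<kappa>1: "NDom (K1 u) = post_func B T (P1 F u) \<odot>\<^bsub>Cat\<^esub> K0 (Src A u)" "NCod (K1 u) = K0 (Trg A u) \<odot>\<^bsub>Cat\<^esub> P1 W u"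
    "x \<in> Obj (P0 W (Src A u)) \<Longrightarrow> NAt (K1 u) x = ?Kt u x" if "u \<in> Cell1 A" for u x
    using that by (simp_all add: K1_def)
  have ND: "FObj (NDom (K1 u)) x = P1 F u \<odot>\<^bsub>B\<^esub> ?H (Src A u) x" "FObj (NCod (K1 u)) x = ?H (Trg A u) (FObj (P1 W u) x)"
    if "u \<in> Cell1 A" "x \<in> Obj (P0 W (Src A u))" for u x
    using that Wat(1)[OF that refl] Hh[of "Src A u" x] by (simp_all add: \<kappa>1 Cat_eval \<kappa>0)
  have natu: "is_nat (P0 W (Src A u)) (hom_cat B T (P0 F (Trg A u))) (K1 u)" if u: "u \<in> Cell1 A" for u
  proof (rule is_natI)
    let ?i = "Src A u" and ?j = "Trg A u"
    interpret category "P0 W ?i" using Wat(5) u by simp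
    show "is_functor (P0 W ?i) (hom_cat B T (P0 F ?j)) (NDom (K1 u))"
      "is_functor (P0 W ?i) (hom_cat B T (P0 F ?j)) (NCod (K1 u))"
      using u by (auto simp: \<kappa>1 intro!: Cat_Cell1D)
    show "NAt (K1 u) \<in> extensional (Obj (P0 W ?i))" using u by (simp add: K1_def)
    fix f assume f: "f \<in> Arr (P0 W ?i)"
    let ?x = "Dom (P0 W ?i) f" and ?y = "Cod (P0 W ?i) f"
    have xy: "?x \<in> Obj (P0 W ?i)" "?y \<in> Obj (P0 W ?i)" using f by simp_all
    have ij: "?i \<in> Cell0 A" "?j \<in> Cell0 A" using u by simp_all
    note Wf = Wat(2-4)[OF u f refl] and Wxy = Wat(1)[OF u xy(1) refl] Wat(1)[OF u xy(2) refl]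
    note a = Ka(2,3)[OF ij(1) f] hom2D[OF Ka(1)[OF ij(1) f]] Ka(2,3)[OF ij(2) Wf(1)] hom2D[OF Ka(1)[OF ij(2) Wf(1)]]
    note b = Kt(2,3)[OF u xy(1)] Kt(2,3)[OF u xy(2)] hom2D[OF Kt(1)[OF u xy(1)]] hom2D[OF Kt(1)[OF u xy(2)]]
    have "?Ka ?j (FArr (P1 W u) f) \<bullet>\<^bsub>B\<^esub> ?Kt u ?x = ?Kt u ?y \<bullet>\<^bsub>B\<^esub> (Id2 B (P1 F u) \<star>\<^bsub>B\<^esub> ?Ka ?i f)"
      by (rule B.cell_eqI)
        (use u xy ij Wf Wxy a b e1(5)[OF u f] t1(5)[OF u f] in simp_all)
    then show "FArr (NCod (K1 u)) f \<cdot>\<^bsub>hom_cat B T (P0 F ?j)\<^esub> NAt (K1 u) ?x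
        = NAt (K1 u) ?y \<cdot>\<^bsub>hom_cat B T (P0 F ?j)\<^esub> FArr (NDom (K1 u)) f"
      using u f xy ij Wf a Hh[OF ij(1) xy(1)] by (simp add: \<kappa>1 Cat_eval \<kappa>0)
  qed (use that in \<open>simp_all add: \<kappa>1(3) ND hom2D[OF Kt(1)] hom1_def Wat(1)\<close>)
  have pn: "pseudo_natural A Cat \<kappa>"
  proof (rule coneI[OF F W B.T_in])
    show "T0 \<kappa> \<in> extensional (Cell0 A)" "T1 \<kappa> \<in> extensional (Cell1 A)" by (simp_all add: \<kappa>_def K0_def K1_def)
    show "invertible2 B (NAt (T1 \<kappa> u) x)" if u: "u \<in> Cell1 A" "x \<in> Obj (P0 W (Src A u))" for u x
      using u hom2D[OF Kt(1)[OF u]] Kt(2,3)[OF u] e1(4)[OF u] t1(4)[OF u]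
      by - (rule B.invertible2_cellI, simp_all add: \<kappa>_def \<kappa>1(3))
  next
    fix mm x assume mm: "mm \<in> Cell2 A" and x: "x \<in> Obj (P0 W (Src A (Dom2 A mm)))"
    let ?u = "Dom2 A mm" and ?v = "Cod2 A mm"
    let ?i = "Src A ?u" and ?j = "Trg A ?u"
    have uv: "?u \<in> Cell1 A" "?v \<in> Cell1 A" "Src A ?v = ?i" "Trg A ?v = ?j" "?i \<in> Cell0 A" "?j \<in> Cell0 A"
      using mm by simp_all
    have xv: "x \<in> Obj (P0 W (Src A ?v))" using x uv by simp
    note w = W2at[OF mm x refl]
    note W1 = Wat(1)[OF uv(1) x refl] Wat(1)[OF uv(2) xv uv(4)]
    note a = Ka(2,3)[OF uv(6) w(1)] hom2D[OF Ka(1)[OF uv(6) w(1)]]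
    note b = Kt(2,3)[OF uv(1) x] Kt(2,3)[OF uv(2) xv] hom2D[OF Kt(1)[OF uv(1) x]] hom2D[OF Kt(1)[OF uv(2) xv]]
    have "?Kt ?v x \<bullet>\<^bsub>B\<^esub> (P2 F mm \<star>\<^bsub>B\<^esub> Id2 B (?H ?i x)) = ?Ka ?j (NAt (P2 W mm) x) \<bullet>\<^bsub>B\<^esub> ?Kt ?u x"
      by (rule B.cell_eqI)
        (use mm x uv w W1 a b e.T1_natural_at[unfolded D, OF mm x] t.T1_natural_at[unfolded D, OF mm x] in simp_all)
    then show "NAt (T1 \<kappa> ?v) x \<bullet>\<^bsub>B\<^esub> (P2 F mm \<star>\<^bsub>B\<^esub> Id2 B (FObj (T0 \<kappa> ?i) x))
        = FArr (T0 \<kappa> ?j) (NAt (P2 W mm) x) \<bullet>\<^bsub>B\<^esub> NAt (T1 \<kappa> ?u) x"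
      using uv x w by (simp add: \<kappa>_def \<kappa>0 \<kappa>1)
  next
    fix u v x assume uv: "u \<in> Cell1 A" "v \<in> Cell1 A" "Trg A u = Src A v" and x: "x \<in> Obj (P0 W (Src A u))"
    let ?i = "Src A u" and ?j = "Src A v" and ?k = "Trg A v" and ?y = "FObj (P1 W u) x"
    have ijk: "?i \<in> Cell0 A" "?j \<in> Cell0 A" "?k \<in> Cell0 A" using uv by simp_all
    have vu: "v \<odot>\<^bsub>A\<^esub> u \<in> Cell1 A" "x \<in> Obj (P0 W (Src A (v \<odot>\<^bsub>A\<^esub> u)))" using uv x by simp_all
    have y: "?y \<in> Obj (P0 W ?j)" using Wat(1)[OF uv(1) x uv(3)] .
    have z: "FObj (P1 W v) ?y \<in> Obj (P0 W ?k)" "FObj (P1 W (v \<odot>\<^bsub>A\<^esub> u)) x \<in> Obj (P0 W ?k)"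
      using Wat(1)[OF uv(2) y refl] Wat(1)[OF vu, of ?k] uv by simp_all
    note w = WPhi[OF uv x refl]
    note a = Ka(2,3)[OF ijk(3) w(1)] hom2D[OF Ka(1)[OF ijk(3) w(1)]]
    note b = Kt(2,3)[OF uv(1) x] Kt(2,3)[OF uv(2) y] Kt(2,3)[OF vu] hom2D[OF Kt(1)[OF uv(1) x]]
      hom2D[OF Kt(1)[OF uv(2) y]] hom2D[OF Kt(1)[OF vu]]
    have "?Kt (v \<odot>\<^bsub>A\<^esub> u) x \<bullet>\<^bsub>B\<^esub> (Phi F u v \<star>\<^bsub>B\<^esub> Id2 B (?H ?i x))
        = ?Ka ?k (NAt (Phi W u v) x) \<bullet>\<^bsub>B\<^esub> (?Kt v ?y \<bullet>\<^bsub>B\<^esub> (Id2 B (P1 F v) \<star>\<^bsub>B\<^esub> ?Kt u x))"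
      by (rule B.cell_eqI)
        (use uv x ijk y z w a b e.T1_Cmp1_at[unfolded D, OF uv x] t.T1_Cmp1_at[unfolded D, OF uv x] in simp_all)
    then show "NAt (T1 \<kappa> (v \<odot>\<^bsub>A\<^esub> u)) x \<bullet>\<^bsub>B\<^esub> (Phi F u v \<star>\<^bsub>B\<^esub> Id2 B (FObj (T0 \<kappa> ?i) x))
        = FArr (T0 \<kappa> ?k) (NAt (Phi W u v) x) \<bullet>\<^bsub>B\<^esub>
          (NAt (T1 \<kappa> v) ?y \<bullet>\<^bsub>B\<^esub> (Id2 B (P1 F v) \<star>\<^bsub>B\<^esub> NAt (T1 \<kappa> u) x))"
      using uv vu x ijk y w by (simp add: \<kappa>_def \<kappa>0 \<kappa>1)
  next
    fix i x assume i: "i \<in> Cell0 A" and x: "x \<in> Obj (P0 W i)"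
    have u: "Id1 A i \<in> Cell1 A" "x \<in> Obj (P0 W (Src A (Id1 A i)))" using i x by simp_all
    have Wx: "FObj (P1 W (Id1 A i)) x = x" using normal_pseudofunctor.P1_Id1[OF W i] x by (simp add: Cat_eval)
    have ei: "NAt (T1 \<eta> (Id1 A i)) x = Id2 B (FObj (T0 \<eta> i) x)" "NAt (T1 \<theta> (Id1 A i)) x = Id2 B (FObj (T0 \<theta> i) x)"
      using i x e.T1_Id1[OF i] t.T1_Id1[OF i] by (simp_all add: Cat_eval)
    have "?Kt (Id1 A i) x = Id2 B (?H i x)"
      by (rule B.cell_eqI)
        (use i x hom2D[OF Kt(1)[OF u]] Kt(2,3)[OF u] Wx ei in simp_all)
    then show "NAt (T1 \<kappa> (Id1 A i)) x = Id2 B (FObj (T0 \<kappa> i) x)"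
      using i x u by (simp add: \<kappa>_def \<kappa>0 \<kappa>1)
  qed (use K0_func natu \<kappa>1 in \<open>simp_all add: \<kappa>_def\<close>)
  have cone: "cone A B F T \<kappa>'" if "\<kappa>' \<in> hom1 (Ps A Cat) W (hom_psfun A B F T)" for \<kappa>'
    using that by (intro cone.intro cone_axioms.intro F) (simp_all add: hom1_def Ps_simps)
  have \<kappa>_in: "\<kappa> \<in> hom1 (Ps A Cat) W (hom_psfun A B F T)"
    using pn by (simp add: hom1_def Ps_simps \<kappa>_def)
  let ?w = "\<lambda>\<kappa>'. hom_modif A B F \<tau> \<star>\<^bsub>Ps A Cat\<^esub> Id2 (Ps A Cat) \<kappa>'"
  have wD: "MDom (?w \<kappa>') = ps_comp A Cat (hom_pstrans A B F p) \<kappa>'"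
    "MCod (?w \<kappa>') = ps_comp A Cat (hom_pstrans A B F q) \<kappa>'" for \<kappa>'
    by (simp_all add: Ps_simps)
  show ?thesis
  proof (rule ex1I)
    interpret k: cone A B F T \<kappa> by (rule cone[OF \<kappa>_in])
    have kD: "TDom \<kappa> = W" by (simp add: \<kappa>_def)
    have kT: "T0 \<kappa> = K0" "T1 \<kappa> = K1" by (simp_all add: \<kappa>_def)
    note pre = k.precomp_at(1-3)[unfolded kD kT]
    have "ps_comp A Cat (hom_pstrans A B F p) \<kappa> = \<eta>"
      by (rule cone_eqI[of A B F Y])
        (use k.precomp_at(4)[of p] e.cone_axioms in
          \<open>simp_all add: kD pre[of p] \<kappa>0(3,4) \<kappa>1(3) Ka(2) Kt(2) del: ps_comp_simps(3,4)\<close>)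
    moreover have "ps_comp A Cat (hom_pstrans A B F q) \<kappa> = \<theta>"
      by (rule cone_eqI[of A B F Y])
        (use k.precomp_at(4)[of q] t.cone_axioms in
          \<open>simp_all add: kD pre[of q] \<kappa>0(3,4) \<kappa>1(3) Ka(3) Kt(3) del: ps_comp_simps(3,4)\<close>)
    ultimately have "?w \<kappa> = \<mu>"
    proof (intro modif_eqI[OF _ \<mu>])
      show "modification A Cat (?w \<kappa>)"
        using F.modification_hom_modif[of \<tau>] modification_Id2[OF pn]
        by (intro modification_HCmp) (simp_all add: Ps_simps kD)
      fix i assume i: "i \<in> Cell0 A"
      assume c: "ps_comp A Cat (hom_pstrans A B F p) \<kappa> = \<eta>" "ps_comp A Cat (hom_pstrans A B F q) \<kappa> = \<theta>"
      interpret w: modification A Cat "?w \<kappa>" by fact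
      show "MAt (?w \<kappa>) i = MAt \<mu> i"
      proof (rule Cat_Cell2_eqI)
        fix x assume "x \<in> Obj (Src Cat (Dom2 Cat (MAt (?w \<kappa>) i)))"
        then have x: "x \<in> Obj (P0 W i)" using i by (simp add: wD c)
        show "NAt (MAt (?w \<kappa>) i) x = NAt (MAt \<mu> i) x"
          using k.whisker_hom_modif_at[of \<tau> i x] i x by (simp add: kD) (simp add: \<kappa>_def \<kappa>0)
      qed (use i M2[OF i] in \<open>simp_all add: wD c\<close>)
    qed (simp_all add: wD)
    with \<kappa>_in show "\<kappa> \<in> hom1 (Ps A Cat) W (hom_psfun A B F T) \<and> ?w \<kappa> = \<mu>" by blast
  next
    fix \<kappa>' assume k': "\<kappa>' \<in> hom1 (Ps A Cat) W (hom_psfun A B F T) \<and> ?w \<kappa>' = \<mu>"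
    interpret k: cone A B F T \<kappa>' using cone k' by blast
    have kD: "TDom \<kappa>' = W" using k' by (simp add: hom1_def Ps_simps)
    have c: "ps_comp A Cat (hom_pstrans A B F p) \<kappa>' = \<eta>" "ps_comp A Cat (hom_pstrans A B F q) \<kappa>' = \<theta>"
      using wD[of \<kappa>'] k' by simp_all
    have o: "FObj (T0 \<kappa>' i) x = ?H i x" if "i \<in> Cell0 A" "x \<in> Obj (P0 W i)" for i x
      using that k.whisker_hom_modif_at[of \<tau> i x] k' k.T0_at(1,2)[of i x]
      by (intro B.lift1_unique) (simp_all add: kD)
    have a: "FArr (T0 \<kappa>' i) f = ?Ka i f" if i: "i \<in> Cell0 A" and f: "f \<in> Arr (P0 W i)" for i f
    proof -
      interpret category "P0 W i" using Wat(5)[OF i] .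
      show ?thesis
        by (rule B.cell_eqI)
          (use i f o hom2D[OF Ka(1)[OF i f]] Ka(2,3)[OF i f] k.T0_at(4-6)[OF i, of f]
            k.precomp_at(2)[of p i f] k.precomp_at(2)[of q i f] c in \<open>simp_all add: kD\<close>)
    qed
    have b: "NAt (T1 \<kappa>' u) x = ?Kt u x" if u: "u \<in> Cell1 A" and x: "x \<in> Obj (P0 W (Src A u))" for u x
      by (rule B.cell_eqI)
        (use u x o Wat(1)[OF u x refl] hom2D[OF Kt(1)[OF u x]] Kt(2,3)[OF u x] k.T1_at(1-3)[OF u, of x]
          k.precomp_at(3)[of p u x] k.precomp_at(3)[of q u x] c in \<open>simp_all add: kD\<close>)
    show "\<kappa>' = \<kappa>"
      by (rule cone_eqI[OF k.cone_axioms cone[OF \<kappa>_in]])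
        (use o a b in \<open>simp_all add: kD \<kappa>_def \<kappa>0 \<kappa>1\<close>)
  qed
qed

section \<open>Weighted bi-limits and bi-initial objects\<close>

theorem theorem7p22:
  fixes I :: "('i, 'u, 'v) two_cat"
    and C :: "('c, 'f, 't) two_cat"
    and F :: "('i, 'u, 'v, 'c, 'f, 't) psfun"
    and W :: "('i, 'u, 'v, ('f, 't) cat, ('f, 't, 'f, 't) func, ('f, 't, 'f, 't) nat_trans) psfun"
  assumes "two_category I"
    and "two_category C"
    and "normal_pseudofunctor I C F"
    and "normal_pseudofunctor I Cat W"
    and "has_tensors C two"
  shows "(\<exists>X lam. weighted_bilimit I C F W X lam) \<longleftrightarrow>
         (\<exists>X\<in>Cell0 C. \<exists>lam\<in>hom1 (Ps I Cat) W (hom_psfun I C F X).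
            bi_initial (pseudo_slice (op2 C) (Ps I Cat) (hom_2func I C F) W) (X, lam))"
proof -
  interpret F: normal_pseudofunctor I C F by fact
  let ?P = "Ps I Cat" and ?G = "hom_2func I C F"
  interpret G: normal_pseudofunctor "op2 C" ?P ?G by (rule F.normal_pseudofunctor_hom_2func)
  have key: "(\<forall>Y\<in>Cell0 C. adjoint_equivalence (hom_cat C Y X) (hom_cat ?P W (hom_psfun I C F Y))
        (bilimit_comparison I C F X lam Y))
      \<longleftrightarrow> bi_initial (pseudo_slice (op2 C) ?P ?G W) (X, lam)"
    if X: "X \<in> Cell0 C" and lam: "lam \<in> hom1 ?P W (hom_psfun I C F X)" for X lam
  proof -
    have X': "X \<in> Cell0 (op2 C)" and lam': "lam \<in> hom1 ?P W (P0 ?G X)"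
      using X lam by (simp_all add: F.hom_2func_simps)
    have "(\<forall>Y\<in>Cell0 (op2 C). adjoint_equivalence (hom_cat (op2 C) X Y) (hom_cat ?P W (P0 ?G Y))
          (comparison (op2 C) ?P ?G X lam Y))
        \<longleftrightarrow> bi_initial (pseudo_slice (op2 C) ?P ?G W) (X, lam)"
    proof (rule G.universal_iff_bi_initial[OF X' lam'])
      show "Phi ?G a a' = Id2 ?P (P1 ?G (a' \<odot>\<^bsub>op2 C\<^esub> a))"
        if "a \<in> Cell1 (op2 C)" "a' \<in> Cell1 (op2 C)" "Trg (op2 C) a = Src (op2 C) a'" for a a'
        using that by (simp add: F.hom_2func_simps)
      fix Y assume "Y \<in> Cell0 (op2 C)"
      then have Y: "Y \<in> Cell0 C" by simp
      then obtain T \<zeta> where "is_tensor C two Y T \<zeta>"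
        using \<open>has_tensors C two\<close> unfolding has_tensors_def by blast
      from arrow_tensor_of_tensor[OF \<open>two_category C\<close> Y this]
      obtain p q \<tau> where tensor: "arrow_tensor C Y T p q \<tau>" by blast
      interpret T: arrow_tensor C Y T p q \<tau> by (rule tensor)
      have "\<exists>h\<in>hom1 (op2 C) X T. \<tau> \<star>\<^bsub>op2 C\<^esub> Id2 (op2 C) h = \<beta>"
        if "b \<in> hom1 (op2 C) X Y" "\<beta> \<in> hom2 (op2 C) b c" for b c \<beta>
        by (rule bexI[of _ "T.lift1 \<beta>"]) (use that in \<open>auto simp: hom1_def hom2_def\<close>)
      moreover have "\<exists>!k. k \<in> hom1 ?P W (P0 ?G T) \<and> P2 ?G \<tau> \<star>\<^bsub>?P\<^esub> Id2 ?P k = \<mu>"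
        if "f \<in> hom1 ?P W (P0 ?G Y)" "\<mu> \<in> hom2 ?P f g" for f g \<mu>
        using modification_eq_cone[OF \<open>normal_pseudofunctor I C F\<close> tensor, of \<mu> W] that Y
        by (simp add: F.hom_2func_simps hom1_def hom2_def Ps_simps)
      ultimately show "\<exists>T p q \<tau>. T \<in> Cell0 (op2 C) \<and> p \<in> hom1 (op2 C) T Y \<and> q \<in> hom1 (op2 C) T Y \<and>
          \<tau> \<in> hom2 (op2 C) p q \<and>
          (\<forall>b\<in>hom1 (op2 C) X Y. \<forall>c\<in>hom1 (op2 C) X Y. \<forall>\<beta>\<in>hom2 (op2 C) b c.
             \<exists>h\<in>hom1 (op2 C) X T. \<tau> \<star>\<^bsub>op2 C\<^esub> Id2 (op2 C) h = \<beta>) \<and>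
          (\<forall>f\<in>hom1 ?P W (P0 ?G Y). \<forall>g\<in>hom1 ?P W (P0 ?G Y). \<forall>\<mu>\<in>hom2 ?P f g.
             \<exists>!k. k \<in> hom1 ?P W (P0 ?G T) \<and> P2 ?G \<tau> \<star>\<^bsub>?P\<^esub> Id2 ?P k = \<mu>)"
        using T.T_in T.p_in T.q_in T.\<tau>_in by (intro exI[of _ T] exI[of _ p] exI[of _ q] exI[of _ \<tau>]) auto
    qed
    then show ?thesis by (simp add: bilimit_comparison_def F.hom_2func_simps)
  qed
  show ?thesis unfolding weighted_bilimit_def using key by blast
qed

end
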